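(* Let $A=C^*(\mathcal G)$ be the $C^*$-algebra of the groupoid $\mathcal G$ of the category of paths $\Lambda$, let $H=L^2(A,\tau)$ be the GNS Hilbert space on which $A$ acts by left multiplication, and let $H_{j,\ell,n}$ ($j\ge 1$, $\ell\ge 0$, $n\ge -2$) be the finite-dimensional, pairwise orthogonal subspaces of $H$ with $H=\bigoplus_{j,\ell,n}H_{j,\ell,n}$ defined in the context. Let $D$ be the unbounded operator on $H$ defined by $D|_{H_{j,\ell,n}}=(j+\ell+n+2)\,\mathds{1}$ for $j\ge 1$, $\ell\ge 0$, $n\ge -2$. Then $(A,H,D)$ is a spectral triple; that is, $D$ is self-adjoint, (a) the set of $a\in A$ such that $[D,a]$ is densely defined and extends to a bounded operator on $H$ is norm-dense in $A$, and (b) $(1+D^2)^{-1}$ is a compact operator.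
   Context: Category of paths. $\mathbb N=\{0,1,2,\dots\}$. Fix a sequence $(k_i)_{i\ge1}$ of nonnegative integers with infinitely many $k_i\ne0$. $\Lambda$ is the small category with objects (vertices) $v_1,v_2,\dots$, identified with identity morphisms, generated by edges $\alpha_i,\beta_i,\gamma_i^{(1)},\dots,\gamma_i^{(k_i)}$ ($i\ge1$), each with range $v_i$ and source $v_{i+1}$, subject only to the relations $\alpha_i\beta_{i+1}=\beta_i\alpha_{i+1}$. The product $\mu\nu$ is defined iff $s(\mu)=r(\nu)$. $\Lambda_1$ (resp. $\Lambda_2$) is the subcategory generated by the $\alpha,\beta$-edges (resp. the $\gamma$-edges); $\Lambda_2^1$ is the set of $\gamma$-edges. Subscripts on $\alpha,\beta$ are dropped: $\alpha^p\beta^q$ is the path in $\Lambda_1$ with $p$ $\alpha$-edges and $q$ $\beta$-edges (range given by context, order irrelevant), with degree $\mathfrak d(\alpha^p\beta^q)=(p,q)$; $\mathfrak d(\rho)\perp\mathfrak d(\theta)$ means the coordinatewise minimum is $(0,0)$. $|\mu|$ is the number of edges of $\mu$; $v\Lambda=\{\lambda\in\Lambda:r(\lambda)=v\}$. A nontrivial common suffix of $\lambda,\lambda'$ is a non-vertex $\nu$ with $\lambda=\lambda_0\nu$, $\lambda'=\lambda_0'\nu$. Infinite paths. Each non-vertex path has a unique normal form $\theta_1\cdots\theta_M$ with non-vertex $\theta_i$ alternately in $\Lambda_1$ and $\Lambda_2$. $X$ is the set of infinite paths: (1) infinite products $\theta_1\theta_2\cdots$ all of whose initial segments are in normal form; (2)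 $\lambda y$ with $\lambda$ a vertex or a path whose normal form ends in $\Lambda_2$, and $y=v_i\alpha^p\beta^q$, $v_i=s(\lambda)$, $p,q\in\mathbb N\cup\{\infty\}$, $p+q=\infty$; (3) $\lambda y$ with $\lambda$ a vertex or a path whose normal form ends in $\Lambda_1$, and $y$ an infinite composable word of $\gamma$-edges with $r(y)=s(\lambda)$. Finite paths concatenate with infinite ones in the obvious way ($\alpha,\beta$ commuting, exponents adding). $Z(\mu)=\mu X$, $Z_m=Z(v_m)$, $Z_m(\mu)=Z(v_m\mu)$, and $\mu E=\{\mu x:x\in E\}$. $X$ has the topology with base the sets $Z(\mu)\setminus\bigcup_{i=1}^kZ(\nu_i)$; these are compact open. Groupoid, algebra, trace. $\mathcal G=\{(\mu,\nu,x):\mu,\nu\in v_1\Lambda,\ x\in X,\ s(\mu)=s(\nu)=r(x)\}/\!\sim$, where $\sim$ is generated by $(\mu,\nu,\varepsilon x)\sim(\mu\varepsilon,\nu\varepsilon,x)$; $[\mu,\nu,x]$ has source $\nu x$ and range $\mu x$, inverse $[\nu,\mu,x]$, and $[\mu,\nu,\delta x][\xi,\kappa,\varepsilon x]=[\mu\delta,\kappa\varepsilon,x]$ when $\nu\delta=\xi\varepsilon$. The unit space $\mathcal G^{(0)}=\{[v_1,v_1,x]\}$ is identified with $v_1X$. For $F\subseteq Z(s(\nu))$, $[\mu,\nu,F]=\{[\mu,\nu,x]:x\in F\}$; these sets with $F$ compact open are a base of compact open bisections of an ample Hausdorff topology on $\mathcal G$. $A=C^*(\mathcal G)$ is generated by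 the characteristic functions $\chi_{[\mu,\nu,F]}$, with $\chi_{[\mu,\nu,F]}^*=\chi_{[\nu,\mu,F]}$ and $\chi_U*\chi_V=\chi_{UV}$. It is known that there is a unique invariant Borel probability measure $\mathfrak m$ on $\mathcal G^{(0)}$ and that $\tau(f)=\int f|_{\mathcal G^{(0)}}\,d\mathfrak m$ defines a faithful tracial state on $A$; it is also known that, for $\theta=[0,1,k_1,1,k_2,1,\dots]$, $A$ is isomorphic to the Effros–Shen AF algebra $\mathcal{AF}_\theta$. $H=L^2(A,\tau)$ is the completion of $A$ for $\langle a,b\rangle=\tau(b^*a)$, $\eta:A\to H$ is the canonical injection, and $a\cdot\eta(b)=\eta(ab)$. Index sets. Let $p_1<p_2<\cdots$ be the indices $i$ with $k_i\ne0$, and $p_0=0$. $\Phi_i=\{v_1\}\cup\{\mu\in v_1\Lambda:1\le|\mu|\le i,\text{ the last edge of }\mu\text{ is in }\Lambda_2^1\}$. For $j\ge0$: $S_j=\{(\mu,\nu)\in\Phi_{p_j}\times\Phi_{p_j}:|\mu|=p_j\text{ or }|\nu|=p_j\}$; $S_{j,0}$ is the set of $(\mu\rho,\nu\theta)$ with $(\mu,\nu)\in S_j$, $\rho,\theta\in\Lambda_1$, $|\mu\rho|=|\nu\theta|=p_j$, and $\mu\rho,\nu\theta$ having no nontrivial common suffix; for $\ell\ge1$, $S_{j,\ell}$ is the set of $(\mu\rho,\nu\theta)$ with $(\mu,\nu)\in S_j$, $\rho,\theta\in\Lambda_1$, $|\mu\rho|=|\nu\theta|=p_j+\ell$, $\mathfrak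 d(\rho)\perp\mathfrak d(\theta)$. Put $m(j,\ell)=p_j+\ell+1$. Partitions. For $m\ge1,n\ge0$: $\Phi^m_n=\{v_m\}\cup\{\mu\in v_m\Lambda:1\le|\mu|\le n,\text{ last edge of }\mu\text{ in }\Lambda_2^1\}$; $P_{m,n}$ consists of the sets $Z_m(\alpha^{n+1}\beta^j)\setminus Z_m(\alpha^{n+1}\beta^{j+1})$ ($0\le j\le n$), $Z_m(\alpha^i\beta^{n+1})\setminus Z_m(\alpha^{i+1}\beta^{n+1})$ ($0\le i\le n$), $Z_m(\alpha^i\beta^j\lambda)$ ($i,j\le n\le i+j$, $\lambda\in v_{m+i+j}\Lambda_2^1$), and $Z_m(\alpha^{n+1}\beta^{n+1})$. $Q^m_{-1}=\{Z_m\}$ and $Q^m_n=\bigcup_{\mu\in\Phi^m_n}\mu P_{m+|\mu|,n-|\mu|}$ for $n\ge0$; each $Q^m_n$ is a finite partition of $Z_m$ into compact open sets. Subspaces. For $\Delta=(\delta,\varepsilon)\in S_{j,\ell}$, $m=m(j,\ell)$ and $F\subseteq Z_m$ compact open, $\eta_{\Delta,F}=\eta(\chi_{[\delta,\varepsilon,F]})$. For $n\ge-1$ and $E\in Q^m_n$, $K_\Delta(E)_{n+1}=\operatorname{span}\{\eta_{\Delta,F}:F\in Q^m_{n+1},F\subseteq E\}\cap\{\eta_{\Delta,E}\}^\perp$. For $j\ge2$: $H_{j,\ell,n}=\bigoplus_{\Delta\in S_{j,\ell}}\bigoplus_{E\in Q_n^{m(j,\ell)}}K_\Delta(E)_{n+1}$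 for $n\ge-1$ and $H_{j,\ell,-2}=\bigoplus_{\Delta\in S_{j,\ell}}\mathbb C\,\eta_{\Delta,Z_{m(j,\ell)}}$. For $j=1$: $H_{1,\ell,n}=\bigoplus_{i\in\{0,1\}}\bigoplus_{\Delta\in S_{i,\ell}}\bigoplus_{E\in Q_n^{m(i,\ell)}}K_\Delta(E)_{n+1}$ for $n\ge-1$ and $H_{1,\ell,-2}=\bigoplus_{i\in\{0,1\}}\bigoplus_{\Delta\in S_{i,\ell}}\mathbb C\,\eta_{\Delta,Z_{m(i,\ell)}}$. $D$ is the (closed, diagonal) operator with domain $\{\xi\in H:\sum (j+\ell+n+2)^2\|\xi_{j,\ell,n}\|^2<\infty\}$, where $\xi_{j,\ell,n}$ is the component of $\xi$ in $H_{j,\ell,n}$; $\mathds 1$ is the identity operator. *)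

theory Defs
  imports "HOL-Probability.Probability_Measure" "HOL-Library.Extended_Nat"
begin

section \<open>Complex Hilbert spaces, C*-algebras, spectral triples\<close>

class cbanach = banach +
  fixes scaleC :: "complex \<Rightarrow> 'a \<Rightarrow> 'a" (infixr "*\<^sub>C" 75)
  assumes scaleC_add_right: "c *\<^sub>C (x + y) = c *\<^sub>C x + c *\<^sub>C y"
    and scaleC_add_left: "(c + d) *\<^sub>C x = c *\<^sub>C x + d *\<^sub>C x"
    and scaleC_scaleC: "c *\<^sub>C (d *\<^sub>C x) = (c * d) *\<^sub>C x"
    and scaleR_scaleC: "r *\<^sub>R x = complex_of_real r *\<^sub>C x"
    and norm_scaleC: "norm (c *\<^sub>C x) = cmod c * norm x"

class cstar_algebra = cbanach + real_normed_algebra +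
  fixes star :: "'a \<Rightarrow> 'a"
  assumes mult_scaleC_left: "(c *\<^sub>C x) * y = c *\<^sub>C (x * y)"
    and mult_scaleC_right: "x * (c *\<^sub>C y) = c *\<^sub>C (x * y)"
    and star_add: "star (x + y) = star x + star y"
    and star_scaleC: "star (c *\<^sub>C x) = cnj c *\<^sub>C star x"
    and star_mult: "star (x * y) = star y * star x"
    and star_star: "star (star x) = x"
    and norm_star_mult: "norm (star x * x) = (norm x)\<^sup>2"

text \<open>The inner product is linear in the first argument, as in \<open>\<langle>a, b\<rangle> = \<tau> (b\<^sup>* a)\<close>.\<close>

class chilbert = cbanach +
  fixes cinner :: "'a \<Rightarrow> 'a \<Rightarrow> complex"
  assumes cinner_add_left: "cinner (x + y) z = cinner x z + cinner y z"
    and cinner_scaleC_left: "cinner (c *\<^sub>C x) y = c * cinner x y"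
    and cinner_commute: "cinner x y = cnj (cinner y x)"
    and cinner_self: "cinner x x = complex_of_real ((norm x)\<^sup>2)"

abbreviation cspan :: "'a::cbanach set \<Rightarrow> 'a set" where
  "cspan \<equiv> module.span scaleC"

definition bounded_clinear :: "('a::cbanach \<Rightarrow> 'b::cbanach) \<Rightarrow> bool" where
  "bounded_clinear T \<longleftrightarrow> bounded_linear T \<and> (\<forall>c x. T (c *\<^sub>C x) = c *\<^sub>C T x)"

definition compact_operator :: "('a::cbanach \<Rightarrow> 'b::cbanach) \<Rightarrow> bool" where
  "compact_operator T \<longleftrightarrow> bounded_clinear T \<and> compact (closure (T ` cball 0 1))"

text \<open>Meaningful for complete subspaces \<open>V\<close>; it is only used for finite-dimensional ones.\<close>

definition orth_proj :: "'a::chilbert set \<Rightarrow> 'a \<Rightarrow> 'a" where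
  "orth_proj V \<xi> = (THE \<upsilon>. \<upsilon> \<in> V \<and> (\<forall>\<omega>\<in>V. cinner (\<xi> - \<upsilon>) \<omega> = 0))"

text \<open>An unbounded operator is a pair of a domain \<open>X\<close> and a function \<open>T\<close>, whose values off
  \<open>X\<close> are irrelevant. The left-hand set below is the graph of the adjoint; as this graph is a
  linear subspace, a selfadjoint \<open>T\<close> is automatically linear on the subspace \<open>X\<close>.\<close>

definition selfadjoint :: "'a::chilbert set \<Rightarrow> ('a \<Rightarrow> 'a) \<Rightarrow> bool" where
  "selfadjoint X T \<longleftrightarrow> closure X = UNIV \<and>
     {(\<xi>, \<zeta>). \<forall>\<psi>\<in>X. cinner (T \<psi>) \<xi> = cinner \<psi> \<zeta>} = {(\<xi>, T \<xi>) | \<xi>. \<xi> \<in> X}"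

definition commutator_dom :: "'a set \<Rightarrow> ('a \<Rightarrow> 'a) \<Rightarrow> 'a set" where
  "commutator_dom X a = {\<xi> \<in> X. a \<xi> \<in> X}"

definition bounded_commutator :: "'a::chilbert set \<Rightarrow> ('a \<Rightarrow> 'a) \<Rightarrow> ('a \<Rightarrow> 'a) \<Rightarrow> bool" where
  "bounded_commutator X T a \<longleftrightarrow> closure (commutator_dom X a) = UNIV \<and>
     (\<exists>C. bounded_clinear C \<and> (\<forall>\<xi>\<in>commutator_dom X a. C \<xi> = T (a \<xi>) - a (T \<xi>)))"

definition square_dom :: "'a set \<Rightarrow> ('a \<Rightarrow> 'a) \<Rightarrow> 'a set" where
  "square_dom X T = {\<xi> \<in> X. T \<xi> \<in> X}"

definition compact_resolvent :: "'a::chilbert set \<Rightarrow> ('a \<Rightarrow> 'a) \<Rightarrow> bool" where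
  "compact_resolvent X T \<longleftrightarrow>
     bij_betw (\<lambda>\<xi>. \<xi> + T (T \<xi>)) (square_dom X T) UNIV \<and>
     compact_operator (the_inv_into (square_dom X T) (\<lambda>\<xi>. \<xi> + T (T \<xi>)))"

definition spectral_triple ::
  "('a::cstar_algebra \<Rightarrow> 'h::chilbert \<Rightarrow> 'h) \<Rightarrow> 'h set \<Rightarrow> ('h \<Rightarrow> 'h) \<Rightarrow> bool" where
  "spectral_triple \<pi> X T \<longleftrightarrow>
     selfadjoint X T \<and>
     closure {a. bounded_commutator X T (\<pi> a)} = UNIV \<and>
     compact_resolvent X T"


section \<open>The category of paths\<close>

text \<open>A finite path is given by its range \<open>v\<^sub>i\<close> and a word of letters. The letter at position \<open>n\<close>
  of the word stands for \<open>\<alpha>\<^sub>i\<^sub>+\<^sub>n\<close>, \<open>\<beta>\<^sub>i\<^sub>+\<^sub>n\<close> or, for \<open>LG c\<close>, for \<open>\<gamma>\<^sub>i\<^sub>+\<^sub>n\<close> with superscript \<open>c\<close>, so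
  composability within a word is automatic. Words are taken modulo the congruence generated by
  \<open>\<alpha>\<beta> = \<beta>\<alpha>\<close>. The requirement that \<open>\<gamma>\<^sub>i\<close> carries a superscript in \<open>{1..k i}\<close> is imposed by
  \<open>Lambda k\<close>.\<close>

datatype letter = LA | LB | LG nat

definition swap_step :: "nat \<times> letter list \<Rightarrow> nat \<times> letter list \<Rightarrow> bool" where
  "swap_step p q \<longleftrightarrow> (\<exists>i u w. p = (i, u @ LA # LB # w) \<and> q = (i, u @ LB # LA # w))"

lemma equivclp_invariant:
  assumes "equivclp R x y" and "\<And>x y. R x y \<Longrightarrow> f x = f y"
  shows "f x = f y"
  using assms(1) by (induction rule: equivclp_induct) (auto dest: assms(2))

lemma equivclp_map:
  assumes "equivclp R x y" and "\<And>x y. R x y \<Longrightarrow> equivclp S (f x) (f y)"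
  shows "equivclp S (f x) (f y)"
  using assms(1)
proof (induction rule: equivclp_induct)
  case base
  then show ?case by simp
next
  case (step y z)
  then have "equivclp S (f y) (f z)" using assms(2) equivclp_sym by metis
  with step show ?case by (metis equivclp_trans)
qed

quotient_type fpath = "nat \<times> letter list" / "equivclp swap_step"
  by simp

lift_definition prange :: "fpath \<Rightarrow> nat" is fst
  by (erule equivclp_invariant) (auto simp: swap_step_def)

lift_definition plen :: "fpath \<Rightarrow> nat" is "\<lambda>(i, w). length w"
  by (erule equivclp_invariant) (auto simp: swap_step_def)

definition psource :: "fpath \<Rightarrow> nat" where
  "psource \<mu> = prange \<mu> + plen \<mu>"

lift_definition pcount :: "letter \<Rightarrow> fpath \<Rightarrow> nat" is "\<lambda>l (i, w). count_list w l"
  by (erule equivclp_invariant) (auto simp: swap_step_def)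

lemma nth_swap:
  "n \<noteq> length u \<Longrightarrow> n \<noteq> Suc (length u) \<Longrightarrow>
    (u @ LA # LB # w) ! n = (u @ LB # LA # w) ! n"
  by (auto simp: nth_append nth_Cons split: nat.splits)

lemma nth_swap_LG:
  "(u @ LA # LB # w) ! n = LG c \<longleftrightarrow> (u @ LB # LA # w) ! n = LG c"
  by (cases "n = length u \<or> n = Suc (length u)") (auto simp: nth_append nth_swap)


lift_definition admissible :: "(nat \<Rightarrow> nat) \<Rightarrow> fpath \<Rightarrow> bool" is
  "\<lambda>k (i, w). 1 \<le> i \<and> (\<forall>n<length w. \<forall>c. w ! n = LG c \<longrightarrow> c \<in> {1..k (i + n)})"
  by (erule equivclp_invariant) (auto simp: swap_step_def nth_swap_LG)


definition Lambda :: "(nat \<Rightarrow> nat) \<Rightarrow> fpath set" where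
  "Lambda k = {\<mu>. admissible k \<mu>}"

definition Lambda_from :: "(nat \<Rightarrow> nat) \<Rightarrow> nat \<Rightarrow> fpath set" where
  "Lambda_from k m = {\<mu> \<in> Lambda k. prange \<mu> = m}"

definition Lambda1 :: "(nat \<Rightarrow> nat) \<Rightarrow> fpath set" where
  "Lambda1 k = {\<mu> \<in> Lambda k. \<forall>c. pcount (LG c) \<mu> = 0}"

text \<open>Juxtaposition, which is the composition of the category if \<open>psource \<mu> = prange \<nu>\<close>.\<close>

definition raw_comp :: "nat \<times> letter list \<Rightarrow> nat \<times> letter list \<Rightarrow> nat \<times> letter list" where
  "raw_comp p q = (fst p, snd p @ snd q)"

lift_definition pcomp :: "fpath \<Rightarrow> fpath \<Rightarrow> fpath" (infixl "\<Zcomp>" 70) is raw_comp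
proof -
  fix p p' q q'
  assume p: "equivclp swap_step p p'" and q: "equivclp swap_step q q'"
  have "equivclp swap_step (raw_comp p q) (raw_comp p' q)"
    using p
  proof (rule equivclp_map[where f = "\<lambda>p. raw_comp p q"])
    fix x y assume "swap_step x y"
    then obtain i u w where xy: "x = (i, u @ LA # LB # w)" "y = (i, u @ LB # LA # w)"
      by (auto simp: swap_step_def)
    have "swap_step (i, u @ LA # LB # (w @ snd q)) (i, u @ LB # LA # (w @ snd q))"
      unfolding swap_step_def by blast
    then show "equivclp swap_step (raw_comp x q) (raw_comp y q)"
      using xy by (auto simp: raw_comp_def intro: r_into_equivclp)
  qed
  moreover have "equivclp swap_step (raw_comp p' q) (raw_comp p' q')"
    using q
  proof (rule equivclp_map[where f = "raw_comp p'"])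
    fix x y assume "swap_step x y"
    then obtain i u w where xy: "x = (i, u @ LA # LB # w)" "y = (i, u @ LB # LA # w)"
      by (auto simp: swap_step_def)
    have "swap_step (fst p', (snd p' @ u) @ LA # LB # w) (fst p', (snd p' @ u) @ LB # LA # w)"
      unfolding swap_step_def by blast
    then show "equivclp swap_step (raw_comp p' x) (raw_comp p' y)"
      using xy by (auto simp: raw_comp_def intro: r_into_equivclp)
  qed
  ultimately show "equivclp swap_step (raw_comp p q) (raw_comp p' q')"
    by (rule equivclp_trans)
qed

lift_definition vertex :: "nat \<Rightarrow> fpath" is "\<lambda>i. (i, [])" .

lift_definition ab_path :: "nat \<Rightarrow> nat \<Rightarrow> nat \<Rightarrow> fpath" is
  "\<lambda>i p q. (i, replicate p LA @ replicate q LB)" .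

lift_definition gamma_edge :: "nat \<Rightarrow> nat \<Rightarrow> fpath" is "\<lambda>i c. (i, [LG c])" .

definition gamma_edges_from :: "(nat \<Rightarrow> nat) \<Rightarrow> nat \<Rightarrow> fpath set" where
  "gamma_edges_from k i = gamma_edge i ` {1..k i}"


section \<open>Infinite paths\<close>

text \<open>An infinite path is given by its range and an infinite word. Two words represent the same
  infinite path iff they have the same \<open>\<gamma>\<close>-edges at the same positions and each maximal
  \<open>\<alpha>\<beta>\<close>-block has the same exponents \<open>p\<close> of \<open>\<alpha>\<close> and \<open>q\<close> of \<open>\<beta>\<close>. For the finite blocks this says
  that the \<open>\<alpha>\<close>'s before every \<open>\<gamma>\<close>-edge are equal in number; an infinite last block, with
  exponents in \<open>\<nat> \<union> {\<infinity>}\<close>, is then determined by the total numbers of \<open>\<alpha>\<close>'s and \<open>\<beta>\<close>'s.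
  The three kinds of infinite paths are the words in which, respectively, the type of the letters
  changes infinitely often, the last block is of type \<open>\<alpha>\<beta>\<close>, and the last block is of type \<open>\<gamma>\<close>.\<close>

definition ecard :: "'a set \<Rightarrow> enat" where
  "ecard S = (if finite S then enat (card S) else \<infinity>)"

definition same_blocks :: "(nat \<Rightarrow> letter) \<Rightarrow> (nat \<Rightarrow> letter) \<Rightarrow> bool" where
  "same_blocks x y \<longleftrightarrow>
     (\<forall>n c. x n = LG c \<longleftrightarrow> y n = LG c) \<and>
     (\<forall>n c. x n = LG c \<longrightarrow> card {t. t < n \<and> x t = LA} = card {t. t < n \<and> y t = LA}) \<and>
     ecard {t. x t = LA} = ecard {t. y t = LA} \<and>
     ecard {t. x t = LB} = ecard {t. y t = LB}"

definition same_ipath :: "nat \<times> (nat \<Rightarrow> letter) \<Rightarrow> nat \<times> (nat \<Rightarrow> letter) \<Rightarrow> bool" where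
  "same_ipath p q \<longleftrightarrow> fst p = fst q \<and> same_blocks (snd p) (snd q)"

lemma same_blocks_refl: "same_blocks x x"
  by (simp add: same_blocks_def)

lemma same_blocks_sym: "same_blocks x y \<Longrightarrow> same_blocks y x"
  by (simp add: same_blocks_def)

lemma same_blocks_trans: "same_blocks x y \<Longrightarrow> same_blocks y z \<Longrightarrow> same_blocks x z"
  by (simp add: same_blocks_def)

quotient_type ipath = "nat \<times> (nat \<Rightarrow> letter)" / same_ipath
  by (rule equivpI)
     (auto simp: reflp_def symp_def transp_def same_ipath_def
       intro: same_blocks_refl same_blocks_sym same_blocks_trans)

lift_definition irange :: "ipath \<Rightarrow> nat" is fst
  by (simp add: same_ipath_def)

lift_definition iadmissible :: "(nat \<Rightarrow> nat) \<Rightarrow> ipath \<Rightarrow> bool" is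
  "\<lambda>k (i, x). 1 \<le> i \<and> (\<forall>n c. x n = LG c \<longrightarrow> c \<in> {1..k (i + n)})"
  by (auto simp: same_ipath_def same_blocks_def)

definition ipaths :: "(nat \<Rightarrow> nat) \<Rightarrow> ipath set" where
  "ipaths k = {x. iadmissible k x}"

definition ipaths_from :: "(nat \<Rightarrow> nat) \<Rightarrow> nat \<Rightarrow> ipath set" where
  "ipaths_from k m = {x \<in> ipaths k. irange x = m}"

definition prepend :: "letter list \<Rightarrow> (nat \<Rightarrow> letter) \<Rightarrow> nat \<Rightarrow> letter" where
  "prepend w x n = (if n < length w then w ! n else x (n - length w))"

lemma prepend_append: "prepend (w @ v) x = prepend w (prepend v x)"
  by (auto simp: prepend_def nth_append fun_eq_iff)

lemma same_blocks_Cons: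
  assumes "same_blocks x y"
  shows "same_blocks (prepend [a] x) (prepend [a] y)"
proof -
  have pr: "prepend [a] z n = (case n of 0 \<Rightarrow> a | Suc m \<Rightarrow> z m)" for z n
    by (auto simp: prepend_def split: nat.splits)
  have eq: "{t. prepend [a] z t = l} = (if a = l then {0} else {}) \<union> Suc ` {t. z t = l}" for z l
  proof (rule set_eqI)
    fix t show "t \<in> {t. prepend [a] z t = l} \<longleftrightarrow> t \<in> (if a = l then {0} else {}) \<union> Suc ` {t. z t = l}"
      by (cases t) (auto simp: pr)
  qed
  have eq': "{t. t < Suc n \<and> prepend [a] z t = l} =
      (if a = l then {0} else {}) \<union> Suc ` {t. t < n \<and> z t = l}" for z l n
  proof (rule set_eqI)
    fix t show "t \<in> {t. t < Suc n \<and> prepend [a] z t = l} \<longleftrightarrow>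
        t \<in> (if a = l then {0} else {}) \<union> Suc ` {t. t < n \<and> z t = l}"
      by (cases t) (auto simp: pr)
  qed
  have card_Suc: "card (Suc ` S) = card S" for S
    by (simp add: card_image)
  have fin: "finite (Suc ` S) \<longleftrightarrow> finite S" for S
    by (simp add: finite_image_iff)
  have ec: "ecard ((if a = l then {0} else {}) \<union> Suc ` S) = ecard ((if a = l then {0} else {}) \<union> Suc ` T)"
    if "ecard S = ecard T" for l S T
    using that by (auto simp: ecard_def fin card_Suc card_insert_if split: if_splits)
  have cc: "card ((if a = l then {0} else {}) \<union> Suc ` {t. t < n \<and> x t = l'}) =
      card ((if a = l then {0} else {}) \<union> Suc ` {t. t < n \<and> y t = l'})"
    if "card {t. t < n \<and> x t = l'} = card {t. t < n \<and> y t = l'}" for l l' n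
    using that by (auto simp: card_Suc card_insert_if)
  have "card {t. t < n \<and> prepend [a] x t = LA} = card {t. t < n \<and> prepend [a] y t = LA}"
    if "prepend [a] x n = LG c" for n c
  proof (cases n)
    case (Suc m)
    then have "x m = LG c" using that by (simp add: pr)
    then show ?thesis unfolding Suc eq' using assms cc[of m LA] by (auto simp: same_blocks_def)
  qed auto
  moreover have "prepend [a] x n = LG c \<longleftrightarrow> prepend [a] y n = LG c" for n c
    using assms by (auto simp: pr same_blocks_def split: nat.splits)
  moreover have "ecard {t. prepend [a] x t = l} = ecard {t. prepend [a] y t = l}"
    if "l \<in> {LA, LB}" for l
    unfolding eq using that assms by (intro ec) (auto simp: same_blocks_def)
  ultimately show ?thesis by (simp add: same_blocks_def)
qed

lemma same_blocks_prepend: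
  "same_blocks x y \<Longrightarrow> same_blocks (prepend w x) (prepend w y)"
proof (induction w)
  case Nil
  then show ?case by (simp add: prepend_def[abs_def])
next
  case (Cons a w)
  have "prepend (a # w) z = prepend [a] (prepend w z)" for z
    using prepend_append[of "[a]" w z] by simp
  with Cons show ?case by (simp add: same_blocks_Cons)
qed

lemma same_blocks_swap: "same_blocks (prepend (LA # LB # w) x) (prepend (LB # LA # w) x)"
proof -
  define y where "y = prepend (LA # LB # w) x"
  define s where "s = Transposition.transpose (0::nat) 1"
  have z: "prepend (LB # LA # w) x = y \<circ> s"
    by (auto simp: y_def s_def prepend_def fun_eq_iff Transposition.transpose_def nth_Cons
        split: nat.splits)
  have y01: "y 0 = LA" "y 1 = LB" by (auto simp: y_def prepend_def)
  have ss: "s (s t) = t" for t by (simp add: s_def)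
  have inj: "inj_on s A" for A
    by (rule inj_on_inverseI[of _ s]) (rule ss)
  have img: "s ` A = {t. s t \<in> A}" for A
  proof
    show "s ` A \<subseteq> {t. s t \<in> A}" by (auto simp: ss)
    show "{t. s t \<in> A} \<subseteq> s ` A"
    proof
      fix t assume "t \<in> {t. s t \<in> A}"
      then have "s (s t) \<in> s ` A" by blast
      then show "t \<in> s ` A" by (simp only: ss)
    qed
  qed
  have im: "{t. (y \<circ> s) t = l} = s ` {t. y t = l}" for l
    by (simp add: img)
  have ge2: "2 \<le> n" if "y n = LG c" for n c
  proof (rule ccontr)
    assume "\<not> 2 \<le> n"
    then have "n = 0 \<or> n = 1" by linarith
    then show False using that y01 by (elim disjE) simp_all
  qed
  have s2: "s n = n" if "2 \<le> n" for n
    using that by (simp add: s_def Transposition.transpose_def)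
  have slt: "s t < n \<longleftrightarrow> t < n" if "2 \<le> n" for t n
    using that by (simp add: s_def Transposition.transpose_def)
  have im': "{t. t < n \<and> (y \<circ> s) t = l} = s ` {t. t < n \<and> y t = l}" if "2 \<le> n" for n l
    by (simp add: img slt[OF that])
  have "y n = LG c \<longleftrightarrow> (y \<circ> s) n = LG c" for n c
  proof (cases "2 \<le> n")
    case False
    then have "n = 0 \<or> n = 1" by auto
    then show ?thesis using y01 by (auto simp: s_def)
  qed (simp add: s2)
  moreover have "ecard {t. y t = l} = ecard {t. (y \<circ> s) t = l}" for l
    unfolding im ecard_def by (simp add: card_image inj finite_image_iff)
  moreover have "card {t. t < n \<and> y t = LA} = card {t. t < n \<and> (y \<circ> s) t = LA}"
    if "y n = LG c" for n c
    unfolding im'[OF ge2[OF that]] by (simp add: card_image inj)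
  ultimately show ?thesis unfolding z y_def[symmetric] by (auto simp: same_blocks_def)
qed

lift_definition icomp :: "fpath \<Rightarrow> ipath \<Rightarrow> ipath" (infixr "\<odot>" 69) is
  "\<lambda>p q. (fst p, prepend (snd p) (snd q))"
proof -
  fix p p' and q q' :: "nat \<times> (nat \<Rightarrow> letter)"
  assume p: "equivclp swap_step p p'" and q: "same_ipath q q'"
  have step: "same_ipath (fst a, prepend (snd a) (snd q)) (fst b, prepend (snd b) (snd q))"
    if "swap_step a b" for a b
    using that same_blocks_prepend[OF same_blocks_swap]
    by (auto simp: swap_step_def prepend_append same_ipath_def)
  have "abs_ipath (fst p, prepend (snd p) (snd q)) = abs_ipath (fst p', prepend (snd p') (snd q))"
    using p
  proof (rule equivclp_invariant[where f = "\<lambda>a. abs_ipath (fst a, prepend (snd a) (snd q))"])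
    fix a b assume "swap_step a b"
    then show "abs_ipath (fst a, prepend (snd a) (snd q)) = abs_ipath (fst b, prepend (snd b) (snd q))"
      unfolding ipath.abs_eq_iff by (rule step)
  qed
  then have "same_ipath (fst p, prepend (snd p) (snd q)) (fst p', prepend (snd p') (snd q))"
    by (simp only: ipath.abs_eq_iff)
  moreover have "same_blocks (prepend (snd p') (snd q)) (prepend (snd p') (snd q'))"
    using q by (auto simp: same_ipath_def intro: same_blocks_prepend)
  ultimately show "same_ipath (fst p, prepend (snd p) (snd q)) (fst p', prepend (snd p') (snd q'))"
    by (auto simp: same_ipath_def intro: same_blocks_trans)
qed

lemma icomp_pcomp: "(\<mu> \<Zcomp> \<nu>) \<odot> x = \<mu> \<odot> \<nu> \<odot> x"
  by transfer (simp add: raw_comp_def prepend_append same_ipath_def same_blocks_refl)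

definition cyl :: "(nat \<Rightarrow> nat) \<Rightarrow> fpath \<Rightarrow> ipath set" where
  "cyl k \<mu> = (\<odot>) \<mu> ` ipaths_from k (psource \<mu>)"

definition ipath_top :: "(nat \<Rightarrow> nat) \<Rightarrow> ipath topology" where
  "ipath_top k = topology_generated_by
     {cyl k \<mu> - (\<Union>\<nu>\<in>N. cyl k \<nu>) | \<mu> N. \<mu> \<in> Lambda k \<and> finite N \<and> N \<subseteq> Lambda k}"

definition compact_open :: "(nat \<Rightarrow> nat) \<Rightarrow> ipath set \<Rightarrow> bool" where
  "compact_open k F \<longleftrightarrow> compactin (ipath_top k) F \<and> openin (ipath_top k) F"


section \<open>The groupoid\<close>

definition germ_step :: "fpath \<times> fpath \<times> ipath \<Rightarrow> fpath \<times> fpath \<times> ipath \<Rightarrow> bool" where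
  "germ_step t t' \<longleftrightarrow> (\<exists>\<mu> \<nu> \<epsilon> x.
     psource \<mu> = prange \<epsilon> \<and> psource \<nu> = prange \<epsilon> \<and> psource \<epsilon> = irange x \<and>
     t = (\<mu>, \<nu>, \<epsilon> \<odot> x) \<and> t' = (\<mu> \<Zcomp> \<epsilon>, \<nu> \<Zcomp> \<epsilon>, x))"

text \<open>The generating relation does not refer to \<open>k\<close>: if one side of a \<open>germ_step\<close> lies in
  \<open>germ_triples k\<close> below, then so does the other, with \<open>\<epsilon> \<in> Lambda k\<close>. Triples outside of
  \<open>germ_triples k\<close> do not contribute to \<open>groupoid k\<close>.\<close>

quotient_type gelem = "fpath \<times> fpath \<times> ipath" / "equivclp germ_step"
  by simp

definition germ :: "fpath \<Rightarrow> fpath \<Rightarrow> ipath \<Rightarrow> gelem" where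
  "germ \<mu> \<nu> x = abs_gelem (\<mu>, \<nu>, x)"

definition grange :: "gelem \<Rightarrow> ipath" where
  "grange g = (case rep_gelem g of (\<mu>, \<nu>, x) \<Rightarrow> \<mu> \<odot> x)"

definition gsource :: "gelem \<Rightarrow> ipath" where
  "gsource g = (case rep_gelem g of (\<mu>, \<nu>, x) \<Rightarrow> \<nu> \<odot> x)"

definition ginv :: "gelem \<Rightarrow> gelem" where
  "ginv g = (case rep_gelem g of (\<mu>, \<nu>, x) \<Rightarrow> germ \<nu> \<mu> x)"

lemma rep_germ: "equivclp germ_step (rep_gelem (germ \<mu> \<nu> x)) (\<mu>, \<nu>, x)"
  unfolding germ_def by (rule Quotient3_rep_abs[OF Quotient3_gelem]) simp

lemma germ_eq_iff: "germ \<mu> \<nu> x = germ \<mu>' \<nu>' x' \<longleftrightarrow> equivclp germ_step (\<mu>, \<nu>, x) (\<mu>', \<nu>', x')"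
  unfolding germ_def by (rule gelem.abs_eq_iff)

lemma grange_germ: "grange (germ \<mu> \<nu> x) = \<mu> \<odot> x"
proof -
  have "(\<lambda>(\<mu>, \<nu>, x). \<mu> \<odot> x) (rep_gelem (germ \<mu> \<nu> x)) = (\<lambda>(\<mu>, \<nu>, x). \<mu> \<odot> x) (\<mu>, \<nu>, x)"
    by (rule equivclp_invariant[OF rep_germ]) (auto simp: germ_step_def icomp_pcomp)
  then show ?thesis by (simp add: grange_def)
qed

lemma gsource_germ: "gsource (germ \<mu> \<nu> x) = \<nu> \<odot> x"
proof -
  have "(\<lambda>(\<mu>, \<nu>, x). \<nu> \<odot> x) (rep_gelem (germ \<mu> \<nu> x)) = (\<lambda>(\<mu>, \<nu>, x). \<nu> \<odot> x) (\<mu>, \<nu>, x)"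
    by (rule equivclp_invariant[OF rep_germ]) (auto simp: germ_step_def icomp_pcomp)
  then show ?thesis by (simp add: gsource_def)
qed

lemma ginv_germ: "ginv (germ \<mu> \<nu> x) = germ \<nu> \<mu> x"
proof -
  have "(\<lambda>(\<mu>, \<nu>, x). germ \<nu> \<mu> x) (rep_gelem (germ \<mu> \<nu> x)) = (\<lambda>(\<mu>, \<nu>, x). germ \<nu> \<mu> x) (\<mu>, \<nu>, x)"
  proof (rule equivclp_invariant[OF rep_germ])
    fix t t' assume "germ_step t t'"
    then obtain \<mu> \<nu> \<epsilon> x where
      "psource \<mu> = prange \<epsilon>" "psource \<nu> = prange \<epsilon>" "psource \<epsilon> = irange x"
      and t: "t = (\<mu>, \<nu>, \<epsilon> \<odot> x)" "t' = (\<mu> \<Zcomp> \<epsilon>, \<nu> \<Zcomp> \<epsilon>, x)"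
      unfolding germ_step_def by blast
    then have "germ_step (\<nu>, \<mu>, \<epsilon> \<odot> x) (\<nu> \<Zcomp> \<epsilon>, \<mu> \<Zcomp> \<epsilon>, x)"
      unfolding germ_step_def by blast
    then show "(\<lambda>(\<mu>, \<nu>, x). germ \<nu> \<mu> x) t = (\<lambda>(\<mu>, \<nu>, x). germ \<nu> \<mu> x) t'"
      by (simp add: t germ_eq_iff r_into_equivclp)
  qed
  then show ?thesis by (simp add: ginv_def)
qed

definition germ_triples :: "(nat \<Rightarrow> nat) \<Rightarrow> (fpath \<times> fpath \<times> ipath) set" where
  "germ_triples k = {(\<mu>, \<nu>, x). \<mu> \<in> Lambda_from k 1 \<and> \<nu> \<in> Lambda_from k 1 \<and> x \<in> ipaths k \<and>
     psource \<mu> = irange x \<and> psource \<nu> = irange x}"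

definition groupoid :: "(nat \<Rightarrow> nat) \<Rightarrow> gelem set" where
  "groupoid k = (\<lambda>(\<mu>, \<nu>, x). germ \<mu> \<nu> x) ` germ_triples k"

text \<open>\<open>is_product k a b c\<close>: \<open>a\<close> and \<open>b\<close> are composable in \<open>groupoid k\<close> and \<open>c = a b\<close>.\<close>

definition is_product :: "(nat \<Rightarrow> nat) \<Rightarrow> gelem \<Rightarrow> gelem \<Rightarrow> gelem \<Rightarrow> bool" where
  "is_product k a b c \<longleftrightarrow> (\<exists>\<mu> \<nu> \<delta> \<xi> \<kappa> \<epsilon> x.
     \<delta> \<in> Lambda k \<and> \<epsilon> \<in> Lambda k \<and>
     psource \<nu> = prange \<delta> \<and> psource \<xi> = prange \<epsilon> \<and> psource \<delta> = irange x \<and> psource \<epsilon> = irange x \<and>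
     (\<mu>, \<nu>, \<delta> \<odot> x) \<in> germ_triples k \<and> (\<xi>, \<kappa>, \<epsilon> \<odot> x) \<in> germ_triples k \<and> \<nu> \<Zcomp> \<delta> = \<xi> \<Zcomp> \<epsilon> \<and>
     a = germ \<mu> \<nu> (\<delta> \<odot> x) \<and> b = germ \<xi> \<kappa> (\<epsilon> \<odot> x) \<and> c = germ (\<mu> \<Zcomp> \<delta>) (\<kappa> \<Zcomp> \<epsilon>) x)"

definition germ_set :: "fpath \<Rightarrow> fpath \<Rightarrow> ipath set \<Rightarrow> gelem set" where
  "germ_set \<mu> \<nu> F = germ \<mu> \<nu> ` F"

definition groupoid_top :: "(nat \<Rightarrow> nat) \<Rightarrow> gelem topology" where
  "groupoid_top k = topology_generated_by
     {germ_set \<mu> \<nu> F | \<mu> \<nu> F. \<mu> \<in> Lambda_from k 1 \<and> \<nu> \<in> Lambda_from k 1 \<and> psource \<mu> = psource \<nu> \<and>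
        F \<subseteq> cyl k (vertex (psource \<nu>)) \<and> compact_open k F}"

definition unit_germ :: "ipath \<Rightarrow> gelem" where
  "unit_germ x = germ (vertex 1) (vertex 1) x"

definition open_bisection :: "(nat \<Rightarrow> nat) \<Rightarrow> gelem set \<Rightarrow> bool" where
  "open_bisection k U \<longleftrightarrow> openin (groupoid_top k) U \<and> inj_on gsource U \<and> inj_on grange U"

text \<open>A measure on the unit space, which is identified with \<open>v\<^sub>1 X\<close>.\<close>

definition invariant_prob :: "(nat \<Rightarrow> nat) \<Rightarrow> ipath measure \<Rightarrow> bool" where
  "invariant_prob k M \<longleftrightarrow>
     prob_space M \<and> space M = ipaths_from k 1 \<and>
     sets M = sigma_sets (ipaths_from k 1)
       {U. openin (subtopology (ipath_top k) (ipaths_from k 1)) U} \<and>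
     (\<forall>U. open_bisection k U \<longrightarrow> emeasure M (gsource ` U) = emeasure M (grange ` U))"


section \<open>The groupoid C*-algebra, its trace and its GNS space\<close>

text \<open>Functions on the groupoid are extended by zero.\<close>

definition Cc :: "(nat \<Rightarrow> nat) \<Rightarrow> (gelem \<Rightarrow> complex) set" where
  "Cc k = {f. continuous_map (groupoid_top k) euclidean f \<and> (\<forall>g. g \<notin> groupoid k \<longrightarrow> f g = 0) \<and>
     compactin (groupoid_top k) (groupoid_top k closure_of {g. f g \<noteq> 0})}"

definition convolution ::
  "(nat \<Rightarrow> nat) \<Rightarrow> (gelem \<Rightarrow> complex) \<Rightarrow> (gelem \<Rightarrow> complex) \<Rightarrow> gelem \<Rightarrow> complex" where
  "convolution k f g c = (\<Sum>\<^sub>\<infinity>(a, b)\<in>{(a, b). is_product k a b c}. f a * g b)"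

definition involution :: "(gelem \<Rightarrow> complex) \<Rightarrow> gelem \<Rightarrow> complex" where
  "involution f g = cnj (f (ginv g))"

definition cstar_seminorm :: "(nat \<Rightarrow> nat) \<Rightarrow> ((gelem \<Rightarrow> complex) \<Rightarrow> real) \<Rightarrow> bool" where
  "cstar_seminorm k N \<longleftrightarrow>
     (\<forall>f\<in>Cc k. \<forall>g\<in>Cc k. N (\<lambda>a. f a + g a) \<le> N f + N g) \<and>
     (\<forall>f\<in>Cc k. \<forall>c. N (\<lambda>a. c * f a) = cmod c * N f) \<and>
     (\<forall>f\<in>Cc k. \<forall>g\<in>Cc k. N (convolution k f g) \<le> N f * N g) \<and>
     (\<forall>f\<in>Cc k. N (convolution k (involution f) f) = (N f)\<^sup>2)"

text \<open>The C*-seminorms on \<open>Cc k\<close> are the functions \<open>f \<mapsto> \<parallel>\<pi> f\<parallel>\<close> for *-representations \<open>\<pi>\<close> of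
  \<open>Cc k\<close> by bounded operators on Hilbert spaces, so this is the full C*-norm.\<close>

definition full_norm :: "(nat \<Rightarrow> nat) \<Rightarrow> (gelem \<Rightarrow> complex) \<Rightarrow> real" where
  "full_norm k f = (SUP N\<in>{N. cstar_seminorm k N}. N f)"

text \<open>\<open>\<iota>\<close> exhibits the C*-algebra \<open>'a\<close> as the completion of \<open>Cc k\<close> in the full C*-norm.\<close>

definition is_groupoid_cstar :: "(nat \<Rightarrow> nat) \<Rightarrow> ((gelem \<Rightarrow> complex) \<Rightarrow> 'a::cstar_algebra) \<Rightarrow> bool" where
  "is_groupoid_cstar k \<iota> \<longleftrightarrow>
     (\<forall>f\<in>Cc k. \<forall>g\<in>Cc k. \<iota> (\<lambda>a. f a + g a) = \<iota> f + \<iota> g) \<and>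
     (\<forall>f\<in>Cc k. \<forall>c. \<iota> (\<lambda>a. c * f a) = c *\<^sub>C \<iota> f) \<and>
     (\<forall>f\<in>Cc k. \<forall>g\<in>Cc k. \<iota> (convolution k f g) = \<iota> f * \<iota> g) \<and>
     (\<forall>f\<in>Cc k. \<iota> (involution f) = star (\<iota> f)) \<and>
     (\<forall>f\<in>Cc k. norm (\<iota> f) = full_norm k f) \<and>
     closure (\<iota> ` Cc k) = UNIV"

text \<open>\<open>\<tau>\<close> is the bounded functional on the completion that is given by integration over the unit
  space on \<open>Cc k\<close>.\<close>

definition is_trace :: "(nat \<Rightarrow> nat) \<Rightarrow> ipath measure \<Rightarrow> ((gelem \<Rightarrow> complex) \<Rightarrow> 'a::cstar_algebra) \<Rightarrow>
    ('a \<Rightarrow> complex) \<Rightarrow> bool" where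
  "is_trace k M \<iota> \<tau> \<longleftrightarrow>
     bounded_linear \<tau> \<and> (\<forall>c a. \<tau> (c *\<^sub>C a) = c * \<tau> a) \<and>
     (\<forall>f\<in>Cc k. \<tau> (\<iota> f) = (LINT x|M. f (unit_germ x)))"

text \<open>\<open>\<eta>\<close> exhibits the Hilbert space \<open>'h\<close> as \<open>L\<^sup>2(A, \<tau>)\<close>.\<close>

definition is_gns_space :: "('a::cstar_algebra \<Rightarrow> complex) \<Rightarrow> ('a \<Rightarrow> 'h::chilbert) \<Rightarrow> bool" where
  "is_gns_space \<tau> \<eta> \<longleftrightarrow>
     (\<forall>a b. \<eta> (a + b) = \<eta> a + \<eta> b) \<and> (\<forall>c a. \<eta> (c *\<^sub>C a) = c *\<^sub>C \<eta> a) \<and>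
     (\<forall>a b. cinner (\<eta> a) (\<eta> b) = \<tau> (star b * a)) \<and>
     closure (range \<eta>) = UNIV"

definition left_mult :: "('a::cstar_algebra \<Rightarrow> 'h::chilbert) \<Rightarrow> 'a \<Rightarrow> 'h \<Rightarrow> 'h" where
  "left_mult \<eta> a = (THE T. bounded_clinear T \<and> (\<forall>b. T (\<eta> b) = \<eta> (a * b)))"


section \<open>Index sets and partitions\<close>

definition p_index :: "(nat \<Rightarrow> nat) \<Rightarrow> nat \<Rightarrow> nat" where
  "p_index k j = (if j = 0 then 0 else enumerate {i. 1 \<le> i \<and> k i \<noteq> 0} (j - 1))"

definition Phi :: "(nat \<Rightarrow> nat) \<Rightarrow> nat \<Rightarrow> nat \<Rightarrow> fpath set" where
  "Phi k m n = {vertex m} \<union>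
     {\<mu> \<in> Lambda_from k m. 1 \<le> plen \<mu> \<and> plen \<mu> \<le> n \<and>
        (\<exists>\<nu>\<in>Lambda k. \<exists>\<epsilon>\<in>gamma_edges_from k (psource \<nu>). \<mu> = \<nu> \<Zcomp> \<epsilon>)}"

definition S0 :: "(nat \<Rightarrow> nat) \<Rightarrow> nat \<Rightarrow> (fpath \<times> fpath) set" where
  "S0 k j = {(\<mu>, \<nu>). \<mu> \<in> Phi k 1 (p_index k j) \<and> \<nu> \<in> Phi k 1 (p_index k j) \<and>
     (plen \<mu> = p_index k j \<or> plen \<nu> = p_index k j)}"

definition common_suffix :: "(nat \<Rightarrow> nat) \<Rightarrow> fpath \<Rightarrow> fpath \<Rightarrow> fpath \<Rightarrow> bool" where
  "common_suffix k \<mu> \<nu> \<sigma> \<longleftrightarrow> \<sigma> \<in> Lambda k \<and>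
     (\<exists>\<mu>'\<in>Lambda k. \<exists>\<nu>'\<in>Lambda k. psource \<mu>' = prange \<sigma> \<and> psource \<nu>' = prange \<sigma> \<and>
        \<mu> = \<mu>' \<Zcomp> \<sigma> \<and> \<nu> = \<nu>' \<Zcomp> \<sigma>)"

definition degree_perp :: "fpath \<Rightarrow> fpath \<Rightarrow> bool" where
  "degree_perp \<rho> \<theta> \<longleftrightarrow>
     min (pcount LA \<rho>) (pcount LA \<theta>) = 0 \<and> min (pcount LB \<rho>) (pcount LB \<theta>) = 0"

definition S_pairs :: "(nat \<Rightarrow> nat) \<Rightarrow> nat \<Rightarrow> nat \<Rightarrow> (fpath \<times> fpath) set" where
  "S_pairs k j l = {(\<mu> \<Zcomp> \<rho>, \<nu> \<Zcomp> \<theta>) | \<mu> \<nu> \<rho> \<theta>.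
     (\<mu>, \<nu>) \<in> S0 k j \<and> \<rho> \<in> Lambda1 k \<and> \<theta> \<in> Lambda1 k \<and>
     psource \<mu> = prange \<rho> \<and> psource \<nu> = prange \<theta> \<and>
     plen (\<mu> \<Zcomp> \<rho>) = p_index k j + l \<and> plen (\<nu> \<Zcomp> \<theta>) = p_index k j + l \<and>
     (if l = 0 then \<not> (\<exists>\<sigma>. 0 < plen \<sigma> \<and> common_suffix k (\<mu> \<Zcomp> \<rho>) (\<nu> \<Zcomp> \<theta>) \<sigma>)
      else degree_perp \<rho> \<theta>)}"

definition P_part :: "(nat \<Rightarrow> nat) \<Rightarrow> nat \<Rightarrow> nat \<Rightarrow> ipath set set" where
  "P_part k m n =
     {cyl k (ab_path m (n + 1) j) - cyl k (ab_path m (n + 1) (j + 1)) | j. j \<le> n} \<union>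
     {cyl k (ab_path m i (n + 1)) - cyl k (ab_path m (i + 1) (n + 1)) | i. i \<le> n} \<union>
     {cyl k (ab_path m i j \<Zcomp> \<epsilon>) | i j \<epsilon>. i \<le> n \<and> j \<le> n \<and> n \<le> i + j \<and>
        \<epsilon> \<in> gamma_edges_from k (m + i + j)} \<union>
     {cyl k (ab_path m (n + 1) (n + 1))}"

text \<open>Only used for \<open>n \<ge> -1\<close>.\<close>

definition Q_part :: "(nat \<Rightarrow> nat) \<Rightarrow> nat \<Rightarrow> int \<Rightarrow> ipath set set" where
  "Q_part k m n = (if n < 0 then {cyl k (vertex m)}
     else \<Union>\<mu>\<in>Phi k m (nat n). (\<lambda>E. (\<odot>) \<mu> ` E) ` P_part k (m + plen \<mu>) (nat n - plen \<mu>))"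


section \<open>The Dirac operator\<close>

text \<open>In this section \<open>e\<close> is the composition of \<open>\<eta>\<close> with the embedding \<open>\<iota>\<close> of \<open>Cc k\<close> into \<open>A\<close>.\<close>

definition eta_vec :: "((gelem \<Rightarrow> complex) \<Rightarrow> 'h) \<Rightarrow> fpath \<times> fpath \<Rightarrow> ipath set \<Rightarrow> 'h" where
  "eta_vec e \<Delta> F = e (indicator (germ_set (fst \<Delta>) (snd \<Delta>) F))"

text \<open>\<open>K_space k e m \<Delta> n E\<close> is \<open>K\<^sub>\<Delta>(E)\<^sub>n\<^sub>+\<^sub>1\<close>, for \<open>\<Delta> \<in> S_pairs k j l\<close> with \<open>m = m(j, l)\<close>.\<close>

definition K_space :: "(nat \<Rightarrow> nat) \<Rightarrow> ((gelem \<Rightarrow> complex) \<Rightarrow> 'h::chilbert) \<Rightarrow> nat \<Rightarrow>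
    fpath \<times> fpath \<Rightarrow> int \<Rightarrow> ipath set \<Rightarrow> 'h set" where
  "K_space k e m \<Delta> n E =
     cspan {eta_vec e \<Delta> F | F. F \<in> Q_part k m (n + 1) \<and> F \<subseteq> E} \<inter>
     {\<xi>. cinner \<xi> (eta_vec e \<Delta> E) = 0}"

definition H_space :: "(nat \<Rightarrow> nat) \<Rightarrow> ((gelem \<Rightarrow> complex) \<Rightarrow> 'h::chilbert) \<Rightarrow>
    nat \<Rightarrow> nat \<Rightarrow> int \<Rightarrow> 'h set" where
  "H_space k e j l n =
     cspan (\<Union>i\<in>(if j = 1 then {0, 1} else {j}). \<Union>\<Delta>\<in>S_pairs k i l.
       let m = p_index k i + l + 1 in
       if n = -2 then {eta_vec e \<Delta> (cyl k (vertex m))}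
       else \<Union>E\<in>Q_part k m n. K_space k e m \<Delta> n E)"

definition H_index :: "(nat \<times> nat \<times> int) set" where
  "H_index = {(j, l, n). 1 \<le> j \<and> -2 \<le> n}"

definition D_weight :: "nat \<Rightarrow> nat \<Rightarrow> int \<Rightarrow> real" where
  "D_weight j l n = real j + real l + real_of_int n + 2"

definition D_dom :: "(nat \<Rightarrow> nat) \<Rightarrow> ((gelem \<Rightarrow> complex) \<Rightarrow> 'h::chilbert) \<Rightarrow> 'h set" where
  "D_dom k e = {\<xi>. (\<lambda>(j, l, n). (D_weight j l n)\<^sup>2 * (norm (orth_proj (H_space k e j l n) \<xi>))\<^sup>2)
     summable_on H_index}"

definition D_op :: "(nat \<Rightarrow> nat) \<Rightarrow> ((gelem \<Rightarrow> complex) \<Rightarrow> 'h::chilbert) \<Rightarrow> 'h \<Rightarrow> 'h" where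
  "D_op k e \<xi> = (\<Sum>\<^sub>\<infinity>(j, l, n)\<in>H_index. D_weight j l n *\<^sub>R orth_proj (H_space k e j l n) \<xi>)"

end

theory Submission
  imports Defs
begin

text \<open>Filter the pairs \<open>(\<Delta>, E)\<close>, \<open>\<Delta> \<in> S\<^sub>j\<^sub>,\<^sub>l\<close>, \<open>E\<close> a cell of the partition \<open>Q\<^sub>q\<^sub>-\<^sub>1\<close>, by the level
  \<open>max j 1 + l + q\<close>. The characteristic functions of the bisections \<open>[\<Delta>, E]\<close> span a dense
  *-subalgebra: every germ lies in exactly one of the bisections indexed by the \<open>S\<^sub>j\<^sub>,\<^sub>l\<close>, and the full
  norm of a function supported on a bisection is its supremum norm. The spectral subspace of \<open>D\<close> for
  \<open>[0, N]\<close> is the finite-dimensional span of the vectors of level at most \<open>N\<close>. Multiplication by a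
  fixed compact open bisection raises the level by at most a constant, because left translation by a
  path of length \<open>r\<close> moves the last \<open>\<gamma>\<close>-edges and the cells by at most \<open>r\<close> positions. The
  same applies to its adjoint, so each generator acts by a matrix that is banded with respect to the
  eigenspaces of \<open>D\<close>. As the eigenvalues are integers, the commutator with \<open>D\<close> of a bounded
  operator with finitely many diagonals is a finite sum of multiples of these (bounded)
  diagonals.\<close>


section \<open>Words\<close>

text \<open>The three indices have to be added in the weight because cancellation trades them
  against each other. A product of two reduced pairs must be reduced again, and stripping a common
  suffix \<sigma> refines the cell: prefixing a path to base points keeps the level q of a cell, but
  a cell seen behind \<sigma> needs level q + |\<sigma>|. What makes multiplication banded is
  therefore an estimate for j + l + |\<sigma>|, not for j + l alone. The obstacle is a drop of j.
  Lengths are p_j + l with possibly unbounded gaps between the p_j, so a product that lost a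
  \<gamma>-edge at a far position p_j could gain an arbitrarily large l. Reducedness excludes this:
  such an edge would have to lie in the stripped suffix, so both paths would share it and everything
  behind it. Since \<alpha> and \<beta> commute, words are not unique; the partitions are handled
  through an equivalence of infinite paths, divisibility by the same test paths, for which
  refinement and translation are transparent. Orthogonality rests on the fact that the inner product
  of two indicator vectors depends on the intersection of their bisections alone.\<close>

definition iCons :: "letter \<Rightarrow> (nat \<Rightarrow> letter) \<Rightarrow> nat \<Rightarrow> letter" (infixr "##" 65) where
  "(a ## x) n = (case n of 0 \<Rightarrow> a | Suc m \<Rightarrow> x m)"

lemma iCons_0 [simp]: "(a ## x) 0 = a"
  and iCons_Suc [simp]: "(a ## x) (Suc n) = x n"
  by (simp_all add: iCons_def)

lemma iCons_tl: "x 0 ## (\<lambda>n. x (Suc n)) = x"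
  by (auto simp: fun_eq_iff iCons_def split: nat.splits)

lemma iCons_exhaust: obtains a y where "x = a ## y"
  using iCons_tl by metis

lemma iCons_inject [simp]: "a ## x = b ## y \<longleftrightarrow> a = b \<and> x = y"
  by (metis iCons_0 iCons_Suc ext)

lemma prepend_Nil [simp]: "prepend [] x = x"
  by (simp add: prepend_def[abs_def])

lemma prepend_Cons [simp]: "prepend (a # w) x = a ## prepend w x"
  by (auto simp: fun_eq_iff prepend_def iCons_def split: nat.splits)

lemma iCons_letter_set:
  "{t. (a ## x) t = l} = (if a = l then {0} else {}) \<union> Suc ` {t. x t = l}"
proof (rule set_eqI)
  fix t show "t \<in> {t. (a ## x) t = l} \<longleftrightarrow> t \<in> (if a = l then {0} else {}) \<union> Suc ` {t. x t = l}"
    by (cases t) auto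
qed

lemma ecard_iCons:
  "ecard {t. (a ## x) t = l} = (if a = l then eSuc else id) (ecard {t. x t = l})"
  unfolding iCons_letter_set
  by (auto simp: ecard_def card_image finite_image_iff card_insert_if eSuc_enat)

lemma card_iCons:
  "card {t. t < Suc n \<and> (a ## x) t = l} = (if a = l then 1 else 0) + card {t. t < n \<and> x t = l}"
proof -
  have "{t. t < Suc n \<and> (a ## x) t = l} = (if a = l then {0} else {}) \<union> Suc ` {t. t < n \<and> x t = l}"
    (is "?L = ?R")
  proof (rule set_eqI)
    fix t show "t \<in> ?L \<longleftrightarrow> t \<in> ?R" by (cases t) auto
  qed
  then show ?thesis by (auto simp: card_image card_insert_if)
qed

section \<open>Cancellation and local confluence for infinite words\<close>

lemma same_blocks_LG:
  "same_blocks x y \<Longrightarrow> x n = LG c \<longleftrightarrow> y n = LG c"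
  by (simp add: same_blocks_def)

text \<open>\<open>eSuc\<close> is injective also at infinity, so the total letter counts, finite or
  infinite, survive the removal of a common first letter. The counts before \<gamma>-edges drop by
  the same amount on both sides.\<close>

lemma same_blocks_cancel: "same_blocks (a ## x) (a ## y) \<Longrightarrow> same_blocks x y"
  unfolding same_blocks_def
proof (intro conjI allI impI)
  assume A: "(\<forall>n c. ((a ## x) n = LG c) = ((a ## y) n = LG c)) \<and>
    (\<forall>n c. (a ## x) n = LG c \<longrightarrow>
      card {t. t < n \<and> (a ## x) t = LA} = card {t. t < n \<and> (a ## y) t = LA}) \<and>
    ecard {t. (a ## x) t = LA} = ecard {t. (a ## y) t = LA} \<and>
    ecard {t. (a ## x) t = LB} = ecard {t. (a ## y) t = LB}"
  show "(x n = LG c) = (y n = LG c)" for n c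
    using A[THEN conjunct1, rule_format, of "Suc n" c] by simp
  show "card {t. t < n \<and> x t = LA} = card {t. t < n \<and> y t = LA}" if "x n = LG c" for n c
    using A[THEN conjunct2, THEN conjunct1, rule_format, of "Suc n" c] that by (simp add: card_iCons)
  show "ecard {t. x t = LA} = ecard {t. y t = LA}" "ecard {t. x t = LB} = ecard {t. y t = LB}"
    using A by (auto simp: ecard_iCons split: if_splits)
qed

lemma same_blocks_iCons [simp]: "same_blocks (a ## x) (a ## y) \<longleftrightarrow> same_blocks x y"
  using same_blocks_cancel same_blocks_Cons[of x y a] by auto

lemma same_blocks_prepend_iff [simp]: "same_blocks (prepend w x) (prepend w y) \<longleftrightarrow> same_blocks x y"
  by (induction w) auto

lemma same_blocks_swap_iCons: "same_blocks (LA ## LB ## x) (LB ## LA ## x)"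
  using same_blocks_swap[of "[]" x] by simp

definition swp :: "letter \<Rightarrow> letter \<Rightarrow> bool" where
  "swp e f \<longleftrightarrow> e = LA \<and> f = LB \<or> e = LB \<and> f = LA"

lemma swp_sym: "swp e f \<longleftrightarrow> swp f e"
  by (auto simp: swp_def)

lemma same_blocks_swp: "swp e f \<Longrightarrow> same_blocks (e ## f ## x) (f ## e ## x)"
  unfolding swp_def using same_blocks_swap_iCons same_blocks_sym by blast

lemma same_blocks_front:
  "swp e f \<Longrightarrow> same_blocks (prepend (replicate r e @ [f]) x) (f ## prepend (replicate r e) x)"
proof (induction r)
  case (Suc r)
  then have "same_blocks (prepend (replicate (Suc r) e @ [f]) x) (e ## f ## prepend (replicate r e) x)"
    by simp
  with same_blocks_swp[OF Suc.prems, of "prepend (replicate r e) x"] show ?case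
    using same_blocks_trans by (metis prepend_Cons replicate_Suc)
qed (simp add: same_blocks_refl)

lemma first_other_letter:
  assumes "x (n::nat) \<noteq> (e::letter)"
  obtains r where "\<forall>t<r. x t = e" "x r \<noteq> e"
  using assms that exists_least_iff[of "\<lambda>n. x n \<noteq> e"] by blast

lemma prepend_split: "x = prepend (map x [0..<n]) (\<lambda>t. x (n + t))"
  by (auto simp: fun_eq_iff prepend_def)

text \<open>Different heads can only be an \<alpha> and a \<beta> of the same block, so the head f
  of the second word must occur in the first word after a pure run of e. This run is what gets
  commuted in all later confluence arguments.\<close>

lemma same_blocks_diff_heads:
  assumes "same_blocks (e ## X) (f ## Y)" and "e \<noteq> f"
  shows "swp e f \<and> (\<exists>r X'. X = prepend (replicate r e @ [f]) X')"
proof -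
  have nG: "e \<noteq> LG c" "f \<noteq> LG c" for c
    using same_blocks_LG[OF assms(1), of 0 c] assms(2) by auto
  have sw: "swp e f"
    using nG assms(2) by (cases e; cases f) (auto simp: swp_def)
  \<comment> \<open>Otherwise the left word contains no f, whereas the right one begins with f, and
    the letter totals would differ.\<close>
  have "\<exists>n. X n \<noteq> e"
  proof (rule ccontr)
    assume "\<not> ?thesis"
    then have all: "X n = e" for n by auto
    have "{t. X t = f} = {}" using assms(2) all by auto
    then have "ecard {t. (e ## X) t = f} = 0"
      using assms(2) unfolding ecard_iCons by (simp only: if_False) (simp add: ecard_def zero_enat_def)
    moreover have "ecard {t. (f ## Y) t = f} \<noteq> 0"
      by (simp add: ecard_iCons)
    moreover have "ecard {t. (e ## X) t = f} = ecard {t. (f ## Y) t = f}"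
      using assms(1) sw by (auto simp: same_blocks_def swp_def)
    ultimately show False by simp
  qed
  then obtain r where r: "\<forall>t<r. X t = e" "X r \<noteq> e" using first_other_letter by metis
  \<comment> \<open>A \<gamma>-edge here would have equally many \<alpha> before it in both words,
    but the left prefix is a power of e and the right prefix of the same length starts with
    f.\<close>
  have "X r = f"
  proof (cases "X r")
    case (LG c)
    then have g: "(e ## X) (Suc r) = LG c" by simp
    then have g': "(f ## Y) (Suc r) = LG c" using same_blocks_LG[OF assms(1)] by blast
    have eq: "card {t. t < Suc r \<and> (e ## X) t = LA} = card {t. t < Suc r \<and> (f ## Y) t = LA}"
      using assms(1) g unfolding same_blocks_def by blast
    have cX: "{t. t < r \<and> X t = LA} = (if e = LA then {..<r} else {})" using r by auto
    have cY: "card {t. t < r \<and> Y t = LA} \<le> r"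
      using card_mono[of "{..<r}" "{t. t < r \<and> Y t = LA}"] by auto
    show ?thesis using eq sw cY by (auto simp: card_iCons cX swp_def)
  qed (use r(2) sw in \<open>auto simp: swp_def\<close>)
  then have "map X [0..<Suc r] = replicate r e @ [f]"
    using r(1) by (auto intro!: nth_equalityI simp: nth_append)
  then have "X = prepend (replicate r e @ [f]) (\<lambda>t. X (Suc r + t))"
    using prepend_split[of X "Suc r"] by metis
  with sw show ?thesis by blast
qed

text \<open>Local confluence: both words are equivalent to words that start with e and f in either
  order and continue with the same Z. Inductions on words use it whenever the two heads
  differ.\<close>

lemma same_blocks_diamond:
  assumes "same_blocks (e ## X) (f ## Y)" and "e \<noteq> f"
  obtains Z where "swp e f" "same_blocks X (f ## Z)" "same_blocks Y (e ## Z)"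
proof -
  obtain r X' where sw: "swp e f" and X: "X = prepend (replicate r e @ [f]) X'"
    using same_blocks_diff_heads[OF assms] by blast
  define Z where "Z = prepend (replicate r e) X'"
  have 1: "same_blocks X (f ## Z)" unfolding X Z_def by (rule same_blocks_front[OF sw])
  then have "same_blocks (e ## X) (e ## f ## Z)" by simp
  also have "same_blocks (e ## f ## Z) (f ## e ## Z)" by (rule same_blocks_swp[OF sw])
  finally (same_blocks_trans) have "same_blocks (f ## Y) (f ## e ## Z)"
    using assms(1) same_blocks_sym same_blocks_trans by blast
  then show ?thesis using that sw 1 by simp
qed

section \<open>Words as representatives of paths\<close>

definition fp :: "nat \<Rightarrow> letter list \<Rightarrow> fpath" where "fp i w = abs_fpath (i, w)"
definition ip :: "nat \<Rightarrow> (nat \<Rightarrow> letter) \<Rightarrow> ipath" where "ip i x = abs_ipath (i, x)"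

lemma fp_cases [cases type]: obtains i w where "\<mu> = fp i w"
  unfolding fp_def using Quotient_abs_rep[OF Quotient_fpath] by (metis surj_pair)

lemma ip_cases [cases type]: obtains i x where "\<mu> = ip i x"
  unfolding ip_def using Quotient_abs_rep[OF Quotient_ipath] by (metis surj_pair)

lemma ip_eq_iff: "ip i x = ip j y \<longleftrightarrow> i = j \<and> same_blocks x y"
  unfolding ip_def ipath.abs_eq_iff same_ipath_def by simp

lemma prange_fp [simp]: "prange (fp i w) = i"
  and plen_fp [simp]: "plen (fp i w) = length w"
  and pcomp_fp [simp]: "fp i u \<Zcomp> fp j v = fp i (u @ v)"
  and irange_ip [simp]: "irange (ip i x) = i"
  and icomp_ip [simp]: "fp i u \<odot> ip j x = ip i (prepend u x)"
  and pcount_fp [simp]: "pcount l (fp i w) = count_list w l"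
  and vertex_fp: "vertex i = fp i []"
  and ab_path_fp: "ab_path i p q = fp i (replicate p LA @ replicate q LB)"
  and gamma_edge_fp: "gamma_edge i c = fp i [LG c]"
  and admissible_fp: "admissible k (fp i w) \<longleftrightarrow>
    1 \<le> i \<and> (\<forall>n<length w. \<forall>c. w ! n = LG c \<longrightarrow> c \<in> {1..k (i + n)})"
  and iadmissible_ip: "iadmissible k (ip i x) \<longleftrightarrow>
    1 \<le> i \<and> (\<forall>n c. x n = LG c \<longrightarrow> c \<in> {1..k (i + n)})"
  unfolding fp_def ip_def
  by (simp_all add: prange.abs_eq plen.abs_eq pcomp.abs_eq raw_comp_def irange.abs_eq icomp.abs_eq
      pcount.abs_eq vertex.abs_eq ab_path.abs_eq gamma_edge.abs_eq admissible.abs_eq iadmissible.abs_eq)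

lemma psource_fp [simp]: "psource (fp i w) = i + length w"
  by (simp add: psource_def)

text \<open>The congruence on words is read off the quotient at the dummy range 0;
  \<open>fp_eq_iff\<close> shows that the range has no influence on it.\<close>

definition feq :: "letter list \<Rightarrow> letter list \<Rightarrow> bool" where
  "feq u v \<longleftrightarrow> fp 0 u = fp 0 v"

lemma fp_swp: "swp e f \<Longrightarrow> fp i (u @ e # f # w) = fp i (u @ f # e # w)"
proof -
  have "equivclp swap_step (i, u @ LA # LB # w) (i, u @ LB # LA # w)"
    by (rule r_into_equivclp) (auto simp: swap_step_def)
  moreover assume "swp e f"
  ultimately show ?thesis
    unfolding fp_def fpath.abs_eq_iff swp_def using equivclp_sym by metis
qed

text \<open>Padding by the constant word of \<open>LG 0\<close> closes the last block, so the
  congruence generated by single swaps becomes the counting criterion \<open>same_blocks\<close>.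
  Cancellation laws for finite words are inherited through this.\<close>

lemma fp_eq_iff_raw:
  "fp i u = fp j v \<longleftrightarrow> i = j \<and> length u = length v \<and>
     same_blocks (prepend u (\<lambda>_. LG 0)) (prepend v (\<lambda>_. LG 0))" (is "_ \<longleftrightarrow> ?R i u j v")
proof
  assume eq: "fp i u = fp j v"
  have "prange (fp i u) = prange (fp j v)" "plen (fp i u) = plen (fp j v)"
    "fp i u \<odot> ip 0 (\<lambda>_. LG 0) = fp j v \<odot> ip 0 (\<lambda>_. LG 0)"
    using eq by simp_all
  then show "?R i u j v" by (simp add: ip_eq_iff)
next
  have "length u = length v \<Longrightarrow> same_blocks (prepend u (\<lambda>_. LG 0)) (prepend v (\<lambda>_. LG 0)) \<Longrightarrow>
     fp i u = fp i v" for u v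
  proof (induction "length u" arbitrary: u v)
    case (Suc n)
    then obtain a u' b v' where uv: "u = a # u'" "v = b # v'" and l: "length u' = n" "length v' = n"
      by (metis length_Suc_conv)
    have cons: "fp i w = fp i w' \<Longrightarrow> fp i (c # w) = fp i (c # w')" for c w w'
      using pcomp_fp[of i "[c]" i w] pcomp_fp[of i "[c]" i w'] by simp
    show ?case
    proof (cases "a = b")
      case True
      then have "same_blocks (prepend u' (\<lambda>_. LG 0)) (prepend v' (\<lambda>_. LG 0))"
        using Suc.prems uv by simp
      then have "fp i u' = fp i v'" using Suc l by metis
      then show ?thesis using uv True cons by blast
    next
      case False
      have sb: "same_blocks (a ## prepend u' (\<lambda>_. LG 0)) (b ## prepend v' (\<lambda>_. LG 0))"
        using Suc.prems uv by simp
      obtain r X' where sw: "swp a b"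
        and X: "prepend u' (\<lambda>_. LG 0) = prepend (replicate r a @ [b]) X'"
        using same_blocks_diff_heads[OF sb False] by blast
      \<comment> \<open>Behind u' stands only the padding, which contains no letter that b could
        be.\<close>
      have rn: "r < n"
      proof (rule ccontr)
        assume "\<not> r < n"
        then have "prepend u' (\<lambda>_. LG 0) r = LG 0" using l by (simp add: prepend_def)
        moreover have "prepend (replicate r a @ [b]) X' r = b" by (simp add: prepend_def nth_append)
        ultimately show False using X sw by (auto simp: swp_def)
      qed
      define w where "w = drop (Suc r) u'"
      have u': "u' = replicate r a @ b # w"
      proof (rule nth_equalityI)
        show "length u' = length (replicate r a @ b # w)" using rn l by (simp add: w_def)
        fix t assume t: "t < length u'"
        then have "u' ! t = prepend (replicate r a @ [b]) X' t"
          using X by (metis prepend_def)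
        then show "u' ! t = (replicate r a @ b # w) ! t"
        proof (cases "t < Suc r")
          case True
          then show ?thesis using \<open>u' ! t = _\<close> by (auto simp: prepend_def nth_append)
        next
          case False
          then show ?thesis using t rn by (simp add: w_def nth_append nth_Cons')
        qed
      qed
      have move: "fp i (replicate s a @ b # w) = fp i (b # replicate s a @ w)" for s
      proof (induction s)
        case (Suc s)
        have "fp i (a # b # replicate s a @ w) = fp i (b # a # replicate s a @ w)"
          using fp_swp[OF sw, of i "[]"] by simp
        then show ?case using cons[OF Suc] by simp
      qed simp
      define z where "z = replicate r a @ w"
      \<comment> \<open>The letter b is moved to the front through the run of a, after which both
        words start with b and the tails have length n.\<close>
      have "fp i u = fp i (a # b # z)"
        using cons[OF move[of r]] by (simp add: uv u' z_def)
      also have "\<dots> = fp i (b # a # z)" using fp_swp[OF sw, of i "[]"] by simp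
      finally have 1: "fp i u = fp i (b # a # z)" .
      then have "fp i u \<odot> ip 0 (\<lambda>_. LG 0) = fp i (b # a # z) \<odot> ip 0 (\<lambda>_. LG 0)" by simp
      then have "same_blocks (prepend u (\<lambda>_. LG 0)) (b ## prepend (a # z) (\<lambda>_. LG 0))"
        by (simp add: ip_eq_iff)
      then have "same_blocks (b ## prepend v' (\<lambda>_. LG 0)) (b ## prepend (a # z) (\<lambda>_. LG 0))"
        using Suc.prems(2) uv same_blocks_sym same_blocks_trans by (metis prepend_Cons)
      then have "same_blocks (prepend (a # z) (\<lambda>_. LG 0)) (prepend v' (\<lambda>_. LG 0))"
        using same_blocks_sym by simp
      moreover have "length (a # z) = n" using rn l by (simp add: z_def w_def)
      ultimately have "fp i (a # z) = fp i v'" using Suc.hyps(1) l by metis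
      then show ?thesis using 1 cons uv by metis
    qed
  qed simp
  then show "?R i u j v \<Longrightarrow> fp i u = fp j v" by blast
qed

lemma fp_eq_iff: "fp i u = fp j v \<longleftrightarrow> i = j \<and> feq u v"
  unfolding feq_def fp_eq_iff_raw by simp

lemma feq_iff: "feq u v \<longleftrightarrow> length u = length v \<and>
     same_blocks (prepend u (\<lambda>_. LG 0)) (prepend v (\<lambda>_. LG 0))"
  unfolding feq_def fp_eq_iff_raw by simp

lemma feq_refl [simp]: "feq u u"
  and feq_sym: "feq u v \<Longrightarrow> feq v u"
  and feq_trans [trans]: "feq u v \<Longrightarrow> feq v w \<Longrightarrow> feq u w"
  by (simp_all add: feq_def)

lemma feq_length: "feq u v \<Longrightarrow> length u = length v"
  by (simp add: feq_iff)

lemma feq_append_left [simp]: "feq (w @ u) (w @ v) \<longleftrightarrow> feq u v"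
  by (simp add: feq_iff prepend_append)

lemma feq_Cons [simp]: "feq (a # u) (a # v) \<longleftrightarrow> feq u v"
  by (simp add: feq_iff)

lemma feq_append: "feq u u' \<Longrightarrow> feq v v' \<Longrightarrow> feq (u @ v) (u' @ v')"
  unfolding feq_def by (metis pcomp_fp)

lemma feq_prepend:
  assumes "feq u u'" "same_blocks x x'" shows "same_blocks (prepend u x) (prepend u' x')"
proof -
  have "fp 0 u \<odot> ip 0 x = fp 0 u' \<odot> ip 0 x'"
    using assms ip_eq_iff[of 0 x 0 x'] unfolding feq_def by metis
  then show ?thesis by (simp add: ip_eq_iff)
qed

lemma feq_swp: "swp e f \<Longrightarrow> feq (e # f # w) (f # e # w)"
  unfolding feq_def using fp_swp[of e f 0 "[]"] by simp

lemma feq_count: "feq u v \<Longrightarrow> count_list u l = count_list v l"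
  unfolding feq_def by (metis pcount_fp)

lemma feq_LG: "feq u v \<Longrightarrow> t < length u \<Longrightarrow> u ! t = LG c \<longleftrightarrow> v ! t = LG c"
  unfolding feq_iff using same_blocks_LG[of _ _ t c] by (metis prepend_def)

text \<open>The commutation relation is symmetric under reversal, so right cancellation and the
  diamond at the last letter follow from the left-hand versions.\<close>

lemma feq_rev: "feq u v \<Longrightarrow> feq (rev u) (rev v)"
proof -
  assume "feq u v"
  then have "equivclp swap_step (0, u) (0, v)"
    by (simp add: feq_def fp_def fpath.abs_eq_iff)
  then have "(\<lambda>(i, w). fp i (rev w)) (0, u) = (\<lambda>(i, w). fp i (rev w)) (0, v)"
  proof (rule equivclp_invariant)
    fix p q assume "swap_step p q"
    then obtain i a b where pq: "p = (i, a @ LA # LB # b)" "q = (i, a @ LB # LA # b)"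
      by (auto simp: swap_step_def)
    have "fp i (rev b @ LB # LA # rev a) = fp i (rev b @ LA # LB # rev a)"
      by (rule fp_swp) (simp add: swp_def)
    then show "(\<lambda>(i, w). fp i (rev w)) p = (\<lambda>(i, w). fp i (rev w)) q" by (simp add: pq)
  qed
  then show ?thesis by (simp add: feq_def)
qed

lemma feq_append_right [simp]: "feq (u @ w) (v @ w) \<longleftrightarrow> feq u v"
proof
  assume "feq (u @ w) (v @ w)"
  from feq_rev[OF this] have "feq (rev u) (rev v)" by simp
  from feq_rev[OF this] show "feq u v" by simp
qed (auto intro: feq_append)

text \<open>The argument for infinite words applied to the padded words; the run of e followed by f
  ends before the padding begins.\<close>

lemma feq_diamond:
  assumes "feq (e # u) (f # v)" "e \<noteq> f"
  obtains z where "swp e f" "feq u (f # z)" "feq v (e # z)"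
proof -
  have sb: "same_blocks (e ## prepend u (\<lambda>_. LG 0)) (f ## prepend v (\<lambda>_. LG 0))"
    and len: "length u = length v"
    using assms(1) by (auto simp: feq_iff)
  obtain r X' where sw: "swp e f"
    and X: "prepend u (\<lambda>_. LG 0) = prepend (replicate r e @ [f]) X'"
    using same_blocks_diff_heads[OF sb assms(2)] by blast
  have rn: "r < length u"
  proof (rule ccontr)
    assume "\<not> r < length u"
    then have "prepend u (\<lambda>_. LG 0) r = LG 0" by (simp add: prepend_def)
    moreover have "prepend (replicate r e @ [f]) X' r = f" by (simp add: prepend_def nth_append)
    ultimately show False using X sw by (auto simp: swp_def)
  qed
  have tk: "take (Suc r) u = replicate r e @ [f]"
  proof (rule nth_equalityI)
    show "length (take (Suc r) u) = length (replicate r e @ [f])" using rn by simp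
    fix t assume "t < length (take (Suc r) u)"
    then have t: "t < Suc r" "t < length u" by auto
    then have "u ! t = prepend (replicate r e @ [f]) X' t" using X by (metis prepend_def)
    then show "take (Suc r) u ! t = (replicate r e @ [f]) ! t" using t by (simp add: prepend_def)
  qed
  define z where "z = replicate r e @ drop (Suc r) u"
  have mv: "feq (replicate s e @ f # w) (f # replicate s e @ w)" for s w
  proof (induction s)
    case (Suc s)
    have "feq (replicate (Suc s) e @ f # w) (e # f # replicate s e @ w)" using Suc by simp
    then show ?case using feq_swp[OF sw] feq_trans by fastforce
  qed simp
  have "u = replicate r e @ f # drop (Suc r) u"
    using tk append_take_drop_id[of "Suc r" u] by simp
  then have 1: "feq u (f # z)" using mv unfolding z_def by metis
  then have "feq (e # u) (e # f # z)" by simp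
  then have "feq (f # v) (f # e # z)" using feq_swp[OF sw] assms(1) feq_sym feq_trans by blast
  then show ?thesis using that sw 1 by simp
qed

lemma feq_diamond_right:
  assumes "feq (u @ [e]) (v @ [f])" "e \<noteq> f"
  obtains z where "swp e f" "feq u (z @ [f])" "feq v (z @ [e])"
proof -
  have "feq (e # rev u) (f # rev v)" using feq_rev[OF assms(1)] by simp
  then obtain z where z: "swp e f" "feq (rev u) (f # z)" "feq (rev v) (e # z)"
    using feq_diamond assms(2) by blast
  from feq_rev[OF z(2)] feq_rev[OF z(3)] show ?thesis using that[of "rev z"] z(1) by simp
qed

section \<open>Cutting at \<gamma>-edges and common extensions\<close>

text \<open>A \<gamma>-edge commutes with nothing, so an equivalence of words splits at its position
  into one of the finite parts before it and one of the tails behind it.\<close>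

lemma same_blocks_cut:
  assumes "same_blocks (prepend u (LG c ## x)) (prepend v y)" "length u = length v"
  shows "feq u v \<and> y 0 = LG c \<and> same_blocks x (\<lambda>n. y (Suc n))"
  using assms
proof (induction "length u" arbitrary: u v x y)
  case 0
  then have sb: "same_blocks (LG c ## x) y" by simp
  then have "y 0 = LG c" using same_blocks_LG[OF sb, of 0 c] by simp
  then show ?case using sb 0 iCons_tl[of y] same_blocks_iCons by (metis feq_refl length_0_conv)
next
  case (Suc n)
  then obtain a u' b v' where uv: "u = a # u'" "v = b # v'" and l: "length u' = n" "length v' = n"
    by (metis length_Suc_conv)
  show ?case
  proof (cases "a = b")
    case True
    then have "feq u' v' \<and> y 0 = LG c \<and> same_blocks x (\<lambda>n. y (Suc n))"
      using Suc.prems uv l by (intro Suc.hyps(1)) auto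
    then show ?thesis using True uv by simp
  next
    case False
    then obtain Z where sw: "swp a b" and Z1: "same_blocks (prepend u' (LG c ## x)) (b ## Z)"
      and Z2: "same_blocks (prepend v' y) (a ## Z)"
      using Suc.prems uv same_blocks_diamond by (metis prepend_Cons)
    have "n \<noteq> 0"
    proof
      assume "n = 0"
      then have "same_blocks (LG c ## x) (b ## Z)" using Z1 l by simp
      then show False using same_blocks_LG[of "LG c ## x" "b ## Z" 0 c] sw by (auto simp: swp_def)
    qed
    then obtain n' where n': "n = Suc n'" using not0_implies_Suc by blast
    define z where "z = map Z [0..<n']"
    define Z' where "Z' = (\<lambda>t. Z (n' + t))"
    have Z: "Z = prepend z Z'" unfolding z_def Z'_def by (rule prepend_split)
    have lz: "length z = n'" by (simp add: z_def)
    \<comment> \<open>Both \<open>b # z\<close> and \<open>a # z\<close> have length n, so the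
      induction hypothesis applies once on either side of the diamond.\<close>
    have 1: "feq u' (b # z) \<and> Z' 0 = LG c \<and> same_blocks x (\<lambda>n. Z' (Suc n))"
      using Z1 l lz n' by (intro Suc.hyps(1)) (auto simp: Z)
    then have "Z' = LG c ## (\<lambda>n. Z' (Suc n))" using iCons_tl[of Z'] by simp
    then have "same_blocks (prepend (a # z) (LG c ## (\<lambda>n. Z' (Suc n)))) (prepend v' y)"
      using Z2 Z same_blocks_sym by (metis prepend_Cons)
    then have 2: "feq (a # z) v' \<and> y 0 = LG c \<and> same_blocks (\<lambda>n. Z' (Suc n)) (\<lambda>n. y (Suc n))"
      using Suc.hyps(1)[of "a # z" "\<lambda>n. Z' (Suc n)" v' y] l lz n' by simp
    have "feq u (a # b # z)" using 1 uv by simp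
    then have "feq u (b # a # z)" using feq_swp[OF sw] feq_trans by blast
    then have "feq u v" using 2 uv feq_trans by (metis feq_Cons)
    then show ?thesis using 1 2 same_blocks_trans by blast
  qed
qed


lemma feq_cut:
  assumes "feq (u @ LG c # u') v"
  obtains v1 v2 where "v = v1 @ LG c # v2" "feq u v1" "feq u' v2"
proof -
  let ?G = "\<lambda>_. LG 0"
  define v1 v2 where "v1 = take (length u) v" and "v2 = drop (Suc (length u)) v"
  have len: "length v = length u + Suc (length u')" using feq_length[OF assms] by simp
  then have v: "v = v1 @ v ! length u # v2" by (simp add: v1_def v2_def id_take_nth_drop[symmetric])
  have "same_blocks (prepend u (LG c ## prepend u' ?G)) (prepend v1 (v ! length u ## prepend v2 ?G))"
    using assms v unfolding feq_iff by (metis prepend_append prepend_Cons)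
  moreover have "length u = length v1" using len by (simp add: v1_def)
  ultimately have *: "feq u v1" "v ! length u = LG c" "same_blocks (prepend u' ?G) (prepend v2 ?G)"
    using same_blocks_cut[of u c "prepend u' ?G" v1 "v ! length u ## prepend v2 ?G"] by auto
  have "feq u' v2" using *(3) len by (simp add: feq_iff v2_def)
  then show ?thesis using that v * by metis
qed

text \<open>Two prefixes of one infinite word extend to a common prefix of it. Each needs at most
  the length of the other; these bounds keep the recursion well founded and later limit the level
  shift caused by a multiplication.\<close>

lemma same_blocks_common_extension:
  assumes "same_blocks (prepend u x) (prepend v y)"
  shows "\<exists>s t z. feq (u @ s) (v @ t) \<and> same_blocks x (prepend s z) \<and> same_blocks y (prepend t z) \<and>
    length s \<le> length v \<and> length t \<le> length u"
  using assms
proof (induction "length u + length v" arbitrary: u v x y rule: less_induct)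
  case less
  show ?case
  proof (cases "u = [] \<or> v = []")
    case True
    then show ?thesis
    proof
      assume "u = []"
      then show ?thesis using less.prems
        by (intro exI[of _ v] exI[of _ "[]"] exI[of _ y]) (simp add: same_blocks_refl)
    next
      assume "v = []"
      then show ?thesis using less.prems
        by (intro exI[of _ "[]"] exI[of _ u] exI[of _ x]) (simp add: same_blocks_refl same_blocks_sym)
    qed
  next
    case False
    then obtain e u' f v' where uv: "u = e # u'" "v = f # v'" by (metis neq_Nil_conv)
    show ?thesis
    proof (cases "e = f")
      case True
      then have "same_blocks (prepend u' x) (prepend v' y)" using less.prems uv by simp
      from less.hyps[OF _ this] obtain s t z where
        "feq (u' @ s) (v' @ t)" "same_blocks x (prepend s z)" "same_blocks y (prepend t z)"
        "length s \<le> length v'" "length t \<le> length u'"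
        using uv by auto
      then show ?thesis using uv True by (intro exI[of _ s] exI[of _ t] exI[of _ z]) auto
    next
      case ef: False
      obtain Z where sw: "swp e f" and Z: "same_blocks (prepend u' x) (prepend [f] Z)"
        "same_blocks (prepend v' y) (prepend [e] Z)"
        using same_blocks_diamond less.prems ef uv by (metis prepend_Cons prepend_Nil)
      obtain s1 t1 z1 where 1: "feq (u' @ s1) (f # t1)" "same_blocks x (prepend s1 z1)"
        "same_blocks Z (prepend t1 z1)" "length s1 \<le> 1" "length t1 \<le> length u'"
      proof -
        have "length u' + length [f] < length u + length v" using uv by simp
        from less.hyps[OF this Z(1)] show ?thesis using that by auto
      qed
      obtain s2 t2 z2 where 2: "feq (v' @ s2) (e # t2)" "same_blocks y (prepend s2 z2)"
        "same_blocks Z (prepend t2 z2)" "length s2 \<le> 1" "length t2 \<le> length v'"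
      proof -
        have "length v' + length [e] < length u + length v" using uv by simp
        from less.hyps[OF this Z(2)] show ?thesis using that by auto
      qed
      have "same_blocks (prepend t1 z1) (prepend t2 z2)" using 1(3) 2(3) same_blocks_sym same_blocks_trans by blast
      \<comment> \<open>The two calls after the diamond leave the common tail Z with two prefixes
        \<open>t1\<close> and \<open>t2\<close>. The length bounds of the induction hypothesis make
        the call that reconciles them a smaller one.\<close>
      moreover have "length t1 + length t2 < length u + length v" using 1(5) 2(5) uv by simp
      ultimately obtain r1 r2 w where 3: "feq (t1 @ r1) (t2 @ r2)" "same_blocks z1 (prepend r1 w)"
        "same_blocks z2 (prepend r2 w)" "length r1 \<le> length t2" "length r2 \<le> length t1"
        using less.hyps[of t1 t2 z1 z2] by blast
      have "feq (u @ s1 @ r1) (e # f # t1 @ r1)"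
        using feq_append[OF 1(1) feq_refl[of r1]] uv by simp
      also have "feq (e # f # t1 @ r1) (f # e # t1 @ r1)" by (rule feq_swp[OF sw])
      also have "feq (f # e # t1 @ r1) (f # e # t2 @ r2)" using 3(1) by simp
      also have "feq (f # e # t2 @ r2) (v @ s2 @ r2)"
        using feq_append[OF 2(1) feq_refl[of r2]] uv feq_sym by simp
      finally have "feq (u @ s1 @ r1) (v @ s2 @ r2)" .
      moreover have "same_blocks x (prepend (s1 @ r1) w)" "same_blocks y (prepend (s2 @ r2) w)"
        using 1(2) 2(2) 3(2,3) by (auto simp: prepend_append intro: same_blocks_trans)
      moreover have "length (s1 @ r1) \<le> length v" "length (s2 @ r2) \<le> length u"
        using 1 2 3 uv by auto
      ultimately show ?thesis by blast
    qed
  qed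
qed

lemma map_iCons_upt: "map (a ## x) [0..<Suc n] = a # map x [0..<n]"
  by (simp add: upt_conv_Cons map_Suc_upt[symmetric] comp_def del: upt_Suc)

lemma map_prepend_upt:
  "length w \<le> n \<Longrightarrow> map (prepend w x) [0..<n] = w @ map x [0..<n - length w]"
  by (auto intro!: nth_equalityI simp: nth_append prepend_def)

lemma map_upt_add: "n \<le> n' \<Longrightarrow> map x [0..<n'] = map x [0..<n] @ map x [n..<n']"
  by (metis le_Suc_ex map_append upt_add_eq_append zero_le)

lemma feq_front: "swp e f \<Longrightarrow> feq (replicate s e @ f # w) (f # replicate s e @ w)"
proof (induction s)
  case (Suc s)
  have "feq (replicate (Suc s) e @ f # w) (e # f # replicate s e @ w)" using Suc by simp
  then show ?case using feq_swp[OF Suc.prems] feq_trans by fastforce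
qed simp

text \<open>An infinite block may have to be searched arbitrarily far for a given letter, but each
  letter of w is found after finitely many steps. So a divisor shows up on a finite piece of the
  very word X.\<close>

lemma same_blocks_finite_prefix:
  assumes "same_blocks X (prepend w Z)"
  shows "\<exists>n v. feq (map X [0..<n]) (w @ v)"
  using assms
proof (induction w arbitrary: X)
  case Nil
  then show ?case by (intro exI[of _ 0] exI[of _ "[]"]) simp
next
  case (Cons a w)
  obtain x0 X' where X: "X = x0 ## X'" using iCons_exhaust .
  show ?case
  proof (cases "x0 = a")
    case True
    then obtain n v where "feq (map X' [0..<n]) (w @ v)" using Cons.IH[of X'] Cons.prems X by auto
    then have "feq (map X [0..<Suc n]) ((a # w) @ v)" unfolding X map_iCons_upt using True by simp
    then show ?thesis by blast
  next
    case False
    obtain r X'' where sw: "swp x0 a" and X': "X' = prepend (replicate r x0 @ [a]) X''"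
      using same_blocks_diff_heads[of x0 X' a "prepend w Z"] Cons.prems X False by auto
    have X2: "X = prepend (replicate (Suc r) x0 @ [a]) X''" using X X' by simp
    define Y where "Y = prepend (replicate (Suc r) x0) X''"
    have "same_blocks (a ## Y) (a ## prepend w Z)"
      using same_blocks_front[OF sw, of "Suc r" X''] Cons.prems unfolding X2 Y_def
      by (metis prepend_Cons same_blocks_sym same_blocks_trans)
    then have "same_blocks Y (prepend w Z)" by simp
    then obtain n v where nv: "feq (map Y [0..<n]) (w @ v)" using Cons.IH by blast
    \<comment> \<open>Long enough to contain the n letters used by the induction hypothesis as well
      as the whole run in front of a.\<close>
    define n' where "n' = n + Suc r"
    have "feq (map Y [0..<n']) (w @ v @ map Y [n..<n'])"
      using map_upt_add[of n n' Y] nv feq_append[OF nv feq_refl] by (simp add: n'_def)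
    moreover have "map Y [0..<n'] = replicate (Suc r) x0 @ map X'' [0..<n]"
      unfolding Y_def by (subst map_prepend_upt) (auto simp: n'_def)
    moreover have "map X [0..<Suc n'] = replicate (Suc r) x0 @ a # map X'' [0..<n]"
      unfolding X2 by (subst map_prepend_upt) (auto simp: n'_def)
    ultimately have "feq (map X [0..<Suc n']) ((a # w) @ v @ map Y [n..<n'])"
      using feq_front[OF sw, of "Suc r" "map X'' [0..<n]"] feq_trans
      by (metis append_Cons feq_Cons)
    then show ?thesis by blast
  qed
qed


section \<open>The category of paths\<close>

lemma plen_pcomp [simp]: "plen (\<mu> \<Zcomp> \<nu>) = plen \<mu> + plen \<nu>"
  and prange_pcomp [simp]: "prange (\<mu> \<Zcomp> \<nu>) = prange \<mu>"
  and irange_icomp [simp]: "irange (\<mu> \<odot> x) = prange \<mu>"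
  by (cases \<mu>; cases \<nu>; cases x; simp)+

lemma psource_pcomp [simp]: "psource \<mu> = prange \<nu> \<Longrightarrow> psource (\<mu> \<Zcomp> \<nu>) = psource \<nu>"
  by (simp add: psource_def)

lemma pcomp_assoc: "(\<mu> \<Zcomp> \<nu>) \<Zcomp> \<kappa> = \<mu> \<Zcomp> (\<nu> \<Zcomp> \<kappa>)"
  by (cases \<mu>; cases \<nu>; cases \<kappa>) simp

lemma pcomp_left_cancel: "prange \<nu> = prange \<kappa> \<Longrightarrow> \<mu> \<Zcomp> \<nu> = \<mu> \<Zcomp> \<kappa> \<longleftrightarrow> \<nu> = \<kappa>"
  by (cases \<mu>; cases \<nu>; cases \<kappa>) (simp add: fp_eq_iff)

lemma pcomp_right_cancel: "\<mu> \<Zcomp> \<kappa> = \<nu> \<Zcomp> \<kappa> \<longleftrightarrow> \<mu> = \<nu>"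
  by (cases \<mu>; cases \<nu>; cases \<kappa>) (simp add: fp_eq_iff)

lemma icomp_left_cancel: "irange x = irange y \<Longrightarrow> \<mu> \<odot> x = \<mu> \<odot> y \<longleftrightarrow> x = y"
  by (cases \<mu>; cases x; cases y) (simp add: ip_eq_iff)

lemma prange_vertex [simp]: "prange (vertex i) = i"
  and plen_vertex [simp]: "plen (vertex i) = 0"
  and psource_vertex [simp]: "psource (vertex i) = i"
  and prange_ab_path [simp]: "prange (ab_path i p q) = i"
  and plen_ab_path [simp]: "plen (ab_path i p q) = p + q"
  and psource_ab_path [simp]: "psource (ab_path i p q) = i + p + q"
  and prange_gamma_edge [simp]: "prange (gamma_edge i c) = i"
  and plen_gamma_edge [simp]: "plen (gamma_edge i c) = 1"
  and psource_gamma_edge [simp]: "psource (gamma_edge i c) = Suc i"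
  by (simp_all add: vertex_fp ab_path_fp gamma_edge_fp)

lemma vertex_pcomp: "prange \<mu> = i \<Longrightarrow> vertex i \<Zcomp> \<mu> = \<mu>"
  and pcomp_vertex [simp]: "\<mu> \<Zcomp> vertex j = \<mu>"
  by (cases \<mu>; auto simp: vertex_fp)+

lemma vertex_icomp: "irange x = i \<Longrightarrow> vertex i \<odot> x = x"
  by (cases x) (auto simp: vertex_fp)

text \<open>The bound of \<open>plen \<tau>\<close> by \<open>plen \<nu>\<close> will make the level
  shift of a product depend on the multiplier only.\<close>

lemma common_extension:
  assumes "\<mu> \<odot> x = \<nu> \<odot> y" "psource \<mu> = irange x" "psource \<nu> = irange y"
  obtains \<tau> \<sigma> z where "\<mu> \<Zcomp> \<tau> = \<nu> \<Zcomp> \<sigma>" "x = \<tau> \<odot> z" "y = \<sigma> \<odot> z" "plen \<tau> \<le> plen \<nu>" "plen \<sigma> \<le> plen \<mu>"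
    "prange \<tau> = psource \<mu>" "prange \<sigma> = psource \<nu>" "psource \<tau> = irange z" "psource \<sigma> = irange z"
proof (cases \<mu>; cases \<nu>; cases x; cases y)
  fix i u j v i' X j' Y
  assume [simp]: "\<mu> = fp i u" "\<nu> = fp j v" "x = ip i' X" "y = ip j' Y"
  have ij: "i = j" and sb: "same_blocks (prepend u X) (prepend v Y)" using assms(1) by (auto simp: ip_eq_iff)
  obtain s t z where stz: "feq (u @ s) (v @ t)" "same_blocks X (prepend s z)" "same_blocks Y (prepend t z)"
    "length s \<le> length v" "length t \<le> length u"
    using same_blocks_common_extension[OF sb] by blast
  have "length u + length s = length v + length t" using feq_length[OF stz(1)] by simp
  then show ?thesis
    using assms ij stz by (intro that[of "fp i' s" "fp j' t" "ip (i' + length s) z"]) (auto simp: ip_eq_iff fp_eq_iff)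
qed

lemma icomp_ipaths_iff:
  "irange x = psource \<mu> \<Longrightarrow> \<mu> \<odot> x \<in> ipaths k \<longleftrightarrow> \<mu> \<in> Lambda k \<and> x \<in> ipaths k"
proof (cases \<mu>; cases x)
  fix i u j X assume mx [simp]: "\<mu> = fp i u" "x = ip j X" and j: "irange x = psource \<mu>"
  have "(\<forall>n c. prepend u X n = LG c \<longrightarrow> c \<in> {1..k (i + n)}) \<longleftrightarrow>
    (\<forall>n<length u. \<forall>c. u ! n = LG c \<longrightarrow> c \<in> {1..k (i + n)}) \<and>
    (\<forall>n c. X n = LG c \<longrightarrow> c \<in> {1..k (i + length u + n)})" (is "?L \<longleftrightarrow> ?R")
  proof
    assume L: ?L
    show ?R
    proof (intro conjI allI impI)
      show "c \<in> {1..k (i + n)}" if "n < length u" "u ! n = LG c" for n c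
        using L[rule_format, of n c] that by (simp add: prepend_def)
      show "c \<in> {1..k (i + length u + n)}" if "X n = LG c" for n c
        using L[rule_format, of "length u + n" c] that by (simp add: prepend_def add.assoc)
    qed
  next
    assume R: ?R
    show ?L
    proof (intro allI impI)
      fix n c assume n: "prepend u X n = LG c"
      show "c \<in> {1..k (i + n)}"
      proof (cases "n < length u")
        case False
        then show ?thesis using R n conjunct2[OF R, rule_format, of "n - length u" c]
          by (simp add: prepend_def)
      qed (use R n in \<open>auto simp: prepend_def\<close>)
    qed
  qed
  then show ?thesis using j by (auto simp: ipaths_def Lambda_def iadmissible_ip admissible_fp)
qed

lemma pcomp_Lambda_iff:
  "prange \<nu> = psource \<mu> \<Longrightarrow> \<mu> \<Zcomp> \<nu> \<in> Lambda k \<longleftrightarrow> \<mu> \<in> Lambda k \<and> \<nu> \<in> Lambda k"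
proof (cases \<mu>; cases \<nu>)
  fix i u j v assume mx [simp]: "\<mu> = fp i u" "\<nu> = fp j v" and j: "prange \<nu> = psource \<mu>"
  have "(\<forall>n<length (u @ v). \<forall>c. (u @ v) ! n = LG c \<longrightarrow> c \<in> {1..k (i + n)}) \<longleftrightarrow>
    (\<forall>n<length u. \<forall>c. u ! n = LG c \<longrightarrow> c \<in> {1..k (i + n)}) \<and>
    (\<forall>n<length v. \<forall>c. v ! n = LG c \<longrightarrow> c \<in> {1..k (i + length u + n)})" (is "?L \<longleftrightarrow> ?R")
  proof
    assume L: ?L
    show ?R
    proof (intro conjI allI impI)
      show "c \<in> {1..k (i + n)}" if "n < length u" "u ! n = LG c" for n c
        using L[rule_format, of n c] that by (simp add: nth_append)
      show "c \<in> {1..k (i + length u + n)}" if "n < length v" "v ! n = LG c" for n c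
        using L[rule_format, of "length u + n" c] that by (simp add: nth_append add.assoc)
    qed
  next
    assume R: ?R
    show ?L
    proof (intro allI impI)
      fix n c assume n: "n < length (u @ v)" "(u @ v) ! n = LG c"
      show "c \<in> {1..k (i + n)}"
      proof (cases "n < length u")
        case False
        then have "n - length u < length v" "v ! (n - length u) = LG c" "i + length u + (n - length u) = i + n"
          using n by (auto simp: nth_append)
        then show ?thesis using conjunct2[OF R] by metis
      qed (use R n in \<open>auto simp: nth_append\<close>)
    qed
  qed
  then show ?thesis using j by (auto simp: Lambda_def admissible_fp)
qed

lemma vertex_Lambda: "vertex i \<in> Lambda k \<longleftrightarrow> 1 \<le> i"
  and ab_path_Lambda: "ab_path i p q \<in> Lambda k \<longleftrightarrow> 1 \<le> i"
  and gamma_edge_Lambda: "gamma_edge i c \<in> Lambda k \<longleftrightarrow> 1 \<le> i \<and> c \<in> {1..k i}"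
  by (auto simp: Lambda_def vertex_fp ab_path_fp gamma_edge_fp admissible_fp nth_append split: if_splits)

section \<open>Divisibility of infinite paths by finite paths\<close>

text \<open>Membership in a cylinder with admissibility removed, so that arguments about words do
  not mention \<open>k\<close>; for \<mu> in \<open>Lambda k\<close> the two are linked by
  \<open>cyl_iff\<close>.\<close>

definition divs :: "fpath \<Rightarrow> ipath \<Rightarrow> bool" where
  "divs \<mu> x \<longleftrightarrow> (\<exists>y. irange y = psource \<mu> \<and> x = \<mu> \<odot> y)"

lemma divs_icomp [intro]: "irange y = psource \<mu> \<Longrightarrow> divs \<mu> (\<mu> \<odot> y)"
  by (auto simp: divs_def)

lemma divs_vertex: "divs (vertex i) x \<longleftrightarrow> irange x = i"
proof
  show "irange x = i" if "divs (vertex i) x" using that by (auto simp: divs_def)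
  show "divs (vertex i) x" if "irange x = i"
    unfolding divs_def using vertex_icomp[OF that] that by (intro exI[of _ x]) simp
qed

lemma divs_pcomp: "psource \<mu> = prange \<nu> \<Longrightarrow> divs (\<mu> \<Zcomp> \<nu>) x \<longleftrightarrow> (\<exists>y. irange y = psource \<mu> \<and> x = \<mu> \<odot> y \<and> divs \<nu> y)"
  unfolding divs_def icomp_pcomp by (metis irange_icomp psource_pcomp)

lemma divs_prefix: "psource \<mu> = prange \<nu> \<Longrightarrow> divs (\<mu> \<Zcomp> \<nu>) x \<Longrightarrow> divs \<mu> x"
  unfolding divs_pcomp by (auto simp: divs_def)

lemma divs_icomp_pcomp:
  "psource \<mu> = prange \<nu> \<Longrightarrow> irange y = psource \<mu> \<Longrightarrow> divs (\<mu> \<Zcomp> \<nu>) (\<mu> \<odot> y) \<longleftrightarrow> divs \<nu> y"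
  by (auto simp: divs_pcomp icomp_left_cancel)

lemma divs_irange: "divs \<mu> x \<Longrightarrow> irange x = prange \<mu>"
  by (auto simp: divs_def)

lemma cyl_iff: "x \<in> cyl k \<mu> \<longleftrightarrow> x \<in> ipaths k \<and> divs \<mu> x" if "\<mu> \<in> Lambda k"
  using that icomp_ipaths_iff by (auto simp: cyl_def ipaths_from_def divs_def)

lemma divs_Lambda: "x \<in> ipaths k \<Longrightarrow> divs \<mu> x \<Longrightarrow> \<mu> \<in> Lambda k"
  using icomp_ipaths_iff by (auto simp: divs_def)

text \<open>A divisor is already visible on all sufficiently long finite pieces of one fixed
  representing word. This is what allows a limit path to be read off a chain of finite
  words.\<close>

lemma divs_finite_prefix:
  assumes "divs \<mu> (ip m X)"
  obtains n where "\<And>n'. n \<le> n' \<Longrightarrow> \<exists>\<nu>. fp m (map X [0..<n']) = \<mu> \<Zcomp> \<nu> \<and> prange \<nu> = psource \<mu>"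
proof -
  obtain i w j Z where mu: "\<mu> = fp i w" and "ip m X = \<mu> \<odot> ip j Z"
    using assms unfolding divs_def by (metis ip_cases fp_cases)
  then have m: "m = i" and "same_blocks X (prepend w Z)" by (auto simp: ip_eq_iff)
  then obtain n v where nv: "feq (map X [0..<n]) (w @ v)" using same_blocks_finite_prefix by blast
  show ?thesis
  proof (rule that[of n])
    fix n' assume "n \<le> n'"
    then have "feq (map X [0..<n']) (w @ v @ map X [n..<n'])"
      using map_upt_add[of n n' X] feq_append[OF nv feq_refl] by simp
    then show "\<exists>\<nu>. fp m (map X [0..<n']) = \<mu> \<Zcomp> \<nu> \<and> prange \<nu> = psource \<mu>"
      using mu m by (intro exI[of _ "fp (psource \<mu>) (v @ map X [n..<n'])"]) (simp add: fp_eq_iff)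
  qed
qed

lemma divs_mono:
  "divs \<nu> x \<Longrightarrow> \<nu> = \<mu> \<Zcomp> \<kappa> \<Longrightarrow> prange \<kappa> = psource \<mu> \<Longrightarrow> divs \<mu> x"
  using divs_prefix by metis

lemma divs_common:
  assumes "divs \<mu> x" "divs \<nu> x"
  obtains \<tau> \<sigma> where "\<mu> \<Zcomp> \<tau> = \<nu> \<Zcomp> \<sigma>" "prange \<tau> = psource \<mu>" "prange \<sigma> = psource \<nu>"
    "divs (\<mu> \<Zcomp> \<tau>) x" "plen (\<mu> \<Zcomp> \<tau>) \<le> plen \<mu> + plen \<nu>"
proof -
  obtain y z where yz: "irange y = psource \<mu>" "x = \<mu> \<odot> y" "irange z = psource \<nu>" "x = \<nu> \<odot> z"
    using assms unfolding divs_def by blast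
  obtain \<tau> \<sigma> w where 1: "\<mu> \<Zcomp> \<tau> = \<nu> \<Zcomp> \<sigma>" "y = \<tau> \<odot> w" "plen \<tau> \<le> plen \<nu>"
    "prange \<tau> = psource \<mu>" "prange \<sigma> = psource \<nu>" "psource \<tau> = irange w"
    using common_extension[of \<mu> y \<nu> z] yz by metis
  have "divs (\<mu> \<Zcomp> \<tau>) x" unfolding divs_def
    using 1 yz by (metis icomp_pcomp psource_pcomp)
  moreover have "plen (\<mu> \<Zcomp> \<tau>) \<le> plen \<mu> + plen \<nu>" using 1(3) by (simp only: plen_pcomp)
  ultimately show ?thesis using that 1(1,4,5) by blast
qed


section \<open>Cells\<close>

definition abw :: "nat \<Rightarrow> nat \<Rightarrow> letter list" where
  "abw i j = replicate i LA @ replicate j LB"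

lemma length_abw [simp]: "length (abw i j) = i + j"
  by (simp add: abw_def)

lemma count_list_replicate_letter [simp]: "count_list (replicate n a) b = (if a = b then n else 0)"
  for a b :: letter
  by (induction n) auto

lemma count_abw [simp]: "count_list (abw i j) LA = i" "count_list (abw i j) LB = j"
  by (simp_all add: abw_def)

lemma abw_not_LG: "t < i + j \<Longrightarrow> abw i j ! t \<noteq> LG c"
  by (auto simp: abw_def nth_append)

lemma ab_path_abw: "ab_path m i j = fp m (abw i j)"
  by (simp add: ab_path_fp abw_def)

lemma feq_abw:
  "(\<And>c. LG c \<notin> set r) \<Longrightarrow> feq r (abw (count_list r LA) (count_list r LB))"
proof (induction r)
  case (Cons e r)
  then have IH: "feq r (abw (count_list r LA) (count_list r LB))" by auto
  show ?case
  proof (cases e)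
    case LA
    then show ?thesis using IH by (simp add: abw_def)
  next
    case LB
    have "feq (e # r) (LB # abw (count_list r LA) (count_list r LB))" using IH LB by simp
    also have "feq (LB # abw (count_list r LA) (count_list r LB)) (abw (count_list r LA) (Suc (count_list r LB)))"
      using feq_sym[OF feq_front[of LA LB "count_list r LA" "replicate (count_list r LB) LB"]]
      by (simp add: abw_def swp_def)
    finally show ?thesis using LB by simp
  qed (use Cons.prems[of "case e of LG c \<Rightarrow> c"] in auto)
qed (simp add: abw_def)

lemma count_list_no_LG: "(\<And>c. LG c \<notin> set r) \<Longrightarrow> count_list r LA + count_list r LB = length r"
  using feq_length[OF feq_abw[of r]] by simp

section \<open>Divisibility of words and the exponents of the first block\<close>

definition dw :: "letter list \<Rightarrow> (nat \<Rightarrow> letter) \<Rightarrow> bool" where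
  "dw w X \<longleftrightarrow> (\<exists>Z. same_blocks X (prepend w Z))"

lemma dwI: "same_blocks X (prepend w Z) \<Longrightarrow> dw w X"
  by (auto simp: dw_def)

lemma dw_prepend [simp]: "dw w (prepend w Z)"
  by (auto simp: dw_def intro: same_blocks_refl)

lemma dw_cong: "same_blocks X Y \<Longrightarrow> dw w X \<longleftrightarrow> dw w Y"
  unfolding dw_def using same_blocks_sym same_blocks_trans by blast

lemma dw_feq: "feq w w' \<Longrightarrow> dw w X \<longleftrightarrow> dw w' X"
proof -
  have "feq w w' \<Longrightarrow> dw w X \<Longrightarrow> dw w' X" for w w'
    unfolding dw_def using feq_prepend[OF _ same_blocks_refl] same_blocks_trans by blast
  then show "feq w w' \<Longrightarrow> dw w X \<longleftrightarrow> dw w' X" using feq_sym by blast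
qed

lemma dw_append: "dw (u @ v) X \<Longrightarrow> dw u X"
  by (auto simp: dw_def prepend_append)

lemma dw_append_prepend [simp]: "dw (u @ v) (prepend u X) \<longleftrightarrow> dw v X"
  by (auto simp: dw_def prepend_append)

lemma dw_Cons [simp]: "dw (a # v) (a ## X) \<longleftrightarrow> dw v X"
  by (auto simp: dw_def)

lemma dw_Nil [simp]: "dw [] X"
  by (auto simp: dw_def intro: same_blocks_refl)

lemma divs_fp_ip: "divs (fp i w) (ip j X) \<longleftrightarrow> i = j \<and> dw w X"
proof
  assume "divs (fp i w) (ip j X)"
  then obtain l Z where "ip j X = fp i w \<odot> ip l Z" unfolding divs_def by (metis ip_cases)
  then show "i = j \<and> dw w X" by (auto simp: ip_eq_iff dw_def)
next
  assume "i = j \<and> dw w X"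
  then obtain Z where "i = j" "same_blocks X (prepend w Z)" by (auto simp: dw_def)
  then have "ip j X = fp i w \<odot> ip (i + length w) Z" by (simp add: ip_eq_iff)
  then show "divs (fp i w) (ip j X)" unfolding divs_def by (intro exI[of _ "ip (i + length w) Z"]) simp
qed

text \<open>How many f can be brought to the front is not affected by a letter e in front that
  commutes with f.\<close>

lemma dw_replicate_swp:
  "swp e f \<Longrightarrow> dw (replicate s f) (e ## Y) \<longleftrightarrow> dw (replicate s f) Y"
proof
  assume sw: "swp e f"
  show "dw (replicate s f) Y" if "dw (replicate s f) (e ## Y)"
    using that
  proof (induction s arbitrary: Y)
    case (Suc s)
    then obtain Z where "same_blocks (e ## Y) (f ## prepend (replicate s f) Z)" by (auto simp: dw_def)
    then obtain Z' where Z': "same_blocks Y (f ## Z')" "same_blocks (prepend (replicate s f) Z) (e ## Z')"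
      using same_blocks_diamond[of e Y f] sw by (auto simp: swp_def)
    then have "dw (replicate s f) (e ## Z')" using dw_cong dw_prepend by blast
    then have "dw (replicate (Suc s) f) (f ## Z')" using Suc.IH by simp
    then show ?case using dw_cong Z'(1) by blast
  qed simp
  show "dw (replicate s f) (e ## Y)" if dY: "dw (replicate s f) Y"
  proof -
    obtain Z where "same_blocks Y (prepend (replicate s f) Z)" using dY by (auto simp: dw_def)
    then have "same_blocks (e ## Y) (e ## prepend (replicate s f) Z)" by simp
    moreover have "same_blocks (prepend (replicate s f @ [e]) Z) (e ## prepend (replicate s f) Z)"
      by (rule same_blocks_front) (use sw in \<open>simp add: swp_sym\<close>)
    ultimately have "same_blocks (e ## Y) (prepend (replicate s f @ [e]) Z)"
      using same_blocks_sym same_blocks_trans by blast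
    then show ?thesis unfolding prepend_append by (rule dwI)
  qed
qed

text \<open>The \<gamma>-edge cannot be moved past e, and e is not among the letters of the would-be
  divisor.\<close>

lemma not_dw_replicate_LG:
  "swp e f \<Longrightarrow> \<not> dw (replicate s f @ [LG c]) (e ## Y)"
proof (induction s arbitrary: Y)
  case 0
  have "\<not> same_blocks (e ## Y) (LG c ## Z)" for Z
    using same_blocks_LG[of "e ## Y" "LG c ## Z" 0 c] 0 by (auto simp: swp_def)
  then show ?case by (auto simp: dw_def)
next
  case (Suc s)
  show ?case
  proof
    assume "dw (replicate (Suc s) f @ [LG c]) (e ## Y)"
    then obtain Z where "same_blocks (e ## Y) (f ## prepend (replicate s f @ [LG c]) Z)" by (auto simp: dw_def)
    then obtain Z' where Z': "same_blocks (prepend (replicate s f @ [LG c]) Z) (e ## Z')"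
      using same_blocks_diamond[of e Y f] Suc.prems by (auto simp: swp_def)
    then have "dw (replicate s f @ [LG c]) (e ## Z')" using dw_cong dw_prepend by blast
    then show False using Suc by blast
  qed
qed

text \<open>Stripping the \<alpha> leaves the available number of \<beta> unchanged, so the two
  exponents can be tested independently.\<close>

lemma dw_abw_iff: "dw (abw i j) X \<longleftrightarrow> dw (replicate i LA) X \<and> dw (replicate j LB) X"
proof -
  have strip: "dw (replicate j LB) (prepend (replicate i LA) Z) \<longleftrightarrow> dw (replicate j LB) Z" for Z
  proof (induction i)
    case (Suc i)
    then show ?case using dw_replicate_swp[of LA LB] by (simp add: swp_def)
  qed simp
  show ?thesis
  proof
    assume d: "dw (abw i j) X"
    then obtain Z where Z: "same_blocks X (prepend (replicate i LA) (prepend (replicate j LB) Z))"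
      by (auto simp: dw_def abw_def prepend_append)
    have "dw (replicate j LB) X" using strip[of "prepend (replicate j LB) Z"] dw_cong[OF Z] by simp
    then show "dw (replicate i LA) X \<and> dw (replicate j LB) X" using dwI[OF Z] by simp
  next
    assume d: "dw (replicate i LA) X \<and> dw (replicate j LB) X"
    then obtain Z where Z: "same_blocks X (prepend (replicate i LA) Z)" by (auto simp: dw_def)
    then have "dw (replicate j LB) Z" using d strip dw_cong by blast
    then show "dw (abw i j) X" using dw_cong[OF Z] unfolding abw_def by simp
  qed
qed

lemma dw_replicate_mono: "a \<le> b \<Longrightarrow> dw (replicate b e) X \<Longrightarrow> dw (replicate a e) X"
  using dw_append[of "replicate a e" "replicate (b - a) e"] by (simp add: replicate_add[symmetric])

lemma dw_abw_mono: "a \<le> i \<Longrightarrow> b \<le> j \<Longrightarrow> dw (abw i j) X \<Longrightarrow> dw (abw a b) X"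
  unfolding dw_abw_iff using dw_replicate_mono by blast

text \<open>The \<gamma>-edge closes the first block, whose exponents are then exactly i and j; any
  \<alpha>\<beta>-divisor must fit inside.\<close>

lemma dw_abw_LG_le:
  assumes "dw (abw i j @ LG c # w) X" "dw (abw a b) X"
  shows "a \<le> i \<and> b \<le> j"
proof -
  obtain Z where Z: "same_blocks X (prepend (abw i j) (LG c ## prepend w Z))"
    using assms(1) by (auto simp: dw_def prepend_append)
  obtain Z' where "same_blocks X (prepend (abw a b) Z')" using assms(2) by (auto simp: dw_def)
  then have sb: "same_blocks (prepend (abw i j) (LG c ## prepend w Z)) (prepend (abw a b) Z')"
    using Z same_blocks_sym same_blocks_trans by blast
  \<comment> \<open>Otherwise position i + j, which carries the \<gamma>-edge, would lie inside the
    block \<open>abw a b\<close>.\<close>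
  have le: "a + b \<le> i + j"
  proof (rule ccontr)
    assume n: "\<not> a + b \<le> i + j"
    have "prepend (abw i j) (LG c ## prepend w Z) (i + j) = LG c" by (simp add: prepend_def)
    then have "prepend (abw a b) Z' (i + j) = LG c" using same_blocks_LG[OF sb] by simp
    then show False using n abw_not_LG[of "i + j" a b c] by (simp add: prepend_def)
  qed
  define z where "z = map Z' [0..<i + j - (a + b)]"
  obtain Z'' where "Z' = prepend z Z''" unfolding z_def using prepend_split by blast
  then have "same_blocks (prepend (abw i j) (LG c ## prepend w Z)) (prepend (abw a b @ z) Z'')"
    using sb by (simp add: prepend_append)
  from same_blocks_cut[OF this] le have "feq (abw i j) (abw a b @ z)" by (simp add: z_def)
  from feq_count[OF this, of LA] feq_count[OF this, of LB] show ?thesis by simp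
qed

lemma dw_abw_LG_eq:
  assumes "dw (abw i j @ LG c # w) X" "dw (abw a b @ LG d # v) X"
  shows "a = i \<and> b = j \<and> c = d"
proof -
  have ab: "a = i" "b = j"
    using dw_abw_LG_le[OF assms(1) dw_append[OF assms(2)]]
      dw_abw_LG_le[OF assms(2) dw_append[OF assms(1)]] by auto
  obtain Z where Z: "same_blocks X (prepend (abw i j) (LG c ## prepend w Z))"
    using assms(1) by (auto simp: dw_def prepend_append)
  obtain Z' where "same_blocks X (prepend (abw i j) (LG d ## prepend v Z'))"
    using assms(2) by (auto simp: dw_def prepend_append ab)
  then have "same_blocks (prepend (abw i j) (LG c ## prepend w Z)) (prepend (abw i j) (LG d ## prepend v Z'))"
    using Z same_blocks_sym same_blocks_trans by blast
  from same_blocks_cut[OF this] ab show ?thesis by simp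
qed

text \<open>The cylinders that generate the partitions \<open>Q_part\<close>: all cells at level \<open>n\<close> are
  determined by membership in the cylinders of the words in \<open>Tw (n + 1)\<close>.\<close>

definition Tw :: "nat \<Rightarrow> letter list \<Rightarrow> bool" where
  "Tw q w \<longleftrightarrow> (\<exists>u i j. w = u @ abw i j \<and> length u + max i j \<le> q) \<or>
     (\<exists>u i j c. w = u @ abw i j @ [LG c] \<and> length u + max i j < q)"

definition Tpath :: "nat \<Rightarrow> fpath \<Rightarrow> bool" where
  "Tpath q \<kappa> \<longleftrightarrow> (\<exists>i w. \<kappa> = fp i w \<and> Tw q w)"

section \<open>Test words and their residuals\<close>

lemma Tw_length: "length w \<le> q \<Longrightarrow> Tw q w"
  unfolding Tw_def by (rule disjI1, rule exI[of _ w], rule exI[of _ 0], rule exI[of _ 0]) (simp add: abw_def)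

lemma Tw_mono: "Tw q w \<Longrightarrow> q \<le> q' \<Longrightarrow> Tw q' w"
proof -
  assume T: "Tw q w" and le: "q \<le> q'"
  show "Tw q' w"
    using T unfolding Tw_def
  proof (elim disjE exE conjE)
    fix u i j assume "w = u @ abw i j" "length u + max i j \<le> q"
    then show "(\<exists>u i j. w = u @ abw i j \<and> length u + max i j \<le> q') \<or>
      (\<exists>u i j c. w = u @ abw i j @ [LG c] \<and> length u + max i j < q')"
      using le by (intro disjI1 exI[of _ u] exI[of _ i] exI[of _ j]) simp
  next
    fix u i j c assume "w = u @ abw i j @ [LG c]" "length u + max i j < q"
    then show "(\<exists>u i j. w = u @ abw i j \<and> length u + max i j \<le> q') \<or>
      (\<exists>u i j c. w = u @ abw i j @ [LG c] \<and> length u + max i j < q')"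
      using le by (intro disjI2 exI[of _ u] exI[of _ i] exI[of _ j] exI[of _ c]) simp
  qed
qed

lemma Tw_append: "Tw q w \<Longrightarrow> Tw (q + length u) (u @ w)"
  unfolding Tw_def
proof (elim disjE exE conjE)
  fix v i j assume "w = v @ abw i j" "length v + max i j \<le> q"
  then show "(\<exists>ua i j. u @ w = ua @ abw i j \<and> length ua + max i j \<le> q + length u) \<or>
    (\<exists>ua i j c. u @ w = ua @ abw i j @ [LG c] \<and> length ua + max i j < q + length u)"
    by (intro disjI1 exI[of _ "u @ v"] exI[of _ i] exI[of _ j]) simp
next
  fix v i j c assume "w = v @ abw i j @ [LG c]" "length v + max i j < q"
  then show "(\<exists>ua i j. u @ w = ua @ abw i j \<and> length ua + max i j \<le> q + length u) \<or>
    (\<exists>ua i j c. u @ w = ua @ abw i j @ [LG c] \<and> length ua + max i j < q + length u)"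
    by (intro disjI2 exI[of _ "u @ v"] exI[of _ i] exI[of _ j] exI[of _ c]) simp
qed

lemma Tw_Cons: "Tw q w \<Longrightarrow> Tw (Suc q) (a # w)"
  using Tw_append[of q w "[a]"] by simp

text \<open>The residual of w after the letter e is again a test word of the same level. Taking the
  maximum of i and j instead of their sum is compatible with this because removing a letter from a
  block never raises an exponent. Hence prefixing costs no level (\<open>ceq_icomp\<close>), whereas
  cancelling a prefix costs its length (\<open>ceq_cancel\<close>).\<close>

lemma Tw_residual:
  assumes "Tw q w" "dw w (e ## Y)"
  shows "\<exists>w'. Tw q w' \<and> dw w' Y \<and> (\<forall>Y'. dw w' Y' \<longrightarrow> dw w (e ## Y'))"
  using assms
proof (induction w arbitrary: q Y)
  case Nil
  then show ?case by (intro exI[of _ "[]"]) auto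
next
  case (Cons f w1)
  obtain u i j g where w: "f # w1 = u @ abw i j @ g" and g: "(g = [] \<and> length u + max i j \<le> q) \<or>
      (\<exists>c. g = [LG c] \<and> length u + max i j < q)"
    using Cons.prems(1) unfolding Tw_def by (metis append_Nil2)
  \<comment> \<open>The optional closing \<gamma>-edge g is carried along, so that both kinds of
    test words are treated together.\<close>
  have Tg: "Tw q' (v @ abw i' j' @ g)" if "length v + max i' j' + q \<le> length u + max i j + q'" for v i' j' q'
    using g that unfolding Tw_def
    by (elim disjE exE conjE)
      (rule disjI1, rule exI[of _ v], rule exI[of _ i'], rule exI[of _ j'], simp,
       rule disjI2, rule exI[of _ v], rule exI[of _ i'], rule exI[of _ j'], simp)
  \<comment> \<open>The easy situation: e can be split off the front of the test word.\<close>
  have red: ?case if "feq (f # w1) (e # v @ abw i' j' @ g)" "length v + max i' j' \<le> length u + max i j"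
    for v i' j'
  proof (intro exI[of _ "v @ abw i' j' @ g"] conjI allI impI)
    show "Tw q (v @ abw i' j' @ g)" using that(2) by (intro Tg) simp
    show "dw (v @ abw i' j' @ g) Y" using Cons.prems(2) dw_feq[OF that(1)] by simp
    show "dw (f # w1) (e ## Y')" if "dw (v @ abw i' j' @ g) Y'" for Y'
      using that dw_feq[OF \<open>feq (f # w1) _\<close>] by simp
  qed
  show ?case
  proof (cases u)
    case (Cons f' u1)
    then have [simp]: "f' = f" and w1: "w1 = u1 @ abw i j @ g" using w by auto
    show ?thesis
    proof (cases "f = e")
      case True
      show ?thesis by (rule red[of u1 i j]) (use True w1 Cons in auto)
    next
      case False
      have q: "q = Suc (q - 1)" using g Cons by auto
      \<comment> \<open>Here e commutes past the head f of u, and the residual is f followed by the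
        residual of \<open>w1\<close>. Dropping f from u frees the level that f takes up again
        afterwards.\<close>
      have T1: "Tw (q - 1) w1" unfolding w1 using Cons q by (intro Tg) simp
      obtain Z where "same_blocks (e ## Y) (f ## prepend w1 Z)" using Cons.prems(2) by (auto simp: dw_def)
      then obtain Z' where sw: "swp e f" and Z': "same_blocks Y (f ## Z')" "same_blocks (prepend w1 Z) (e ## Z')"
        using same_blocks_diamond[of e Y f] False by metis
      have "dw w1 (e ## Z')" using Z'(2) dw_cong dw_prepend by blast
      from Cons.IH[OF T1 this] obtain w' where w': "Tw (q - 1) w'" "dw w' Z'" "\<And>Y'. dw w' Y' \<Longrightarrow> dw w1 (e ## Y')"
        by blast
      show ?thesis
      proof (intro exI[of _ "f # w'"] conjI allI impI)
        show "Tw q (f # w')" using Tw_Cons[OF w'(1)] q by metis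
        show "dw (f # w') Y" using dw_cong[OF Z'(1)] w'(2) by simp
        fix Y' assume "dw (f # w') Y'"
        then obtain Z3 where Z3: "same_blocks Y' (f ## prepend w' Z3)" by (auto simp: dw_def)
        then have "same_blocks (e ## Y') (e ## f ## prepend w' Z3)" by simp
        also have "same_blocks (e ## f ## prepend w' Z3) (f ## e ## prepend w' Z3)" by (rule same_blocks_swp[OF sw])
        finally (same_blocks_trans) show "dw (f # w1) (e ## Y')"
          using dw_cong w'(3)[of "prepend w' Z3"] by simp
      qed
    qed
  next
    case Nil
    show ?thesis
    proof (cases "e = LA \<and> 0 < i \<or> e = LB \<and> 0 < j")
      case True
      then show ?thesis
      proof
        assume "e = LA \<and> 0 < i"
        then show ?thesis using w Nil by (intro red[of "[]" "i - 1" j]) (auto simp: abw_def gr0_conv_Suc)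
      next
        assume e: "e = LB \<and> 0 < j"
        then have "feq (f # w1) (e # abw i (j - 1) @ g)"
          using feq_front[of LA LB i "replicate (j - 1) LB @ g"] w Nil by (auto simp: abw_def swp_def gr0_conv_Suc)
        then show ?thesis using Nil by (intro red[of "[]" i "j - 1"]) auto
      qed
    next
      case ne: False
      show ?thesis
      proof (cases "e = LA \<or> e = LB")
        case AB: True
        \<comment> \<open>The block contains no e, hence is a power of the other letter. A closing
          \<gamma>-edge could not pass e, so the test word is that power alone and is its own
          residual.\<close>
        define f' s where "f' = (if e = LA then LB else LA)" and "s = (if e = LA then j else i)"
        have sw: "swp e f'" using AB by (auto simp: swp_def f'_def)
        have fw: "f # w1 = replicate s f' @ g" using w Nil ne AB by (auto simp: abw_def f'_def s_def)
        have "g = []"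
          using g not_dw_replicate_LG[OF sw] Cons.prems(2) fw by auto
        then show ?thesis
          using dw_replicate_swp[OF sw] fw Cons.prems by (intro exI[of _ "f # w1"]) auto
      next
        case False
        then obtain d where d: "e = LG d" by (cases e) auto
        obtain Z where "same_blocks (e ## Y) (f ## prepend w1 Z)" using Cons.prems(2) by (auto simp: dw_def)
        from same_blocks_LG[OF this, of 0 d] d have "f = e" by simp
        then have "i = 0 \<and> j = 0" using w Nil d by (cases i; cases j) (simp_all add: abw_def)
        then have "w1 = []" using w Nil g by (auto simp: abw_def)
        then show ?thesis using \<open>f = e\<close> by (intro exI[of _ "[]"]) (auto intro: Tw_length)
      qed
    qed
  qed
qed

section \<open>Equivalence of infinite paths at a level\<close>

text \<open>The index is shifted against the partitions: the classes of \<open>ceq q\<close> over a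
  vertex are the non-empty cells of the partition with lower index q - 1, so level 0 only records
  the range.\<close>

definition ceq :: "nat \<Rightarrow> ipath \<Rightarrow> ipath \<Rightarrow> bool" where
  "ceq q x y \<longleftrightarrow> (\<forall>\<kappa>. Tpath q \<kappa> \<longrightarrow> divs \<kappa> x = divs \<kappa> y)"

lemma Tpath_plen: "plen \<kappa> \<le> q \<Longrightarrow> Tpath q \<kappa>"
  unfolding Tpath_def by (cases \<kappa>) (auto intro: Tw_length)

lemma Tpath_mono: "Tpath q \<kappa> \<Longrightarrow> q \<le> q' \<Longrightarrow> Tpath q' \<kappa>"
  unfolding Tpath_def using Tw_mono by blast

lemma Tpath_pcomp: "Tpath q \<kappa> \<Longrightarrow> Tpath (q + plen \<sigma>) (\<sigma> \<Zcomp> \<kappa>)"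
  unfolding Tpath_def by (cases \<sigma>) (force intro: Tw_append)

lemma ceq_refl [simp]: "ceq q x x"
  and ceq_sym: "ceq q x y \<Longrightarrow> ceq q y x"
  and ceq_trans: "ceq q x y \<Longrightarrow> ceq q y z \<Longrightarrow> ceq q x z"
  by (auto simp: ceq_def)

lemma ceq_mono: "ceq q' x y \<Longrightarrow> q \<le> q' \<Longrightarrow> ceq q x y"
  by (auto simp: ceq_def intro: Tpath_mono)

lemma ceq_divs: "ceq q x y \<Longrightarrow> plen \<kappa> \<le> q \<Longrightarrow> divs \<kappa> x \<longleftrightarrow> divs \<kappa> y"
  by (auto simp: ceq_def intro: Tpath_plen)

lemma ceq_irange: "ceq q x y \<Longrightarrow> irange x = irange y"
  using ceq_divs[of q x y "vertex (irange x)"] by (simp add: divs_vertex)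

text \<open>A test path \<kappa> for the tails is a test path behind \<sigma> for the whole paths,
  at a level that is higher by the length of \<sigma>.\<close>

lemma ceq_cancel:
  assumes "ceq (q + plen \<sigma>) (\<sigma> \<odot> x) (\<sigma> \<odot> y)" "irange x = psource \<sigma>" "irange y = psource \<sigma>"
  shows "ceq q x y"
  unfolding ceq_def
proof (intro allI impI)
  fix \<kappa> assume T: "Tpath q \<kappa>"
  show "divs \<kappa> x = divs \<kappa> y"
  proof (cases "prange \<kappa> = psource \<sigma>")
    case True
    have "divs (\<sigma> \<Zcomp> \<kappa>) (\<sigma> \<odot> x) = divs (\<sigma> \<Zcomp> \<kappa>) (\<sigma> \<odot> y)"
      using assms(1) Tpath_pcomp[OF T] by (auto simp: ceq_def)
    then show ?thesis using True assms by (simp add: divs_icomp_pcomp)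
  next
    case False
    then show ?thesis using divs_irange assms by metis
  qed
qed

text \<open>One letter at a time, each test path is replaced by its residual, which has the same
  level.\<close>

lemma ceq_icomp:
  assumes "ceq q x y" "irange x = psource \<tau>"
  shows "ceq q (\<tau> \<odot> x) (\<tau> \<odot> y)"
proof -
  have one: "divs \<kappa> (fp i (e # []) \<odot> y)"
    if "ceq q x y" "irange x = Suc i" "Tpath q \<kappa>" "divs \<kappa> (fp i (e # []) \<odot> x)" for x y i e \<kappa>
  proof -
    note prems = that
    obtain m w where \<kappa>: "\<kappa> = fp m w" and T: "Tw q w" using prems(3) by (auto simp: Tpath_def)
    obtain X where x: "x = ip (Suc i) X" using prems(2) by (cases x) auto
    have "irange y = Suc i" using ceq_irange prems by metis
    then obtain Y where y: "y = ip (Suc i) Y" by (cases y) auto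
    have m: "m = i" "dw w (e ## X)" using prems(4) by (auto simp: \<kappa> x divs_fp_ip)
    obtain w' where w': "Tw q w'" "dw w' X" "\<And>Y'. dw w' Y' \<Longrightarrow> dw w (e ## Y')"
      using Tw_residual[OF T m(2)] by blast
    have "divs (fp (Suc i) w') y"
      using prems(1) w' x unfolding ceq_def Tpath_def by (metis divs_fp_ip)
    then have "dw w (e ## Y)" using w'(3) y by (simp add: divs_fp_ip)
    then show ?thesis by (simp add: \<kappa> y divs_fp_ip m)
  qed
  have one': "ceq q (fp i [e] \<odot> x) (fp i [e] \<odot> y)" if "ceq q x y" "irange x = Suc i" for x y i e
    unfolding ceq_def using one[OF that] one[OF ceq_sym[OF that(1)]] that ceq_irange by metis
  obtain i w where \<tau>: "\<tau> = fp i w" by (cases \<tau>)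
  have "irange x = i + length w \<Longrightarrow> ceq q (fp i w \<odot> x) (fp i w \<odot> y)" for i w
  proof (induction w arbitrary: i)
    case Nil
    then have "irange x = i" "irange y = i" using ceq_irange[OF assms(1)] by simp_all
    then show ?case using assms(1) vertex_icomp[of x i] vertex_icomp[of y i] by (simp add: vertex_fp)
  next
    case (Cons e w)
    then have "ceq q (fp (Suc i) w \<odot> x) (fp (Suc i) w \<odot> y)" by simp
    from one'[OF this, of i e] show ?case
      using icomp_pcomp[of "fp i [e]" "fp (Suc i) w"] by simp
  qed
  then show ?thesis using assms \<tau> by simp
qed


section \<open>The cells of the partitions as equivalence classes\<close>

definition cls :: "(nat \<Rightarrow> nat) \<Rightarrow> nat \<Rightarrow> ipath \<Rightarrow> ipath set" where
  "cls k q x = {y \<in> ipaths k. ceq q x y}"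

text \<open>What a test word of level n + 1 can ask about the first block: exponents up to n + 1, or
  a closing \<gamma>-edge after exponents up to n. Words that look behind the first \<gamma>-edge
  reach it before n letters; this matches the condition n \<le> i + j in \<open>P_part\<close>,
  since earlier \<gamma>-edges are absorbed into the paths of \<open>Phi\<close>.\<close>

lemma Tw_first_block:
  assumes "Tw (Suc n) w"
  obtains (AB) a b where "feq w (abw a b)" "a \<le> Suc n" "b \<le> Suc n"
  | (ABG) a b c where "feq w (abw a b @ [LG c])" "a \<le> n" "b \<le> n"
  | (more) a b c v where "feq w (abw a b @ LG c # v)" "a + b < n"
proof -
  obtain u i j g where w: "w = u @ abw i j @ g" and g: "(g = [] \<and> length u + max i j \<le> Suc n) \<or>
      (\<exists>c. g = [LG c] \<and> length u + max i j < Suc n)"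
    using assms unfolding Tw_def by (metis append_Nil2)
  show ?thesis
  proof (cases "\<exists>c. LG c \<in> set u")
    case False
    let ?a = "count_list u LA + i" and ?b = "count_list u LB + j"
    have "\<And>c. LG c \<notin> set (u @ abw i j)" using False by (auto simp: abw_def)
    from feq_abw[OF this] have "feq (u @ abw i j) (abw ?a ?b)" by simp
    from feq_append[OF this feq_refl[of g]] have feq: "feq w (abw ?a ?b @ g)" by (simp add: w)
    have len: "count_list u LA + count_list u LB = length u"
      using False by (intro count_list_no_LG) auto
    from g show ?thesis
    proof
      assume "g = [] \<and> length u + max i j \<le> Suc n"
      then show ?thesis using len feq by (intro AB[of ?a ?b]) auto
    next
      assume "\<exists>c. g = [LG c] \<and> length u + max i j < Suc n"
      then show ?thesis using len feq by (auto intro!: ABG[of ?a ?b])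
    qed
  next
    case True
    then have "\<exists>l\<in>set u. \<exists>c. l = LG c" by blast
    then obtain u1 l u2 where u: "u = u1 @ l # u2" "\<exists>c. l = LG c" "\<forall>l\<in>set u1. \<not> (\<exists>c. l = LG c)"
      by (rule split_list_first_propE)
    then obtain c where c: "l = LG c" by blast
    let ?a = "count_list u1 LA" and ?b = "count_list u1 LB"
    have no: "\<And>c. LG c \<notin> set u1" using u by auto
    have len: "?a + ?b = length u1" using no by (rule count_list_no_LG)
    have feq: "feq w (abw ?a ?b @ LG c # u2 @ abw i j @ g)"
      using feq_append[OF feq_abw[OF no] feq_refl] by (simp add: w u c)
    show ?thesis
    proof (cases "u2 @ abw i j @ g = []")
      case True
      then show ?thesis using feq g len by (intro ABG[of ?a ?b c]) (auto simp: u)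
    next
      case False
      then have "0 < length (u2 @ abw i j @ g)" unfolding length_greater_0_conv .
      then have l: "0 < length u2 + (i + j) + length g" unfolding length_append length_abw by linarith
      have "length u = Suc (length u1 + length u2)" by (simp add: u)
      moreover have "i \<le> max i j" "j \<le> max i j" by simp_all
      moreover have "length u + max i j + length g \<le> Suc n" using g by auto
      \<comment> \<open>One position is taken by the \<gamma>-edge and at least one more letter
        follows it, whence the strict inequality.\<close>
      ultimately have "?a + ?b < n" using len l by linarith
      then show ?thesis using feq by (intro more[of ?a ?b c "u2 @ abw i j @ g"])
    qed
  qed
qed

text \<open>The cells of \<open>P_part\<close> as predicates on words, detached from vertex and
  admissibility; the superscript of the \<gamma>-edge is arbitrary here.\<close>

definition Pcell :: "nat \<Rightarrow> ((nat \<Rightarrow> letter) \<Rightarrow> bool) \<Rightarrow> bool" where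
  "Pcell n E \<longleftrightarrow>
    (\<exists>j\<le>n. E = (\<lambda>X. dw (abw (n + 1) j) X \<and> \<not> dw (abw (n + 1) (j + 1)) X)) \<or>
    (\<exists>i\<le>n. E = (\<lambda>X. dw (abw i (n + 1)) X \<and> \<not> dw (abw (i + 1) (n + 1)) X)) \<or>
    (\<exists>i j c. i \<le> n \<and> j \<le> n \<and> n \<le> i + j \<and> E = dw (abw i j @ [LG c])) \<or>
    E = dw (abw (n + 1) (n + 1))"

text \<open>A cell fixes the exponents of the first block up to the cap n + 1 and, if both are at
  most n, also the \<gamma>-edge behind it. By \<open>Tw_first_block\<close> a test word asks
  nothing more, except for those that pass an early \<gamma>-edge, and these divide no point of the
  cell.\<close>

lemma Pcell_Tw:
  assumes "Pcell n E" "E X" "E Y" "Tw (Suc n) w" "dw w X"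
  shows "dw w Y"
proof -
  have noG: "\<not> dw (abw a b @ LG c # v) X" if "dw (abw (n + 1) j) X" "a \<le> n" for a b c v j
    using dw_abw_LG_le[OF _ that(1)] that(2) by fastforce
  have noG': "\<not> dw (abw a b @ LG c # v) X" if "dw (abw i (n + 1)) X" "b \<le> n" for a b c v i
    using dw_abw_LG_le[OF _ that(1)] that(2) by fastforce
  have leA: "dw (abw a b) Y" if "dw (abw a b) X" "dw (abw (n + 1) j) Y" "a \<le> n + 1"
    "\<not> dw (abw (n + 1) (j + 1)) X" "dw (abw (n + 1) j) X" for a b j
  proof -
    have "b \<le> j"
    proof (rule ccontr)
      assume "\<not> b \<le> j"
      then have "dw (replicate (j + 1) LB) X" using that(1) dw_replicate_mono[of "j + 1" b] by (simp add: dw_abw_iff)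
      then show False using that(4,5) by (simp add: dw_abw_iff)
    qed
    then show ?thesis using that(2,3) dw_abw_mono by blast
  qed
  have leB: "dw (abw a b) Y" if "dw (abw a b) X" "dw (abw i (n + 1)) Y" "b \<le> n + 1"
    "\<not> dw (abw (i + 1) (n + 1)) X" "dw (abw i (n + 1)) X" for a b i
  proof -
    have "a \<le> i"
    proof (rule ccontr)
      assume "\<not> a \<le> i"
      then have "dw (replicate (i + 1) LA) X" using that(1) dw_replicate_mono[of "i + 1" a] by (simp add: dw_abw_iff)
      then show False using that(4,5) by (simp add: dw_abw_iff)
    qed
    then show ?thesis using that(2,3) dw_abw_mono by blast
  qed
  show ?thesis
    using assms(4)
  proof (cases rule: Tw_first_block)
    case (AB a b)
    have X: "dw (abw a b) X" using assms(5) dw_feq[OF AB(1)] by simp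
    have "dw (abw a b) Y"
      using assms(1) unfolding Pcell_def
    proof (elim disjE exE conjE)
      fix j assume "E = (\<lambda>X. dw (abw (n + 1) j) X \<and> \<not> dw (abw (n + 1) (j + 1)) X)"
      then show ?thesis using assms(2,3) leA[OF X, of j] AB by simp
    next
      fix i assume "E = (\<lambda>X. dw (abw i (n + 1)) X \<and> \<not> dw (abw (i + 1) (n + 1)) X)"
      then show ?thesis using assms(2,3) leB[OF X, of i] AB by simp
    next
      fix i j c assume E: "E = dw (abw i j @ [LG c])"
      then have "a \<le> i \<and> b \<le> j" using dw_abw_LG_le[of i j c "[]" X a b] X assms(2) by simp
      then show ?thesis using dw_abw_mono dw_append assms(3) E by blast
    next
      assume "E = dw (abw (n + 1) (n + 1))"
      then show ?thesis using dw_abw_mono[of a "n + 1" b "n + 1"] AB assms(3) by simp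
    qed
    then show ?thesis using dw_feq[OF AB(1)] by simp
  next
    case (ABG a b c)
    have X: "dw (abw a b @ LG c # []) X" using assms(5) dw_feq[OF ABG(1)] by simp
    have "dw (abw a b @ [LG c]) Y"
      using assms(1) unfolding Pcell_def
    proof (elim disjE exE conjE)
      fix i j d assume E: "E = dw (abw i j @ [LG d])"
      then have "a = i \<and> b = j \<and> d = c" using dw_abw_LG_eq[of i j d "[]" X a b c "[]"] X assms(2) by simp
      then show ?thesis using assms(3) E by simp
    qed (use X noG noG' ABG assms(2) in blast)+
    then show ?thesis using dw_feq[OF ABG(1)] by simp
  next
    case (more a b c v)
    have X: "dw (abw a b @ LG c # v) X" using assms(5) dw_feq[OF more(1)] by simp
    have ab: "a \<le> n" "b \<le> n" using more(2) by auto
    have False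
      using assms(1) unfolding Pcell_def
    proof (elim disjE exE conjE)
      fix i j d assume E: "n \<le> i + j" "E = dw (abw i j @ [LG d])"
      then have "a = i \<and> b = j" using dw_abw_LG_eq[of i j d "[]" X a b c v] X assms(2) by simp
      then show ?thesis using more(2) E by simp
    qed (use X noG noG' ab assms(2) in blast)+
    then show ?thesis ..
  qed
qed

text \<open>The cell is found by capping both exponents of the first block at n + 1. The assumption
  is used only if neither reaches the cap, when the block is closed by a \<gamma>-edge.\<close>

lemma Pcell_cover:
  assumes "\<And>i j c. dw (abw i j @ [LG c]) X \<Longrightarrow> i \<le> n \<Longrightarrow> j \<le> n \<Longrightarrow> n \<le> i + j"
  obtains E where "Pcell n E" "E X"
proof -
  have max: "\<exists>s\<le>n. dw (replicate s e) X \<and> \<not> dw (replicate (s + 1) e) X"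
    if "\<not> dw (replicate (n + 1) e) X" for e
  proof -
    define s where "s = (LEAST s. \<not> dw (replicate (s + 1) e) X)"
    have 1: "\<not> dw (replicate (s + 1) e) X" unfolding s_def by (rule LeastI) (rule that)
    moreover have "s \<le> n" unfolding s_def by (rule Least_le) (rule that)
    moreover have "dw (replicate s e) X"
    proof (cases s)
      case (Suc s')
      then show ?thesis using not_less_Least[of s' "\<lambda>s. \<not> dw (replicate (s + 1) e) X"] unfolding s_def[symmetric] by simp
    qed simp
    ultimately show ?thesis by blast
  qed
  consider "dw (replicate (n + 1) LA) X" "dw (replicate (n + 1) LB) X"
    | "dw (replicate (n + 1) LA) X" "\<not> dw (replicate (n + 1) LB) X"
    | "\<not> dw (replicate (n + 1) LA) X" "dw (replicate (n + 1) LB) X"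
    | "\<not> dw (replicate (n + 1) LA) X" "\<not> dw (replicate (n + 1) LB) X" by blast
  then show ?thesis
  proof cases
    case 1
    then show ?thesis by (intro that[of "dw (abw (n + 1) (n + 1))"]) (simp_all add: Pcell_def dw_abw_iff)
  next
    case 2
    then obtain j where "j \<le> n" "dw (replicate j LB) X" "\<not> dw (replicate (j + 1) LB) X" using max by blast
    then show ?thesis using 2
      by (intro that[of "\<lambda>X. dw (abw (n + 1) j) X \<and> \<not> dw (abw (n + 1) (j + 1)) X"]) (auto simp: Pcell_def dw_abw_iff)
  next
    case 3
    then obtain i where "i \<le> n" "dw (replicate i LA) X" "\<not> dw (replicate (i + 1) LA) X" using max by blast
    then show ?thesis using 3
      by (intro that[of "\<lambda>X. dw (abw i (n + 1)) X \<and> \<not> dw (abw (i + 1) (n + 1)) X"]) (auto simp: Pcell_def dw_abw_iff)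
  next
    case 4
    then obtain i j where i: "i \<le> n" "dw (replicate i LA) X" "\<not> dw (replicate (i + 1) LA) X"
      and j: "j \<le> n" "dw (replicate j LB) X" "\<not> dw (replicate (j + 1) LB) X" using max by meson
    have "dw (abw i j) X" using i j by (simp add: dw_abw_iff)
    then obtain Z where Z: "same_blocks X (prepend (abw i j) Z)" by (auto simp: dw_def)
    obtain e Z' where e: "Z = e ## Z'" using iCons_exhaust .
    \<comment> \<open>Both exponents are maximal, so the next letter e can be neither \<alpha> nor
      \<beta>.\<close>
    have X: "dw (abw i j @ [e]) X" using Z e dw_cong by simp
    have "\<exists>c. e = LG c"
    proof (cases e)
      case LA
      have "feq (abw i j @ [LA]) (abw (i + 1) j)" using feq_abw[of "abw i j @ [LA]"] by (auto simp: abw_def)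
      then have "dw (abw (i + 1) j) X" using X LA dw_feq by blast
      then show ?thesis using i by (simp add: dw_abw_iff)
    next
      case LB
      have "abw i j @ [LB] = abw i (j + 1)" by (simp add: abw_def replicate_append_same)
      then have "dw (abw i (j + 1)) X" using X LB by simp
      then show ?thesis using j by (simp add: dw_abw_iff)
    qed simp
    then obtain c where c: "dw (abw i j @ [LG c]) X" using X by auto
    then have "n \<le> i + j" using assms i j by blast
    then show ?thesis using c i j by (intro that[of "dw (abw i j @ [LG c])"]) (auto simp: Pcell_def)
  qed
qed

definition wset :: "(nat \<Rightarrow> nat) \<Rightarrow> nat \<Rightarrow> ((nat \<Rightarrow> letter) \<Rightarrow> bool) \<Rightarrow> ipath set" where
  "wset k m E = {x \<in> ipaths_from k m. \<exists>X. x = ip m X \<and> E X}"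

lemma cyl_fp: "fp m w \<in> Lambda k \<Longrightarrow> cyl k (fp m w) = wset k m (dw w)"
proof (rule set_eqI)
  fix x assume L: "fp m w \<in> Lambda k"
  obtain j X where x: "x = ip j X" by (cases x)
  show "x \<in> cyl k (fp m w) \<longleftrightarrow> x \<in> wset k m (dw w)"
    unfolding cyl_iff[OF L] wset_def ipaths_from_def x divs_fp_ip
    using dw_cong by (auto simp: ip_eq_iff intro: same_blocks_refl)
qed

lemma wset_Diff: "wset k m (dw v) - wset k m (dw w) = wset k m (\<lambda>X. dw v X \<and> \<not> dw w X)"
proof -
  have *: "x \<in> wset k m (dw u) \<longleftrightarrow> x \<in> ipaths_from k m \<and> divs (fp m u) x" for x u
    by (cases x) (auto simp: wset_def divs_fp_ip ip_eq_iff dw_cong intro: same_blocks_refl)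
  have "x \<in> wset k m (\<lambda>X. dw v X \<and> \<not> dw w X) \<longleftrightarrow> x \<in> ipaths_from k m \<and> divs (fp m v) x \<and> \<not> divs (fp m w) x" for x
    by (cases x) (auto simp: wset_def divs_fp_ip ip_eq_iff dw_cong ipaths_from_def; blast intro: same_blocks_refl)
  then show ?thesis using * by blast
qed

lemma P_part_Pcell:
  assumes "1 \<le> m"
  shows "P_part k m n \<subseteq> wset k m ` Collect (Pcell n)"
proof
  fix E assume E: "E \<in> P_part k m n"
  have c: "cyl k (ab_path m i j) = wset k m (dw (abw i j))" for i j
    using assms cyl_fp[of m "abw i j" k] ab_path_Lambda[of m i j k] by (simp add: ab_path_abw)
  have g: "cyl k (ab_path m i j \<Zcomp> gamma_edge (m + i + j) d) = wset k m (dw (abw i j @ [LG d]))"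
    if "d \<in> {1..k (m + i + j)}" for i j d
  proof -
    have "ab_path m i j \<Zcomp> gamma_edge (m + i + j) d = fp m (abw i j @ [LG d])"
      by (simp add: ab_path_abw gamma_edge_fp)
    moreover have "ab_path m i j \<Zcomp> gamma_edge (m + i + j) d \<in> Lambda k"
      using that assms by (simp add: pcomp_Lambda_iff ab_path_Lambda gamma_edge_Lambda)
    ultimately show ?thesis using cyl_fp by metis
  qed
  have "\<exists>E'. Pcell n E' \<and> E = wset k m E'"
    using E unfolding P_part_def
  proof (elim UnE CollectE exE conjE)
    fix j assume "E = cyl k (ab_path m (n + 1) j) - cyl k (ab_path m (n + 1) (j + 1))" "j \<le> n"
    then show ?thesis unfolding c wset_Diff Pcell_def by blast
  next
    fix i assume "E = cyl k (ab_path m i (n + 1)) - cyl k (ab_path m (i + 1) (n + 1))" "i \<le> n"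
    then show ?thesis unfolding c wset_Diff Pcell_def by blast
  next
    fix i j \<epsilon> assume "E = cyl k (ab_path m i j \<Zcomp> \<epsilon>)" "i \<le> n" "j \<le> n" "n \<le> i + j"
      "\<epsilon> \<in> gamma_edges_from k (m + i + j)"
    then show ?thesis using g unfolding gamma_edges_from_def Pcell_def by blast
  next
    assume "E \<in> {cyl k (ab_path m (n + 1) (n + 1))}"
    then show ?thesis unfolding c Pcell_def by blast
  qed
  then show "E \<in> wset k m ` Collect (Pcell n)" by blast
qed

lemma Pcell_P_part:
  assumes "1 \<le> m" "Pcell n E'" "x \<in> wset k m E'"
  shows "wset k m E' \<in> P_part k m n"
proof -
  have c: "wset k m (dw (abw i j)) = cyl k (ab_path m i j)" for i j
    using assms(1) cyl_fp[of m "abw i j" k] ab_path_Lambda[of m i j k] by (simp add: ab_path_abw)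
  show ?thesis
    using assms(2) unfolding Pcell_def
  proof (elim disjE exE conjE)
    fix j assume E: "j \<le> n" "E' = (\<lambda>X. dw (abw (n + 1) j) X \<and> \<not> dw (abw (n + 1) (j + 1)) X)"
    show ?thesis unfolding E(2) wset_Diff[symmetric] c P_part_def using E(1) by blast
  next
    fix i assume E: "i \<le> n" "E' = (\<lambda>X. dw (abw i (n + 1)) X \<and> \<not> dw (abw (i + 1) (n + 1)) X)"
    show ?thesis unfolding E(2) wset_Diff[symmetric] c P_part_def using E(1) by blast
  next
    fix i j d assume E: "i \<le> n" "j \<le> n" "n \<le> i + j" "E' = dw (abw i j @ [LG d])"
    have eq: "ab_path m i j \<Zcomp> gamma_edge (m + i + j) d = fp m (abw i j @ [LG d])"
      by (simp add: ab_path_abw gamma_edge_fp)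
    obtain X where X: "x = ip m X" "dw (abw i j @ [LG d]) X" "x \<in> ipaths k"
      using assms(3) E by (auto simp: wset_def ipaths_from_def)
    then have "divs (fp m (abw i j @ [LG d])) x" by (simp add: divs_fp_ip)
    then have L: "fp m (abw i j @ [LG d]) \<in> Lambda k" using divs_Lambda X(3) by blast
    then have "d \<in> {1..k (m + i + j)}"
      unfolding eq[symmetric] by (subst (asm) pcomp_Lambda_iff) (auto simp: gamma_edge_Lambda)
    then have "gamma_edge (m + i + j) d \<in> gamma_edges_from k (m + i + j)" by (auto simp: gamma_edges_from_def)
    moreover have "wset k m E' = cyl k (ab_path m i j \<Zcomp> gamma_edge (m + i + j) d)"
      unfolding E(4) eq using cyl_fp[OF L] by simp
    ultimately show ?thesis unfolding P_part_def using E by blast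
  next
    assume E: "E' = dw (abw (n + 1) (n + 1))"
    show ?thesis unfolding E c P_part_def by blast
  qed
qed

text \<open>The \<gamma>-edge acts as a barrier: a divisor either stops before it and does not see
  X, or contains it at the same position and tests X with the remaining letters.\<close>

lemma dw_gamma_end:
  assumes "dw w (prepend (t @ [LG c]) X)"
  shows "(\<forall>X'. dw w (prepend (t @ [LG c]) X')) \<or>
    (\<exists>w1 w2. w = w1 @ LG c # w2 \<and> feq w1 t \<and> dw w2 X)"
proof -
  obtain Z where Z: "same_blocks (prepend t (LG c ## X)) (prepend w Z)"
    using assms by (auto simp: dw_def prepend_append)
  show ?thesis
  proof (cases "length t < length w")
    case True
    define w1 w2 where "w1 = take (length t) w" and "w2 = drop (Suc (length t)) w"
    have w: "w = w1 @ w ! length t # w2" using True by (simp add: w1_def w2_def id_take_nth_drop[symmetric])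
    have "same_blocks (prepend t (LG c ## X)) (prepend w1 (w ! length t ## prepend w2 Z))"
      using Z w by (metis prepend_append prepend_Cons)
    from same_blocks_cut[OF this] True have "feq t w1" "w ! length t = LG c" "same_blocks X (prepend w2 Z)"
      by (auto simp: w1_def)
    then show ?thesis using w dwI feq_sym by metis
  next
    case False
    define z where "z = map Z [0..<length t - length w]"
    obtain Z' where "Z = prepend z Z'" unfolding z_def using prepend_split by blast
    then have "same_blocks (prepend t (LG c ## X)) (prepend (w @ z) Z')" using Z by (simp add: prepend_append)
    from same_blocks_cut[OF this] False have f: "feq t (w @ z)" by (simp add: z_def)
    have "dw w (prepend (t @ [LG c]) X')" for X'
    proof -
      have "same_blocks (prepend (t @ [LG c]) X') (prepend w (prepend (z @ [LG c]) X'))"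
        using feq_prepend[OF f same_blocks_refl] by (simp add: prepend_append)
      then show ?thesis by (rule dwI)
    qed
    then show ?thesis by blast
  qed
qed

text \<open>Inside a test word a \<gamma>-edge lies in the free part u, and then dropping everything
  up to it shortens u by the right amount, or it is the closing letter, and nothing remains.\<close>

lemma Tw_drop_gamma:
  assumes "Tw q (w1 @ LG c # w2)" "Suc (length w1) \<le> q"
  shows "Tw (q - Suc (length w1)) w2"
proof -
  obtain u i j g where w: "w1 @ LG c # w2 = u @ abw i j @ g" and g: "(g = [] \<and> length u + max i j \<le> q) \<or>
      (\<exists>c. g = [LG c] \<and> length u + max i j < q)"
    using assms(1) unfolding Tw_def by (metis append_Nil2)
  show ?thesis
  proof (cases "length w1 < length u")
    case True
    define u2 where "u2 = drop (Suc (length w1)) u"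
    have "w2 = u2 @ abw i j @ g"
      using arg_cong[OF w, of "drop (Suc (length w1))"] True by (simp add: u2_def)
    moreover have "length u2 + Suc (length w1) = length u" using True by (simp add: u2_def)
    ultimately show ?thesis
      using g unfolding Tw_def
      by (elim disjE exE conjE) (rule disjI1, rule exI[of _ u2], rule exI[of _ i], rule exI[of _ j], simp,
          rule disjI2, rule exI[of _ u2], rule exI[of _ i], rule exI[of _ j], simp)
  next
    case False
    have "(w1 @ LG c # w2) ! length w1 = LG c" by simp
    then have G: "(u @ abw i j @ g) ! length w1 = LG c" using w by simp
    have "\<not> length w1 < length u + (i + j)"
    proof
      assume "length w1 < length u + (i + j)"
      then have *: "length w1 - length u < i + j" using False by linarith
      then have "abw i j ! (length w1 - length u) = LG c" using G False by (simp add: nth_append)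
      moreover note *
      ultimately show False using abw_not_LG by blast
    qed
    moreover have "length (w1 @ LG c # w2) = length u + (i + j) + length g" using w by simp
    moreover have "length g \<le> 1" using g by auto
    ultimately have "length w2 = 0" unfolding length_append list.size(4) by linarith
    then have "w2 = []" by simp
    then show ?thesis by (simp add: Tw_length)
  qed
qed

lemma Phi_cases:
  assumes "\<mu> \<in> Phi k m n"
  obtains "\<mu> = vertex m" | t c where "\<mu> = fp m (t @ [LG c])" "Suc (length t) \<le> n" "\<mu> \<in> Lambda k"
proof -
  consider "\<mu> = vertex m" | \<nu> \<epsilon> where "\<mu> \<in> Lambda_from k m" "plen \<mu> \<le> n" "\<epsilon> \<in> gamma_edges_from k (psource \<nu>)" "\<mu> = \<nu> \<Zcomp> \<epsilon>"
    using assms unfolding Phi_def by blast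
  then show ?thesis
  proof cases
    case 1
    then show ?thesis by (rule that(1))
  next
    case 2
    obtain i w where \<nu>: "\<nu> = fp i w" by (cases \<nu>)
    obtain c where "\<epsilon> = gamma_edge (psource \<nu>) c" using 2(3) by (auto simp: gamma_edges_from_def)
    then have \<mu>: "\<mu> = fp i (w @ [LG c])" using 2(4) \<nu> by (simp add: gamma_edge_fp)
    then have "i = m" using 2(1) by (simp add: Lambda_from_def)
    moreover have "plen \<mu> = Suc (length w)" by (simp add: \<mu>)
    ultimately show ?thesis using that(2)[of w c] 2(1,2) \<mu> by (simp add: Lambda_from_def)
  qed
qed

lemma Phi_gammaI:
  assumes "fp m (t @ [LG c]) \<in> Lambda k" "Suc (length t) \<le> n"
  shows "fp m (t @ [LG c]) \<in> Phi k m n"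
proof -
  have eq: "fp m (t @ [LG c]) = fp m t \<Zcomp> gamma_edge (m + length t) c" by (simp add: gamma_edge_fp)
  then have "fp m t \<in> Lambda k \<and> gamma_edge (m + length t) c \<in> Lambda k"
    using assms(1) by (metis pcomp_Lambda_iff prange_gamma_edge psource_fp)
  then have "gamma_edge (m + length t) c \<in> gamma_edges_from k (psource (fp m t))" "fp m t \<in> Lambda k"
    by (auto simp: gamma_edges_from_def gamma_edge_Lambda)
  then have "\<exists>\<nu>\<in>Lambda k. \<exists>\<epsilon>\<in>gamma_edges_from k (psource \<nu>). fp m (t @ [LG c]) = \<nu> \<Zcomp> \<epsilon>"
    using eq by blast
  then show ?thesis unfolding Phi_def Lambda_from_def using assms by simp
qed

lemma ceq_of_Pcell:
  assumes "Pcell n E'" "x \<in> wset k m E'" "y \<in> wset k m E'"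
  shows "ceq (Suc n) x y"
proof -
  have "divs \<kappa> y" if "Tpath (Suc n) \<kappa>" "divs \<kappa> x" "x \<in> wset k m E'" "y \<in> wset k m E'" for x y \<kappa>
  proof -
    obtain i w where \<kappa>: "\<kappa> = fp i w" "Tw (Suc n) w" using \<open>Tpath (Suc n) \<kappa>\<close> by (auto simp: Tpath_def)
    obtain X Y where XY: "x = ip m X" "E' X" "y = ip m Y" "E' Y"
      using \<open>x \<in> _\<close> \<open>y \<in> _\<close> by (auto simp: wset_def)
    have "dw w X" "i = m" using \<open>divs \<kappa> x\<close> \<kappa> XY by (auto simp: divs_fp_ip)
    then show ?thesis using Pcell_Tw[OF assms(1) XY(2,4) \<kappa>(2)] \<kappa> XY by (simp add: divs_fp_ip)
  qed
  then show ?thesis using assms unfolding ceq_def by blast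
qed

lemma Pcell_saturated:
  assumes "Pcell n E'" "x \<in> wset k m E'" "y \<in> ipaths k" "ceq (Suc n) x y"
  shows "y \<in> wset k m E'"
proof -
  obtain X where X: "x = ip m X" "E' X" using assms(2) by (auto simp: wset_def)
  have "irange y = m" using ceq_irange[OF assms(4)] X by simp
  then obtain Y where Y: "y = ip m Y" by (cases y) auto
  have T: "dw w X \<longleftrightarrow> dw w Y" if "Tw (Suc n) w" for w
  proof -
    have "Tpath (Suc n) (fp m w)" using that by (auto simp: Tpath_def)
    then show ?thesis using assms(4) unfolding ceq_def X Y by (metis divs_fp_ip)
  qed
  have T1: "Tw (Suc n) (abw i j)" if "i \<le> n + 1" "j \<le> n + 1" for i j
    unfolding Tw_def by (rule disjI1, rule exI[of _ "[]"], rule exI[of _ i], rule exI[of _ j]) (use that in simp)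
  have T2: "Tw (Suc n) (abw i j @ [LG c])" if "i \<le> n" "j \<le> n" for i j c
    unfolding Tw_def by (rule disjI2, rule exI[of _ "[]"], rule exI[of _ i], rule exI[of _ j], rule exI[of _ c]) (use that in simp)
  have "E' Y"
    using assms(1) X(2) unfolding Pcell_def
  proof (elim disjE exE conjE)
    fix j assume "j \<le> n" "E' = (\<lambda>X. dw (abw (n + 1) j) X \<and> \<not> dw (abw (n + 1) (j + 1)) X)"
    then show ?thesis using X(2) T[OF T1[of "n + 1" j]] T[OF T1[of "n + 1" "j + 1"]] by simp
  next
    fix i assume "i \<le> n" "E' = (\<lambda>X. dw (abw i (n + 1)) X \<and> \<not> dw (abw (i + 1) (n + 1)) X)"
    then show ?thesis using X(2) T[OF T1[of i "n + 1"]] T[OF T1[of "i + 1" "n + 1"]] by simp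
  next
    fix i j c assume "i \<le> n" "j \<le> n" "E' = dw (abw i j @ [LG c])"
    then show ?thesis using X(2) T[OF T2[of i j c]] by simp
  next
    assume "E' = dw (abw (n + 1) (n + 1))"
    then show ?thesis using X(2) T[OF T1[of "n + 1" "n + 1"]] by simp
  qed
  then show ?thesis using Y assms(3) unfolding wset_def by (auto simp: ipaths_from_def)
qed

lemma Q_part_nonneg:
  "0 \<le> n \<Longrightarrow> Q_part k m n = (\<Union>\<mu>\<in>Phi k m (nat n). (\<lambda>E. (\<odot>) \<mu> ` E) ` P_part k (m + plen \<mu>) (nat n - plen \<mu>))"
  by (simp add: Q_part_def)

lemma Phi_plen: "\<mu> \<in> Phi k m n \<Longrightarrow> plen \<mu> \<le> n \<and> prange \<mu> = m \<and> (1 \<le> m \<longrightarrow> \<mu> \<in> Lambda k)"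
  by (auto simp: Phi_def Lambda_from_def vertex_Lambda)

text \<open>Identifies the explicit partition with an equivalence relation. Every path of
  \<open>Phi\<close> other than a vertex ends in a \<gamma>-edge, so the test paths split at its end
  and the claim reduces to \<open>Pcell_Tw\<close>. Disjointness, nesting and refinement of cells
  then follow from monotonicity of \<open>ceq\<close> in the level.\<close>

lemma Q_part_cls:
  assumes m: "1 \<le> m" and E: "E \<in> Q_part k m n" and n: "-1 \<le> n" and x: "x \<in> E"
  shows "E = cls k (nat (n + 1)) x \<and> x \<in> ipaths_from k m"
proof (cases "n < 0")
  case True
  then have "n = -1" using n by simp
  then have E: "E = cyl k (vertex m)" using E by (simp add: Q_part_def)
  have x': "x \<in> ipaths k" "irange x = m" using x m by (auto simp: E cyl_iff vertex_Lambda divs_vertex)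
  \<comment> \<open>At level 0 the only test words are empty, and the corresponding vertices test
    just the range.\<close>
  have c0: "ceq 0 x y" if "irange y = m" for y
  proof -
    have "divs \<kappa> x \<longleftrightarrow> divs \<kappa> y" if "Tpath 0 \<kappa>" for \<kappa>
    proof -
      obtain i w where "\<kappa> = fp i w" "Tw 0 w" using \<open>Tpath 0 \<kappa>\<close> by (auto simp: Tpath_def)
      then have "\<kappa> = vertex i" by (auto simp: Tw_def vertex_fp abw_def)
      then show ?thesis using x' \<open>irange y = m\<close> by (simp add: divs_vertex)
    qed
    then show ?thesis by (simp add: ceq_def)
  qed
  have c: "ceq 0 x y \<longleftrightarrow> irange y = m" for y
  proof
    show "irange y = m" if "ceq 0 x y" using ceq_irange[OF that] x'(2) by simp
  qed (rule c0)
  have "E = cls k 0 x"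
    unfolding E cls_def c using m by (auto simp: cyl_iff vertex_Lambda divs_vertex)
  then show ?thesis
    using x' \<open>n = -1\<close> by (simp add: ipaths_from_def)
next
  case False
  define N where "N = nat n"
  have q: "nat (n + 1) = Suc N" using False by (simp add: N_def)
  obtain \<mu> E1 where \<mu>: "\<mu> \<in> Phi k m N" and "E1 \<in> P_part k (m + plen \<mu>) (N - plen \<mu>)" and EE: "E = (\<odot>) \<mu> ` E1"
    using E False by (auto simp: Q_part_nonneg N_def)
  then obtain E' where E': "Pcell (N - plen \<mu>) E'" "E1 = wset k (m + plen \<mu>) E'"
    using P_part_Pcell[of "m + plen \<mu>" k "N - plen \<mu>"] m by auto
  have pl: "plen \<mu> \<le> N" "prange \<mu> = m" "\<mu> \<in> Lambda k" using Phi_plen[OF \<mu>] m by auto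
  have src: "psource \<mu> = m + plen \<mu>" using pl by (simp add: psource_def)
  have qq: "Suc N = Suc (N - plen \<mu>) + plen \<mu>" using pl by simp
  obtain x1 where x1: "x = \<mu> \<odot> x1" "x1 \<in> E1" using x EE by blast
  have E1: "y \<in> ipaths k \<and> irange y = psource \<mu>" if "y \<in> E1" for y
    using that src E' by (auto simp: wset_def ipaths_from_def)
  have inX: "\<mu> \<odot> y \<in> ipaths k" if "y \<in> E1" for y
    using E1[OF that] pl icomp_ipaths_iff by simp
  have same: "ceq (Suc N) (\<mu> \<odot> y) (\<mu> \<odot> z)" if "y \<in> E1" "z \<in> E1" for y z
    unfolding ceq_def
  proof (intro allI impI)
    fix \<kappa> assume T: "Tpath (Suc N) \<kappa>"
    have sub: "ceq (Suc (N - plen \<mu>)) y z"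
      using ceq_of_Pcell[OF E'(1)] that E'(2) by blast
    have dir: "divs \<kappa> (\<mu> \<odot> z)" if "divs \<kappa> (\<mu> \<odot> y)" "y \<in> E1" "z \<in> E1" "ceq (Suc (N - plen \<mu>)) y z" for y z
    proof -
      note prems = that
      show ?thesis
      proof (cases "\<mu> = vertex m")
        case True
        then show ?thesis using prems T E1 vertex_icomp src unfolding ceq_def
          by (metis diff_zero plen_vertex psource_vertex)
      next
        case False
        then obtain t c where tc: "\<mu> = fp m (t @ [LG c])" using Phi_cases[OF \<mu>] by metis
        obtain i w where \<kappa>: "\<kappa> = fp i w" "Tw (Suc N) w" using T by (auto simp: Tpath_def)
        obtain j Y j' Z where yz: "y = ip j Y" "z = ip j' Z" by (metis ip_cases)
        have jj: "j = psource \<mu>" "j' = psource \<mu>" using E1[OF prems(2)] E1[OF prems(3)] yz by auto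
        have i: "i = m" and d: "dw w (prepend (t @ [LG c]) Y)"
          using prems(1) by (auto simp: \<kappa> tc yz divs_fp_ip)
        \<comment> \<open>Since \<mu> ends in a \<gamma>-edge, \<kappa> either stops inside \<mu> or
          passes through its end and leaves a test word of the reduced level.\<close>
        show ?thesis
          using dw_gamma_end[OF d]
        proof
          assume "\<forall>X'. dw w (prepend (t @ [LG c]) X')"
          then show ?thesis by (auto simp: \<kappa> tc yz divs_fp_ip i)
        next
          assume "\<exists>w1 w2. w = w1 @ LG c # w2 \<and> feq w1 t \<and> dw w2 Y"
          then obtain w1 w2 where w: "w = w1 @ LG c # w2" "feq w1 t" "dw w2 Y" by blast
          have len: "length w1 = length t" using w(2) feq_length by blast
          have "Tw (Suc N - Suc (length w1)) w2"
            using \<kappa>(2) pl len tc unfolding w by (intro Tw_drop_gamma) auto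
          moreover have "Suc N - Suc (length w1) = Suc (N - plen \<mu>)" using len tc pl by simp
          ultimately have "Tpath (Suc (N - plen \<mu>)) (fp j w2)"
            unfolding Tpath_def by metis
          then have "dw w2 Z" using prems(4) w(3) yz jj unfolding ceq_def by (metis divs_fp_ip)
          then have "dw ((t @ [LG c]) @ w2) (prepend (t @ [LG c]) Z)" using dw_append_prepend by blast
          moreover have "feq w ((t @ [LG c]) @ w2)" using w feq_append[OF w(2) feq_refl] by simp
          ultimately have "dw w (prepend (t @ [LG c]) Z)" using dw_feq by blast
          then show ?thesis by (simp add: \<kappa> tc yz divs_fp_ip i)
        qed
      qed
    qed
    show "divs \<kappa> (\<mu> \<odot> y) = divs \<kappa> (\<mu> \<odot> z)"
      using dir that sub ceq_sym by blast
  qed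
  show ?thesis
  proof
    show "E = cls k (nat (n + 1)) x"
    proof (intro equalityI subsetI)
      fix y assume "y \<in> E"
      then show "y \<in> cls k (nat (n + 1)) x" using same inX x1 EE by (auto simp: cls_def q)
    next
      fix y assume y: "y \<in> cls k (nat (n + 1)) x"
      then have c: "ceq (Suc N) x y" "y \<in> ipaths k" by (auto simp: cls_def q)
      have "divs \<mu> x" using x1 E1 by (auto simp: divs_def)
      then have "divs \<mu> y" using ceq_divs[OF c(1)] pl by simp
      then obtain y1 where y1: "y = \<mu> \<odot> y1" "irange y1 = psource \<mu>" by (auto simp: divs_def)
      have "ceq (Suc (N - plen \<mu>) + plen \<mu>) (\<mu> \<odot> x1) (\<mu> \<odot> y1)" using c(1) qq x1(1) y1(1) by metis
      then have "ceq (Suc (N - plen \<mu>)) x1 y1"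
        by (rule ceq_cancel) (use E1[OF x1(2)] y1(2) in auto)
      moreover have "y1 \<in> ipaths k" using c(2) y1 icomp_ipaths_iff by blast
      ultimately have "y1 \<in> E1" using Pcell_saturated[OF E'(1)] x1 E' by blast
      then show "y \<in> E" using EE y1 by blast
    qed
    show "x \<in> ipaths_from k m" using inX x1 pl by (auto simp: ipaths_from_def)
  qed
qed

text \<open>The longest path of \<open>Phi\<close> that divides x selects the piece of the
  partition; its maximality supplies the lower bound that \<open>Pcell_cover\<close> asks
  for.\<close>

lemma Q_part_cover:
  assumes x: "x \<in> ipaths_from k m" and m: "1 \<le> m"
  obtains E where "E \<in> Q_part k m n" "x \<in> E"
proof (cases "n < 0")
  case True
  then show ?thesis using that x m by (auto simp: Q_part_def cyl_iff vertex_Lambda divs_vertex ipaths_from_def)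
next
  case False
  define N where "N = nat n"
  let ?P = "\<lambda>s. \<exists>\<mu>\<in>Phi k m N. divs \<mu> x \<and> plen \<mu> = s"
  have x': "x \<in> ipaths k" "irange x = m" using x by (auto simp: ipaths_from_def)
  have "vertex m \<in> Phi k m N" by (simp add: Phi_def)
  then have "?P 0" using x' by (intro bexI[of _ "vertex m"]) (auto simp: divs_vertex)
  moreover have "\<forall>s. ?P s \<longrightarrow> s \<le> N" using Phi_plen by blast
  ultimately have "?P (GREATEST s. ?P s)" "\<And>s'. ?P s' \<Longrightarrow> s' \<le> (GREATEST s. ?P s)"
    using GreatestI_nat[of ?P 0 N] Greatest_le_nat[of ?P _ N] by blast+
  then obtain s where s: "?P s" "\<And>s'. ?P s' \<Longrightarrow> s' \<le> s" by metis
  then obtain \<mu> where \<mu>: "\<mu> \<in> Phi k m N" "divs \<mu> x" "plen \<mu> = s" by blast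
  obtain y where y: "x = \<mu> \<odot> y" "irange y = psource \<mu>" using \<mu> by (auto simp: divs_def)
  have pl: "plen \<mu> \<le> N" "prange \<mu> = m" "\<mu> \<in> Lambda k" using Phi_plen[OF \<mu>(1)] m by auto
  have src: "psource \<mu> = m + plen \<mu>" using pl by (simp add: psource_def)
  obtain Y where Y: "y = ip (m + plen \<mu>) Y" using y src by (cases y) auto
  obtain u where u: "\<mu> = fp m u" using pl by (cases \<mu>) auto
  \<comment> \<open>A \<gamma>-edge met earlier would extend \<mu> to a longer divisor of x in
    \<open>Phi\<close>.\<close>
  have "N - plen \<mu> \<le> i + j" if "dw (abw i j @ [LG c]) Y" for i j c
  proof (rule ccontr)
    assume lt: "\<not> N - plen \<mu> \<le> i + j"
    have "dw (u @ abw i j @ [LG c]) (prepend u Y)" using that by simp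
    then have d: "divs (fp m ((u @ abw i j) @ [LG c])) x" by (simp add: y Y u divs_fp_ip)
    then have "fp m ((u @ abw i j) @ [LG c]) \<in> Lambda k" using divs_Lambda x' by blast
    then have "fp m ((u @ abw i j) @ [LG c]) \<in> Phi k m N" using lt u pl by (intro Phi_gammaI) auto
    then have "plen (fp m ((u @ abw i j) @ [LG c])) \<le> s" using s(2) d by blast
    then show False using \<mu>(3) u by simp
  qed
  then obtain E' where E': "Pcell (N - plen \<mu>) E'" "E' Y" using Pcell_cover by metis
  have "y \<in> wset k (m + plen \<mu>) E'"
    using x' y E' Y icomp_ipaths_iff by (auto simp: wset_def ipaths_from_def)
  then have "wset k (m + plen \<mu>) E' \<in> P_part k (m + plen \<mu>) (N - plen \<mu>)"
    using Pcell_P_part E' m by (metis trans_le_add1)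
  then have "(\<odot>) \<mu> ` wset k (m + plen \<mu>) E' \<in> Q_part k m n"
    using False \<mu>(1) by (auto simp: Q_part_nonneg N_def)
  moreover have "x \<in> (\<odot>) \<mu> ` wset k (m + plen \<mu>) E'" using y \<open>y \<in> _\<close> by blast
  ultimately show ?thesis using that by blast
qed

lemma cls_Q_part:
  assumes "x \<in> ipaths_from k m" "1 \<le> m" "-1 \<le> n"
  shows "cls k (nat (n + 1)) x \<in> Q_part k m n"
  using Q_part_cover[OF assms(1,2)] Q_part_cls[OF assms(2) _ assms(3)] by metis

section \<open>Finiteness of paths and cells\<close>

lemma finite_letters: "finite {l. \<forall>c. l = LG c \<longrightarrow> c \<in> {1..K}}"
proof (rule finite_subset)
  show "{l. \<forall>c. l = LG c \<longrightarrow> c \<in> {1..K}} \<subseteq> {LA, LB} \<union> LG ` {1..K}"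
  proof
    fix l assume "l \<in> {l. \<forall>c. l = LG c \<longrightarrow> c \<in> {1..K}}"
    then show "l \<in> {LA, LB} \<union> LG ` {1..K}" by (cases l) auto
  qed
qed simp

text \<open>Only vertices up to m + n are met, so the superscripts are bounded by one number K and
  the words come from a finite alphabet.\<close>

lemma finite_Lambda_from: "finite {\<mu> \<in> Lambda_from k m. plen \<mu> = n}"
proof -
  define K where "K = Max (k ` {..m + n})"
  have K: "k i \<le> K" if "i \<le> m + n" for i unfolding K_def using that by (intro Max_ge) auto
  have "{\<mu> \<in> Lambda_from k m. plen \<mu> = n} \<subseteq>
    fp m ` {w. set w \<subseteq> {l. \<forall>c. l = LG c \<longrightarrow> c \<in> {1..K}} \<and> length w = n}"
  proof
    fix \<mu> assume \<mu>: "\<mu> \<in> {\<mu> \<in> Lambda_from k m. plen \<mu> = n}"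
    then obtain w where w: "\<mu> = fp m w" by (cases \<mu>) (auto simp: Lambda_from_def)
    have "c \<in> {1..K}" if c: "LG c \<in> set w" for c
    proof -
      obtain t where t: "t < length w" "w ! t = LG c" using c unfolding in_set_conv_nth by blast
      have "admissible k (fp m w)" "length w = n" using \<mu> w by (auto simp: Lambda_from_def Lambda_def)
      then have "c \<in> {1..k (m + t)}" using t unfolding admissible_fp by blast
      moreover have "k (m + t) \<le> K" using t(1) \<open>length w = n\<close> by (intro K) simp
      ultimately show ?thesis by auto
    qed
    then show "\<mu> \<in> fp m ` {w. set w \<subseteq> {l. \<forall>c. l = LG c \<longrightarrow> c \<in> {1..K}} \<and> length w = n}"
      using w \<mu> by auto
  qed
  then show ?thesis
    by (rule finite_subset) (intro finite_imageI finite_lists_length_eq finite_letters)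
qed

lemma finite_Lambda_from_le: "finite {\<mu> \<in> Lambda_from k m. plen \<mu> \<le> n}"
proof -
  have "{\<mu> \<in> Lambda_from k m. plen \<mu> \<le> n} = (\<Union>i\<le>n. {\<mu> \<in> Lambda_from k m. plen \<mu> = i})" by auto
  then show ?thesis using finite_Lambda_from by simp
qed

lemma finite_Phi: "finite (Phi k m n)"
  unfolding Phi_def by (rule finite_UnI) (auto intro: finite_subset[OF _ finite_Lambda_from_le[of k m n]])

lemma finite_P_part: "finite (P_part k m n)"
proof -
  have "{cyl k (ab_path m i j \<Zcomp> \<epsilon>) | i j \<epsilon>. i \<le> n \<and> j \<le> n \<and> n \<le> i + j \<and> \<epsilon> \<in> gamma_edges_from k (m + i + j)}
     \<subseteq> (\<Union>i\<le>n. \<Union>j\<le>n. (\<lambda>\<epsilon>. cyl k (ab_path m i j \<Zcomp> \<epsilon>)) ` gamma_edges_from k (m + i + j))" by auto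
  moreover have "finite \<dots>" by (auto simp: gamma_edges_from_def)
  ultimately have "finite {cyl k (ab_path m i j \<Zcomp> \<epsilon>) | i j \<epsilon>. i \<le> n \<and> j \<le> n \<and> n \<le> i + j \<and> \<epsilon> \<in> gamma_edges_from k (m + i + j)}"
    by (rule finite_subset)
  then show ?thesis unfolding P_part_def by simp
qed

lemma finite_Q_part: "finite (Q_part k m n)"
  unfolding Q_part_def using finite_Phi finite_P_part by auto


section \<open>Compactness\<close>

lemma ipaths_from_ip: "x \<in> ipaths_from k m \<Longrightarrow> \<exists>X. x = ip m X"
  by (cases x) (auto simp: ipaths_from_def)

lemma ipaths_from_sub: "x \<in> ipaths_from k m \<Longrightarrow> x \<in> ipaths k"
  by (simp add: ipaths_from_def)

lemma mem_cls: "x \<in> ipaths k \<Longrightarrow> x \<in> cls k q x"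
  by (simp add: cls_def)

lemma cls_eq: "y \<in> cls k q x \<Longrightarrow> cls k q y = cls k q x"
  unfolding cls_def using ceq_trans ceq_sym by blast

lemma cls_mono: "q \<le> q' \<Longrightarrow> cls k q' x \<subseteq> cls k q x"
  unfolding cls_def using ceq_mono by blast

lemma cls_ipaths_from: "x \<in> ipaths_from k m \<Longrightarrow> cls k q x \<subseteq> ipaths_from k m"
  unfolding cls_def ipaths_from_def using ceq_irange by auto

lemma cls_Q_part': "x \<in> ipaths_from k m \<Longrightarrow> 1 \<le> m \<Longrightarrow> cls k q x \<in> Q_part k m (int q - 1)"
  using cls_Q_part[of x k m "int q - 1"] by simp

lemma cyl_vertex: "1 \<le> m \<Longrightarrow> cyl k (vertex m) = ipaths_from k m"
  by (rule set_eqI) (simp add: cyl_iff vertex_Lambda divs_vertex ipaths_from_def)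

lemma finite_cells: "1 \<le> m \<Longrightarrow> finite (cls k q ` ipaths_from k m)"
  using cls_Q_part' by (intro finite_subset[OF _ finite_Q_part[of k m "int q - 1"]]) auto

definition extends :: "fpath \<Rightarrow> fpath \<Rightarrow> bool" where
  "extends \<mu> \<nu> \<longleftrightarrow> (\<exists>\<tau>. \<nu> = \<mu> \<Zcomp> \<tau> \<and> prange \<tau> = psource \<mu>)"

lemma extends_trans: "extends \<mu> \<nu> \<Longrightarrow> extends \<nu> \<kappa> \<Longrightarrow> extends \<mu> \<kappa>"
proof -
  assume "extends \<mu> \<nu>" "extends \<nu> \<kappa>"
  then obtain \<tau> \<sigma> where "\<nu> = \<mu> \<Zcomp> \<tau>" "prange \<tau> = psource \<mu>" "\<kappa> = \<nu> \<Zcomp> \<sigma>" "prange \<sigma> = psource \<nu>"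
    unfolding extends_def by blast
  then have "\<kappa> = \<mu> \<Zcomp> (\<tau> \<Zcomp> \<sigma>)" "prange (\<tau> \<Zcomp> \<sigma>) = psource \<mu>" by (auto simp: pcomp_assoc)
  then show ?thesis unfolding extends_def by blast
qed

lemma extends_divs: "extends \<mu> \<nu> \<Longrightarrow> divs \<nu> x \<Longrightarrow> divs \<mu> x"
  unfolding extends_def using divs_mono by blast

lemma divs_upt: "divs (fp m (map X [0..<n])) (ip m X)"
  unfolding divs_fp_ip using prepend_split[of X n] dw_prepend by metis

text \<open>The limit is read off a chain of finite paths which is cofinal in the directed set of all
  finite paths that eventually divide the given sequence.\<close>

lemma ipaths_complete:
  assumes xs: "\<And>q. xs q \<in> ipaths_from k m" and coh: "\<And>q q'. q \<le> q' \<Longrightarrow> ceq q (xs q) (xs q')"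
  obtains x where "x \<in> ipaths_from k m" "\<And>q. ceq q (xs q) x"
proof -
  \<comment> \<open>By coherence of the sequence, testing \<mu> at the stage of its own length
    decides all later stages.\<close>
  define S where "S = {\<mu>. divs \<mu> (xs (plen \<mu>))}"
  have S_iff: "divs \<mu> (xs q) \<longleftrightarrow> \<mu> \<in> S" if "plen \<mu> \<le> q" for \<mu> q
    using ceq_divs[OF coh[OF that]] by (simp add: S_def)
  have S_Lambda: "\<mu> \<in> Lambda_from k m" if "\<mu> \<in> S" for \<mu>
    using that xs[of "plen \<mu>"] divs_Lambda divs_irange unfolding S_def Lambda_from_def ipaths_from_def by auto
  have dir: "\<exists>\<kappa>\<in>S. extends \<mu> \<kappa> \<and> extends \<nu> \<kappa>" if mn: "\<mu> \<in> S" "\<nu> \<in> S" for \<mu> \<nu>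
  proof -
    let ?q = "plen \<mu> + plen \<nu>"
    have d: "divs \<mu> (xs ?q)" "divs \<nu> (xs ?q)" using mn S_iff by auto
    obtain \<tau> \<sigma> where *: "\<mu> \<Zcomp> \<tau> = \<nu> \<Zcomp> \<sigma>" "prange \<tau> = psource \<mu>" "prange \<sigma> = psource \<nu>"
      "divs (\<mu> \<Zcomp> \<tau>) (xs ?q)" "plen (\<mu> \<Zcomp> \<tau>) \<le> ?q"
      using divs_common[OF d] .
    have "\<mu> \<Zcomp> \<tau> \<in> S" using S_iff[OF *(5)] *(4) by simp
    then show ?thesis unfolding extends_def using *(1-3) by blast
  qed
  have vS: "vertex m \<in> S" using xs[of 0] by (simp add: S_def divs_vertex ipaths_from_def)
  have fin_dir: "\<exists>\<kappa>\<in>S. \<forall>\<mu>\<in>F. extends \<mu> \<kappa>" if "finite F" "F \<subseteq> S" for F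
    using that
  proof (induction F rule: finite_induct)
    case empty
    then show ?case using vS by blast
  next
    case (insert \<mu> F)
    then obtain \<kappa> where "\<kappa> \<in> S" "\<forall>\<mu>\<in>F. extends \<mu> \<kappa>" by auto
    moreover then obtain \<kappa>' where "\<kappa>' \<in> S" "extends \<mu> \<kappa>'" "extends \<kappa> \<kappa>'" using dir insert.prems by blast
    ultimately show ?case using extends_trans by blast
  qed
  have long: "\<exists>\<mu>\<in>S. plen \<mu> = i" for i
  proof -
    obtain X where X: "xs i = ip m X" using xs ipaths_from_ip by blast
    have "fp m (map X [0..<i]) \<in> S" using divs_upt[of m X i] by (simp add: S_def X)
    then show ?thesis by (intro bexI[of _ "fp m (map X [0..<i])"]) auto
  qed
  have finS: "finite {\<mu> \<in> S. plen \<mu> \<le> i}" for i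
    using S_Lambda by (intro finite_subset[OF _ finite_Lambda_from_le[of k m i]]) auto
  \<comment> \<open>A good word extends all members of S up to length i. There are finitely many of
    these and S is directed, so good words exist above any given word; the bound on the length makes
    the chain define an infinite word.\<close>
  define good where "good i w \<longleftrightarrow> fp m w \<in> S \<and> i \<le> length w \<and> (\<forall>\<kappa>\<in>S. plen \<kappa> \<le> i \<longrightarrow> extends \<kappa> (fp m w))" for i w
  have step: "\<exists>v. good i (w @ v)" if w: "fp m w \<in> S" for i w
  proof -
    obtain \<mu> where \<mu>: "\<mu> \<in> S" "plen \<mu> = i" using long by blast
    obtain \<kappa> where \<kappa>: "\<kappa> \<in> S" "\<forall>\<nu>\<in>insert (fp m w) (insert \<mu> {\<mu> \<in> S. plen \<mu> \<le> i}). extends \<nu> \<kappa>"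
      using fin_dir[of "insert (fp m w) (insert \<mu> {\<mu> \<in> S. plen \<mu> \<le> i})"] finS w \<mu> by auto
    then obtain \<tau> where "\<kappa> = fp m w \<Zcomp> \<tau>" by (auto simp: extends_def)
    then obtain v where v: "\<kappa> = fp m (w @ v)" by (cases \<tau>) auto
    have "extends \<mu> \<kappa>" using \<kappa> by blast
    then have "i \<le> plen \<kappa>" using \<mu> by (auto simp: extends_def)
    then show ?thesis using \<kappa> v by (intro exI[of _ v]) (auto simp: good_def)
  qed
  have "\<exists>W. \<forall>i. good i (W i) \<and> (\<exists>v. W (Suc i) = W i @ v)"
  proof (rule dependent_nat_choice)
    show "\<exists>w. good 0 w" using step[of "[]" 0] vS by (auto simp: vertex_fp)
    show "\<exists>y. good (Suc n) y \<and> (\<exists>v. y = x @ v)" if "good n x" for x n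
      using step[of x "Suc n"] that by (auto simp: good_def)
  qed
  then obtain W where W: "\<And>i. good i (W i)" "\<And>i. \<exists>v. W (Suc i) = W i @ v" by blast
  have pre: "\<exists>v. W j = W i @ v" if "i \<le> j" for i j
    using that
  proof (induction j rule: dec_induct)
    case (step j)
    then show ?case using W(2)[of j] by auto
  qed simp
  \<comment> \<open>\<open>W (Suc t)\<close> has more than t letters, and later members of the chain
    agree with it there.\<close>
  define X where "X t = W (Suc t) ! t" for t
  have len: "i \<le> length (W i)" for i using W(1) by (simp add: good_def)
  have WX: "map X [0..<length (W i)] = W i" for i
  proof (rule nth_equalityI)
    fix t assume t: "t < length (map X [0..<length (W i)])"
    have "W (Suc t) ! t = W i ! t"
    proof (cases "Suc t \<le> i")
      case True
      then obtain v where "W i = W (Suc t) @ v" using pre by blast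
      then show ?thesis using len[of "Suc t"] by (simp add: nth_append)
    next
      case False
      then obtain v where "W (Suc t) = W i @ v" using pre by (metis nat_le_linear)
      then show ?thesis using t by (simp add: nth_append)
    qed
    then show "map X [0..<length (W i)] ! t = W i ! t" using t by (simp add: X_def)
  qed simp
  have "admissible k (fp m (W i))" for i using S_Lambda W(1) by (auto simp: good_def Lambda_from_def Lambda_def)
  then have "c \<in> {1..k (m + n)}" if "X n = LG c" for n c
    using that len[of "Suc n"] unfolding admissible_fp X_def by (metis Suc_le_eq)
  moreover have "1 \<le> m" using S_Lambda[OF vS] by (simp add: Lambda_from_def vertex_Lambda)
  ultimately have x: "ip m X \<in> ipaths_from k m"
    by (simp add: ipaths_from_def ipaths_def iadmissible_ip)
  have "ceq q (xs q) (ip m X)" for q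
    unfolding ceq_def
  proof (intro allI impI)
    fix \<kappa> assume T: "Tpath q \<kappa>"
    have up: "divs \<kappa> (xs q) \<longleftrightarrow> divs \<kappa> (xs q')" if "q \<le> q'" for q'
      using coh[OF that] T by (simp add: ceq_def)
    show "divs \<kappa> (xs q) = divs \<kappa> (ip m X)"
    proof
      assume "divs \<kappa> (xs q)"
      then have "\<kappa> \<in> S" using up[of "max q (plen \<kappa>)"] S_iff[of \<kappa> "max q (plen \<kappa>)"] by simp
      then have "extends \<kappa> (fp m (W (plen \<kappa>)))" using W(1)[of "plen \<kappa>"] by (simp add: good_def)
      then show "divs \<kappa> (ip m X)" using extends_divs divs_upt WX by metis
    next
      assume "divs \<kappa> (ip m X)"
      then obtain n where n: "\<And>n'. n \<le> n' \<Longrightarrow> \<exists>\<nu>. fp m (map X [0..<n']) = \<kappa> \<Zcomp> \<nu> \<and> prange \<nu> = psource \<kappa>"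
        using divs_finite_prefix by blast
      have e: "extends \<kappa> (fp m (W n))" using n[OF len[of n]] by (simp add: WX extends_def)
      let ?q = "max q (plen (fp m (W n)))"
      have "fp m (W n) \<in> S" using W(1) by (simp add: good_def)
      then have "divs (fp m (W n)) (xs ?q)" using S_iff[of "fp m (W n)" ?q] by simp
      then show "divs \<kappa> (xs q)" using up[of ?q] extends_divs[OF e] by simp
    qed
  qed
  then show ?thesis using that x by blast
qed

text \<open>Compactness in the form of a Lebesgue number, by a Koenig argument: if no level were
  uniform, finiteness of the cells would give a nested sequence of bad cells, and its limit point
  would contradict the local hypothesis.\<close>

lemma cls_Lebesgue:
  assumes m: "1 \<le> m" and P: "\<And>x. x \<in> ipaths_from k m \<Longrightarrow> \<exists>q. P (cls k q x)"
    and mono: "\<And>A B. P B \<Longrightarrow> A \<subseteq> B \<Longrightarrow> P A"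
  shows "\<exists>q. \<forall>x\<in>ipaths_from k m. P (cls k q x)"
proof (rule ccontr)
  assume neg: "\<not> ?thesis"
  \<comment> \<open>The cell of x at level q cannot be handled by any uniform finer level.\<close>
  define bad where "bad q x \<longleftrightarrow> x \<in> ipaths_from k m \<and> (\<forall>q'\<ge>q. \<exists>y\<in>cls k q x. \<not> P (cls k q' y))" for q x
  have cls0: "cls k 0 x = ipaths_from k m" if x: "x \<in> ipaths_from k m" for x
  proof -
    have "cls k 0 x \<in> Q_part k m (-1)" using cls_Q_part'[OF x m, of 0] by simp
    then have "cls k 0 x = cyl k (vertex m)" by (simp add: Q_part_def)
    then show ?thesis using cyl_vertex[OF m] by simp
  qed
  have "\<exists>xs. \<forall>q. bad q (xs q) \<and> xs (Suc q) \<in> cls k q (xs q)"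
  proof (rule dependent_nat_choice)
    obtain x where x: "x \<in> ipaths_from k m" using neg by blast
    have "\<exists>y\<in>cls k 0 x. \<not> P (cls k q' y)" for q' using neg cls0[OF x] by blast
    then show "\<exists>x. bad 0 x" using x unfolding bad_def by blast
  next
    fix x q assume b: "bad q x"
    have sub: "cls k q x \<subseteq> ipaths_from k m" using b cls_ipaths_from unfolding bad_def by blast
    show "\<exists>y. bad (Suc q) y \<and> y \<in> cls k q x"
    proof (rule ccontr)
      assume none: "\<not> ?thesis"
      let ?C = "cls k (Suc q) ` cls k q x"
      have finC: "finite ?C" using finite_subset[OF image_mono[OF sub] finite_cells[OF m]] .
      have "\<exists>q'. \<forall>z\<in>C. P (cls k q' z)" if "C \<in> ?C" for C
      proof -
        obtain y where y: "y \<in> cls k q x" "C = cls k (Suc q) y" using \<open>C \<in> ?C\<close> by blast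
        have "\<not> bad (Suc q) y" using none y(1) by blast
        then show ?thesis using y sub unfolding bad_def by blast
      qed
      then have "\<exists>g. \<forall>C\<in>?C. \<forall>z\<in>C. P (cls k (g C) z)" by (intro bchoice) blast
      then obtain g where g: "\<And>C z. C \<in> ?C \<Longrightarrow> z \<in> C \<Longrightarrow> P (cls k (g C) z)" by blast
      \<comment> \<open>If no child cell were bad, the maximum of the finitely many levels of the
        children would be uniform for the parent.\<close>
      define M where "M = Max (insert q (g ` ?C))"
      have "q \<le> M" unfolding M_def using finC by (intro Max_ge) auto
      then obtain y where y: "y \<in> cls k q x" "\<not> P (cls k M y)" using b unfolding bad_def by blast
      let ?C1 = "cls k (Suc q) y"
      have "g ?C1 \<le> M" unfolding M_def using finC y by (intro Max_ge) auto
      moreover have "y \<in> ?C1" using y sub by (intro mem_cls) (auto simp: ipaths_from_def)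
      ultimately have "P (cls k M y)" using g[of ?C1 y] y(1) cls_mono mono by blast
      then show False using y by blast
    qed
  qed
  then obtain xs where xs: "\<And>q. bad q (xs q)" "\<And>q. xs (Suc q) \<in> cls k q (xs q)" by blast
  have coh: "ceq q (xs q) (xs q')" if "q \<le> q'" for q q'
    using that
  proof (induction q' rule: dec_induct)
    case (step n)
    have "ceq n (xs n) (xs (Suc n))" using xs(2)[of n] by (simp add: cls_def)
    then show ?case using step ceq_mono ceq_trans by blast
  qed simp
  have "xs q \<in> ipaths_from k m" for q using xs(1) by (simp add: bad_def)
  then obtain x where x: "x \<in> ipaths_from k m" "\<And>q. ceq q (xs q) x" using ipaths_complete coh by metis
  obtain q where q: "P (cls k q x)" using P[OF x(1)] by blast
  have "x \<in> cls k q (xs q)" using x by (simp add: cls_def ipaths_from_def)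
  then have e: "cls k q x = cls k q (xs q)" by (rule cls_eq)
  obtain y where y: "y \<in> cls k q (xs q)" "\<not> P (cls k q y)" using xs(1)[of q] unfolding bad_def by blast
  then show False using cls_eq[OF y(1)] e q by simp
qed

section \<open>The topology of the path space\<close>

text \<open>The block contributes i + j, at most twice its maximum, and the \<gamma>-edge adds one.
  Thus only finitely many admissible test paths over a vertex exist at a given level.\<close>

lemma Tpath_plen_le: "Tpath q \<kappa> \<Longrightarrow> plen \<kappa> \<le> 2 * q + 1"
  by (auto simp: Tpath_def Tw_def max_def split: if_splits)

lemma openin_cyl: "\<mu> \<in> Lambda k \<Longrightarrow> openin (ipath_top k) (cyl k \<mu>)"
  unfolding ipath_top_def by (rule topology_generated_by_Basis) (auto intro!: exI[of _ \<mu>] exI[of _ "{}"])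

lemma openin_cyl_Diff: "\<mu> \<in> Lambda k \<Longrightarrow> \<nu> \<in> Lambda k \<Longrightarrow> openin (ipath_top k) (cyl k \<mu> - cyl k \<nu>)"
  unfolding ipath_top_def by (rule topology_generated_by_Basis) (auto intro!: exI[of _ \<mu>] exI[of _ "{\<nu>}"])

lemma ipaths_irange: "x \<in> ipaths k \<Longrightarrow> 1 \<le> irange x"
  by (cases x) (simp add: ipaths_def iadmissible_ip)

text \<open>Only admissible test paths can divide an admissible infinite path; there are finitely
  many of them, and each imposes an open condition, a cylinder or the complement of one.\<close>

lemma openin_cls:
  assumes x: "x \<in> ipaths k"
  shows "openin (ipath_top k) (cls k q x)"
proof -
  let ?m = "irange x"
  let ?T = "{\<kappa> \<in> Lambda_from k ?m. Tpath q \<kappa>}"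
  have m: "1 \<le> ?m" using ipaths_irange[OF x] .
  have "finite ?T"
    by (rule finite_subset[OF _ finite_Lambda_from_le[of k ?m "2 * q + 1"]]) (auto dest: Tpath_plen_le)
  have eq: "cls k q x = cyl k (vertex ?m) \<inter> {y \<in> cyl k (vertex ?m). \<forall>\<kappa>\<in>?T. divs \<kappa> x = divs \<kappa> y}"
  proof (intro equalityI subsetI)
    fix y assume "y \<in> cls k q x"
    then show "y \<in> cyl k (vertex ?m) \<inter> {y \<in> cyl k (vertex ?m). \<forall>\<kappa>\<in>?T. divs \<kappa> x = divs \<kappa> y}"
      using m ceq_irange by (auto simp: cls_def cyl_iff vertex_Lambda divs_vertex ceq_def)
  next
    fix y assume y: "y \<in> cyl k (vertex ?m) \<inter> {y \<in> cyl k (vertex ?m). \<forall>\<kappa>\<in>?T. divs \<kappa> x = divs \<kappa> y}"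
    then have y': "y \<in> ipaths k" "irange y = ?m" using m by (auto simp: cyl_iff vertex_Lambda divs_vertex)
    have "divs \<kappa> x = divs \<kappa> y" if T: "Tpath q \<kappa>" for \<kappa>
    proof (cases "\<kappa> \<in> Lambda_from k ?m")
      case True
      then show ?thesis using y T by blast
    next
      case False
      have "\<not> divs \<kappa> z" if "z \<in> ipaths k" "irange z = ?m" for z
        using that False divs_Lambda divs_irange unfolding Lambda_from_def by auto
      then show ?thesis using x y' by blast
    qed
    then show "y \<in> cls k q x" using y' by (simp add: cls_def ceq_def)
  qed
  have "openin (ipath_top k) {y \<in> cyl k (vertex ?m). \<forall>\<kappa>\<in>T. divs \<kappa> x = divs \<kappa> y}"
    if "finite T" "T \<subseteq> ?T" for T
    using that
  proof (induction T rule: finite_induct)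
    case empty
    then show ?case using openin_cyl m by (simp add: vertex_Lambda)
  next
    case (insert \<kappa> T)
    have L: "\<kappa> \<in> Lambda k" "vertex ?m \<in> Lambda k" using insert.prems m by (auto simp: Lambda_from_def vertex_Lambda)
    have o: "openin (ipath_top k) {y \<in> cyl k (vertex ?m). divs \<kappa> x = divs \<kappa> y}"
    proof (cases "divs \<kappa> x")
      case True
      have "{y \<in> cyl k (vertex ?m). divs \<kappa> x = divs \<kappa> y} = cyl k (vertex ?m) \<inter> cyl k \<kappa>"
        using True L by (auto simp: cyl_iff)
      then show ?thesis using L openin_cyl by (metis openin_Int)
    next
      case False
      have "{y \<in> cyl k (vertex ?m). divs \<kappa> x = divs \<kappa> y} = cyl k (vertex ?m) - cyl k \<kappa>"
        using False L by (auto simp: cyl_iff)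
      then show ?thesis using L openin_cyl_Diff by metis
    qed
    have "{y \<in> cyl k (vertex ?m). \<forall>\<kappa>\<in>insert \<kappa> T. divs \<kappa> x = divs \<kappa> y} =
      {y \<in> cyl k (vertex ?m). divs \<kappa> x = divs \<kappa> y} \<inter> {y \<in> cyl k (vertex ?m). \<forall>\<kappa>\<in>T. divs \<kappa> x = divs \<kappa> y}" by auto
    then show ?case using o insert by (metis (no_types, lifting) insert_subset openin_Int)
  qed
  from this[OF \<open>finite ?T\<close> order_refl] show ?thesis
    unfolding eq using m openin_cyl by (intro openin_Int) (auto simp: vertex_Lambda)
qed

text \<open>The cells form a base: a basic set is saturated at the level given by the longest path
  in its description.\<close>

lemma openin_ipath_top_iff:
  "openin (ipath_top k) U \<longleftrightarrow> U \<subseteq> ipaths k \<and> (\<forall>x\<in>U. \<exists>q. cls k q x \<subseteq> U)"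
proof
  assume "openin (ipath_top k) U"
  then have "generate_topology_on {cyl k \<mu> - (\<Union>\<nu>\<in>N. cyl k \<nu>) | \<mu> N. \<mu> \<in> Lambda k \<and> finite N \<and> N \<subseteq> Lambda k} U"
    unfolding ipath_top_def openin_topology_generated_by_iff .
  then show "U \<subseteq> ipaths k \<and> (\<forall>x\<in>U. \<exists>q. cls k q x \<subseteq> U)"
  proof (induction rule: generate_topology_on.induct)
    case (Int a b)
    have "\<exists>q. cls k q x \<subseteq> a \<inter> b" if "x \<in> a \<inter> b" for x
    proof -
      obtain q r where "cls k q x \<subseteq> a" "cls k r x \<subseteq> b" using Int.IH \<open>x \<in> a \<inter> b\<close> by blast
      then have "cls k (max q r) x \<subseteq> a \<inter> b" using cls_mono[of q "max q r" k x] cls_mono[of r "max q r" k x] by auto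
      then show ?thesis by blast
    qed
    then show ?case using Int.IH by blast
  next
    case (UN K)
    then show ?case by blast
  next
    case (Basis s)
    then obtain \<mu> N where s: "s = cyl k \<mu> - (\<Union>\<nu>\<in>N. cyl k \<nu>)" "\<mu> \<in> Lambda k" "finite N" "N \<subseteq> Lambda k" by blast
    have s_iff: "y \<in> s \<longleftrightarrow> y \<in> ipaths k \<and> divs \<mu> y \<and> (\<forall>\<nu>\<in>N. \<not> divs \<nu> y)" for y
      using s by (auto simp: cyl_iff subset_iff)
    define q where "q = Max (plen ` insert \<mu> N)"
    have q: "plen \<nu> \<le> q" if "\<nu> \<in> insert \<mu> N" for \<nu> unfolding q_def using s that by (intro Max_ge) auto
    have "cls k q x \<subseteq> s" if "x \<in> s" for x
    proof
      fix y assume "y \<in> cls k q x"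
      then have "y \<in> ipaths k" "divs \<nu> x \<longleftrightarrow> divs \<nu> y" if "\<nu> \<in> insert \<mu> N" for \<nu>
        using ceq_divs[OF _ q[OF that]] by (auto simp: cls_def)
      then show "y \<in> s" using \<open>x \<in> s\<close> unfolding s_iff by blast
    qed
    then show ?case using s_iff by blast
  qed auto
next
  assume U: "U \<subseteq> ipaths k \<and> (\<forall>x\<in>U. \<exists>q. cls k q x \<subseteq> U)"
  then obtain q where q: "\<And>x. x \<in> U \<Longrightarrow> cls k (q x) x \<subseteq> U" by metis
  have "U = (\<Union>x\<in>U. cls k (q x) x)" using q mem_cls U by blast
  moreover have "openin (ipath_top k) (\<Union>x\<in>U. cls k (q x) x)" using U openin_cls by (intro openin_Union) auto
  ultimately show "openin (ipath_top k) U" by simp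
qed

lemma topspace_ipath_top: "topspace (ipath_top k) = ipaths k"
proof
  show "topspace (ipath_top k) \<subseteq> ipaths k" using openin_ipath_top_iff[of k "topspace (ipath_top k)"] by simp
  have "openin (ipath_top k) (ipaths k)" unfolding openin_ipath_top_iff by (auto simp: cls_def)
  then show "ipaths k \<subseteq> topspace (ipath_top k)" by (rule openin_subset)
qed

text \<open>Unions of cells of one level. By \<open>compact_open_iff\<close> these are exactly the
  compact open sets over a vertex.\<close>

definition sat :: "(nat \<Rightarrow> nat) \<Rightarrow> nat \<Rightarrow> ipath set \<Rightarrow> bool" where
  "sat k q F \<longleftrightarrow> F \<subseteq> ipaths k \<and> (\<forall>x\<in>F. cls k q x \<subseteq> F)"

lemma satD: "sat k q F \<Longrightarrow> x \<in> F \<Longrightarrow> y \<in> ipaths k \<Longrightarrow> ceq q x y \<Longrightarrow> y \<in> F"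
  by (auto simp: sat_def cls_def)

lemma sat_cls: "sat k q (cls k q x)"
  unfolding sat_def by (auto simp: cls_def intro: ceq_trans)

lemma sat_ipaths_from: "sat k 0 (ipaths_from k m)"
  unfolding sat_def using cls_ipaths_from ipaths_from_sub by blast

text \<open>Formulated for the image under a map f into any space in order to serve both the path
  space, with f the identity, and the bisections of the groupoid, with f a germ map.\<close>

lemma compactin_of_cover:
  assumes m: "1 \<le> m" and F: "F \<subseteq> ipaths_from k m" "sat k q F"
    and f: "\<And>\<U>. (\<And>U. U \<in> \<U> \<Longrightarrow> openin T U) \<Longrightarrow> f ` F \<subseteq> \<Union>\<U> \<Longrightarrow> (\<And>x. x \<in> F \<Longrightarrow> \<exists>q. \<exists>U\<in>\<U>. f ` cls k q x \<subseteq> U)"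
    and top: "f ` F \<subseteq> topspace T"
  shows "compactin T (f ` F)"
  unfolding compactin_def
proof (intro conjI allI impI)
  fix \<U> assume \<U>: "(\<forall>U\<in>\<U>. openin T U) \<and> f ` F \<subseteq> \<Union>\<U>"
  let ?P = "\<lambda>E. E \<inter> F = {} \<or> (\<exists>U\<in>\<U>. f ` E \<subseteq> U)"
  have "\<exists>q. \<forall>x\<in>ipaths_from k m. ?P (cls k q x)"
  proof (rule cls_Lebesgue[OF m])
    fix x assume x: "x \<in> ipaths_from k m"
    show "\<exists>q. ?P (cls k q x)"
    proof (cases "x \<in> F")
      case True
      then show ?thesis using f \<U> by meson
    next
      case False
      have "cls k q x \<inter> F = {}"
        using False F(2) x cls_eq[of _ k q x] mem_cls[of x k q] unfolding sat_def ipaths_from_def by blast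
      then show ?thesis by blast
    qed
  qed blast
  then obtain q' where q': "\<And>x. x \<in> ipaths_from k m \<Longrightarrow> ?P (cls k q' x)" by blast
  have "\<exists>U\<in>\<U>. f ` C \<subseteq> U" if C: "C \<in> cls k q' ` F" for C
  proof -
    obtain x where x: "x \<in> F" "C = cls k q' x" using C by blast
    then have "x \<in> C" using F mem_cls[of x k q'] by (auto simp: ipaths_from_def)
    then show ?thesis using q'[of x] x F by blast
  qed
  then obtain h where h: "\<And>C. C \<in> cls k q' ` F \<Longrightarrow> h C \<in> \<U> \<and> f ` C \<subseteq> h C" by metis
  have "finite (h ` cls k q' ` F)"
    using finite_subset[OF image_mono[OF F(1)] finite_cells[OF m]] by blast
  moreover have "f ` F \<subseteq> \<Union>(h ` cls k q' ` F)"
  proof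
    fix y assume "y \<in> f ` F"
    then obtain x where x: "x \<in> F" "y = f x" by blast
    then have "y \<in> f ` cls k q' x" using F mem_cls[of x k q'] by (auto simp: ipaths_from_def)
    then show "y \<in> \<Union>(h ` cls k q' ` F)" using h x by blast
  qed
  ultimately show "\<exists>\<F>. finite \<F> \<and> \<F> \<subseteq> \<U> \<and> f ` F \<subseteq> \<Union>\<F>" using h by (intro exI[of _ "h ` cls k q' ` F"]) blast
qed (rule top)

text \<open>Openness gives a level at every point; finitely many of the resulting cells cover, and
  the maximum of their levels works throughout F.\<close>

lemma compact_open_iff:
  assumes m: "1 \<le> m" and F: "F \<subseteq> ipaths_from k m"
  shows "compact_open k F \<longleftrightarrow> (\<exists>q. sat k q F)"
proof
  assume co: "compact_open k F"
  let ?\<U> = "{C. \<exists>x\<in>F. \<exists>q. C = cls k q x \<and> C \<subseteq> F}"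
  have "F \<subseteq> \<Union>?\<U>"
  proof
    fix x assume x: "x \<in> F"
    obtain q where "cls k q x \<subseteq> F" using co x unfolding compact_open_def openin_ipath_top_iff by blast
    then show "x \<in> \<Union>?\<U>" using x mem_cls[of x k q] F by (auto simp: ipaths_from_def)
  qed
  moreover have "openin (ipath_top k) U" if "U \<in> ?\<U>" for U
    using that F openin_cls by (auto simp: ipaths_from_def)
  ultimately obtain \<F> where \<F>: "finite \<F>" "\<F> \<subseteq> ?\<U>" "F \<subseteq> \<Union>\<F>"
    using co unfolding compact_open_def compactin_def by (metis (no_types, lifting))
  have "\<exists>x q. C = cls k q x" if "C \<in> \<F>" for C using \<F>(2) that by blast
  then obtain xx qq where xq: "\<And>C. C \<in> \<F> \<Longrightarrow> C = cls k (qq C) (xx C)" by metis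
  define q where "q = Max (insert 0 (qq ` \<F>))"
  have "cls k q y \<subseteq> F" if y: "y \<in> F" for y
  proof -
    obtain C where C: "C \<in> \<F>" "y \<in> C" using \<F> y by blast
    have "qq C \<le> q" unfolding q_def using \<F> C by (intro Max_ge) auto
    then have "cls k q y \<subseteq> cls k (qq C) y" by (rule cls_mono)
    also have "\<dots> = C" using xq[OF C(1)] C(2) cls_eq by metis
    also have "\<dots> \<subseteq> F" using \<F> C by blast
    finally show ?thesis .
  qed
  then show "\<exists>q. sat k q F" using F by (auto simp: sat_def ipaths_from_def)
next
  assume "\<exists>q. sat k q F"
  then obtain q where q: "sat k q F" by blast
  have "openin (ipath_top k) F" unfolding openin_ipath_top_iff using q unfolding sat_def by blast
  moreover have "compactin (ipath_top k) (id ` F)"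
  proof (rule compactin_of_cover[OF m F q])
    fix \<U> x assume "\<And>U. U \<in> \<U> \<Longrightarrow> openin (ipath_top k) U" "id ` F \<subseteq> \<Union>\<U>" "x \<in> F"
    then obtain U where "U \<in> \<U>" "x \<in> U" "openin (ipath_top k) U" by auto
    then obtain q where "cls k q x \<subseteq> U" unfolding openin_ipath_top_iff by blast
    then show "\<exists>q. \<exists>U\<in>\<U>. id ` cls k q x \<subseteq> U" using \<open>U \<in> \<U>\<close> by (intro exI[of _ q] bexI[of _ U]) auto
  qed (use F topspace_ipath_top in \<open>auto simp: ipaths_from_def\<close>)
  ultimately show "compact_open k F" by (simp add: compact_open_def)
qed


section \<open>Germs\<close>

text \<open>A direct description of the generated equivalence: two triples are identified iff they
  refine to the same triple.\<close>

definition common_germ :: "fpath \<times> fpath \<times> ipath \<Rightarrow> fpath \<times> fpath \<times> ipath \<Rightarrow> bool" where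
  "common_germ t t' \<longleftrightarrow> (case t of (\<mu>, \<nu>, x) \<Rightarrow> case t' of (\<mu>', \<nu>', x') \<Rightarrow>
    (\<exists>\<sigma> \<sigma>' z. \<mu> \<Zcomp> \<sigma> = \<mu>' \<Zcomp> \<sigma>' \<and> \<nu> \<Zcomp> \<sigma> = \<nu>' \<Zcomp> \<sigma>' \<and> x = \<sigma> \<odot> z \<and> x' = \<sigma>' \<odot> z \<and>
      prange \<sigma> = psource \<mu> \<and> prange \<sigma> = psource \<nu> \<and> prange \<sigma>' = psource \<mu>' \<and> prange \<sigma>' = psource \<nu>' \<and>
      psource \<sigma> = irange z \<and> psource \<sigma>' = irange z))"

lemma common_germI:
  assumes "\<mu> \<Zcomp> \<sigma> = \<mu>' \<Zcomp> \<sigma>'" "\<nu> \<Zcomp> \<sigma> = \<nu>' \<Zcomp> \<sigma>'" "x = \<sigma> \<odot> z" "x' = \<sigma>' \<odot> z"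
      "prange \<sigma> = psource \<mu>" "prange \<sigma> = psource \<nu>" "prange \<sigma>' = psource \<mu>'" "prange \<sigma>' = psource \<nu>'"
      "psource \<sigma> = irange z" "psource \<sigma>' = irange z"
  shows "common_germ (\<mu>, \<nu>, x) (\<mu>', \<nu>', x')"
  unfolding common_germ_def prod.case using assms by (intro exI[of _ \<sigma>] exI[of _ \<sigma>'] exI[of _ z] conjI)

lemma common_germ_sym: "common_germ t t' \<Longrightarrow> common_germ t' t"
proof -
  obtain \<mu> \<nu> x \<mu>' \<nu>' x' where t: "t = (\<mu>, \<nu>, x)" "t' = (\<mu>', \<nu>', x')" by (metis prod_cases3)
  assume "common_germ t t'"
  then obtain \<sigma> \<sigma>' z where "\<mu> \<Zcomp> \<sigma> = \<mu>' \<Zcomp> \<sigma>'" "\<nu> \<Zcomp> \<sigma> = \<nu>' \<Zcomp> \<sigma>'" "x = \<sigma> \<odot> z" "x' = \<sigma>' \<odot> z"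
      "prange \<sigma> = psource \<mu>" "prange \<sigma> = psource \<nu>" "prange \<sigma>' = psource \<mu>'" "prange \<sigma>' = psource \<nu>'"
      "psource \<sigma> = irange z" "psource \<sigma>' = irange z"
    unfolding common_germ_def t prod.case by blast
  then show ?thesis unfolding t by (intro common_germI[of \<mu>' \<sigma>' \<mu> \<sigma> \<nu>' \<nu> x' z x]) simp_all
qed

lemma common_germ_refl:
  "psource \<mu> = irange x \<Longrightarrow> psource \<nu> = irange x \<Longrightarrow> common_germ (\<mu>, \<nu>, x) (\<mu>, \<nu>, x)"
  by (intro common_germI[of \<mu> "vertex (irange x)" \<mu> "vertex (irange x)" \<nu> \<nu> x x x]) (simp_all add: vertex_icomp)

text \<open>The middle triple is refined in two ways, along \<sigma>1 and along \<rho>1. Both divide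
  the same infinite path, so \<open>common_extension\<close> yields a refinement of the two.\<close>

lemma common_germ_trans:
  assumes "common_germ t t1" "common_germ t1 t2" shows "common_germ t t2"
proof -
  obtain \<mu> \<nu> x \<mu>1 \<nu>1 x1 \<mu>2 \<nu>2 x2 where t: "t = (\<mu>, \<nu>, x)" "t1 = (\<mu>1, \<nu>1, x1)" "t2 = (\<mu>2, \<nu>2, x2)"
    by (metis prod_cases3)
  obtain \<sigma> \<sigma>1 z where 1: "\<mu> \<Zcomp> \<sigma> = \<mu>1 \<Zcomp> \<sigma>1" "\<nu> \<Zcomp> \<sigma> = \<nu>1 \<Zcomp> \<sigma>1" "x = \<sigma> \<odot> z" "x1 = \<sigma>1 \<odot> z"
      "prange \<sigma> = psource \<mu>" "prange \<sigma> = psource \<nu>" "prange \<sigma>1 = psource \<mu>1" "prange \<sigma>1 = psource \<nu>1"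
      "psource \<sigma> = irange z" "psource \<sigma>1 = irange z"
    using assms(1) unfolding common_germ_def t by auto
  obtain \<rho>1 \<rho>2 y where 2: "\<mu>1 \<Zcomp> \<rho>1 = \<mu>2 \<Zcomp> \<rho>2" "\<nu>1 \<Zcomp> \<rho>1 = \<nu>2 \<Zcomp> \<rho>2" "x1 = \<rho>1 \<odot> y" "x2 = \<rho>2 \<odot> y"
      "prange \<rho>1 = psource \<mu>1" "prange \<rho>1 = psource \<nu>1" "prange \<rho>2 = psource \<mu>2" "prange \<rho>2 = psource \<nu>2"
      "psource \<rho>1 = irange y" "psource \<rho>2 = irange y"
    using assms(2) unfolding common_germ_def t by auto
  obtain \<kappa> \<kappa>' w where 3: "\<sigma>1 \<Zcomp> \<kappa> = \<rho>1 \<Zcomp> \<kappa>'" "z = \<kappa> \<odot> w" "y = \<kappa>' \<odot> w"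
    "prange \<kappa> = psource \<sigma>1" "prange \<kappa>' = psource \<rho>1" "psource \<kappa> = irange w" "psource \<kappa>' = irange w"
    using common_extension[of \<sigma>1 z \<rho>1 y] 1 2 by metis
  have "(\<mu> \<Zcomp> \<sigma>) \<Zcomp> \<kappa> = (\<mu>2 \<Zcomp> \<rho>2) \<Zcomp> \<kappa>'"
    unfolding 1(1) 2(1)[symmetric] pcomp_assoc 3(1) ..
  moreover have "(\<nu> \<Zcomp> \<sigma>) \<Zcomp> \<kappa> = (\<nu>2 \<Zcomp> \<rho>2) \<Zcomp> \<kappa>'"
    unfolding 1(2) 2(2)[symmetric] pcomp_assoc 3(1) ..
  moreover have "irange z = prange \<kappa>" "irange y = prange \<kappa>'" unfolding 3(2,3) by simp_all
  then have "psource (\<sigma> \<Zcomp> \<kappa>) = irange w" "psource (\<rho>2 \<Zcomp> \<kappa>') = irange w"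
    using 1(9) 2(10) 3(6,7) by simp_all
  moreover have "x = (\<sigma> \<Zcomp> \<kappa>) \<odot> w" "x2 = (\<rho>2 \<Zcomp> \<kappa>') \<odot> w"
    unfolding icomp_pcomp 1(3) 2(4) 3(2,3)[symmetric] by simp_all
  ultimately show ?thesis unfolding t pcomp_assoc
    using 1(5,6) 2(7,8) by (intro common_germI[of \<mu> "\<sigma> \<Zcomp> \<kappa>" \<mu>2 "\<rho>2 \<Zcomp> \<kappa>'" \<nu> \<nu>2 x w x2]) simp_all
qed

lemma germ_step_common: "germ_step t t' \<Longrightarrow> common_germ t t'"
proof -
  assume "germ_step t t'"
  then obtain \<mu> \<nu> \<epsilon> x where s: "psource \<mu> = prange \<epsilon>" "psource \<nu> = prange \<epsilon>" "psource \<epsilon> = irange x"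
    and t: "t = (\<mu>, \<nu>, \<epsilon> \<odot> x)" "t' = (\<mu> \<Zcomp> \<epsilon>, \<nu> \<Zcomp> \<epsilon>, x)"
    unfolding germ_step_def by blast
  show ?thesis unfolding t
    using s by (intro common_germI[of \<mu> \<epsilon> "\<mu> \<Zcomp> \<epsilon>" "vertex (irange x)" \<nu> "\<nu> \<Zcomp> \<epsilon>" _ x]) (simp_all add: vertex_icomp)
qed

lemma germ_pcomp:
  "psource \<mu> = prange \<epsilon> \<Longrightarrow> psource \<nu> = prange \<epsilon> \<Longrightarrow> psource \<epsilon> = irange x \<Longrightarrow>
    germ (\<mu> \<Zcomp> \<epsilon>) (\<nu> \<Zcomp> \<epsilon>) x = germ \<mu> \<nu> (\<epsilon> \<odot> x)"
  unfolding germ_eq_iff by (rule equivclp_sym, rule r_into_equivclp) (auto simp: germ_step_def)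

text \<open>Composability provides reflexivity of \<open>common_germ\<close>, the base case of the
  induction; the quotient type contains other triples as well.\<close>

lemma germ_eq_common:
  assumes "psource \<mu> = irange x" "psource \<nu> = irange x"
  shows "germ \<mu> \<nu> x = germ \<mu>' \<nu>' x' \<longleftrightarrow> common_germ (\<mu>, \<nu>, x) (\<mu>', \<nu>', x')"
proof
  assume "germ \<mu> \<nu> x = germ \<mu>' \<nu>' x'"
  then have "equivclp germ_step (\<mu>, \<nu>, x) (\<mu>', \<nu>', x')" by (simp add: germ_eq_iff)
  then show "common_germ (\<mu>, \<nu>, x) (\<mu>', \<nu>', x')"
  proof (induction rule: equivclp_induct)
    case base
    then show ?case using common_germ_refl assms by blast
  next
    case (step y z)
    then show ?case using germ_step_common common_germ_sym common_germ_trans by blast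
  qed
next
  assume "common_germ (\<mu>, \<nu>, x) (\<mu>', \<nu>', x')"
  then show "germ \<mu> \<nu> x = germ \<mu>' \<nu>' x'"
    unfolding common_germ_def prod.case using germ_pcomp by (elim exE conjE) metis
qed

lemma germ_eqE:
  assumes "germ \<mu> \<nu> x = germ \<mu>' \<nu>' x'" "psource \<mu> = irange x" "psource \<nu> = irange x"
  obtains \<sigma> \<sigma>' z where "\<mu> \<Zcomp> \<sigma> = \<mu>' \<Zcomp> \<sigma>'" "\<nu> \<Zcomp> \<sigma> = \<nu>' \<Zcomp> \<sigma>'" "x = \<sigma> \<odot> z" "x' = \<sigma>' \<odot> z"
      "prange \<sigma> = psource \<mu>" "prange \<sigma> = psource \<nu>" "prange \<sigma>' = psource \<mu>'" "prange \<sigma>' = psource \<nu>'"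
      "psource \<sigma> = irange z" "psource \<sigma>' = irange z"
  using assms germ_eq_common[OF assms(2,3)] unfolding common_germ_def prod.case by blast


section \<open>Reduced pairs\<close>

definition redw :: "letter list \<Rightarrow> letter list \<Rightarrow> bool" where
  "redw d e \<longleftrightarrow> \<not> (\<exists>d' e' s. s \<noteq> [] \<and> feq d (d' @ s) \<and> feq e (e' @ s))"

text \<open>Absence of a common suffix among all paths, admissible or not; on
  \<open>Lambda k\<close> this agrees with \<open>common_suffix\<close>, see
  \<open>common_suffix_red\<close>.\<close>

definition red :: "fpath \<Rightarrow> fpath \<Rightarrow> bool" where
  "red \<delta> \<epsilon> \<longleftrightarrow> \<not> (\<exists>\<delta>' \<epsilon>' \<sigma>. \<delta> = \<delta>' \<Zcomp> \<sigma> \<and> \<epsilon> = \<epsilon>' \<Zcomp> \<sigma> \<and> prange \<sigma> = psource \<delta>' \<and> prange \<sigma> = psource \<epsilon>' \<and> 0 < plen \<sigma>)"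

lemma red_fp: "i + length d = j + length e \<Longrightarrow> red (fp i d) (fp j e) \<longleftrightarrow> redw d e"
proof
  assume len: "i + length d = j + length e" and r: "red (fp i d) (fp j e)"
  show "redw d e"
    unfolding redw_def
  proof clarify
    fix d' e' s assume s: "s \<noteq> []" "feq d (d' @ s)" "feq e (e' @ s)"
    have "i + length d' = j + length e'" using len feq_length[OF s(2)] feq_length[OF s(3)] by simp
    then have "fp i d = fp i d' \<Zcomp> fp (i + length d') s" "fp j e = fp j e' \<Zcomp> fp (i + length d') s"
      "prange (fp (i + length d') s) = psource (fp i d')" "prange (fp (i + length d') s) = psource (fp j e')"
      "0 < plen (fp (i + length d') s)"
      using s by (auto simp: fp_eq_iff)
    then show False using r unfolding red_def by blast
  qed
next
  assume r: "redw d e"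
  show "red (fp i d) (fp j e)"
    unfolding red_def
  proof clarify
    fix \<delta>' \<epsilon>' \<sigma> assume *: "fp i d = \<delta>' \<Zcomp> \<sigma>" "fp j e = \<epsilon>' \<Zcomp> \<sigma>" "0 < plen \<sigma>"
    obtain a d' b e' c s where "\<delta>' = fp a d'" "\<epsilon>' = fp b e'" "\<sigma> = fp c s" by (metis fp_cases)
    then have "s \<noteq> []" "feq d (d' @ s)" "feq e (e' @ s)" using * by (auto simp: fp_eq_iff)
    then show False using r unfolding redw_def by blast
  qed
qed

lemma red_sym: "red \<delta> \<epsilon> \<Longrightarrow> red \<epsilon> \<delta>"
  unfolding red_def by metis

lemma redw_exists: "\<exists>d0 e0 t. feq d (d0 @ t) \<and> feq e (e0 @ t) \<and> redw d0 e0"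
proof (induction "length d" arbitrary: d e rule: less_induct)
  case less
  show ?case
  proof (cases "redw d e")
    case True
    then show ?thesis by (intro exI[of _ d] exI[of _ e] exI[of _ "[]"]) simp
  next
    case False
    then obtain d' e' s where s: "s \<noteq> []" "feq d (d' @ s)" "feq e (e' @ s)" unfolding redw_def by blast
    then have "length d' < length d" using feq_length[OF s(2)] by simp
    then obtain d0 e0 t where t: "feq d' (d0 @ t)" "feq e' (e0 @ t)" "redw d0 e0" using less by blast
    have "feq d (d0 @ t @ s)" using s(2) feq_append[OF t(1) feq_refl[of s]] feq_trans by fastforce
    moreover have "feq e (e0 @ t @ s)" using s(3) feq_append[OF t(2) feq_refl[of s]] feq_trans by fastforce
    ultimately show ?thesis using t(3) by blast
  qed
qed

text \<open>Stripping common last edges is confluent.\<close>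

lemma redw_unique:
  assumes "feq (d @ s) (d' @ s')" "feq (e @ s) (e' @ s')" "redw d e" "redw d' e'"
  shows "feq d d' \<and> feq e e' \<and> feq s s'"
  using assms
proof (induction "length (d @ s)" arbitrary: d s d' s' e e' rule: less_induct)
  case less
  consider "s = []" | "s' = []" | "s \<noteq> []" "s' \<noteq> []" by blast
  then show ?case
  proof cases
    case 1
    then have "s' = []" using less.prems unfolding redw_def by auto
    then show ?thesis using 1 less.prems by simp
  next
    case 2
    then have "s = []" using less.prems feq_sym unfolding redw_def by (metis append_Nil2)
    then show ?thesis using 2 less.prems by simp
  next
    case 3
    obtain r a r' b where s: "s = r @ [a]" "s' = r' @ [b]" using 3 by (metis rev_exhaust)
    have short: "length (d @ r) < length (d @ s)" by (simp add: s)
    have len': "length (d' @ r') < length (d @ s)" using feq_length[OF less.prems(1)] by (simp add: s)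
    have ee: "feq ((d @ r) @ [a]) ((d' @ r') @ [b])" "feq ((e @ r) @ [a]) ((e' @ r') @ [b])"
      using less.prems s by simp_all
    have dd: "feq d d' \<and> feq e e'"
    proof (cases "a = b")
      case True
      then have "feq (d @ r) (d' @ r')" "feq (e @ r) (e' @ r')" using ee by (auto simp del: append_assoc)
      then show ?thesis using less.hyps[OF short] less.prems by blast
    next
      case False
      obtain z where z: "feq (d @ r) (z @ [b])" "feq (d' @ r') (z @ [a])" using feq_diamond_right[OF ee(1) False] .
      obtain y where y: "feq (e @ r) (y @ [b])" "feq (e' @ r') (y @ [a])" using feq_diamond_right[OF ee(2) False] .
      \<comment> \<open>A reduction of the pair left after both last letters have been removed is a
        common target for the two given reductions.\<close>
      obtain d0 e0 t where t: "feq z (d0 @ t)" "feq y (e0 @ t)" "redw d0 e0" using redw_exists by blast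
      have "feq (z @ [b]) (d0 @ t @ [b])" "feq (y @ [b]) (e0 @ t @ [b])"
        "feq (z @ [a]) (d0 @ t @ [a])" "feq (y @ [a]) (e0 @ t @ [a])"
        using feq_append[OF t(1) feq_refl] feq_append[OF t(2) feq_refl] by simp_all
      then have 1: "feq (d @ r) (d0 @ t @ [b])" "feq (e @ r) (e0 @ t @ [b])"
        and 2: "feq (d' @ r') (d0 @ t @ [a])" "feq (e' @ r') (e0 @ t @ [a])"
        using z y feq_trans by blast+
      have "feq d d0 \<and> feq e e0" using less.hyps[OF short 1 less.prems(3) t(3)] by blast
      moreover have "feq d' d0 \<and> feq e' e0" using less.hyps[OF len' 2 less.prems(4) t(3)] by blast
      ultimately show ?thesis using feq_sym feq_trans by blast
    qed
    then have "feq (d @ s) (d @ s')"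
      using less.prems(1) feq_append[OF _ feq_refl[of s'], of d' d] feq_sym feq_trans by blast
    then show ?thesis using dd by simp
  qed
qed

lemma red_unique:
  assumes "\<delta> \<Zcomp> \<sigma> = \<delta>' \<Zcomp> \<sigma>'" "\<epsilon> \<Zcomp> \<sigma> = \<epsilon>' \<Zcomp> \<sigma>'" "red \<delta> \<epsilon>" "red \<delta>' \<epsilon>'"
    "prange \<sigma> = psource \<delta>" "prange \<sigma> = psource \<epsilon>" "prange \<sigma>' = psource \<delta>'" "prange \<sigma>' = psource \<epsilon>'"
  shows "\<delta> = \<delta>' \<and> \<epsilon> = \<epsilon>' \<and> \<sigma> = \<sigma>'"
proof -
  obtain i d j e l s i' d' j' e' l' s' where w: "\<delta> = fp i d" "\<epsilon> = fp j e" "\<sigma> = fp l s" "\<delta>' = fp i' d'" "\<epsilon>' = fp j' e'" "\<sigma>' = fp l' s'"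
    by (metis fp_cases)
  have r: "redw d e" "redw d' e'" using assms red_fp by (simp_all add: w)
  have f: "feq (d @ s) (d' @ s')" "feq (e @ s) (e' @ s')" "i = i'" "j = j'" using assms by (simp_all add: w fp_eq_iff)
  have "feq d d' \<and> feq e e' \<and> feq s s'" using redw_unique[OF f(1,2) r] .
  then show ?thesis using f assms feq_length[of d d'] by (simp add: w fp_eq_iff)
qed

lemma red_exists:
  assumes "psource \<mu> = psource \<nu>"
  obtains \<delta> \<epsilon> \<sigma> where "\<mu> = \<delta> \<Zcomp> \<sigma>" "\<nu> = \<epsilon> \<Zcomp> \<sigma>" "red \<delta> \<epsilon>" "prange \<sigma> = psource \<delta>" "prange \<sigma> = psource \<epsilon>"
proof -
  obtain i d j e where w: "\<mu> = fp i d" "\<nu> = fp j e" by (metis fp_cases)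
  obtain d0 e0 t where t: "feq d (d0 @ t)" "feq e (e0 @ t)" "redw d0 e0" using redw_exists by blast
  have "i + length d0 = j + length e0" using assms feq_length[OF t(1)] feq_length[OF t(2)] by (simp add: w)
  then show ?thesis using t red_fp[of i d0 j e0]
    by (intro that[of "fp i d0" "fp (i + length d0) t" "fp j e0"]) (auto simp: w fp_eq_iff)
qed

text \<open>Equality of germs supplies a common refinement, and a pair has only one reduction.
  Together with \<open>red_exists\<close> this gives every composable germ a normal form, so the
  bisections of reduced pairs partition the groupoid.\<close>

lemma germ_reduced_unique:
  assumes "germ \<delta> \<epsilon> x = germ \<delta>' \<epsilon>' x'" "red \<delta> \<epsilon>" "red \<delta>' \<epsilon>'"
    "psource \<delta> = irange x" "psource \<epsilon> = irange x"
  shows "\<delta> = \<delta>' \<and> \<epsilon> = \<epsilon>' \<and> x = x'"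
proof -
  obtain \<sigma> \<sigma>' z where s: "\<delta> \<Zcomp> \<sigma> = \<delta>' \<Zcomp> \<sigma>'" "\<epsilon> \<Zcomp> \<sigma> = \<epsilon>' \<Zcomp> \<sigma>'" "x = \<sigma> \<odot> z" "x' = \<sigma>' \<odot> z"
      "prange \<sigma> = psource \<delta>" "prange \<sigma> = psource \<epsilon>" "prange \<sigma>' = psource \<delta>'" "prange \<sigma>' = psource \<epsilon>'"
    by (rule germ_eqE[OF assms(1,4,5)]) blast
  then show ?thesis using red_unique[OF s(1,2) assms(2,3) s(5-8)] by simp
qed

lemma red_germ_common:
  assumes "germ \<mu> \<nu> y = germ \<delta> \<epsilon> x" "psource \<mu> = irange y" "psource \<nu> = irange y" "red \<delta> \<epsilon>"
    "psource \<delta> = irange x" "psource \<epsilon> = irange x"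
  obtains \<sigma> where "\<mu> = \<delta> \<Zcomp> \<sigma>" "\<nu> = \<epsilon> \<Zcomp> \<sigma>" "x = \<sigma> \<odot> y" "prange \<sigma> = psource \<delta>" "psource \<sigma> = irange y"
proof -
  obtain \<delta>0 \<epsilon>0 \<sigma> where *: "\<mu> = \<delta>0 \<Zcomp> \<sigma>" "\<nu> = \<epsilon>0 \<Zcomp> \<sigma>" "red \<delta>0 \<epsilon>0" "prange \<sigma> = psource \<delta>0" "prange \<sigma> = psource \<epsilon>0"
    using red_exists[of \<mu> \<nu>] assms by metis
  have ps: "psource \<sigma> = irange y" using assms(2) * by simp
  have "germ \<mu> \<nu> y = germ \<delta>0 \<epsilon>0 (\<sigma> \<odot> y)" using * ps by (simp add: germ_pcomp)
  then have "germ \<delta>0 \<epsilon>0 (\<sigma> \<odot> y) = germ \<delta> \<epsilon> x" using assms(1) by simp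
  then have "\<delta>0 = \<delta> \<and> \<epsilon>0 = \<epsilon> \<and> \<sigma> \<odot> y = x" using * assms by (intro germ_reduced_unique) auto
  then show ?thesis using * that ps by auto
qed

section \<open>Positions of \<gamma>-edges and the index sets\<close>

definition isG :: "letter list \<Rightarrow> nat \<Rightarrow> bool" where
  "isG w t \<longleftrightarrow> t < length w \<and> (\<exists>c. w ! t = LG c)"

definition gat :: "fpath \<Rightarrow> nat \<Rightarrow> bool" where
  "gat \<mu> t \<longleftrightarrow> (\<exists>i w. \<mu> = fp i w \<and> isG w t)"

lemma feq_isG: "feq u v \<Longrightarrow> isG u t \<longleftrightarrow> isG v t"
  unfolding isG_def using feq_LG feq_length by metis

lemma gat_fp [simp]: "gat (fp i w) t \<longleftrightarrow> isG w t"
proof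
  show "isG w t" if "gat (fp i w) t" using that feq_isG by (auto simp: gat_def fp_eq_iff)
qed (auto simp: gat_def)

lemma isG_append: "isG (u @ v) t \<longleftrightarrow> isG u t \<or> length u \<le> t \<and> isG v (t - length u)"
  by (auto simp: isG_def nth_append)

lemma no_LG_isG: "(\<forall>c. LG c \<notin> set r) \<longleftrightarrow> (\<forall>t. \<not> isG r t)"
  unfolding isG_def in_set_conv_nth by blast

lemma isG_snoc: "isG (t @ [LG c]) (length t)"
  by (simp add: isG_def)

lemma last_block:
  obtains m r where "d = m @ r" "\<forall>c. LG c \<notin> set r" "m = [] \<or> (\<exists>t c. m = t @ [LG c])"
proof (cases "\<exists>l\<in>set d. \<exists>c. l = LG c")
  case True
  then obtain m l r where "d = m @ l # r" "\<exists>c. l = LG c" "\<forall>l\<in>set r. \<not> (\<exists>c. l = LG c)"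
    by (rule split_list_last_propE)
  then show ?thesis using that[of "m @ [l]" r] by auto
next
  case False
  then show ?thesis using that[of "[]" d] by auto
qed

text \<open>However the word is written, its last edge belongs to a non-empty last block: cutting at
  the \<gamma>-edge before r leaves r equivalent to a word that ends in c.\<close>

lemma last_letter_in_block:
  assumes "feq (m @ r) (d @ [c])" "\<And>c. LG c \<notin> set r" "m = [] \<or> (\<exists>t x. m = t @ [LG x])" "r \<noteq> []"
  shows "0 < count_list r c"
proof (cases "m = []")
  case True
  then show ?thesis using feq_count[of r "d @ [c]" c] assms(1) by simp
next
  case False
  then obtain t x where m: "m = t @ [LG x]" using assms(3) by blast
  then have "feq (t @ LG x # r) (d @ [c])" using assms(1) by simp
  then obtain v1 v2 where v: "d @ [c] = v1 @ LG x # v2" "feq r v2" by (rule feq_cut)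
  have "v2 \<noteq> []" using feq_length[OF v(2)] assms(4) by auto
  then have "c \<in> set v2" using v(1) by (metis last_appendR last_ConsR last_in_set last_snoc list.distinct(1))
  then have "0 < count_list v2 c" by (metis count_list_0_iff gr0I)
  then show ?thesis using feq_count[OF v(2)] by simp
qed

lemma block_ends_with:
  assumes "\<And>c. LG c \<notin> set r" "0 < count_list r e"
  obtains r' where "feq r (r' @ [e])"
proof -
  have e: "e = LA \<or> e = LB" using assms by (cases e) (auto simp: count_list_0_iff)
  let ?a = "count_list r LA" and ?b = "count_list r LB"
  have r: "feq r (abw ?a ?b)" by (rule feq_abw) (rule assms(1))
  from e show ?thesis
  proof
    assume e: "e = LA"
    have "feq (abw (?a - 1) ?b @ [LA]) (abw ?a ?b)"
      using feq_abw[of "abw (?a - 1) ?b @ [LA]"] assms(2) e by (cases ?a) (simp_all add: abw_def)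
    then show ?thesis using r feq_sym feq_trans that e by blast
  next
    assume e: "e = LB"
    have "abw ?a (?b - 1) @ [LB] = abw ?a ?b"
      using assms(2) e by (simp add: abw_def replicate_append_same flip: replicate_Suc)
    then show ?thesis using r that e by metis
  qed
qed

lemma common_suffix_red:
  assumes "\<delta> \<in> Lambda k" "\<epsilon> \<in> Lambda k"
  shows "red \<delta> \<epsilon> \<longleftrightarrow> \<not> (\<exists>\<sigma>. 0 < plen \<sigma> \<and> common_suffix k \<delta> \<epsilon> \<sigma>)"
proof
  show "\<not> (\<exists>\<sigma>. 0 < plen \<sigma> \<and> common_suffix k \<delta> \<epsilon> \<sigma>)" if "red \<delta> \<epsilon>"
    using that unfolding red_def common_suffix_def by metis
  assume n: "\<not> (\<exists>\<sigma>. 0 < plen \<sigma> \<and> common_suffix k \<delta> \<epsilon> \<sigma>)"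
  show "red \<delta> \<epsilon>"
    unfolding red_def
  proof clarify
    fix \<delta>' \<epsilon>' \<sigma> assume *: "\<delta> = \<delta>' \<Zcomp> \<sigma>" "\<epsilon> = \<epsilon>' \<Zcomp> \<sigma>" "prange \<sigma> = psource \<delta>'" "prange \<sigma> = psource \<epsilon>'" "0 < plen \<sigma>"
    then have "common_suffix k \<delta> \<epsilon> \<sigma>"
      using assms pcomp_Lambda_iff unfolding common_suffix_def by metis
    then show False using n *(5) by blast
  qed
qed

lemma Phi_word:
  assumes "\<mu> \<in> Phi k 1 p"
  obtains m where "\<mu> = fp 1 m" "m = [] \<or> (\<exists>t c. m = t @ [LG c])" "length m \<le> p" "\<mu> \<in> Lambda k"
  using assms by (cases rule: Phi_cases) (auto simp: vertex_fp vertex_Lambda[unfolded vertex_fp])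

text \<open>An intrinsic description: reduced pairs of length p_j + l whose last \<gamma>-edge, in
  either path, is the p_j-th edge, that is, the letter with index p_j - 1. For l > 0 both paths end
  in non-empty \<alpha>\<beta>-blocks, and a common suffix exists iff these blocks share a letter,
  so reducedness is orthogonality of the degrees.\<close>

lemma S_pairs_iff:
  "(\<delta>, \<epsilon>) \<in> S_pairs k j l \<longleftrightarrow> \<delta> \<in> Lambda_from k 1 \<and> \<epsilon> \<in> Lambda_from k 1 \<and>
     plen \<delta> = p_index k j + l \<and> plen \<epsilon> = p_index k j + l \<and> red \<delta> \<epsilon> \<and>
     (\<forall>t\<ge>p_index k j. \<not> gat \<delta> t \<and> \<not> gat \<epsilon> t) \<and>
     (p_index k j = 0 \<or> gat \<delta> (p_index k j - 1) \<or> gat \<epsilon> (p_index k j - 1))" (is "_ \<longleftrightarrow> ?R")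
proof -
  let ?p = "p_index k j"
  show ?thesis
  proof
    assume "(\<delta>, \<epsilon>) \<in> S_pairs k j l"
    then obtain \<mu> \<nu> \<rho> \<theta> where S: "\<delta> = \<mu> \<Zcomp> \<rho>" "\<epsilon> = \<nu> \<Zcomp> \<theta>" "(\<mu>, \<nu>) \<in> S0 k j" "\<rho> \<in> Lambda1 k" "\<theta> \<in> Lambda1 k"
      "psource \<mu> = prange \<rho>" "psource \<nu> = prange \<theta>" "plen \<delta> = ?p + l" "plen \<epsilon> = ?p + l"
      and cond: "if l = 0 then \<not> (\<exists>\<sigma>. 0 < plen \<sigma> \<and> common_suffix k \<delta> \<epsilon> \<sigma>) else degree_perp \<rho> \<theta>"
      unfolding S_pairs_def by blast
    obtain m where m: "\<mu> = fp 1 m" "m = [] \<or> (\<exists>t c. m = t @ [LG c])" "length m \<le> ?p" "\<mu> \<in> Lambda k"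
      using S(3) Phi_word unfolding S0_def by blast
    obtain n where n: "\<nu> = fp 1 n" "n = [] \<or> (\<exists>t c. n = t @ [LG c])" "length n \<le> ?p" "\<nu> \<in> Lambda k"
      using S(3) Phi_word unfolding S0_def by blast
    obtain a r b h where rh: "\<rho> = fp a r" "\<theta> = fp b h" by (metis fp_cases)
    have nor: "LG c \<notin> set r" "LG c \<notin> set h" for c
      using S(4,5) by (auto simp: Lambda1_def rh count_list_0_iff)
    have L: "\<delta> \<in> Lambda_from k 1" "\<epsilon> \<in> Lambda_from k 1"
      using S m n pcomp_Lambda_iff by (auto simp: Lambda_from_def Lambda1_def)
    have d: "\<delta> = fp 1 (m @ r)" "\<epsilon> = fp 1 (n @ h)" using S m n rh by simp_all
    have noG: "\<not> isG r t" "\<not> isG h t" for t using nor no_LG_isG by blast+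
    have g1: "\<not> gat \<delta> t \<and> \<not> gat \<epsilon> t" if "t \<ge> ?p" for t
    proof -
      have "\<not> isG m t" "\<not> isG n t" using that m(3) n(3) by (auto simp: isG_def)
      then show ?thesis using noG by (simp add: d isG_append)
    qed
    have g2: "?p = 0 \<or> gat \<delta> (?p - 1) \<or> gat \<epsilon> (?p - 1)"
    proof (cases "?p = 0")
      case False
      have "plen \<mu> = ?p \<or> plen \<nu> = ?p" using S(3) by (simp add: S0_def)
      then show ?thesis
      proof
        assume "plen \<mu> = ?p"
        then obtain t c where "m = t @ [LG c]" "length m = ?p" using False m by auto
        then have "isG m (?p - 1)" using isG_snoc[of t c] by (metis diff_Suc_1 length_append_singleton)
        then show ?thesis by (simp add: d isG_append)
      next
        assume "plen \<nu> = ?p"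
        then obtain t c where "n = t @ [LG c]" "length n = ?p" using False n by auto
        then have "isG n (?p - 1)" using isG_snoc[of t c] by (metis diff_Suc_1 length_append_singleton)
        then show ?thesis by (simp add: d isG_append)
      qed
    qed simp
    have "red \<delta> \<epsilon>"
    proof (cases "l = 0")
      case True
      then show ?thesis using cond common_suffix_red L by (auto simp: Lambda_from_def)
    next
      case False
      then have perp: "degree_perp \<rho> \<theta>" using cond by simp
      have "length m + length r = ?p + l" "length n + length h = ?p + l"
        using S(8,9) unfolding d by simp_all
      \<comment> \<open>The parts before the last blocks have length at most p_j, so positive l
        leaves room for both blocks.\<close>
      then have ne: "r \<noteq> []" "h \<noteq> []" using False m(3) n(3) by auto
      have "redw (m @ r) (n @ h)"
        unfolding redw_def
      proof clarify
        fix d' e' s assume s: "s \<noteq> []" "feq (m @ r) (d' @ s)" "feq (n @ h) (e' @ s)"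
        obtain s' c where s': "s = s' @ [c]" using s(1) by (metis rev_exhaust)
        have "0 < count_list r c" using last_letter_in_block[of m r "d' @ s'" c] s(2) s' nor m ne by simp
        moreover have "0 < count_list h c" using last_letter_in_block[of n h "e' @ s'" c] s(3) s' nor n ne by simp
        moreover have "c = LA \<or> c = LB" using calculation(1) nor(1) by (cases c) (auto simp: count_list_0_iff)
        ultimately show False using perp by (auto simp: degree_perp_def rh)
      qed
      moreover have "length m + length r = length n + length h"
        using S(8,9) unfolding d by simp
      ultimately show ?thesis unfolding d by (subst red_fp) simp_all
    qed
    then show ?R using L S g1 g2 by blast
  next
    assume R: ?R
    obtain d e where d: "\<delta> = fp 1 d" "\<epsilon> = fp 1 e" using R by (cases \<delta>; cases \<epsilon>) (auto simp: Lambda_from_def)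
    obtain m r where mr: "d = m @ r" "\<forall>c. LG c \<notin> set r" "m = [] \<or> (\<exists>t c. m = t @ [LG c])" by (rule last_block[of d])
    obtain n h where nh: "e = n @ h" "\<forall>c. LG c \<notin> set h" "n = [] \<or> (\<exists>t c. n = t @ [LG c])" by (rule last_block[of e])
    define \<mu> \<nu> \<rho> \<theta> where "\<mu> = fp 1 m" "\<nu> = fp 1 n" "\<rho> = fp (1 + length m) r" "\<theta> = fp (1 + length n) h"
    note defs = this
    have comp: "\<delta> = \<mu> \<Zcomp> \<rho>" "\<epsilon> = \<nu> \<Zcomp> \<theta>" "psource \<mu> = prange \<rho>" "psource \<nu> = prange \<theta>"
      by (simp_all add: d mr nh defs)
    have L: "\<mu> \<in> Lambda k" "\<rho> \<in> Lambda k" "\<nu> \<in> Lambda k" "\<theta> \<in> Lambda k"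
      using R comp pcomp_Lambda_iff unfolding Lambda_from_def by (metis (no_types, lifting) mem_Collect_eq)+
    have L1: "\<rho> \<in> Lambda1 k" "\<theta> \<in> Lambda1 k"
      using L mr(2) nh(2) by (auto simp: Lambda1_def defs count_list_0_iff)
    have lm: "length m \<le> ?p"
    proof (rule ccontr)
      assume n: "\<not> length m \<le> ?p"
      then obtain t c where t: "m = t @ [LG c]" using mr(3) by auto
      have "isG m (length t)" unfolding t by (rule isG_snoc)
      then have "isG d (length t)" unfolding mr(1) isG_append by blast
      then show False using R n t by (auto simp: d)
    qed
    have ln: "length n \<le> ?p"
    proof (rule ccontr)
      assume n': "\<not> length n \<le> ?p"
      then obtain t c where t: "n = t @ [LG c]" using nh(3) by auto
      have "isG n (length t)" unfolding t by (rule isG_snoc)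
      then have "isG e (length t)" unfolding nh(1) isG_append by blast
      then show False using R n' t by (auto simp: d)
    qed
    have Phi: "\<mu> \<in> Phi k 1 ?p" "\<nu> \<in> Phi k 1 ?p"
    proof -
      have "fp 1 u \<in> Phi k 1 ?p" if "u = [] \<or> (\<exists>t c. u = t @ [LG c])" "fp 1 u \<in> Lambda k" "length u \<le> ?p" for u
      proof (cases "u = []")
        case True
        then show ?thesis by (simp add: Phi_def vertex_fp)
      next
        case False
        then obtain t c where "u = t @ [LG c]" using \<open>u = [] \<or> _\<close> by blast
        then show ?thesis using Phi_gammaI[of 1 t c k ?p] that(2,3) by simp
      qed
      then show "\<mu> \<in> Phi k 1 ?p" "\<nu> \<in> Phi k 1 ?p" using mr(3) nh(3) L lm ln unfolding defs by blast+
    qed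
    have pp: "plen \<mu> = ?p \<or> plen \<nu> = ?p"
    proof (cases "?p = 0")
      case True
      then show ?thesis using lm by (simp add: defs)
    next
      case False
      have noG: "\<not> isG r t" "\<not> isG h t" for t using mr(2) nh(2) no_LG_isG by blast+
      have "isG d (?p - 1) \<or> isG e (?p - 1)" using R False by (auto simp: d)
      then have "isG m (?p - 1) \<or> isG n (?p - 1)" using noG by (auto simp: mr nh isG_append)
      then have "?p \<le> length m \<or> ?p \<le> length n" using False by (auto simp: isG_def)
      then show ?thesis using lm ln by (auto simp: defs)
    qed
    have cond: "if l = 0 then \<not> (\<exists>\<sigma>. 0 < plen \<sigma> \<and> common_suffix k (\<mu> \<Zcomp> \<rho>) (\<nu> \<Zcomp> \<theta>) \<sigma>) else degree_perp \<rho> \<theta>"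
    proof (cases "l = 0")
      case True
      then show ?thesis using R common_suffix_red[of \<delta> k \<epsilon>] comp by (auto simp: Lambda_from_def)
    next
      case False
      have rw: "redw d e" using R red_fp[of 1 d 1 e] d by simp
      have "count_list r c = 0 \<or> count_list h c = 0" for c
      proof (rule ccontr)
        assume "\<not> ?thesis"
        then have "0 < count_list r c" "0 < count_list h c" by auto
        then obtain r' h' where rh': "feq r (r' @ [c])" "feq h (h' @ [c])" using block_ends_with mr(2) nh(2) by metis
        then have "feq d ((m @ r') @ [c])" "feq e ((n @ h') @ [c])" by (simp_all add: mr nh)
        then show False using rw unfolding redw_def by blast
      qed
      from this[of LA] this[of LB] show ?thesis using False by (auto simp: degree_perp_def defs)
    qed
    have S0: "(\<mu>, \<nu>) \<in> S0 k j" using Phi pp by (simp add: S0_def)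
    have "plen \<delta> = ?p + l" "plen \<epsilon> = ?p + l" using R by blast+
    then have pl: "plen (\<mu> \<Zcomp> \<rho>) = ?p + l" "plen (\<nu> \<Zcomp> \<theta>) = ?p + l" unfolding comp(1,2) .
    show "(\<delta>, \<epsilon>) \<in> S_pairs k j l"
      unfolding S_pairs_def mem_Collect_eq
      by (intro exI[of _ \<mu>] exI[of _ \<nu>] exI[of _ \<rho>] exI[of _ \<theta>] conjI S0 L1 comp(3,4) pl cond)
        (simp only: comp(1,2))
  qed
qed

lemma S_pairs_sub: "(\<delta>, \<epsilon>) \<in> S_pairs k j l \<Longrightarrow>
    \<delta> \<in> Lambda_from k 1 \<and> \<epsilon> \<in> Lambda_from k 1 \<and> red \<delta> \<epsilon> \<and>
    psource \<delta> = p_index k j + l + 1 \<and> psource \<epsilon> = p_index k j + l + 1"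
  unfolding S_pairs_iff by (simp add: psource_def Lambda_from_def)

lemma finite_S_pairs: "finite (S_pairs k j l)"
proof -
  have "S_pairs k j l \<subseteq> {\<mu> \<in> Lambda_from k 1. plen \<mu> = p_index k j + l} \<times> {\<mu> \<in> Lambda_from k 1. plen \<mu> = p_index k j + l}"
    by (rule subrelI) (simp add: S_pairs_iff)
  then show ?thesis by (rule finite_subset) (intro finite_cartesian_product finite_Lambda_from)
qed

context
  fixes k :: "nat \<Rightarrow> nat"
  assumes inf: "infinite {i. 1 \<le> i \<and> k i \<noteq> 0}"
begin

lemma p_index_strict_mono: "i < j \<Longrightarrow> p_index k i < p_index k j"
proof -
  assume ij: "i < j"
  have in_set: "enumerate {i. 1 \<le> i \<and> k i \<noteq> 0} n \<in> {i. 1 \<le> i \<and> k i \<noteq> 0}" for n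
    using inf by (rule enumerate_in_set)
  show ?thesis
  proof (cases "i = 0")
    case True
    then show ?thesis using ij in_set[of "j - 1"] by (simp add: p_index_def)
  next
    case False
    then show ?thesis using ij enumerate_mono[of "i - 1" "j - 1"] inf by (simp add: p_index_def)
  qed
qed

text \<open>Gaps of at least one: a gain in j is always paid for by at least as large a gain in
  p_j.\<close>

lemma p_index_diff: "i \<le> j \<Longrightarrow> p_index k i + (j - i) \<le> p_index k j"
proof (induction j rule: dec_induct)
  case (step j)
  then show ?case using p_index_strict_mono[of j "Suc j"] by simp
qed simp

lemma p_index_ge: "j \<le> p_index k j"
  using p_index_diff[of 0 j] by (simp add: p_index_def)

lemma p_index_inj: "p_index k i = p_index k j \<Longrightarrow> i = j"
  using p_index_strict_mono by (metis less_irrefl linorder_neqE_nat)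

text \<open>The last \<gamma>-position of the pair determines p_j and hence j; the length then
  determines l.\<close>

lemma S_pairs_unique:
  assumes "\<Delta> \<in> S_pairs k j l" "\<Delta> \<in> S_pairs k j' l'"
  shows "j = j' \<and> l = l'"
proof -
  obtain \<delta> \<epsilon> where D: "\<Delta> = (\<delta>, \<epsilon>)" by (cases \<Delta>)
  have "\<not> p_index k i < p_index k i'" if "(\<delta>, \<epsilon>) \<in> S_pairs k i a" "(\<delta>, \<epsilon>) \<in> S_pairs k i' a'" for i i' a a'
  proof
    assume less: "p_index k i < p_index k i'"
    then have "gat \<delta> (p_index k i' - 1) \<or> gat \<epsilon> (p_index k i' - 1)" using that(2) unfolding S_pairs_iff by auto
    moreover have "p_index k i \<le> p_index k i' - 1" using less by simp
    ultimately show False using that(1) unfolding S_pairs_iff by blast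
  qed
  then have "p_index k j = p_index k j'" using assms D by (metis linorder_neqE_nat)
  then have "j = j'" by (rule p_index_inj)
  then show ?thesis using assms S_pairs_iff[of \<delta> \<epsilon> k j l] S_pairs_iff[of \<delta> \<epsilon> k j' l'] D by simp
qed

text \<open>The index j is read off the last position of a \<gamma>-edge in either path; without
  \<gamma>-edges it is 0.\<close>

lemma S_pairs_exists:
  assumes "\<delta> \<in> Lambda_from k 1" "\<epsilon> \<in> Lambda_from k 1" "red \<delta> \<epsilon>" "plen \<delta> = plen \<epsilon>"
  obtains j l where "(\<delta>, \<epsilon>) \<in> S_pairs k j l"
proof -
  have G: "k (Suc t) \<noteq> 0" "t < plen \<delta>" if gat: "gat \<mu> t" and L: "\<mu> \<in> Lambda_from k 1" "plen \<mu> = plen \<delta>" for \<mu> t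
  proof -
    obtain i w c where w: "\<mu> = fp i w" "t < length w" "w ! t = LG c" using gat by (auto simp: gat_def isG_def)
    have "i = 1" "admissible k (fp i w)" using L(1) by (auto simp: Lambda_from_def Lambda_def w(1))
    then have "admissible k (fp 1 w)" by simp
    then have "c \<in> {1..k (1 + t)}" using w(2,3) unfolding admissible_fp by blast
    then show "k (Suc t) \<noteq> 0" by auto
    show "t < plen \<delta>" using w L(2) by simp
  qed
  define T where "T = {t. gat \<delta> t \<or> gat \<epsilon> t}"
  have T: "k (Suc t) \<noteq> 0 \<and> t < plen \<delta>" if "t \<in> T" for t
  proof -
    have "gat \<delta> t \<or> gat \<epsilon> t" using that by (simp add: T_def)
    then show ?thesis using G[OF _ assms(1) refl, of t] G[OF _ assms(2) assms(4)[symmetric], of t] by blast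
  qed
  have fT: "finite T" using T by (intro finite_subset[of T "{..<plen \<delta>}"]) auto
  show ?thesis
  proof (cases "T = {}")
    case True
    then have "(\<delta>, \<epsilon>) \<in> S_pairs k 0 (plen \<delta>)"
      unfolding S_pairs_iff using assms by (auto simp: T_def p_index_def)
    then show ?thesis by (rule that)
  next
    case False
    define t where "t = Max T"
    have t: "t \<in> T" unfolding t_def using fT False by simp
    have max: "s \<le> t" if "s \<in> T" for s unfolding t_def using fT that by simp
    \<comment> \<open>Words start at vertex 1, so the letter with index t has range
      \<open>Suc t\<close>, and admissibility of a \<gamma>-edge there makes this one of the
      p_i.\<close>
    have "Suc t \<in> {i. 1 \<le> i \<and> k i \<noteq> 0}" using T[OF t] by simp
    from enumerate_Ex[OF inf this] obtain n where n: "enumerate {i. 1 \<le> i \<and> k i \<noteq> 0} n = Suc t" ..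
    then have p: "p_index k (Suc n) = Suc t" by (simp add: p_index_def)
    have "(\<delta>, \<epsilon>) \<in> S_pairs k (Suc n) (plen \<delta> - Suc t)"
      unfolding S_pairs_iff p
    proof (intro conjI allI impI)
      show "plen \<delta> = Suc t + (plen \<delta> - Suc t)" "plen \<epsilon> = Suc t + (plen \<delta> - Suc t)" using T[OF t] assms(4) by auto
      show "\<not> gat \<delta> s" "\<not> gat \<epsilon> s" if "Suc t \<le> s" for s
        using max[of s] that by (auto simp: T_def)
      show "Suc t = 0 \<or> gat \<delta> (Suc t - 1) \<or> gat \<epsilon> (Suc t - 1)" using t by (simp add: T_def)
    qed (use assms in auto)
    then show ?thesis by (rule that)
  qed
qed

end

section \<open>The band estimate for the indices\<close>

lemma feq_cut_at:
  assumes "feq u v" "isG u t"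
  shows "feq (drop (Suc t) u) (drop (Suc t) v)"
proof -
  obtain c where c: "t < length u" "u ! t = LG c" using assms(2) by (auto simp: isG_def)
  have "feq (take t u @ LG c # drop (Suc t) u) v" using assms(1) id_take_nth_drop[OF c(1)] c(2) by simp
  then obtain v1 v2 where v: "v = v1 @ LG c # v2" "feq (take t u) v1" "feq (drop (Suc t) u) v2" by (rule feq_cut)
  have "length v1 = t" using feq_length[OF v(2)] c(1) by simp
  then show ?thesis using v by simp
qed

text \<open>The last \<open>\<gamma>\<close>-edge of a reduced pair can only be lost under translation by a bisection
  of length \<open>length n\<close> if it lies among the first \<open>length n\<close> edges.\<close>

lemma last_gamma_survives:
  assumes dt: "feq (d @ t) (n @ d1)" and md: "feq (m @ d1) (d2 @ s)" and et: "feq (e @ t) (e2 @ s)"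
    and len: "length m = length n" "length d2 = length e2" "length d = length e"
    and red: "redw d e" and p: "length n < p" "p \<le> length d" "isG d (p - 1) \<or> isG e (p - 1)"
    and p2: "\<And>t. p2 \<le> t \<Longrightarrow> \<not> isG d2 t \<and> \<not> isG e2 t"
  shows "p \<le> p2"
proof (rule ccontr)
  assume "\<not> p \<le> p2"
  then have n2: "\<not> isG d2 (p - 1)" "\<not> isG e2 (p - 1)" using p2[of "p - 1"] by auto
  have pn: "length n \<le> p - 1" "p - 1 < length d" "Suc (p - 1) = p" using p by auto
  have d1: "isG (n @ d1) (p - 1) \<longleftrightarrow> isG (m @ d1) (p - 1)"
    using pn len by (auto simp: isG_append) (auto simp: isG_def)
  have s1: "isG (d2 @ s) (p - 1) \<longleftrightarrow> isG (e2 @ s) (p - 1)"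
    using n2 len by (auto simp: isG_append)
  have dd: "isG (d @ t) (p - 1) \<longleftrightarrow> isG d (p - 1)" "isG (e @ t) (p - 1) \<longleftrightarrow> isG e (p - 1)"
    using pn len by (auto simp: isG_append)
  \<comment> \<open>The \<gamma>-edge lies behind n and outside d2 and e2, hence inside the common
    suffix s. Through s it passes from one coordinate to the other, so both d and e carry
    it.\<close>
  have G: "isG (d @ t) (p - 1)" "isG (m @ d1) (p - 1)" "isG (e @ t) (p - 1)"
  proof -
    have "isG (d @ t) (p - 1) = isG (m @ d1) (p - 1)" using d1 feq_isG[OF dt, of "p - 1"] by simp
    moreover have "isG (m @ d1) (p - 1) = isG (e @ t) (p - 1)"
      using s1 feq_isG[OF md, of "p - 1"] feq_isG[OF et, of "p - 1"] by simp
    ultimately show "isG (d @ t) (p - 1)" "isG (m @ d1) (p - 1)" "isG (e @ t) (p - 1)"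
      using p(3) dd by auto
  qed
  have le2: "length d2 \<le> p - 1"
    using G(2) feq_isG[OF md, of "p - 1"] n2 by (auto simp: isG_append)
  \<comment> \<open>Cutting all three equations at this \<gamma>-edge shows that d and e also agree
    behind it, so they have a common suffix that begins with the edge.\<close>
  have "feq (drop p (d @ t)) (drop p (n @ d1))" "feq (drop p (m @ d1)) (drop p (d2 @ s))" "feq (drop p (e @ t)) (drop p (e2 @ s))"
    using feq_cut_at[OF dt G(1)] feq_cut_at[OF md G(2)] feq_cut_at[OF et G(3)] pn by simp_all
  then have "feq (drop p d @ t) (drop (p - length n) d1)" "feq (drop (p - length n) d1) (drop (p - length d2) s)"
    "feq (drop p e @ t) (drop (p - length d2) s)"
    using pn len le2 p by auto
  then have "feq (drop p d @ t) (drop p e @ t)" using feq_sym feq_trans by blast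
  then have de: "feq (drop p d) (drop p e)" by simp
  obtain c where c: "d ! (p - 1) = LG c" using G(1) dd by (auto simp: isG_def)
  have "e ! (p - 1) = LG c"
  proof -
    have "(d @ t) ! (p - 1) = LG c" using c pn by (simp add: nth_append)
    then have "(n @ d1) ! (p - 1) = LG c" using feq_LG[OF dt, of "p - 1" c] pn by simp
    then have "(m @ d1) ! (p - 1) = LG c" using pn len by (simp add: nth_append)
    then have "(d2 @ s) ! (p - 1) = LG c" using feq_LG[OF md, of "p - 1" c] G(2) by (simp add: isG_def)
    then have "(e2 @ s) ! (p - 1) = LG c" using le2 len by (simp add: nth_append)
    then have "(e @ t) ! (p - 1) = LG c" using feq_LG[OF et, of "p - 1" c] G(3) by (simp add: isG_def)
    then show ?thesis using pn len by (simp add: nth_append)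
  qed
  then have "e = take (p - 1) e @ LG c # drop p e" using id_take_nth_drop[of "p - 1" e] pn len by simp
  moreover have "d = take (p - 1) d @ LG c # drop p d" using id_take_nth_drop[of "p - 1" d] pn c by simp
  ultimately have "feq d (take (p - 1) d @ LG c # drop p d)" "feq e (take (p - 1) e @ LG c # drop p d)"
    using de feq_sym by (metis feq_refl, metis feq_Cons feq_append_left)
  then show False using red unfolding redw_def by blast
qed

text \<open>Lengths balance: p_j + l + |\<tau>| = p_j2 + l2 + |\<sigma>|. If the last \<gamma>-edge
  is among the first |\<nu>| edges, p_j is at most |\<nu>| and can be given away. Otherwise it
  survives, so p_j \<le> p_j2, and j2 - j is at most p_j2 - p_j. The summand 1 absorbs the maximum
  with 1; |\<sigma>| is kept on the left to pay for the refinement of cells.\<close>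

lemma band_index:
  assumes inf: "infinite {i. 1 \<le> i \<and> k i \<noteq> 0}"
    and S: "(\<delta>, \<epsilon>) \<in> S_pairs k j l" "(\<delta>2, \<epsilon>2) \<in> S_pairs k j2 l2"
    and eqs: "\<delta> \<Zcomp> \<tau> = \<nu> \<Zcomp> \<delta>1" "\<mu> \<Zcomp> \<delta>1 = \<delta>2 \<Zcomp> \<sigma>" "\<epsilon> \<Zcomp> \<tau> = \<epsilon>2 \<Zcomp> \<sigma>"
    and len: "plen \<mu> = plen \<nu>"
  shows "max j2 1 + l2 + plen \<sigma> \<le> max j 1 + l + plen \<tau> + plen \<nu> + 1"
proof -
  let ?p = "p_index k j" and ?p2 = "p_index k j2"
  obtain d e d2 e2 where w: "\<delta> = fp 1 d" "\<epsilon> = fp 1 e" "\<delta>2 = fp 1 d2" "\<epsilon>2 = fp 1 e2"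
    using S unfolding S_pairs_iff Lambda_from_def by (metis (mono_tags, lifting) fp_cases mem_Collect_eq prange_fp)
  obtain a t b n c d1 a' m b' s where w': "\<tau> = fp a t" "\<nu> = fp b n" "\<delta>1 = fp c d1" "\<mu> = fp a' m" "\<sigma> = fp b' s"
    by (metis fp_cases)
  have f: "feq (d @ t) (n @ d1)" "feq (m @ d1) (d2 @ s)" "feq (e @ t) (e2 @ s)"
    using eqs by (simp_all add: w w' fp_eq_iff)
  have l: "length d = ?p + l" "length e = ?p + l" "length d2 = ?p2 + l2" "length e2 = ?p2 + l2"
    using S unfolding S_pairs_iff by (auto simp: w)
  have tot: "?p + l + length t = ?p2 + l2 + length s" using feq_length[OF f(3)] l by simp
  have "?p \<le> length n \<or> ?p \<le> ?p2"
  proof (cases "?p \<le> length n")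
    case False
    have "?p \<le> ?p2"
    proof (rule last_gamma_survives[OF f])
      show "length m = length n" using len by (simp add: w')
      show "redw d e" using S(1) red_fp[of 1 d 1 e] l unfolding S_pairs_iff by (simp add: w)
      show "isG d (?p - 1) \<or> isG e (?p - 1)" using S(1) False unfolding S_pairs_iff by (auto simp: w)
      show "\<not> isG d2 t \<and> \<not> isG e2 t" if "?p2 \<le> t" for t using S(2) that unfolding S_pairs_iff by (auto simp: w)
    qed (use l False in auto)
    then show ?thesis ..
  qed simp
  then show ?thesis
  proof
    assume "?p \<le> length n"
    then show ?thesis using tot p_index_ge[OF inf, of j2] by (simp add: w')
  next
    assume le: "?p \<le> ?p2"
    then have "j \<le> j2" using p_index_strict_mono[OF inf] by (meson leD leI)
    then show ?thesis using tot p_index_diff[OF inf, of j j2] by (simp add: w')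
  qed
qed


section \<open>The topology of the groupoid\<close>

definition gpair :: "(nat \<Rightarrow> nat) \<Rightarrow> fpath \<Rightarrow> fpath \<Rightarrow> bool" where
  "gpair k \<mu> \<nu> \<longleftrightarrow> \<mu> \<in> Lambda_from k 1 \<and> \<nu> \<in> Lambda_from k 1 \<and> psource \<mu> = psource \<nu>"

abbreviation Zs :: "(nat \<Rightarrow> nat) \<Rightarrow> fpath \<Rightarrow> ipath set" where
  "Zs k \<mu> \<equiv> ipaths_from k (psource \<mu>)"

lemma gpair_sym: "gpair k \<mu> \<nu> \<Longrightarrow> gpair k \<nu> \<mu>"
  by (simp add: gpair_def)

lemma gpair_psource: "gpair k \<mu> \<nu> \<Longrightarrow> 1 \<le> psource \<mu> \<and> 1 \<le> psource \<nu> \<and> psource \<mu> = psource \<nu>"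
  by (simp add: gpair_def Lambda_from_def psource_def)

lemma germ_triples_iff: "(\<mu>, \<nu>, x) \<in> germ_triples k \<longleftrightarrow> gpair k \<mu> \<nu> \<and> x \<in> Zs k \<mu>"
  by (auto simp: germ_triples_def gpair_def ipaths_from_def)

lemma germ_groupoid: "gpair k \<mu> \<nu> \<Longrightarrow> x \<in> Zs k \<mu> \<Longrightarrow> germ \<mu> \<nu> x \<in> groupoid k"
  unfolding groupoid_def using germ_triples_iff by force

lemma groupoidE:
  assumes "g \<in> groupoid k"
  obtains \<mu> \<nu> x where "g = germ \<mu> \<nu> x" "gpair k \<mu> \<nu>" "x \<in> Zs k \<mu>"
  using assms unfolding groupoid_def by (auto simp: germ_triples_iff)

lemma S_pairs_gpair: "(\<delta>, \<epsilon>) \<in> S_pairs k j l \<Longrightarrow> gpair k \<delta> \<epsilon> \<and> red \<delta> \<epsilon> \<and> psource \<delta> = p_index k j + l + 1"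
  using S_pairs_sub[of \<delta> \<epsilon> k j l] by (simp add: gpair_def)

lemma groupoid_reduced:
  assumes "g \<in> groupoid k"
  obtains \<delta> \<epsilon> x where "g = germ \<delta> \<epsilon> x" "gpair k \<delta> \<epsilon>" "red \<delta> \<epsilon>" "x \<in> Zs k \<delta>"
proof -
  obtain \<mu> \<nu> y where g: "g = germ \<mu> \<nu> y" "gpair k \<mu> \<nu>" "y \<in> Zs k \<mu>" using groupoidE[OF assms] .
  obtain \<delta> \<epsilon> \<sigma> where r: "\<mu> = \<delta> \<Zcomp> \<sigma>" "\<nu> = \<epsilon> \<Zcomp> \<sigma>" "red \<delta> \<epsilon>" "prange \<sigma> = psource \<delta>" "prange \<sigma> = psource \<epsilon>"
    using red_exists[of \<mu> \<nu>] g(2) unfolding gpair_def by metis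
  have y: "y \<in> ipaths k" "irange y = psource \<sigma>" using g(3) r by (auto simp: ipaths_from_def)
  have L: "\<delta> \<in> Lambda k" "\<sigma> \<in> Lambda k" "\<epsilon> \<in> Lambda k"
    using g(2) r pcomp_Lambda_iff unfolding gpair_def Lambda_from_def by auto
  show ?thesis
  proof (rule that)
    show "g = germ \<delta> \<epsilon> (\<sigma> \<odot> y)" using g(1) r y by (simp add: germ_pcomp)
    show "gpair k \<delta> \<epsilon>" using g(2) r L by (auto simp: gpair_def Lambda_from_def)
    show "\<sigma> \<odot> y \<in> Zs k \<delta>" using y L r icomp_ipaths_iff[of y \<sigma> k] by (simp add: ipaths_from_def)
  qed (rule r)
qed

lemma ceq_transport:
  assumes "ceq (q + plen \<sigma>) (\<sigma> \<odot> z) y" "irange z = psource \<sigma>" "y \<in> ipaths k"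
  obtains z' where "y = \<sigma> \<odot> z'" "irange z' = psource \<sigma>" "z' \<in> ipaths k" "ceq q z z'"
proof -
  have "divs \<sigma> (\<sigma> \<odot> z)" using assms by auto
  then have "divs \<sigma> y" using ceq_divs[OF assms(1)] by simp
  then obtain z' where z': "y = \<sigma> \<odot> z'" "irange z' = psource \<sigma>" by (auto simp: divs_def)
  have "ceq q z z'" using assms(1) z' assms(2) by (intro ceq_cancel[of q \<sigma>]) auto
  then show ?thesis using that z' assms(3) icomp_ipaths_iff by blast
qed

lemma icomp_in_ipaths:
  "\<sigma> \<odot> z \<in> ipaths k \<Longrightarrow> irange z = psource \<sigma> \<Longrightarrow> z' \<in> ipaths k \<Longrightarrow> irange z' = psource \<sigma> \<Longrightarrow> \<sigma> \<odot> z' \<in> ipaths k"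
  using icomp_ipaths_iff by blast

text \<open>The criterion ranges over all representatives of a germ, reduced or not. A change of
  representative cancels one path, which costs finitely many levels, and prefixes another, which
  costs none.\<close>

lemma openin_groupoid_top_iff:
  "openin (groupoid_top k) U \<longleftrightarrow> U \<subseteq> groupoid k \<and>
    (\<forall>\<mu> \<nu> x. gpair k \<mu> \<nu> \<longrightarrow> x \<in> Zs k \<mu> \<longrightarrow> germ \<mu> \<nu> x \<in> U \<longrightarrow> (\<exists>q. germ \<mu> \<nu> ` cls k q x \<subseteq> U))"
    (is "_ \<longleftrightarrow> ?R U")
proof
  let ?B = "{germ_set \<mu> \<nu> F | \<mu> \<nu> F. \<mu> \<in> Lambda_from k 1 \<and> \<nu> \<in> Lambda_from k 1 \<and> psource \<mu> = psource \<nu> \<and>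
        F \<subseteq> cyl k (vertex (psource \<nu>)) \<and> compact_open k F}"
  assume "openin (groupoid_top k) U"
  then have "generate_topology_on ?B U"
    unfolding groupoid_top_def openin_topology_generated_by_iff .
  then show "?R U"
  proof (induction rule: generate_topology_on.induct)
    case (Int a b)
    show ?case
    proof (intro conjI allI impI)
      show "a \<inter> b \<subseteq> groupoid k" using Int.IH by blast
      fix \<mu> \<nu> x assume *: "gpair k \<mu> \<nu>" "x \<in> Zs k \<mu>" "germ \<mu> \<nu> x \<in> a \<inter> b"
      obtain q where q: "germ \<mu> \<nu> ` cls k q x \<subseteq> a" using Int.IH(1) * by blast
      obtain r where r: "germ \<mu> \<nu> ` cls k r x \<subseteq> b" using Int.IH(2) * by blast
      show "\<exists>q. germ \<mu> \<nu> ` cls k q x \<subseteq> a \<inter> b"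
      proof (intro exI[of _ "max q r"] Int_greatest)
        show "germ \<mu> \<nu> ` cls k (max q r) x \<subseteq> a"
          using image_mono[OF cls_mono[of q "max q r" k x]] q by (meson max.cobounded1 order_trans)
        show "germ \<mu> \<nu> ` cls k (max q r) x \<subseteq> b"
          using image_mono[OF cls_mono[of r "max q r" k x]] r by (meson max.cobounded2 order_trans)
      qed
    qed
  next
    case (UN K)
    show ?case
    proof (intro conjI allI impI)
      show "\<Union>K \<subseteq> groupoid k" using UN.IH by blast
      fix \<mu> \<nu> x assume *: "gpair k \<mu> \<nu>" "x \<in> Zs k \<mu>" "germ \<mu> \<nu> x \<in> \<Union>K"
      then obtain a where a: "a \<in> K" "germ \<mu> \<nu> x \<in> a" by blast
      then obtain q where "germ \<mu> \<nu> ` cls k q x \<subseteq> a" using UN.IH * by blast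
      then show "\<exists>q. germ \<mu> \<nu> ` cls k q x \<subseteq> \<Union>K" using a by blast
    qed
  next
    case (Basis s)
    then obtain \<mu>' \<nu>' F where s: "s = germ_set \<mu>' \<nu>' F" and gp': "gpair k \<mu>' \<nu>'"
      and F: "F \<subseteq> cyl k (vertex (psource \<nu>'))" "compact_open k F" unfolding gpair_def by blast
    have FZ: "F \<subseteq> Zs k \<mu>'" using F gpair_psource[OF gp'] by (simp add: cyl_vertex)
    then obtain q' where q': "sat k q' F" using F(2) compact_open_iff gpair_psource[OF gp'] by metis
    show ?case
    proof (intro conjI allI impI)
      show "s \<subseteq> groupoid k" using FZ gp' germ_groupoid by (auto simp: s germ_set_def)
      fix \<mu> \<nu> x assume *: "gpair k \<mu> \<nu>" "x \<in> Zs k \<mu>" "germ \<mu> \<nu> x \<in> s"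
      then obtain x' where x': "x' \<in> F" "germ \<mu> \<nu> x = germ \<mu>' \<nu>' x'" by (auto simp: s germ_set_def)
      have xr: "psource \<mu> = irange x" "psource \<nu> = irange x" using * by (auto simp: gpair_def ipaths_from_def)
      obtain \<sigma> \<sigma>' z where sz: "\<mu> \<Zcomp> \<sigma> = \<mu>' \<Zcomp> \<sigma>'" "\<nu> \<Zcomp> \<sigma> = \<nu>' \<Zcomp> \<sigma>'" "x = \<sigma> \<odot> z" "x' = \<sigma>' \<odot> z"
        "prange \<sigma> = psource \<mu>" "prange \<sigma> = psource \<nu>" "prange \<sigma>' = psource \<mu>'" "prange \<sigma>' = psource \<nu>'"
        "psource \<sigma> = irange z" "psource \<sigma>' = irange z"
        using germ_eqE[OF x'(2) xr] by blast
      \<comment> \<open>The summand \<open>plen \<sigma>\<close> is the price for removing \<sigma>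
        from y; the new prefix \<sigma>' keeps the level q'.\<close>
      have "germ \<mu> \<nu> y \<in> s" if "y \<in> cls k (q' + plen \<sigma>) x" for y
      proof -
        have y: "ceq (q' + plen \<sigma>) (\<sigma> \<odot> z) y" "y \<in> ipaths k" using that sz(3) by (auto simp: cls_def)
        obtain z' where z': "y = \<sigma> \<odot> z'" "irange z' = psource \<sigma>" "z' \<in> ipaths k" "ceq q' z z'"
          using ceq_transport[OF y(1) sz(9)[symmetric] y(2)] .
        have "ceq q' (\<sigma>' \<odot> z) (\<sigma>' \<odot> z')" using z'(4) sz(10) by (intro ceq_icomp) auto
        moreover have "\<sigma>' \<odot> z' \<in> ipaths k"
        proof (rule icomp_in_ipaths)
          show "\<sigma>' \<odot> z \<in> ipaths k" using x'(1) FZ sz(4) by (auto simp: ipaths_from_def)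
        qed (use z' sz in auto)
        ultimately have "\<sigma>' \<odot> z' \<in> F" using satD[OF q'] x'(1) sz(4) by blast
        moreover have "germ \<mu> \<nu> y = germ \<mu>' \<nu>' (\<sigma>' \<odot> z')"
          using z' sz germ_pcomp[of \<mu> \<sigma> \<nu> z'] germ_pcomp[of \<mu>' \<sigma>' \<nu>' z'] by simp
        ultimately show ?thesis by (auto simp: s germ_set_def)
      qed
      then show "\<exists>q. germ \<mu> \<nu> ` cls k q x \<subseteq> s" by blast
    qed
  qed auto
next
  assume R: "?R U"
  have "\<exists>B. openin (groupoid_top k) B \<and> g \<in> B \<and> B \<subseteq> U" if g: "g \<in> U" for g
  proof -
    obtain \<mu> \<nu> x where m: "g = germ \<mu> \<nu> x" "gpair k \<mu> \<nu>" "x \<in> Zs k \<mu>" using R g groupoidE by blast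
    then obtain q where q: "germ \<mu> \<nu> ` cls k q x \<subseteq> U" using R g by blast
    have ps: "1 \<le> psource \<nu>" "psource \<mu> = psource \<nu>" using gpair_psource[OF m(2)] by auto
    have sub: "cls k q x \<subseteq> Zs k \<nu>" using cls_ipaths_from[OF m(3)] ps by simp
    have "compact_open k (cls k q x)" using compact_open_iff[OF ps(1) sub] sat_cls by blast
    moreover have "cls k q x \<subseteq> cyl k (vertex (psource \<nu>))" using sub ps(1) by (simp add: cyl_vertex)
    ultimately have "openin (groupoid_top k) (germ_set \<mu> \<nu> (cls k q x))"
      unfolding groupoid_top_def using m(2) unfolding gpair_def
      by (intro topology_generated_by_Basis CollectI exI[of _ \<mu>] exI[of _ \<nu>] exI[of _ "cls k q x"] conjI refl) blast+
    moreover have "g \<in> germ_set \<mu> \<nu> (cls k q x)" using m mem_cls[of x k q] by (auto simp: germ_set_def ipaths_from_def)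
    ultimately show ?thesis using q unfolding germ_set_def by blast
  qed
  then show "openin (groupoid_top k) U" by (subst openin_subopen) blast
qed

lemma topspace_groupoid_top: "topspace (groupoid_top k) = groupoid k"
proof
  show "topspace (groupoid_top k) \<subseteq> groupoid k" using openin_groupoid_top_iff[of k "topspace (groupoid_top k)"] by simp
  have "openin (groupoid_top k) (groupoid k)"
    unfolding openin_groupoid_top_iff
  proof (intro conjI allI impI)
    fix \<mu> \<nu> x assume "gpair k \<mu> \<nu>" "x \<in> Zs k \<mu>"
    then have "germ \<mu> \<nu> ` cls k 0 x \<subseteq> groupoid k" using germ_groupoid cls_ipaths_from[of x k "psource \<mu>" 0] by blast
    then show "\<exists>q. germ \<mu> \<nu> ` cls k q x \<subseteq> groupoid k" by blast
  qed simp
  then show "groupoid k \<subseteq> topspace (groupoid_top k)" by (rule openin_subset)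
qed

lemma continuous_groupoid_iff:
  fixes f :: "gelem \<Rightarrow> complex"
  shows "continuous_map (groupoid_top k) euclidean f \<longleftrightarrow>
    (\<forall>\<mu> \<nu> x e. gpair k \<mu> \<nu> \<longrightarrow> x \<in> Zs k \<mu> \<longrightarrow> 0 < e \<longrightarrow>
      (\<exists>q. \<forall>y\<in>cls k q x. dist (f (germ \<mu> \<nu> y)) (f (germ \<mu> \<nu> x)) < e))" (is "_ \<longleftrightarrow> ?R")
proof
  assume c: "continuous_map (groupoid_top k) euclidean f"
  show ?R
  proof (intro allI impI)
    fix \<mu> \<nu> x and e :: real assume *: "gpair k \<mu> \<nu>" "x \<in> Zs k \<mu>" "0 < e"
    let ?U = "{g \<in> groupoid k. f g \<in> ball (f (germ \<mu> \<nu> x)) e}"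
    have "openin (groupoid_top k) ?U"
      using c openin_continuous_map_preimage[of "groupoid_top k" euclidean f "ball (f (germ \<mu> \<nu> x)) e"]
      by (simp add: topspace_groupoid_top)
    moreover have "germ \<mu> \<nu> x \<in> ?U" using * germ_groupoid by simp
    ultimately obtain q where "germ \<mu> \<nu> ` cls k q x \<subseteq> ?U" using * unfolding openin_groupoid_top_iff by blast
    then show "\<exists>q. \<forall>y\<in>cls k q x. dist (f (germ \<mu> \<nu> y)) (f (germ \<mu> \<nu> x)) < e"
      by (intro exI[of _ q]) (auto simp: dist_commute)
  qed
next
  assume R: ?R
  show "continuous_map (groupoid_top k) euclidean f"
    unfolding continuous_map_def
  proof (intro conjI allI impI)
    fix U :: "complex set" assume "openin euclidean U"
    then have U: "open U" by simp
    show "openin (groupoid_top k) {g \<in> topspace (groupoid_top k). f g \<in> U}"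
      unfolding openin_groupoid_top_iff topspace_groupoid_top
    proof (intro conjI allI impI)
      fix \<mu> \<nu> x assume *: "gpair k \<mu> \<nu>" "x \<in> Zs k \<mu>" "germ \<mu> \<nu> x \<in> {g \<in> groupoid k. f g \<in> U}"
      then obtain e where e: "0 < e" "ball (f (germ \<mu> \<nu> x)) e \<subseteq> U" using U openE by blast
      obtain q where q: "\<forall>y\<in>cls k q x. dist (f (germ \<mu> \<nu> y)) (f (germ \<mu> \<nu> x)) < e" using R * e(1) by blast
      have "f (germ \<mu> \<nu> y) \<in> U \<and> germ \<mu> \<nu> y \<in> groupoid k" if y: "y \<in> cls k q x" for y
      proof
        show "f (germ \<mu> \<nu> y) \<in> U" using q y e(2) by (auto simp: dist_commute subset_iff)
        show "germ \<mu> \<nu> y \<in> groupoid k" using germ_groupoid *(1) cls_ipaths_from[OF *(2)] y by blast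
      qed
      then show "\<exists>q. germ \<mu> \<nu> ` cls k q x \<subseteq> {g \<in> groupoid k. f g \<in> U}" by blast
    qed auto
  qed simp
qed

lemma germ_set_mem_iff:
  assumes "gpair k \<delta> \<epsilon>" "red \<delta> \<epsilon>" "F \<subseteq> Zs k \<delta>" "gpair k \<mu> \<nu>" "y \<in> Zs k \<mu>"
  shows "germ \<mu> \<nu> y \<in> germ_set \<delta> \<epsilon> F \<longleftrightarrow> (\<exists>\<sigma>. \<mu> = \<delta> \<Zcomp> \<sigma> \<and> \<nu> = \<epsilon> \<Zcomp> \<sigma> \<and> prange \<sigma> = psource \<delta> \<and> \<sigma> \<odot> y \<in> F)"
proof
  have yr: "psource \<mu> = irange y" "psource \<nu> = irange y" using assms by (auto simp: gpair_def ipaths_from_def)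
  assume "germ \<mu> \<nu> y \<in> germ_set \<delta> \<epsilon> F"
  then obtain x where x: "x \<in> F" "germ \<mu> \<nu> y = germ \<delta> \<epsilon> x" by (auto simp: germ_set_def)
  have xr: "psource \<delta> = irange x" "psource \<epsilon> = irange x" using assms x by (auto simp: gpair_def ipaths_from_def)
  show "\<exists>\<sigma>. \<mu> = \<delta> \<Zcomp> \<sigma> \<and> \<nu> = \<epsilon> \<Zcomp> \<sigma> \<and> prange \<sigma> = psource \<delta> \<and> \<sigma> \<odot> y \<in> F"
    using red_germ_common[OF x(2) yr assms(2) xr] x(1) by blast
next
  have yr: "psource \<mu> = irange y" "psource \<nu> = irange y" using assms by (auto simp: gpair_def ipaths_from_def)
  assume "\<exists>\<sigma>. \<mu> = \<delta> \<Zcomp> \<sigma> \<and> \<nu> = \<epsilon> \<Zcomp> \<sigma> \<and> prange \<sigma> = psource \<delta> \<and> \<sigma> \<odot> y \<in> F"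
  then obtain \<sigma> where s: "\<mu> = \<delta> \<Zcomp> \<sigma>" "\<nu> = \<epsilon> \<Zcomp> \<sigma>" "prange \<sigma> = psource \<delta>" "\<sigma> \<odot> y \<in> F" by blast
  then have "germ \<mu> \<nu> y = germ \<delta> \<epsilon> (\<sigma> \<odot> y)" using yr assms(1) by (simp add: germ_pcomp gpair_def)
  then show "germ \<mu> \<nu> y \<in> germ_set \<delta> \<epsilon> F" using s by (simp add: germ_set_def)
qed

text \<open>For a reduced pair, membership depends on the base point only through \<sigma> \<odot>
  y, and prefixing \<sigma> keeps the level. So the same q works at every representative.\<close>

lemma germ_set_local:
  assumes "gpair k \<delta> \<epsilon>" "red \<delta> \<epsilon>" "F \<subseteq> Zs k \<delta>" "sat k q F" "gpair k \<mu> \<nu>" "x \<in> Zs k \<mu>" "y \<in> cls k q x"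
  shows "germ \<mu> \<nu> y \<in> germ_set \<delta> \<epsilon> F \<longleftrightarrow> germ \<mu> \<nu> x \<in> germ_set \<delta> \<epsilon> F"
proof -
  have y: "y \<in> Zs k \<mu>" using cls_ipaths_from[OF assms(6)] assms(7) by blast
  have yc: "ceq q x y" using assms(7) by (simp add: cls_def)
  have "\<sigma> \<odot> y \<in> F \<longleftrightarrow> \<sigma> \<odot> x \<in> F" if "\<mu> = \<delta> \<Zcomp> \<sigma>" "prange \<sigma> = psource \<delta>" for \<sigma>
  proof -
    have r: "irange x = psource \<sigma>" "irange y = psource \<sigma>" using that assms(6) y by (auto simp: ipaths_from_def)
    have "ceq q (\<sigma> \<odot> x) (\<sigma> \<odot> y)" using yc r by (intro ceq_icomp) auto
    moreover have "\<sigma> \<in> Lambda k"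
      using assms(5) that pcomp_Lambda_iff unfolding gpair_def Lambda_from_def by auto
    then have "\<sigma> \<odot> x \<in> ipaths k" "\<sigma> \<odot> y \<in> ipaths k"
      using r assms(6) y icomp_ipaths_iff by (auto simp: ipaths_from_def)
    ultimately show ?thesis using satD[OF assms(4)] ceq_sym by blast
  qed
  then show ?thesis unfolding germ_set_mem_iff[OF assms(1-3,5) assms(6)] germ_set_mem_iff[OF assms(1-3,5) y] by blast
qed

definition rpairs :: "(nat \<Rightarrow> nat) \<Rightarrow> (fpath \<times> fpath) set" where
  "rpairs k = {(\<delta>, \<epsilon>). gpair k \<delta> \<epsilon> \<and> red \<delta> \<epsilon>}"

definition bis :: "(nat \<Rightarrow> nat) \<Rightarrow> fpath \<times> fpath \<Rightarrow> gelem set" where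
  "bis k \<Delta> = germ_set (fst \<Delta>) (snd \<Delta>) (Zs k (fst \<Delta>))"

lemma rpairsD: "\<Delta> \<in> rpairs k \<Longrightarrow> gpair k (fst \<Delta>) (snd \<Delta>) \<and> red (fst \<Delta>) (snd \<Delta>)"
  by (auto simp: rpairs_def)

lemma groupoid_bis: "groupoid k = (\<Union>\<Delta>\<in>rpairs k. bis k \<Delta>)"
proof
  show "groupoid k \<subseteq> (\<Union>\<Delta>\<in>rpairs k. bis k \<Delta>)"
  proof
    fix g assume "g \<in> groupoid k"
    then obtain \<delta> \<epsilon> x where "g = germ \<delta> \<epsilon> x" "gpair k \<delta> \<epsilon>" "red \<delta> \<epsilon>" "x \<in> Zs k \<delta>" by (rule groupoid_reduced)
    then show "g \<in> (\<Union>\<Delta>\<in>rpairs k. bis k \<Delta>)"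
      by (intro UN_I[of "(\<delta>, \<epsilon>)"]) (auto simp: rpairs_def bis_def germ_set_def)
  qed
qed (auto simp: bis_def germ_set_def germ_groupoid dest!: rpairsD)

lemma bis_disjoint:
  assumes "\<Delta> \<in> rpairs k" "\<Delta>' \<in> rpairs k" "F \<subseteq> Zs k (fst \<Delta>)" "F' \<subseteq> Zs k (fst \<Delta>')"
    "g \<in> germ_set (fst \<Delta>) (snd \<Delta>) F" "g \<in> germ_set (fst \<Delta>') (snd \<Delta>') F'"
  shows "\<Delta> = \<Delta>' \<and> g \<in> germ_set (fst \<Delta>) (snd \<Delta>) (F \<inter> F')"
proof -
  obtain x x' where x: "x \<in> F" "g = germ (fst \<Delta>) (snd \<Delta>) x" "x' \<in> F'" "g = germ (fst \<Delta>') (snd \<Delta>') x'"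
    using assms by (auto simp: germ_set_def)
  have "fst \<Delta> = fst \<Delta>' \<and> snd \<Delta> = snd \<Delta>' \<and> x = x'"
  proof (rule germ_reduced_unique)
    show "germ (fst \<Delta>) (snd \<Delta>) x = germ (fst \<Delta>') (snd \<Delta>') x'" using x by simp
  qed (use x assms rpairsD in \<open>auto simp: gpair_def ipaths_from_def subset_iff\<close>)
  then show ?thesis using x by (auto simp: germ_set_def prod_eq_iff)
qed

lemma openin_bis_iff:
  assumes "\<Delta> \<in> rpairs k"
  shows "openin (groupoid_top k) (bis k \<Delta>)" "openin (groupoid_top k) (groupoid k - bis k \<Delta>)"
proof -
  have r: "gpair k (fst \<Delta>) (snd \<Delta>)" "red (fst \<Delta>) (snd \<Delta>)" using rpairsD[OF assms] by auto
  have loc: "germ \<mu> \<nu> y \<in> bis k \<Delta> \<longleftrightarrow> germ \<mu> \<nu> x \<in> bis k \<Delta>"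
    if "gpair k \<mu> \<nu>" "x \<in> Zs k \<mu>" "y \<in> cls k 0 x" for \<mu> \<nu> x y
    unfolding bis_def using that by (intro germ_set_local[OF r _ sat_ipaths_from]) auto
  show "openin (groupoid_top k) (bis k \<Delta>)"
    unfolding openin_groupoid_top_iff using loc groupoid_bis assms by blast
  show "openin (groupoid_top k) (groupoid k - bis k \<Delta>)"
    unfolding openin_groupoid_top_iff
  proof (intro conjI allI impI)
    fix \<mu> \<nu> x assume *: "gpair k \<mu> \<nu>" "x \<in> Zs k \<mu>" "germ \<mu> \<nu> x \<in> groupoid k - bis k \<Delta>"
    have "germ \<mu> \<nu> y \<in> groupoid k - bis k \<Delta>" if "y \<in> cls k 0 x" for y
      using loc[OF *(1,2) that] * germ_groupoid cls_ipaths_from[OF *(2)] that by blast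
    then show "\<exists>q. germ \<mu> \<nu> ` cls k q x \<subseteq> groupoid k - bis k \<Delta>" by blast
  qed blast
qed

lemma compactin_bis:
  assumes "\<Delta> \<in> rpairs k" shows "compactin (groupoid_top k) (bis k \<Delta>)"
proof -
  have r: "gpair k (fst \<Delta>) (snd \<Delta>)" using rpairsD[OF assms] by auto
  show ?thesis
    unfolding bis_def germ_set_def
  proof (rule compactin_of_cover)
    show "1 \<le> psource (fst \<Delta>)" using gpair_psource[OF r] by simp
    fix \<U> x assume *: "\<And>U. U \<in> \<U> \<Longrightarrow> openin (groupoid_top k) U"
      "germ (fst \<Delta>) (snd \<Delta>) ` Zs k (fst \<Delta>) \<subseteq> \<Union>\<U>" "x \<in> Zs k (fst \<Delta>)"
    then obtain U where U: "U \<in> \<U>" "germ (fst \<Delta>) (snd \<Delta>) x \<in> U" by blast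
    then show "\<exists>q. \<exists>U\<in>\<U>. germ (fst \<Delta>) (snd \<Delta>) ` cls k q x \<subseteq> U"
      using *(1)[OF U(1)] r *(3) unfolding openin_groupoid_top_iff by blast
  qed (use sat_ipaths_from r germ_groupoid topspace_groupoid_top in auto)
qed

section \<open>Continuous functions with compact support\<close>

text \<open>The bisections of reduced pairs are compact, open and closed and cover the groupoid, so
  compactness of the support means that finitely many of them contain it.\<close>

lemma Cc_iff:
  "f \<in> Cc k \<longleftrightarrow> (\<forall>\<mu> \<nu> x e. gpair k \<mu> \<nu> \<longrightarrow> x \<in> Zs k \<mu> \<longrightarrow> 0 < e \<longrightarrow>
      (\<exists>q. \<forall>y\<in>cls k q x. dist (f (germ \<mu> \<nu> y)) (f (germ \<mu> \<nu> x)) < e)) \<and>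
    (\<exists>\<D>. finite \<D> \<and> \<D> \<subseteq> rpairs k \<and> (\<forall>g. f g \<noteq> 0 \<longrightarrow> (\<exists>\<Delta>\<in>\<D>. g \<in> bis k \<Delta>)))" (is "_ \<longleftrightarrow> ?C \<and> ?S")
proof
  assume f: "f \<in> Cc k"
  let ?K = "groupoid_top k closure_of {g. f g \<noteq> 0}"
  have K: "compactin (groupoid_top k) ?K" and z: "\<And>g. g \<notin> groupoid k \<Longrightarrow> f g = 0" using f by (auto simp: Cc_def)
  have sub: "{g. f g \<noteq> 0} \<subseteq> ?K" using z by (intro closure_of_subset) (auto simp: topspace_groupoid_top)
  have "?K \<subseteq> \<Union>(bis k ` rpairs k)" using compactin_subset_topspace[OF K] groupoid_bis by (auto simp: topspace_groupoid_top)
  then obtain \<F> where \<F>: "finite \<F>" "\<F> \<subseteq> bis k ` rpairs k" "?K \<subseteq> \<Union>\<F>"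
    using K openin_bis_iff unfolding compactin_def by (metis (no_types, lifting) imageE)
  obtain \<D> where "finite \<D>" "\<D> \<subseteq> rpairs k" "\<F> = bis k ` \<D>" using finite_subset_image[OF \<F>(1,2)] by blast
  then have ?S using \<F> sub by (intro exI[of _ \<D>]) blast
  moreover have ?C using f continuous_groupoid_iff by (simp add: Cc_def)
  ultimately show "?C \<and> ?S" by blast
next
  assume CS: "?C \<and> ?S"
  then obtain \<D> where \<D>: "finite \<D>" "\<D> \<subseteq> rpairs k" "\<And>g. f g \<noteq> 0 \<Longrightarrow> \<exists>\<Delta>\<in>\<D>. g \<in> bis k \<Delta>" by blast
  let ?K = "\<Union>(bis k ` \<D>)"
  have Kc: "compactin (groupoid_top k) ?K"
    using \<D> compactin_bis by (intro compactin_Union) auto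
  have Kcl: "closedin (groupoid_top k) ?K"
    using \<D> openin_bis_iff groupoid_bis
    by (intro closedin_Union) (auto simp: closedin_def topspace_groupoid_top)
  have "groupoid_top k closure_of {g. f g \<noteq> 0} \<subseteq> ?K"
    using \<D>(3) by (intro closure_of_minimal Kcl) blast
  then have "compactin (groupoid_top k) (groupoid_top k closure_of {g. f g \<noteq> 0})"
    by (rule closed_compactin[OF Kc]) (rule closedin_closure_of)
  moreover have "f g = 0" if "g \<notin> groupoid k" for g using that \<D> groupoid_bis by blast
  ultimately show "f \<in> Cc k" using CS continuous_groupoid_iff unfolding Cc_def by blast
qed

lemma Cc_support:
  "f \<in> Cc k \<Longrightarrow> \<exists>\<D>. finite \<D> \<and> \<D> \<subseteq> rpairs k \<and> (\<forall>g. f g \<noteq> 0 \<longrightarrow> (\<exists>\<Delta>\<in>\<D>. g \<in> bis k \<Delta>))"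
  by (simp only: Cc_iff)

lemma Cc_continuous:
  "f \<in> Cc k \<Longrightarrow> gpair k \<mu> \<nu> \<Longrightarrow> x \<in> Zs k \<mu> \<Longrightarrow> 0 < e \<Longrightarrow>
    \<exists>q. \<forall>y\<in>cls k q x. dist (f (germ \<mu> \<nu> y)) (f (germ \<mu> \<nu> x)) < e"
  by (simp only: Cc_iff)

lemma Cc_add: "f \<in> Cc k \<Longrightarrow> g \<in> Cc k \<Longrightarrow> (\<lambda>a. f a + g a) \<in> Cc k"
proof -
  assume f: "f \<in> Cc k" and g: "g \<in> Cc k"
  obtain \<D> where \<D>: "finite \<D>" "\<D> \<subseteq> rpairs k" "\<forall>a. f a \<noteq> 0 \<longrightarrow> (\<exists>\<Delta>\<in>\<D>. a \<in> bis k \<Delta>)" using Cc_support[OF f] by blast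
  obtain \<E> where \<E>: "finite \<E>" "\<E> \<subseteq> rpairs k" "\<forall>a. g a \<noteq> 0 \<longrightarrow> (\<exists>\<Delta>\<in>\<E>. a \<in> bis k \<Delta>)" using Cc_support[OF g] by blast
  have c: "continuous_map (groupoid_top k) euclidean (\<lambda>a. f a + g a)"
    using f g by (intro continuous_map_add) (auto simp: Cc_def)
  have "\<forall>a. f a + g a \<noteq> 0 \<longrightarrow> (\<exists>\<Delta>\<in>\<D> \<union> \<E>. a \<in> bis k \<Delta>)"
  proof (intro allI impI)
    fix a assume "f a + g a \<noteq> 0"
    then have "f a \<noteq> 0 \<or> g a \<noteq> 0" by auto
    then show "\<exists>\<Delta>\<in>\<D> \<union> \<E>. a \<in> bis k \<Delta>" using \<D>(3) \<E>(3) by blast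
  qed
  then show ?thesis unfolding Cc_iff using c[unfolded continuous_groupoid_iff] \<D> \<E>
    by (intro conjI exI[of _ "\<D> \<union> \<E>"]) auto
qed

lemma Cc_cut:
  assumes f: "f \<in> Cc k" and G: "\<And>\<mu> \<nu> x. gpair k \<mu> \<nu> \<Longrightarrow> x \<in> Zs k \<mu> \<Longrightarrow> \<exists>q. \<forall>y\<in>cls k q x. germ \<mu> \<nu> y \<in> G \<longleftrightarrow> germ \<mu> \<nu> x \<in> G"
  shows "(\<lambda>a. if a \<in> G then f a else 0) \<in> Cc k"
proof -
  obtain \<D> where \<D>: "finite \<D>" "\<D> \<subseteq> rpairs k" "\<forall>a. f a \<noteq> 0 \<longrightarrow> (\<exists>\<Delta>\<in>\<D>. a \<in> bis k \<Delta>)" using Cc_support[OF f] by blast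
  show ?thesis
    unfolding Cc_iff
  proof (intro conjI allI impI)
    fix \<mu> \<nu> x and e :: real assume *: "gpair k \<mu> \<nu>" "x \<in> Zs k \<mu>" "0 < e"
    obtain q where q: "\<forall>y\<in>cls k q x. dist (f (germ \<mu> \<nu> y)) (f (germ \<mu> \<nu> x)) < e" using Cc_continuous[OF f *] by blast
    obtain r where r: "\<forall>y\<in>cls k r x. germ \<mu> \<nu> y \<in> G \<longleftrightarrow> germ \<mu> \<nu> x \<in> G" using G * by blast
    show "\<exists>q. \<forall>y\<in>cls k q x. dist (if germ \<mu> \<nu> y \<in> G then f (germ \<mu> \<nu> y) else 0) (if germ \<mu> \<nu> x \<in> G then f (germ \<mu> \<nu> x) else 0) < e"
    proof (intro exI[of _ "max q r"] ballI)
      fix y assume "y \<in> cls k (max q r) x"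
      then have "y \<in> cls k q x" "y \<in> cls k r x" using cls_mono[of q "max q r" k x] cls_mono[of r "max q r" k x] by auto
      then show "dist (if germ \<mu> \<nu> y \<in> G then f (germ \<mu> \<nu> y) else 0) (if germ \<mu> \<nu> x \<in> G then f (germ \<mu> \<nu> x) else 0) < e"
        using q r *(3) by auto
    qed
  qed (use \<D> in \<open>intro exI[of _ \<D>], auto\<close>)
qed

lemma Cc_scale: "f \<in> Cc k \<Longrightarrow> (\<lambda>a. c * f a) \<in> Cc k"
proof -
  assume f: "f \<in> Cc k"
  have c: "continuous_map (groupoid_top k) euclidean (\<lambda>a. c * f a)"
  proof (rule continuous_map_compose[of _ euclidean f euclidean "\<lambda>z. c * z", unfolded comp_def])
    show "continuous_map (groupoid_top k) euclidean f" using f by (simp add: Cc_def)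
    show "continuous_map euclidean euclidean (\<lambda>z. c * z)" by (simp add: continuous_on_mult_left)
  qed
  obtain \<D> where \<D>: "finite \<D>" "\<D> \<subseteq> rpairs k" "\<forall>a. f a \<noteq> 0 \<longrightarrow> (\<exists>\<Delta>\<in>\<D>. a \<in> bis k \<Delta>)" using Cc_support[OF f] by blast
  show ?thesis unfolding Cc_iff using c[unfolded continuous_groupoid_iff] \<D>
    by (intro conjI exI[of _ \<D>]) auto
qed

lemma Cc_indicator:
  assumes \<Delta>: "\<Delta> \<in> rpairs k" and F: "F \<subseteq> Zs k (fst \<Delta>)" "sat k q F"
  shows "indicator (germ_set (fst \<Delta>) (snd \<Delta>) F) \<in> Cc k"
  unfolding Cc_iff
proof (intro conjI allI impI)
  have r: "gpair k (fst \<Delta>) (snd \<Delta>)" "red (fst \<Delta>) (snd \<Delta>)" using rpairsD[OF \<Delta>] by auto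
  fix \<mu> \<nu> x and e :: real assume *: "gpair k \<mu> \<nu>" "x \<in> Zs k \<mu>" "0 < e"
  show "\<exists>q. \<forall>y\<in>cls k q x. dist (indicator (germ_set (fst \<Delta>) (snd \<Delta>) F) (germ \<mu> \<nu> y))
       (indicator (germ_set (fst \<Delta>) (snd \<Delta>) F) (germ \<mu> \<nu> x) :: complex) < e"
    using germ_set_local[OF r F *(1,2)] *(3) by (intro exI[of _ q]) (auto simp: indicator_def)
next
  show "\<exists>\<D>. finite \<D> \<and> \<D> \<subseteq> rpairs k \<and>
    (\<forall>g. indicator (germ_set (fst \<Delta>) (snd \<Delta>) F) g \<noteq> (0::complex) \<longrightarrow> (\<exists>\<Delta>\<in>\<D>. g \<in> bis k \<Delta>))"
    using \<Delta> F(1) by (intro exI[of _ "{\<Delta>}"]) (auto simp: bis_def germ_set_def indicator_def split: if_splits)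
qed

lemma Cc_zero: "(\<lambda>_. 0) \<in> Cc k"
  unfolding Cc_iff by (auto intro!: exI[of _ "{}"])

lemma Cc_sum: "(\<And>i. i \<in> S \<Longrightarrow> f i \<in> Cc k) \<Longrightarrow> (\<lambda>a. \<Sum>i\<in>S. f i a) \<in> Cc k"
  by (induction S rule: infinite_finite_induct) (auto intro: Cc_zero Cc_add)


section \<open>Products\<close>

lemma ginv_ginv [simp]: "ginv (ginv g) = g"
  and grange_ginv: "grange (ginv g) = gsource g"
  and gsource_ginv: "gsource (ginv g) = grange g"
proof -
  obtain \<mu> \<nu> x where "g = germ \<mu> \<nu> x"
    unfolding germ_def using Quotient3_abs_rep[OF Quotient3_gelem] by (metis prod_cases3)
  then show "ginv (ginv g) = g" "grange (ginv g) = gsource g" "gsource (ginv g) = grange g"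
    by (simp_all add: ginv_germ grange_germ gsource_germ)
qed

lemma is_productE:
  assumes "is_product k a b c"
  obtains \<mu> \<nu> \<delta> \<xi> \<kappa> \<epsilon> x where "a = germ (\<mu> \<Zcomp> \<delta>) (\<nu> \<Zcomp> \<delta>) x" "b = germ (\<nu> \<Zcomp> \<delta>) (\<kappa> \<Zcomp> \<epsilon>) x"
    "c = germ (\<mu> \<Zcomp> \<delta>) (\<kappa> \<Zcomp> \<epsilon>) x" "psource (\<mu> \<Zcomp> \<delta>) = irange x" "psource (\<nu> \<Zcomp> \<delta>) = irange x" "psource (\<kappa> \<Zcomp> \<epsilon>) = irange x"
proof -
  obtain \<mu> \<nu> \<delta> \<xi> \<kappa> \<epsilon> x where *: "psource \<nu> = prange \<delta>" "psource \<xi> = prange \<epsilon>" "psource \<delta> = irange x" "psource \<epsilon> = irange x"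
     "(\<mu>, \<nu>, \<delta> \<odot> x) \<in> germ_triples k" "(\<xi>, \<kappa>, \<epsilon> \<odot> x) \<in> germ_triples k" "\<nu> \<Zcomp> \<delta> = \<xi> \<Zcomp> \<epsilon>"
     "a = germ \<mu> \<nu> (\<delta> \<odot> x)" "b = germ \<xi> \<kappa> (\<epsilon> \<odot> x)" "c = germ (\<mu> \<Zcomp> \<delta>) (\<kappa> \<Zcomp> \<epsilon>) x"
    using assms unfolding is_product_def by blast
  have ps: "psource \<mu> = prange \<delta>" "psource \<kappa> = prange \<epsilon>" using *(5,6) by (auto simp: germ_triples_def)
  show ?thesis
  proof (rule that)
    show "a = germ (\<mu> \<Zcomp> \<delta>) (\<nu> \<Zcomp> \<delta>) x" unfolding *(8) using *(1,3) ps by (intro germ_pcomp[symmetric])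
    show "b = germ (\<nu> \<Zcomp> \<delta>) (\<kappa> \<Zcomp> \<epsilon>) x" unfolding *(7,9) using *(2,4) ps by (intro germ_pcomp[symmetric])
    show "psource (\<nu> \<Zcomp> \<delta>) = irange x" using * by simp
  qed (use * ps in simp_all)
qed

lemma is_product_ranges:
  assumes "is_product k a b c"
  shows "grange a = grange c" "gsource b = gsource c" "gsource a = grange b"
  using assms by (auto elim!: is_productE simp: grange_germ gsource_germ)

text \<open>Products are given through representatives. One refinement has to reconcile two
  presentations of a and two of b simultaneously.\<close>

lemma is_product_unique:
  assumes "is_product k a b c" "is_product k a b c'" shows "c = c'"
proof -
  obtain \<mu> \<nu> \<kappa> x where 1: "a = germ \<mu> \<nu> x" "b = germ \<nu> \<kappa> x" "c = germ \<mu> \<kappa> x"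
    "psource \<mu> = irange x" "psource \<nu> = irange x" "psource \<kappa> = irange x"
    using assms(1) by (elim is_productE) blast
  obtain \<mu>' \<nu>' \<kappa>' x' where 2: "a = germ \<mu>' \<nu>' x'" "b = germ \<nu>' \<kappa>' x'" "c' = germ \<mu>' \<kappa>' x'"
    "psource \<mu>' = irange x'" "psource \<nu>' = irange x'" "psource \<kappa>' = irange x'"
    using assms(2) by (elim is_productE) blast
  obtain \<sigma> \<sigma>' z where s: "\<mu> \<Zcomp> \<sigma> = \<mu>' \<Zcomp> \<sigma>'" "\<nu> \<Zcomp> \<sigma> = \<nu>' \<Zcomp> \<sigma>'" "x = \<sigma> \<odot> z" "x' = \<sigma>' \<odot> z"
      "prange \<sigma> = psource \<mu>" "prange \<sigma>' = psource \<mu>'" "psource \<sigma> = irange z" "psource \<sigma>' = irange z"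
    using germ_eqE[of \<mu> \<nu> x \<mu>' \<nu>' x'] 1 2 by metis
  obtain \<rho> \<rho>' y where r: "\<nu> \<Zcomp> \<rho> = \<nu>' \<Zcomp> \<rho>'" "\<kappa> \<Zcomp> \<rho> = \<kappa>' \<Zcomp> \<rho>'" "x = \<rho> \<odot> y" "x' = \<rho>' \<odot> y"
      "prange \<rho> = psource \<nu>" "prange \<rho>' = psource \<nu>'" "psource \<rho> = irange y" "psource \<rho>' = irange y"
    using germ_eqE[of \<nu> \<kappa> x \<nu>' \<kappa>' x'] 1 2 by metis
  have "\<sigma> \<odot> z = \<rho> \<odot> y" using s r by simp
  then obtain \<alpha> \<beta> w where w: "\<sigma> \<Zcomp> \<alpha> = \<rho> \<Zcomp> \<beta>" "z = \<alpha> \<odot> w" "y = \<beta> \<odot> w"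
    "prange \<alpha> = psource \<sigma>" "prange \<beta> = psource \<rho>" "psource \<alpha> = irange w" "psource \<beta> = irange w"
    using common_extension[of \<sigma> z \<rho> y] s(7) r(7) by metis
  have "\<nu>' \<Zcomp> (\<sigma>' \<Zcomp> \<alpha>) = \<nu>' \<Zcomp> (\<rho>' \<Zcomp> \<beta>)" using s(2) r(1) w(1) by (metis pcomp_assoc)
  \<comment> \<open>Cancelling \<nu>' shows that the refinement chosen on the unprimed side fits the
    primed side as well.\<close>
  then have eq: "\<sigma>' \<Zcomp> \<alpha> = \<rho>' \<Zcomp> \<beta>" using pcomp_left_cancel s(6) r(6) 2 by simp
  have zr: "irange z = prange \<alpha>" "irange y = prange \<beta>" using w by simp_all
  have psa: "psource (\<sigma> \<Zcomp> \<alpha>) = irange w" "psource (\<sigma>' \<Zcomp> \<alpha>) = irange w" using w s zr by simp_all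
  have x: "x = (\<sigma> \<Zcomp> \<alpha>) \<odot> w" "x' = (\<sigma>' \<Zcomp> \<alpha>) \<odot> w"
    unfolding s(3,4) w(2) icomp_pcomp by (rule refl)+
  have "c = germ (\<mu> \<Zcomp> (\<sigma> \<Zcomp> \<alpha>)) (\<kappa> \<Zcomp> (\<sigma> \<Zcomp> \<alpha>)) w"
    using 1 s(5) psa x(1) germ_pcomp[of \<mu> "\<sigma> \<Zcomp> \<alpha>" \<kappa> w] by simp
  also have "\<mu> \<Zcomp> (\<sigma> \<Zcomp> \<alpha>) = \<mu>' \<Zcomp> (\<sigma>' \<Zcomp> \<alpha>)" using s(1) by (metis pcomp_assoc)
  also have "\<kappa> \<Zcomp> (\<sigma> \<Zcomp> \<alpha>) = \<kappa>' \<Zcomp> (\<sigma>' \<Zcomp> \<alpha>)" unfolding w(1) eq using r(2) by (metis pcomp_assoc)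
  also have "germ (\<mu>' \<Zcomp> (\<sigma>' \<Zcomp> \<alpha>)) (\<kappa>' \<Zcomp> (\<sigma>' \<Zcomp> \<alpha>)) w = c'"
    using 2 s(6) psa x(2) germ_pcomp[of \<mu>' "\<sigma>' \<Zcomp> \<alpha>" \<kappa>' w] by simp
  finally show ?thesis .
qed

lemma is_product_unit:
  assumes "is_product k a b (unit_germ x)"
  shows "b = ginv a"
proof -
  obtain \<mu> \<nu> \<kappa> y where 1: "a = germ \<mu> \<nu> y" "b = germ \<nu> \<kappa> y" "unit_germ x = germ \<mu> \<kappa> y"
    "psource \<mu> = irange y" "psource \<nu> = irange y" "psource \<kappa> = irange y"
    using assms by (elim is_productE) blast
  have "germ \<mu> \<kappa> y = germ (vertex 1) (vertex 1) x" using 1(3) by (simp add: unit_germ_def)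
  then obtain \<sigma> \<sigma>' where "\<mu> \<Zcomp> \<sigma> = vertex 1 \<Zcomp> \<sigma>'" "\<kappa> \<Zcomp> \<sigma> = vertex 1 \<Zcomp> \<sigma>'"
    using germ_eqE 1 by metis
  then have "\<mu> = \<kappa>" using pcomp_right_cancel by metis
  then show ?thesis using 1 by (simp add: ginv_germ)
qed

text \<open>The middle paths are matched by a common extension whose part \<tau> is no longer than
  \<nu>, hence bounded by the left factor alone. The product formula is stated for all base points
  y' because whole cells have to be multiplied later.\<close>

lemma is_product_compose:
  assumes gp: "gpair k \<mu> \<nu>" "gpair k \<delta> \<epsilon>" and z: "z \<in> Zs k \<nu>" and x: "x \<in> Zs k \<delta>" and eq: "\<nu> \<odot> z = \<delta> \<odot> x"
  obtains \<delta>1 \<tau> y where "\<nu> \<Zcomp> \<delta>1 = \<delta> \<Zcomp> \<tau>" "z = \<delta>1 \<odot> y" "x = \<tau> \<odot> y" "plen \<tau> \<le> plen \<nu>"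
    "prange \<delta>1 = psource \<nu>" "prange \<tau> = psource \<delta>" "psource \<delta>1 = irange y" "psource \<tau> = irange y" "y \<in> ipaths k"
    "\<forall>y'\<in>ipaths k. irange y' = irange y \<longrightarrow>
      is_product k (germ \<mu> \<nu> (\<delta>1 \<odot> y')) (germ \<delta> \<epsilon> (\<tau> \<odot> y')) (germ (\<mu> \<Zcomp> \<delta>1) (\<epsilon> \<Zcomp> \<tau>) y')"
proof -
  have nu_z: "psource \<nu> = irange z" and de_x: "psource \<delta> = irange x" using z x by (simp_all add: ipaths_from_def)
  obtain \<delta>1 \<tau> y where c: "\<nu> \<Zcomp> \<delta>1 = \<delta> \<Zcomp> \<tau>" "z = \<delta>1 \<odot> y" "x = \<tau> \<odot> y" "plen \<tau> \<le> plen \<nu>"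
    "prange \<delta>1 = psource \<nu>" "prange \<tau> = psource \<delta>" "psource \<delta>1 = irange y" "psource \<tau> = irange y"
    by (rule common_extension[OF eq nu_z de_x])
  have L: "\<delta>1 \<in> Lambda k" "\<tau> \<in> Lambda k" "y \<in> ipaths k"
    using z x c icomp_ipaths_iff[of y \<delta>1 k] icomp_ipaths_iff[of y \<tau> k] by (auto simp: ipaths_from_def)
  have "is_product k (germ \<mu> \<nu> (\<delta>1 \<odot> y')) (germ \<delta> \<epsilon> (\<tau> \<odot> y')) (germ (\<mu> \<Zcomp> \<delta>1) (\<epsilon> \<Zcomp> \<tau>) y')"
    if y': "y' \<in> ipaths k" "irange y' = irange y" for y'
  proof -
    have "\<delta>1 \<odot> y' \<in> ipaths k" "\<tau> \<odot> y' \<in> ipaths k"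
      using L y' c icomp_ipaths_iff[of y' \<delta>1 k] icomp_ipaths_iff[of y' \<tau> k] by auto
    then have tr: "(\<mu>, \<nu>, \<delta>1 \<odot> y') \<in> germ_triples k" "(\<delta>, \<epsilon>, \<tau> \<odot> y') \<in> germ_triples k"
      using gp c(5,6) by (auto simp: germ_triples_iff ipaths_from_def gpair_def)
    have ps: "psource \<delta>1 = irange y'" "psource \<tau> = irange y'" using c(7,8) y'(2) by simp_all
    show ?thesis unfolding is_product_def
      by (intro exI[of _ \<mu>] exI[of _ \<nu>] exI[of _ \<delta>1] exI[of _ \<delta>] exI[of _ \<epsilon>] exI[of _ \<tau>] exI[of _ y']
          conjI L(1,2) c(5,6)[symmetric] ps tr c(1) refl)
  qed
  then show ?thesis using that[OF c L(3)] by blast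
qed

definition gprod :: "(nat \<Rightarrow> nat) \<Rightarrow> gelem set \<Rightarrow> gelem set \<Rightarrow> gelem set" where
  "gprod k U V = {c. \<exists>a\<in>U. \<exists>b\<in>V. is_product k a b c}"

lemma inj_on_germ_set:
  "F \<subseteq> ipaths_from k m \<Longrightarrow> inj_on grange (germ_set \<mu> \<nu> F)"
  "F \<subseteq> ipaths_from k m \<Longrightarrow> inj_on gsource (germ_set \<mu> \<nu> F)"
  unfolding inj_on_def germ_set_def
  by (auto simp: grange_germ gsource_germ ipaths_from_def subset_iff icomp_left_cancel)

text \<open>The range of c determines a in U and the source of c determines b in V, so the
  convolution sum has at most one non-zero term.\<close>

lemma convolution_bisections:
  assumes f: "\<And>a. f a \<noteq> 0 \<Longrightarrow> a \<in> U" and g: "\<And>b. g b \<noteq> 0 \<Longrightarrow> b \<in> V"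
    and U: "inj_on grange U" and V: "inj_on gsource V"
  shows "a \<in> U \<Longrightarrow> b \<in> V \<Longrightarrow> is_product k a b c \<Longrightarrow> convolution k f g c = f a * g b"
    and "c \<notin> gprod k U V \<Longrightarrow> convolution k f g c = 0"
proof -
  let ?h = "\<lambda>(a, b). f a * g b"
  show "convolution k f g c = f a * g b" if "a \<in> U" "b \<in> V" "is_product k a b c"
  proof -
    have "?h p = 0" if p: "p \<in> {(a, b). is_product k a b c} - {(a, b)}" for p
    proof (rule ccontr)
      obtain a' b' where p': "p = (a', b')" by (cases p)
      assume "?h p \<noteq> 0"
      then have "a' \<in> U" "b' \<in> V" using f g p' by auto
      moreover have pr: "is_product k a' b' c" using p p' by auto
      ultimately have "a' = a" "b' = b"
        using U V \<open>a \<in> U\<close> \<open>b \<in> V\<close> is_product_ranges[OF pr] is_product_ranges[OF \<open>is_product k a b c\<close>]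
        by (auto simp: inj_on_def)
      then show False using p p' by simp
    qed
    then have "infsum ?h {(a, b). is_product k a b c} = infsum ?h {(a, b)}"
      using that by (intro infsum_cong_neutral) auto
    then show ?thesis by (simp add: convolution_def)
  qed
  show "convolution k f g c = 0" if "c \<notin> gprod k U V"
  proof -
    have "?h p = 0" if p: "p \<in> {(a, b). is_product k a b c}" for p
    proof (rule ccontr)
      obtain a b where ab: "p = (a, b)" by (cases p)
      assume "?h p \<noteq> 0"
      then have "a \<in> U" "b \<in> V" using f g ab by auto
      then show False using p ab \<open>c \<notin> gprod k U V\<close> by (auto simp: gprod_def)
    qed
    then show ?thesis unfolding convolution_def by (intro infsum_0) auto
  qed
qed

lemma convolution_indicator:
  assumes "inj_on grange U" "inj_on gsource V"
  shows "convolution k (indicator U) (indicator V) = indicator (gprod k U V)"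
proof
  fix c
  have nz: "x \<in> S" if "(indicator S x :: complex) \<noteq> 0" for x and S :: "gelem set"
    using that by (simp add: indicator_def split: if_splits)
  show "convolution k (indicator U) (indicator V) c = indicator (gprod k U V) c"
  proof (cases "c \<in> gprod k U V")
    case True
    then obtain a b where ab: "a \<in> U" "b \<in> V" "is_product k a b c" by (auto simp: gprod_def)
    have "convolution k (indicator U) (indicator V) c = indicator U a * indicator V b"
      by (rule convolution_bisections(1)[OF _ _ assms ab]) (rule nz; assumption)+
    then show ?thesis using ab True by simp
  next
    case False
    have "convolution k (indicator U) (indicator V) c = 0"
      by (rule convolution_bisections(2)[OF _ _ assms False]) (rule nz; assumption)+
    then show ?thesis using False by simp
  qed
qed

text \<open>The constant C collects one |\<nu>| for the extension \<tau>, one for \<gamma>-edges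
  among the first |\<nu>| positions and 1 from \<open>band_index\<close>. The reduced pair of the
  product has its base point behind the stripped suffix \<sigma>, so the cell must be finer by
  |\<sigma>|; what \<open>band_index\<close> leaves of C covers exactly this.\<close>

lemma gprod_level:
  assumes inf: "infinite {i. 1 \<le> i \<and> k i \<noteq> 0}"
    and gp: "gpair k \<mu> \<nu>" and F: "F \<subseteq> Zs k \<mu>" "sat k q0 F"
    and S: "(\<delta>, \<epsilon>) \<in> S_pairs k j l" and E: "E \<subseteq> Zs k \<delta>" "sat k q E"
    and S2: "(\<delta>2, \<epsilon>2) \<in> S_pairs k j2 l2" and y2: "y2 \<in> Zs k \<delta>2"
    and c: "germ \<delta>2 \<epsilon>2 y2 \<in> gprod k (germ_set \<mu> \<nu> F) (germ_set \<delta> \<epsilon> E)"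
    and C: "C = max j 1 + l + 2 * plen \<nu> + 1"
  shows "max j2 1 + l2 \<le> C"
    and "y' \<in> cls k (C + max q q0 - (max j2 1 + l2)) y2 \<Longrightarrow> germ \<delta>2 \<epsilon>2 y' \<in> gprod k (germ_set \<mu> \<nu> F) (germ_set \<delta> \<epsilon> E)"
proof -
  have gpd: "gpair k \<delta> \<epsilon>" "red \<delta> \<epsilon>" and gp2: "gpair k \<delta>2 \<epsilon>2" "red \<delta>2 \<epsilon>2" using S_pairs_gpair S S2 by blast+
  obtain z x where zx: "z \<in> F" "x \<in> E" and pr: "is_product k (germ \<mu> \<nu> z) (germ \<delta> \<epsilon> x) (germ \<delta>2 \<epsilon>2 y2)"
    using c by (auto simp: gprod_def germ_set_def)
  have nz: "\<nu> \<odot> z = \<delta> \<odot> x" using is_product_ranges(3)[OF pr] by (simp add: grange_germ gsource_germ)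
  have zZ: "z \<in> Zs k \<nu>" using zx F gpair_psource[OF gp] by auto
  obtain \<delta>1 \<tau> y where t: "\<nu> \<Zcomp> \<delta>1 = \<delta> \<Zcomp> \<tau>" "z = \<delta>1 \<odot> y" "x = \<tau> \<odot> y" "plen \<tau> \<le> plen \<nu>"
    "prange \<delta>1 = psource \<nu>" "prange \<tau> = psource \<delta>" "psource \<delta>1 = irange y" "psource \<tau> = irange y" "y \<in> ipaths k"
    "\<forall>y'\<in>ipaths k. irange y' = irange y \<longrightarrow>
      is_product k (germ \<mu> \<nu> (\<delta>1 \<odot> y')) (germ \<delta> \<epsilon> (\<tau> \<odot> y')) (germ (\<mu> \<Zcomp> \<delta>1) (\<epsilon> \<Zcomp> \<tau>) y')"
    by (rule is_product_compose[OF gp gpd(1) zZ subsetD[OF E(1) zx(2)] nz])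
  have "is_product k (germ \<mu> \<nu> z) (germ \<delta> \<epsilon> x) (germ (\<mu> \<Zcomp> \<delta>1) (\<epsilon> \<Zcomp> \<tau>) y)"
    using t(10)[rule_format, OF t(9) refl] unfolding t(2,3) .
  then have eq: "germ (\<mu> \<Zcomp> \<delta>1) (\<epsilon> \<Zcomp> \<tau>) y = germ \<delta>2 \<epsilon>2 y2" using is_product_unique pr by blast
  have ps: "psource (\<mu> \<Zcomp> \<delta>1) = irange y" "psource (\<epsilon> \<Zcomp> \<tau>) = irange y"
    using t gp gpd by (auto simp: gpair_def)
  have ps2: "psource \<delta>2 = irange y2" "psource \<epsilon>2 = irange y2" using y2 gp2 by (auto simp: gpair_def ipaths_from_def)
  obtain \<sigma> where s: "\<mu> \<Zcomp> \<delta>1 = \<delta>2 \<Zcomp> \<sigma>" "\<epsilon> \<Zcomp> \<tau> = \<epsilon>2 \<Zcomp> \<sigma>" "y2 = \<sigma> \<odot> y" "prange \<sigma> = psource \<delta>2" "psource \<sigma> = irange y"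
    using red_germ_common[OF eq ps gp2(2) ps2] .
  have "plen \<mu> = plen \<nu>" using gp by (auto simp: gpair_def psource_def Lambda_from_def)
  then have bnd: "max j2 1 + l2 + plen \<sigma> \<le> C"
    using band_index[OF inf S S2 t(1)[symmetric] s(1,2)] t(4) C by simp
  then show "max j2 1 + l2 \<le> C" by simp
  assume y': "y' \<in> cls k (C + max q q0 - (max j2 1 + l2)) y2"
  then have y'i: "y' \<in> ipaths k" and "ceq (C + max q q0 - (max j2 1 + l2)) y2 y'" by (auto simp: cls_def)
  \<comment> \<open>The band estimate leaves room for the |\<sigma>| levels spent on cancelling
    \<sigma>; prefixing \<delta>1 and \<tau> afterwards costs nothing.\<close>
  then have "ceq (max q q0 + plen \<sigma>) (\<sigma> \<odot> y) y'" using bnd unfolding s(3) by (elim ceq_mono) simp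
  then obtain y1 where y1: "y' = \<sigma> \<odot> y1" "irange y1 = psource \<sigma>" "y1 \<in> ipaths k" "ceq (max q q0) y y1"
    using ceq_transport s(5) y'i by metis
  have r1: "irange y1 = irange y" using y1 s by simp
  have "ceq (max q q0) (\<delta>1 \<odot> y) (\<delta>1 \<odot> y1)" "ceq (max q q0) (\<tau> \<odot> y) (\<tau> \<odot> y1)"
    using y1(4) t(7,8) by (auto intro: ceq_icomp)
  then have "ceq q0 z (\<delta>1 \<odot> y1)" "ceq q x (\<tau> \<odot> y1)" unfolding t(2,3) by (auto elim: ceq_mono)
  moreover have "\<delta>1 \<odot> y1 \<in> ipaths k" "\<tau> \<odot> y1 \<in> ipaths k"
  proof -
    have "\<delta>1 \<odot> y \<in> ipaths k" "\<tau> \<odot> y \<in> ipaths k"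
      using subsetD[OF F(1) zx(1)] subsetD[OF E(1) zx(2)] unfolding t(2,3) ipaths_from_def by blast+
    then show "\<delta>1 \<odot> y1 \<in> ipaths k" "\<tau> \<odot> y1 \<in> ipaths k"
      using icomp_in_ipaths t(7,8) y1(3) r1 by metis+
  qed
  ultimately have "\<delta>1 \<odot> y1 \<in> F" "\<tau> \<odot> y1 \<in> E" using satD[OF F(2)] satD[OF E(2)] zx by blast+
  moreover have "germ (\<mu> \<Zcomp> \<delta>1) (\<epsilon> \<Zcomp> \<tau>) y1 = germ \<delta>2 \<epsilon>2 y'"
    unfolding s(1,2) y1(1) using s gp2 r1 by (intro germ_pcomp) (auto simp: gpair_def)
  ultimately show "germ \<delta>2 \<epsilon>2 y' \<in> gprod k (germ_set \<mu> \<nu> F) (germ_set \<delta> \<epsilon> E)"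
    using t(10)[rule_format, OF y1(3) r1] by (auto simp: gprod_def germ_set_def)
qed


section \<open>The full norm on bisections\<close>

definition unit_fun :: "(nat \<Rightarrow> nat) \<Rightarrow> (ipath \<Rightarrow> complex) \<Rightarrow> gelem \<Rightarrow> complex" where
  "unit_fun k \<phi> g = (if g \<in> germ_set (vertex 1) (vertex 1) (ipaths_from k 1) then \<phi> (gsource g) else 0)"

definition lcont :: "(nat \<Rightarrow> nat) \<Rightarrow> (ipath \<Rightarrow> complex) \<Rightarrow> bool" where
  "lcont k \<phi> \<longleftrightarrow> (\<forall>x\<in>ipaths_from k 1. \<forall>e>0. \<exists>q. \<forall>y\<in>cls k q x. dist (\<phi> y) (\<phi> x) < e)"

lemma lcont_comp:
  assumes "lcont k \<phi>" "\<And>z. isCont U z" shows "lcont k (\<lambda>x. U (\<phi> x))"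
  unfolding lcont_def
proof (intro ballI allI impI)
  fix x and e :: real assume x: "x \<in> ipaths_from k 1" and e: "0 < e"
  obtain d where d: "0 < d" "\<And>z. dist z (\<phi> x) < d \<Longrightarrow> dist (U z) (U (\<phi> x)) < e"
    using assms(2)[of "\<phi> x"] e unfolding continuous_at_eps_delta by blast
  obtain q where "\<forall>y\<in>cls k q x. dist (\<phi> y) (\<phi> x) < d" using assms(1) x d(1) unfolding lcont_def by blast
  then show "\<exists>q. \<forall>y\<in>cls k q x. dist (U (\<phi> y)) (U (\<phi> x)) < e" using d(2) by blast
qed

lemma gpair_vertex: "gpair k (vertex 1) (vertex 1)"
  by (simp add: gpair_def Lambda_from_def vertex_Lambda)

lemma red_vertex: "red (vertex 1) (vertex 1)"
proof -
  have "plen \<sigma> = 0" if "vertex 1 = \<delta> \<Zcomp> \<sigma>" for \<delta> \<sigma>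
    using arg_cong[OF that, of plen] by simp
  then show ?thesis unfolding red_def by fastforce
qed

lemma unit_rpair: "(vertex 1, vertex 1) \<in> rpairs k"
  using gpair_vertex red_vertex by (simp add: rpairs_def)

lemma germ_diagonal:
  assumes "\<epsilon> \<in> Lambda_from k 1" "y \<in> Zs k \<epsilon>"
  shows "germ \<epsilon> \<epsilon> y = germ (vertex 1) (vertex 1) (\<epsilon> \<odot> y)" "\<epsilon> \<odot> y \<in> ipaths_from k 1"
proof -
  have p: "prange \<epsilon> = 1" "irange y = psource \<epsilon>" "y \<in> ipaths k" "\<epsilon> \<in> Lambda k"
    using assms by (auto simp: Lambda_from_def ipaths_from_def)
  show "germ \<epsilon> \<epsilon> y = germ (vertex 1) (vertex 1) (\<epsilon> \<odot> y)"
    using germ_pcomp[of "vertex 1" \<epsilon> "vertex 1" y] p by (simp add: vertex_pcomp)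
  show "\<epsilon> \<odot> y \<in> ipaths_from k 1" using p icomp_ipaths_iff by (simp add: ipaths_from_def)
qed

text \<open>The unit space is the bisection of the reduced pair of vertices, so a germ is a unit
  exactly if the two paths of a representative agree.\<close>

lemma unit_fun_germ:
  assumes "gpair k \<mu> \<nu>" "y \<in> Zs k \<mu>"
  shows "unit_fun k \<phi> (germ \<mu> \<nu> y) = (if \<mu> = \<nu> then \<phi> (\<nu> \<odot> y) else 0)"
proof -
  have "germ \<mu> \<nu> y \<in> germ_set (vertex 1) (vertex 1) (ipaths_from k 1) \<longleftrightarrow>
    (\<exists>\<sigma>. \<mu> = vertex 1 \<Zcomp> \<sigma> \<and> \<nu> = vertex 1 \<Zcomp> \<sigma> \<and> prange \<sigma> = psource (vertex 1) \<and> \<sigma> \<odot> y \<in> ipaths_from k 1)"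
    by (rule germ_set_mem_iff[OF gpair_vertex red_vertex _ assms]) simp
  also have "\<dots> \<longleftrightarrow> \<mu> = \<nu>"
  proof
    assume "\<mu> = \<nu>"
    then show "\<exists>\<sigma>. \<mu> = vertex 1 \<Zcomp> \<sigma> \<and> \<nu> = vertex 1 \<Zcomp> \<sigma> \<and> prange \<sigma> = psource (vertex 1) \<and> \<sigma> \<odot> y \<in> ipaths_from k 1"
      using assms germ_diagonal(2)[of \<mu> k y] by (intro exI[of _ \<mu>]) (auto simp: gpair_def Lambda_from_def vertex_pcomp)
  qed blast
  finally show ?thesis by (simp add: unit_fun_def gsource_germ)
qed

lemma unit_fun_Cc:
  assumes "lcont k \<phi>" shows "unit_fun k \<phi> \<in> Cc k"
  unfolding Cc_iff
proof (intro conjI allI impI)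
  fix \<mu> \<nu> x and e :: real assume *: "gpair k \<mu> \<nu>" "x \<in> Zs k \<mu>" "0 < e"
  show "\<exists>q. \<forall>y\<in>cls k q x. dist (unit_fun k \<phi> (germ \<mu> \<nu> y)) (unit_fun k \<phi> (germ \<mu> \<nu> x)) < e"
  proof (cases "\<mu> = \<nu>")
    case True
    have L: "\<nu> \<in> Lambda_from k 1" using * by (simp add: gpair_def)
    have "\<nu> \<odot> x \<in> ipaths_from k 1" using germ_diagonal(2)[OF L] * True by simp
    then obtain q where q: "\<forall>y\<in>cls k q (\<nu> \<odot> x). dist (\<phi> y) (\<phi> (\<nu> \<odot> x)) < e" using assms *(3) unfolding lcont_def by blast
    have "dist (\<phi> (\<nu> \<odot> y)) (\<phi> (\<nu> \<odot> x)) < e" "y \<in> Zs k \<mu>" if y: "y \<in> cls k q x" for y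
    proof -
      show yZ: "y \<in> Zs k \<mu>" using cls_ipaths_from[OF *(2)] y by blast
      have "ceq q (\<nu> \<odot> x) (\<nu> \<odot> y)" using y * True by (intro ceq_icomp) (auto simp: cls_def ipaths_from_def)
      then have "\<nu> \<odot> y \<in> cls k q (\<nu> \<odot> x)" using germ_diagonal(2)[OF L, of y] yZ True by (simp add: cls_def ipaths_from_def)
      then show "dist (\<phi> (\<nu> \<odot> y)) (\<phi> (\<nu> \<odot> x)) < e" using q by blast
    qed
    then show ?thesis using unit_fun_germ[OF *(1)] *(2) True by (intro exI[of _ q]) simp
  next
    case False
    then show ?thesis using unit_fun_germ[OF *(1)] *(2,3) cls_ipaths_from[OF *(2)] by (intro exI[of _ 0]) (simp add: subset_iff)
  qed
next
  show "\<exists>\<D>. finite \<D> \<and> \<D> \<subseteq> rpairs k \<and> (\<forall>g. unit_fun k \<phi> g \<noteq> 0 \<longrightarrow> (\<exists>\<Delta>\<in>\<D>. g \<in> bis k \<Delta>))"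
    using unit_rpair by (intro exI[of _ "{(vertex 1, vertex 1)}"]) (auto simp: unit_fun_def bis_def split: if_splits)
qed

lemma germ_set_involution: "ginv g \<in> germ_set \<mu> \<nu> F \<longleftrightarrow> g \<in> germ_set \<nu> \<mu> F"
proof -
  have "ginv g \<in> germ_set \<nu> \<mu> F" if "g \<in> germ_set \<mu> \<nu> F" for g \<mu> \<nu>
    using that by (auto simp: germ_set_def ginv_germ)
  then show ?thesis by (metis ginv_ginv)
qed

lemma involution_indicator: "involution (indicator (germ_set \<mu> \<nu> F)) = indicator (germ_set \<nu> \<mu> F)"
  unfolding involution_def by (auto simp: fun_eq_iff indicator_def germ_set_involution)

text \<open>Two germs of a bisection with the same range coincide, so the product lives on the unit
  space, and \<phi> is the squared modulus of f transported along the source map.\<close>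

lemma star_times_self:
  assumes \<Delta>: "gpair k \<delta> \<epsilon>" and f: "\<And>g. f g \<noteq> 0 \<Longrightarrow> g \<in> germ_set \<delta> \<epsilon> (Zs k \<delta>)"
    and \<phi>1: "\<And>y. y \<in> Zs k \<delta> \<Longrightarrow> \<phi> (\<epsilon> \<odot> y) = cnj (f (germ \<delta> \<epsilon> y)) * f (germ \<delta> \<epsilon> y)"
    and \<phi>0: "\<And>x. \<not> divs \<epsilon> x \<Longrightarrow> \<phi> x = 0"
  shows "convolution k (involution f) f = unit_fun k \<phi>"
proof
  fix c
  let ?U = "germ_set \<epsilon> \<delta> (Zs k \<delta>)" and ?V = "germ_set \<delta> \<epsilon> (Zs k \<delta>)"
  have inv: "involution f a \<noteq> 0 \<Longrightarrow> a \<in> ?U" for a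
    using f[of "ginv a"] germ_set_involution by (auto simp: involution_def)
  have inj: "inj_on grange ?U" "inj_on gsource ?V" by (rule inj_on_germ_set[OF order_refl])+
  have L: "\<epsilon> \<in> Lambda_from k 1" "psource \<epsilon> = psource \<delta>" using \<Delta> by (auto simp: gpair_def)
  have prod: "is_product k (germ \<epsilon> \<delta> y) (germ \<delta> \<epsilon> y) (germ \<epsilon> \<epsilon> y)" if y: "y \<in> Zs k \<delta>" for y
  proof -
    have yl: "irange y = psource \<delta>" "y \<in> ipaths k" using y by (simp_all add: ipaths_from_def)
    let ?v = "vertex (psource \<delta>)"
    have v1: "?v \<odot> y = y" using yl(1) by (rule vertex_icomp)
    have v2: "\<epsilon> \<Zcomp> ?v = \<epsilon>" "\<delta> \<Zcomp> ?v = \<delta>" "psource ?v = psource \<delta>" "prange ?v = psource \<delta>"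
      using L(2) pcomp_vertex by simp_all
    have v3: "?v \<in> Lambda k" using gpair_psource[OF \<Delta>] by (simp add: vertex_Lambda)
    have v4: "(\<epsilon>, \<delta>, y) \<in> germ_triples k" "(\<delta>, \<epsilon>, y) \<in> germ_triples k"
      using \<Delta> gpair_sym[OF \<Delta>] y L(2) unfolding germ_triples_iff by simp_all
    show ?thesis
      unfolding is_product_def
      by (rule exI[of _ \<epsilon>], rule exI[of _ \<delta>], rule exI[of _ ?v], rule exI[of _ \<delta>],
          rule exI[of _ \<epsilon>], rule exI[of _ ?v], rule exI[of _ y],
          simp add: yl L(2) v1 v2 v3 v4)
  qed
  show "convolution k (involution f) f c = unit_fun k \<phi> c"
  proof (cases "c \<in> gprod k ?U ?V")
    case True
    then obtain y z where yz: "y \<in> Zs k \<delta>" "z \<in> Zs k \<delta>" and pr: "is_product k (germ \<epsilon> \<delta> y) (germ \<delta> \<epsilon> z) c"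
      by (auto simp: gprod_def germ_set_def)
    have "\<delta> \<odot> y = \<delta> \<odot> z" using is_product_ranges(3)[OF pr] by (simp add: grange_germ gsource_germ)
    then have "y = z" using yz icomp_left_cancel by (simp add: ipaths_from_def)
    then have c: "c = germ \<epsilon> \<epsilon> y" and pr: "is_product k (germ \<epsilon> \<delta> y) (germ \<delta> \<epsilon> y) c"
      using is_product_unique[OF pr] prod[OF yz(1)] pr by simp_all
    have "convolution k (involution f) f c = involution f (germ \<epsilon> \<delta> y) * f (germ \<delta> \<epsilon> y)"
      using convolution_bisections(1)[of "involution f" ?U f ?V, OF inv f inj _ _ pr] yz by (auto simp: germ_set_def)
    also have "\<dots> = \<phi> (\<epsilon> \<odot> y)" using \<phi>1[OF yz(1)] by (simp add: involution_def ginv_germ)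
    also have "\<dots> = unit_fun k \<phi> c"
      unfolding c using unit_fun_germ[of k \<epsilon> \<epsilon> y \<phi>] L yz by (simp add: gpair_def)
    finally show ?thesis .
  next
    case False
    have "unit_fun k \<phi> c = 0"
    proof (rule ccontr)
      assume "unit_fun k \<phi> c \<noteq> 0"
      then obtain x where x: "c = germ (vertex 1) (vertex 1) x" "x \<in> ipaths_from k 1" and nz: "\<phi> (gsource c) \<noteq> 0"
        by (auto simp: unit_fun_def germ_set_def split: if_splits)
      have "gsource c = x" using x by (simp add: gsource_germ vertex_icomp ipaths_from_def)
      then have "divs \<epsilon> x" using nz \<phi>0 by metis
      then obtain y where y: "x = \<epsilon> \<odot> y" "irange y = psource \<epsilon>" by (auto simp: divs_def)
      then have yZ: "y \<in> Zs k \<delta>" using x(2) L icomp_ipaths_iff by (auto simp: ipaths_from_def)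
      have "c = germ \<epsilon> \<epsilon> y" using germ_diagonal(1)[OF L(1), of y] yZ L x y by simp
      then have "c \<in> gprod k ?U ?V" using prod[OF yZ] yZ by (auto simp: gprod_def germ_set_def)
      then show False using False by blast
    qed
    then show ?thesis using convolution_bisections(2)[of "involution f" ?U f ?V, OF inv f inj False] by simp
  qed
qed

text \<open>\<open>f\<^sup>* f\<close> is a function \<open>\<phi>\<close> on the unit space with values in \<open>[0, 1]\<close>, hence the average of the
  unitaries \<open>\<phi> \<plusminus> i \<surd>(1 - \<phi>\<^sup>2)\<close>, on which every C*-seminorm is at most 1.\<close>

lemma seminorm_bisection:
  assumes N: "cstar_seminorm k N" and f: "f \<in> Cc k" and \<Delta>: "gpair k \<delta> \<epsilon>"
    and sup: "\<And>g. f g \<noteq> 0 \<Longrightarrow> g \<in> germ_set \<delta> \<epsilon> (Zs k \<delta>)" and le1: "\<And>g. cmod (f g) \<le> 1"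
  shows "N f \<le> 1"
proof -
  have tri: "N (\<lambda>a. f a + g a) \<le> N f + N g" and hom: "N (\<lambda>a. c * f a) = cmod c * N f"
    and star: "N (convolution k (involution f) f) = (N f)\<^sup>2" if "f \<in> Cc k" "g \<in> Cc k" for f g c
    using N that unfolding cstar_seminorm_def by blast+
  have L: "\<epsilon> \<in> Lambda_from k 1" "psource \<epsilon> = psource \<delta>" using \<Delta> by (auto simp: gpair_def)
  \<comment> \<open>The description picks the base point of the germ with source x; it is unique by
    left cancellation.\<close>
  define \<phi> where "\<phi> x = (if divs \<epsilon> x then of_real ((cmod (f (germ \<delta> \<epsilon> (THE y. irange y = psource \<epsilon> \<and> x = \<epsilon> \<odot> y))))\<^sup>2) else (0::complex))" for x
  have \<phi>y: "\<phi> (\<epsilon> \<odot> y) = of_real ((cmod (f (germ \<delta> \<epsilon> y)))\<^sup>2)" if "irange y = psource \<epsilon>" for y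
  proof -
    have "(THE y'. irange y' = psource \<epsilon> \<and> \<epsilon> \<odot> y = \<epsilon> \<odot> y') = y"
      using that icomp_left_cancel by (intro the_equality) auto
    then show ?thesis using that by (simp add: \<phi>_def divs_icomp)
  qed
  have conv: "convolution k (involution f) f = unit_fun k \<phi>"
  proof (rule star_times_self[OF \<Delta> sup])
    show "\<phi> (\<epsilon> \<odot> y) = cnj (f (germ \<delta> \<epsilon> y)) * f (germ \<delta> \<epsilon> y)" if "y \<in> Zs k \<delta>" for y
      using \<phi>y[of y] that L complex_norm_square[of "f (germ \<delta> \<epsilon> y)"] by (simp add: ipaths_from_def mult.commute)
  qed (auto simp: \<phi>_def)
  have lc: "lcont k \<phi>"
    unfolding lcont_def
  proof (intro ballI allI impI)
    fix x and e :: real assume x: "x \<in> ipaths_from k 1" and e: "0 < e"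
    show "\<exists>q. \<forall>y\<in>cls k q x. dist (\<phi> y) (\<phi> x) < e"
    proof (cases "divs \<epsilon> x")
      case False
      have "\<phi> y = 0" if "y \<in> cls k (plen \<epsilon>) x" for y
        using that False ceq_divs[of "plen \<epsilon>" x y \<epsilon>] by (simp add: cls_def \<phi>_def)
      moreover have "\<phi> x = 0" using False by (simp add: \<phi>_def)
      ultimately show ?thesis using e by (intro exI[of _ "plen \<epsilon>"]) simp
    next
      case True
      then obtain z where z: "x = \<epsilon> \<odot> z" "irange z = psource \<epsilon>" by (auto simp: divs_def)
      then have zZ: "z \<in> Zs k \<delta>" using x L icomp_ipaths_iff by (auto simp: ipaths_from_def)
      have "isCont (\<lambda>w. complex_of_real ((cmod w)\<^sup>2)) (f (germ \<delta> \<epsilon> z))" by (intro continuous_intros)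
      then obtain d where d: "0 < d" "\<And>w. dist w (f (germ \<delta> \<epsilon> z)) < d \<Longrightarrow>
          dist (complex_of_real ((cmod w)\<^sup>2)) (of_real ((cmod (f (germ \<delta> \<epsilon> z)))\<^sup>2)) < e"
        unfolding continuous_at_eps_delta using e by blast
      obtain q where q: "\<forall>y\<in>cls k q z. dist (f (germ \<delta> \<epsilon> y)) (f (germ \<delta> \<epsilon> z)) < d"
        using Cc_continuous[OF f \<Delta> zZ d(1)] by blast
      have "dist (\<phi> y) (\<phi> x) < e" if y: "y \<in> cls k (q + plen \<epsilon>) x" for y
      proof -
        have "ceq (q + plen \<epsilon>) (\<epsilon> \<odot> z) y" "y \<in> ipaths k" using y z by (auto simp: cls_def)
        then obtain z' where z': "y = \<epsilon> \<odot> z'" "irange z' = psource \<epsilon>" "z' \<in> ipaths k" "ceq q z z'"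
          using ceq_transport z(2) by metis
        then have "z' \<in> cls k q z" by (simp add: cls_def)
        then show ?thesis using d(2) q \<phi>y[OF z'(2)] \<phi>y[OF z(2)] z'(1) z(1) by simp
      qed
      then show ?thesis by blast
    qed
  qed
  have re: "\<phi> x = of_real (Re (\<phi> x)) \<and> 0 \<le> Re (\<phi> x) \<and> Re (\<phi> x) \<le> 1" for x
  proof (cases "divs \<epsilon> x")
    case True
    then show ?thesis using le1 by (auto simp: \<phi>_def power_le_one)
  next
    case False
    then show ?thesis by (simp add: \<phi>_def)
  qed
  define U V where "U z = Complex (Re z) (sqrt (1 - (Re z)\<^sup>2))" and "V z = Complex (Re z) (- sqrt (1 - (Re z)\<^sup>2))" for z
  have contU: "isCont U z" "isCont V z" for z
  proof -
    have r: "isCont Re z" by (rule linear_continuous_at[OF bounded_linear_Re])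
    show "isCont U z" "isCont V z"
      unfolding U_def V_def Complex_eq by (intro continuous_intros r)+
  qed
  have UC: "unit_fun k (\<lambda>x. U (\<phi> x)) \<in> Cc k" "unit_fun k (\<lambda>x. V (\<phi> x)) \<in> Cc k"
    using lcont_comp[OF lc] contU unit_fun_Cc by blast+
  have one: "unit_fun k (\<lambda>_. 1) \<in> Cc k" by (rule unit_fun_Cc) (simp add: lcont_def)
  have gp1: "gpair k (vertex 1) (vertex 1)" by (rule gpair_vertex)
  have unitary: "convolution k (involution (unit_fun k \<psi>)) (unit_fun k \<psi>) = unit_fun k (\<lambda>_. 1)"
    if u: "\<And>x. cnj (\<psi> x) * \<psi> x = 1" for \<psi>
  proof -
    have "convolution k (involution (unit_fun k \<psi>)) (unit_fun k \<psi>) = unit_fun k (\<lambda>x. if irange x = 1 then 1 else 0)"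
    proof (rule star_times_self[OF gp1])
      fix y assume y: "y \<in> Zs k (vertex 1)"
      then have "unit_fun k \<psi> (germ (vertex 1) (vertex 1) y) = \<psi> (vertex 1 \<odot> y)" using unit_fun_germ[OF gp1] by simp
      then show "(if irange (vertex 1 \<odot> y) = 1 then 1 else 0) =
          cnj (unit_fun k \<psi> (germ (vertex 1) (vertex 1) y)) * unit_fun k \<psi> (germ (vertex 1) (vertex 1) y)"
        using u by simp
    qed (auto simp: unit_fun_def divs_vertex split: if_splits)
    also have "\<dots> = unit_fun k (\<lambda>_. 1)"
      by (auto simp: unit_fun_def fun_eq_iff germ_set_def gsource_germ)
    finally show ?thesis .
  qed
  \<comment> \<open>The unit equals its adjoint times itself, so its seminorm is a solution of t =
    t^2, that is, 0 or 1.\<close>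
  have N1: "N (unit_fun k (\<lambda>_. 1)) \<le> 1"
  proof -
    have "N (unit_fun k (\<lambda>_. 1)) = (N (unit_fun k (\<lambda>_. 1)))\<^sup>2"
      using star[OF one one] unitary[of "\<lambda>_. 1"] by simp
    then show ?thesis by (smt (verit) mult_le_cancel_right1 power2_eq_square mult_cancel_right2)
  qed
  have uni: "cnj (U z) * U z = 1" "cnj (V z) * V z = 1" if "0 \<le> Re z" "Re z \<le> 1" for z
  proof -
    have "(Re z)\<^sup>2 \<le> 1" using that by (simp add: power_le_one)
    then show "cnj (U z) * U z = 1" "cnj (V z) * V z = 1"
      by (auto simp: U_def V_def complex_eq_iff power2_eq_square[symmetric])
  qed
  have NU: "N (unit_fun k (\<lambda>x. U (\<phi> x))) \<le> 1" "N (unit_fun k (\<lambda>x. V (\<phi> x))) \<le> 1"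
  proof -
    have "(N (unit_fun k (\<lambda>x. U (\<phi> x))))\<^sup>2 \<le> 1"
      using star[OF UC(1) UC(1)] unitary[of "\<lambda>x. U (\<phi> x)"] uni re N1 by simp
    then show "N (unit_fun k (\<lambda>x. U (\<phi> x))) \<le> 1" using power2_le_imp_le[of _ 1] by simp
    have "(N (unit_fun k (\<lambda>x. V (\<phi> x))))\<^sup>2 \<le> 1"
      using star[OF UC(2) UC(2)] unitary[of "\<lambda>x. V (\<phi> x)"] uni re N1 by simp
    then show "N (unit_fun k (\<lambda>x. V (\<phi> x))) \<le> 1" using power2_le_imp_le[of _ 1] by simp
  qed
  have "unit_fun k \<phi> = (\<lambda>a. (1/2) * (unit_fun k (\<lambda>x. U (\<phi> x)) a + unit_fun k (\<lambda>x. V (\<phi> x)) a))"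
  proof
    fix a
    have "\<phi> (gsource a) = (1/2) * (U (\<phi> (gsource a)) + V (\<phi> (gsource a)))"
      using re[of "gsource a"] by (simp add: U_def V_def complex_eq_iff)
    then show "unit_fun k \<phi> a = (1/2) * (unit_fun k (\<lambda>x. U (\<phi> x)) a + unit_fun k (\<lambda>x. V (\<phi> x)) a)"
      by (simp add: unit_fun_def)
  qed
  then have "N (unit_fun k \<phi>) \<le> (1/2) * (1 + 1)"
    using hom[OF Cc_add[OF UC] one, of "1/2"] tri[OF UC] NU by simp
  then have "(N f)\<^sup>2 \<le> 1" using star[OF f f] conv by simp
  then show ?thesis using power2_le_imp_le[of "N f" 1] by simp
qed

lemma full_norm_bisection:
  assumes f: "f \<in> Cc k" and \<Delta>: "gpair k \<delta> \<epsilon>"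
    and sup: "\<And>g. f g \<noteq> 0 \<Longrightarrow> g \<in> germ_set \<delta> \<epsilon> (Zs k \<delta>)" and le: "\<And>g. cmod (f g) \<le> e" and e: "0 < e"
  shows "full_norm k f \<le> e"
  unfolding full_norm_def
proof (rule cSUP_least)
  \<comment> \<open>The zero seminorm makes the supremum one over a non-empty set.\<close>
  show "{N. cstar_seminorm k N} \<noteq> {}"
    by (auto simp: cstar_seminorm_def intro!: exI[of _ "\<lambda>_. 0"])
  fix N assume "N \<in> {N. cstar_seminorm k N}"
  then have N: "cstar_seminorm k N" by simp
  define h where "h = (\<lambda>a. of_real (1 / e) * f a)"
  have h: "h \<in> Cc k" unfolding h_def by (rule Cc_scale[OF f])
  have "N h \<le> 1"
  proof (rule seminorm_bisection[OF N h \<Delta>])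
    show "h g \<noteq> 0 \<Longrightarrow> g \<in> germ_set \<delta> \<epsilon> (Zs k \<delta>)" for g using sup by (auto simp: h_def)
    show "cmod (h g) \<le> 1" for g using le[of g] e by (simp add: h_def norm_mult norm_divide field_simps)
  qed
  moreover have "N (\<lambda>a. of_real (1 / e) * f a) = cmod (of_real (1 / e)) * N f"
    using N f unfolding cstar_seminorm_def by blast
  then have "N h = (1 / e) * N f" using e unfolding h_def norm_of_real by simp
  ultimately show "N f \<le> e" using e by (simp add: field_simps)
qed


section \<open>Approximation by locally constant functions\<close>

lemma indicator_disjoint_sum:
  assumes "finite S" "\<And>s t x. s \<in> S \<Longrightarrow> t \<in> S \<Longrightarrow> x \<in> A s \<Longrightarrow> x \<in> A t \<Longrightarrow> s = t"
  shows "indicator (\<Union>s\<in>S. A s) x = (\<Sum>s\<in>S. indicator (A s) x :: complex)"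
  using assms by (intro indicator_UN_disjoint) (auto simp: disjoint_family_on_def)

text \<open>The count q starts at 0 for the trivial partition with lower index -1.
  \<open>max j 1\<close> reflects that the pairs of index 0 and 1 share the spaces
  \<open>H_space\<close> with j = 1. With n = q - 2 the level is then the eigenvalue of the
  operator.\<close>

definition level_gens :: "(nat \<Rightarrow> nat) \<Rightarrow> nat \<Rightarrow> ((fpath \<times> fpath) \<times> ipath set) set" where
  "level_gens k N = {(\<Delta>, E). \<exists>j l q. \<Delta> \<in> S_pairs k j l \<and> max j 1 + l + q \<le> N \<and>
     E \<in> Q_part k (p_index k j + l + 1) (int q - 1)}"

definition gset :: "(fpath \<times> fpath) \<times> ipath set \<Rightarrow> gelem set" where
  "gset D = germ_set (fst (fst D)) (snd (fst D)) (snd D)"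

lemma S_pairs_rpairs: "\<Delta> \<in> S_pairs k j l \<Longrightarrow> \<Delta> \<in> rpairs k \<and> psource (fst \<Delta>) = p_index k j + l + 1"
  using S_pairs_gpair[of "fst \<Delta>" "snd \<Delta>" k j l] by (cases \<Delta>) (simp add: rpairs_def)

lemma Q_part_sat:
  assumes "1 \<le> m" "E \<in> Q_part k m (int q - 1)"
  shows "E \<subseteq> ipaths_from k m \<and> sat k q E"
proof -
  have "E = cls k q x \<and> x \<in> ipaths_from k m" if "x \<in> E" for x
    using Q_part_cls[OF assms(1,2) _ that] by simp
  then show ?thesis unfolding sat_def by (auto simp: ipaths_from_def)
qed

lemma gset_level:
  assumes "(\<Delta>, E) \<in> level_gens k N"
  obtains j l q where "\<Delta> \<in> S_pairs k j l" "max j 1 + l + q \<le> N" "E \<in> Q_part k (p_index k j + l + 1) (int q - 1)"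
    "\<Delta> \<in> rpairs k" "E \<subseteq> Zs k (fst \<Delta>)" "sat k q E" "psource (fst \<Delta>) = p_index k j + l + 1"
proof -
  obtain j l q where *: "\<Delta> \<in> S_pairs k j l" "max j 1 + l + q \<le> N" "E \<in> Q_part k (p_index k j + l + 1) (int q - 1)"
    using assms unfolding level_gens_def by blast
  have "\<Delta> \<in> rpairs k" "psource (fst \<Delta>) = p_index k j + l + 1" using S_pairs_rpairs[OF *(1)] by auto
  moreover then have "E \<subseteq> Zs k (fst \<Delta>) \<and> sat k q E" using Q_part_sat[OF _ *(3)] by simp
  ultimately show ?thesis using that * by blast
qed

lemma gset_Cc: "D \<in> level_gens k N \<Longrightarrow> indicator (gset D) \<in> Cc k"
  unfolding gset_def by (cases D) (auto elim!: gset_level intro: Cc_indicator)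

text \<open>Each reduced pair of index j, l spends its whole remaining budget N - (max j 1 + l) on
  the fineness of cells; by hypothesis its part of G is a union of cells of that level.\<close>

lemma indicator_level_decomposition:
  assumes inf: "infinite {i. 1 \<le> i \<and> k i \<noteq> 0}" and G: "G \<subseteq> groupoid k"
    and lev: "\<And>\<delta> \<epsilon> j l y. (\<delta>, \<epsilon>) \<in> S_pairs k j l \<Longrightarrow> y \<in> Zs k \<delta> \<Longrightarrow> germ \<delta> \<epsilon> y \<in> G \<Longrightarrow>
      max j 1 + l \<le> N \<and> (\<forall>y'\<in>cls k (N - (max j 1 + l)) y. germ \<delta> \<epsilon> y' \<in> G)"
  obtains W where "finite W" "W \<subseteq> level_gens k N" "indicator G = (\<lambda>g. \<Sum>D\<in>W. indicator (gset D) g :: complex)"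
proof -
  define W where "W = {(\<Delta>, E). \<exists>j l. \<Delta> \<in> S_pairs k j l \<and> max j 1 + l \<le> N \<and>
     E \<in> Q_part k (p_index k j + l + 1) (int (N - (max j 1 + l)) - 1) \<and> gset (\<Delta>, E) \<subseteq> G}"
  have "W \<subseteq> (\<Union>j\<in>{..N}. \<Union>l\<in>{..N}. S_pairs k j l \<times> Q_part k (p_index k j + l + 1) (int (N - (max j 1 + l)) - 1))"
  proof
    fix D assume "D \<in> W"
    then obtain \<Delta> E j l where "D = (\<Delta>, E)" "\<Delta> \<in> S_pairs k j l" "max j 1 + l \<le> N"
      "E \<in> Q_part k (p_index k j + l + 1) (int (N - (max j 1 + l)) - 1)" unfolding W_def by blast
    then show "D \<in> (\<Union>j\<in>{..N}. \<Union>l\<in>{..N}. S_pairs k j l \<times> Q_part k (p_index k j + l + 1) (int (N - (max j 1 + l)) - 1))"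
      by (intro UN_I[of j] UN_I[of l]) auto
  qed
  moreover have "finite \<dots>" using finite_S_pairs finite_Q_part by auto
  ultimately have fW: "finite W" by (rule finite_subset)
  have WL: "W \<subseteq> level_gens k N"
  proof
    fix D assume "D \<in> W"
    then obtain \<Delta> E j l where *: "D = (\<Delta>, E)" "\<Delta> \<in> S_pairs k j l" "max j 1 + l \<le> N"
      "E \<in> Q_part k (p_index k j + l + 1) (int (N - (max j 1 + l)) - 1)" unfolding W_def by blast
    then have "max j 1 + l + (N - (max j 1 + l)) \<le> N" by simp
    with * show "D \<in> level_gens k N" unfolding level_gens_def by blast
  qed
  have disj: "D = D'" if h: "D \<in> W" "D' \<in> W" "g \<in> gset D" "g \<in> gset D'" for D D' g
  proof -
    obtain \<Delta> E \<Delta>' E' where D: "D = (\<Delta>, E)" "D' = (\<Delta>', E')" by (metis prod.exhaust)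
    obtain j l where 1: "\<Delta> \<in> S_pairs k j l" "E \<in> Q_part k (p_index k j + l + 1) (int (N - (max j 1 + l)) - 1)"
      using h(1) unfolding W_def D by blast
    obtain j' l' where 2: "\<Delta>' \<in> S_pairs k j' l'" "E' \<in> Q_part k (p_index k j' + l' + 1) (int (N - (max j' 1 + l')) - 1)"
      using h(2) unfolding W_def D by blast
    have r: "\<Delta> \<in> rpairs k" "\<Delta>' \<in> rpairs k" "E \<subseteq> Zs k (fst \<Delta>)" "E' \<subseteq> Zs k (fst \<Delta>')"
      using S_pairs_rpairs[OF 1(1)] S_pairs_rpairs[OF 2(1)] Q_part_sat[OF _ 1(2)] Q_part_sat[OF _ 2(2)] by auto
    have *: "\<Delta> = \<Delta>' \<and> g \<in> germ_set (fst \<Delta>) (snd \<Delta>) (E \<inter> E')"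
      by (rule bis_disjoint[OF r]) (use h D in \<open>auto simp: gset_def\<close>)
    then obtain x where x: "x \<in> E" "x \<in> E'" by (auto simp: germ_set_def)
    have jl: "j = j' \<and> l = l'" using S_pairs_unique[OF inf] 1(1) 2(1) * by blast
    have "E = cls k (N - (max j 1 + l)) x" using Q_part_cls[OF _ 1(2) _ x(1)] by simp
    moreover have "E' = cls k (N - (max j 1 + l)) x" using Q_part_cls[OF _ 2(2) _ x(2)] jl by simp
    ultimately show ?thesis using D * by simp
  qed
  have "G = (\<Union>D\<in>W. gset D)"
  proof
    show "(\<Union>D\<in>W. gset D) \<subseteq> G" by (auto simp: W_def)
    show "G \<subseteq> (\<Union>D\<in>W. gset D)"
    proof
      fix g assume g: "g \<in> G"
      obtain \<delta> \<epsilon> y where y: "g = germ \<delta> \<epsilon> y" "gpair k \<delta> \<epsilon>" "red \<delta> \<epsilon>" "y \<in> Zs k \<delta>"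
        using groupoid_reduced subsetD[OF G g] by metis
      then have "\<delta> \<in> Lambda_from k 1" "\<epsilon> \<in> Lambda_from k 1" "plen \<delta> = plen \<epsilon>"
        by (auto simp: gpair_def psource_def Lambda_from_def)
      then obtain j l where S: "(\<delta>, \<epsilon>) \<in> S_pairs k j l" using S_pairs_exists[OF inf] y(3) by metis
      define q where "q = N - (max j 1 + l)"
      have lv: "max j 1 + l \<le> N" "\<forall>y'\<in>cls k q y. germ \<delta> \<epsilon> y' \<in> G" using lev[OF S y(4)] g y(1) by (auto simp: q_def)
      have ps: "psource \<delta> = p_index k j + l + 1" using S_pairs_rpairs[OF S] by simp
      have "cls k q y \<in> Q_part k (p_index k j + l + 1) (int q - 1)" using cls_Q_part' y(4) ps by simp
      then have "((\<delta>, \<epsilon>), cls k q y) \<in> W"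
        using S lv unfolding W_def q_def gset_def germ_set_def mem_Collect_eq case_prod_conv fst_conv snd_conv by blast
      moreover have "g \<in> gset ((\<delta>, \<epsilon>), cls k q y)"
        using y mem_cls by (auto simp: gset_def germ_set_def ipaths_from_def)
      ultimately show "g \<in> (\<Union>D\<in>W. gset D)" by blast
    qed
  qed
  then have "indicator G g = (\<Sum>D\<in>W. indicator (gset D) g :: complex)" for g
    by (simp only:) (rule indicator_disjoint_sum[OF fW disj])
  then have "indicator G = (\<lambda>g. \<Sum>D\<in>W. indicator (gset D) g :: complex)" by (rule ext)
  then show ?thesis using that fW WL by blast
qed

section \<open>The level shift of a product\<close>

lemma gprod_groupoid: "gpair k \<mu> \<nu> \<Longrightarrow> gprod k U V \<subseteq> groupoid k"
proof
  fix c assume "c \<in> gprod k U V"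
  then obtain a b where "is_product k a b c" by (auto simp: gprod_def)
  then obtain \<mu> \<nu> \<delta> \<xi> \<kappa> \<epsilon> x where *: "psource \<nu> = prange \<delta>" "psource \<xi> = prange \<epsilon>" "psource \<delta> = irange x" "psource \<epsilon> = irange x"
     "\<delta> \<in> Lambda k" "\<epsilon> \<in> Lambda k"
     "(\<mu>, \<nu>, \<delta> \<odot> x) \<in> germ_triples k" "(\<xi>, \<kappa>, \<epsilon> \<odot> x) \<in> germ_triples k" "c = germ (\<mu> \<Zcomp> \<delta>) (\<kappa> \<Zcomp> \<epsilon>) x"
    unfolding is_product_def by blast
  have ps: "psource \<mu> = prange \<delta>" "psource \<kappa> = prange \<epsilon>" "\<mu> \<in> Lambda_from k 1" "\<kappa> \<in> Lambda_from k 1" "\<delta> \<odot> x \<in> ipaths k"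
    using *(7,8) by (auto simp: germ_triples_def)
  have "x \<in> ipaths k" using icomp_ipaths_iff[of x \<delta> k] * ps by simp
  moreover have "gpair k (\<mu> \<Zcomp> \<delta>) (\<kappa> \<Zcomp> \<epsilon>)"
    using * ps pcomp_Lambda_iff by (auto simp: gpair_def Lambda_from_def)
  ultimately show "c \<in> groupoid k" using germ_groupoid[of k "\<mu> \<Zcomp> \<delta>" "\<kappa> \<Zcomp> \<epsilon>" x] * ps by (simp add: ipaths_from_def)
qed

lemma convolution_level:
  assumes inf: "infinite {i. 1 \<le> i \<and> k i \<noteq> 0}" and D: "D \<in> level_gens k N0"
  obtains c where "\<And>N D'. D' \<in> level_gens k N \<Longrightarrow>
    \<exists>W. finite W \<and> W \<subseteq> level_gens k (N + c) \<and>
      convolution k (indicator (gset D)) (indicator (gset D')) = (\<lambda>g. \<Sum>D\<in>W. indicator (gset D) g)"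
proof -
  obtain \<Delta> F where DF: "D = (\<Delta>, F)" by (cases D)
  obtain j0 l0 q0 where 0: "\<Delta> \<in> S_pairs k j0 l0" "\<Delta> \<in> rpairs k" "F \<subseteq> Zs k (fst \<Delta>)" "sat k q0 F"
    using gset_level D DF by metis
  obtain \<mu> \<nu> where \<Delta>: "\<Delta> = (\<mu>, \<nu>)" by (cases \<Delta>)
  have gp: "gpair k \<mu> \<nu>" using 0(2) by (simp add: rpairs_def \<Delta>)
  show ?thesis
  \<comment> \<open>The part \<open>2 * plen \<nu> + 1\<close> comes from
    \<open>gprod_level\<close>, and q0 is there because max q q0 \<le> q + q0. All three depend on
    the left factor only.\<close>
  proof (rule that[of "2 * plen \<nu> + 1 + q0"])
    fix N D' assume D': "D' \<in> level_gens k N"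
    obtain \<delta> \<epsilon> E where DE: "D' = ((\<delta>, \<epsilon>), E)" by (metis prod.exhaust)
    obtain j l q where 1: "(\<delta>, \<epsilon>) \<in> S_pairs k j l" "max j 1 + l + q \<le> N" "(\<delta>, \<epsilon>) \<in> rpairs k" "E \<subseteq> Zs k \<delta>" "sat k q E"
      using gset_level D' DE by (metis fst_conv)
    let ?G = "gprod k (gset D) (gset D')" and ?C = "max j 1 + l + 2 * plen \<nu> + 1"
    have g: "gset D = germ_set \<mu> \<nu> F" "gset D' = germ_set \<delta> \<epsilon> E" by (simp_all add: gset_def DF DE \<Delta>)
    have F: "F \<subseteq> Zs k \<mu>" using 0(3) \<Delta> by simp
    have conv: "convolution k (indicator (gset D)) (indicator (gset D')) = indicator ?G"
      unfolding g by (rule convolution_indicator) (rule inj_on_germ_set[OF F] inj_on_germ_set[OF 1(4)])+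
    have lev: "max j2 1 + l2 \<le> N + (2 * plen \<nu> + 1 + q0) \<and>
        (\<forall>y'\<in>cls k (N + (2 * plen \<nu> + 1 + q0) - (max j2 1 + l2)) y. germ \<delta>2 \<epsilon>2 y' \<in> ?G)"
      if S2: "(\<delta>2, \<epsilon>2) \<in> S_pairs k j2 l2" "y \<in> Zs k \<delta>2" "germ \<delta>2 \<epsilon>2 y \<in> ?G" for \<delta>2 \<epsilon>2 j2 l2 y
    proof -
      note L = gprod_level[OF inf gp F 0(4) 1(1) 1(4,5) S2(1,2) S2(3)[unfolded g] refl]
      have "cls k (N + (2 * plen \<nu> + 1 + q0) - (max j2 1 + l2)) y \<subseteq> cls k (?C + max q q0 - (max j2 1 + l2)) y"
        using 1(2) by (intro cls_mono diff_le_mono) simp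
      then show ?thesis using L 1(2) unfolding g by (auto simp del: max.bounded_iff)
    qed
    obtain W where "finite W" "W \<subseteq> level_gens k (N + (2 * plen \<nu> + 1 + q0))" "indicator ?G = (\<lambda>g. \<Sum>D\<in>W. indicator (gset D) g :: complex)"
      using indicator_level_decomposition[OF inf gprod_groupoid[OF gp] lev] by blast
    then show "\<exists>W. finite W \<and> W \<subseteq> level_gens k (N + (2 * plen \<nu> + 1 + q0)) \<and>
      convolution k (indicator (gset D)) (indicator (gset D')) = (\<lambda>g. \<Sum>D\<in>W. indicator (gset D) g)"
      using conv by metis
  qed
qed


section \<open>Complex Hilbert spaces\<close>

interpretation cvec: vector_space "scaleC :: complex \<Rightarrow> 'a::cbanach \<Rightarrow> 'a"
proof
  show "1 *\<^sub>C x = x" for x :: 'a using scaleR_scaleC[of 1 x] by simp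
qed (rule scaleC_add_right scaleC_add_left scaleC_scaleC)+

lemma scaleC_of_real [simp]: "complex_of_real r *\<^sub>C (x::'a::cbanach) = r *\<^sub>R x"
  by (simp add: scaleR_scaleC)

lemma bounded_linear_scaleC: "bounded_linear (\<lambda>x::'a::cbanach. c *\<^sub>C x)"
  by (rule bounded_linear_intro[of _ "cmod c"])
    (simp_all add: scaleC_add_right norm_scaleC scaleR_scaleC scaleC_scaleC mult.commute del: scaleC_of_real)

lemma bounded_linear_scaleC_left: "bounded_linear (\<lambda>c. c *\<^sub>C (x::'a::cbanach))"
  by (rule bounded_linear_intro[of _ "norm x"])
    (simp_all add: scaleC_add_left norm_scaleC scaleR_scaleC scaleC_scaleC scaleR_conv_of_real del: scaleC_of_real)

lemma scaleC_scaleR_commute: "c *\<^sub>C (r *\<^sub>R x) = r *\<^sub>R (c *\<^sub>C (x::'a::cbanach))"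
  unfolding scaleR_scaleC scaleC_scaleC by (simp only: mult.commute)

lemma cinner_add_right: "cinner x (y + z) = cinner x y + cinner x (z::'h::chilbert)"
  by (metis cinner_add_left cinner_commute complex_cnj_add)

lemma cinner_scaleC_right: "cinner x (c *\<^sub>C y) = cnj c * cinner x (y::'h::chilbert)"
  by (metis cinner_commute cinner_scaleC_left complex_cnj_mult)

lemma cinner_scaleR_left: "cinner (r *\<^sub>R x) y = of_real r * cinner x (y::'h::chilbert)"
  by (simp add: scaleR_scaleC cinner_scaleC_left del: scaleC_of_real)

lemma cinner_scaleR_right: "cinner x (r *\<^sub>R y) = of_real r * cinner x (y::'h::chilbert)"
  by (simp add: scaleR_scaleC cinner_scaleC_right del: scaleC_of_real)

lemma cinner_zero_left [simp]: "cinner 0 (y::'h::chilbert) = 0"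
  using cinner_scaleC_left[of 0 y y] by simp

lemma cinner_zero_right [simp]: "cinner (y::'h::chilbert) 0 = 0"
  using cinner_scaleC_right[of y 0 y] by simp

lemma cinner_minus_left: "cinner (- x) y = - cinner x (y::'h::chilbert)"
  using cinner_scaleR_left[of "-1" x y] by simp

lemma cinner_diff_left: "cinner (x - z) y = cinner x y - cinner z (y::'h::chilbert)"
  using cinner_add_left[of x "- z" y] by (simp add: cinner_minus_left)

lemma cinner_sum_left: "cinner (\<Sum>i\<in>F. f i) y = (\<Sum>i\<in>F. cinner (f i) (y::'h::chilbert))"
  by (induction F rule: infinite_finite_induct) (auto simp: cinner_add_left)

lemma cinner_sum_right: "cinner y (\<Sum>i\<in>F. f i) = (\<Sum>i\<in>F. cinner (y::'h::chilbert) (f i))"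
  by (induction F rule: infinite_finite_induct) (auto simp: cinner_add_right)

lemma cinner_eq_zero_sym: "cinner x y = 0 \<longleftrightarrow> cinner y (x::'h::chilbert) = 0"
  by (metis cinner_commute complex_cnj_zero)

lemma cinner_self_zero [simp]: "cinner x x = 0 \<longleftrightarrow> x = (0::'h::chilbert)"
  by (simp add: cinner_self)

lemma norm_add_orthogonal:
  assumes "cinner x (y::'h::chilbert) = 0"
  shows "(norm (x + y))\<^sup>2 = (norm x)\<^sup>2 + (norm y)\<^sup>2"
proof -
  have "cinner (x + y) (x + y) = cinner x x + cinner y y"
    using assms cinner_eq_zero_sym[of x y] by (simp add: cinner_add_left cinner_add_right)
  then show ?thesis unfolding cinner_self of_real_add[symmetric] of_real_eq_iff .
qed

lemma Cauchy_Schwarz_cinner: "cmod (cinner x (y::'h::chilbert)) \<le> norm x * norm y"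
proof (cases "y = 0")
  case False
  define c where "c = cinner x y / cinner y y"
  have "cinner (x - c *\<^sub>C y) (c *\<^sub>C y) = 0"
    using False by (simp add: cinner_diff_left cinner_scaleC_left cinner_scaleC_right c_def)
  from norm_add_orthogonal[OF this] have "(norm (c *\<^sub>C y))\<^sup>2 \<le> (norm x)\<^sup>2" by simp
  then have "norm (c *\<^sub>C y) \<le> norm x" using power2_le_imp_le norm_ge_zero by blast
  then have "cmod (cinner x y) / (norm y)\<^sup>2 * norm y \<le> norm x"
    by (simp add: norm_scaleC c_def norm_divide cinner_self norm_power)
  then show ?thesis using False by (simp add: power2_eq_square field_simps)
qed simp

lemma bounded_linear_cinner_left: "bounded_linear (\<lambda>x. cinner x (y::'h::chilbert))"
  by (rule bounded_linear_intro[of _ "norm y"])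
    (simp_all add: cinner_add_left cinner_scaleR_left Cauchy_Schwarz_cinner scaleR_conv_of_real)

lemma bounded_linear_cinner_right: "bounded_linear (\<lambda>y. cinner (x::'h::chilbert) y)"
  by (rule bounded_linear_intro[of _ "norm x"])
    (simp_all add: cinner_add_right cinner_scaleR_right Cauchy_Schwarz_cinner scaleR_conv_of_real mult.commute
      order.trans[OF Cauchy_Schwarz_cinner])

lemma norm_sum_orthogonal:
  assumes "\<And>i j. i \<in> F \<Longrightarrow> j \<in> F \<Longrightarrow> i \<noteq> j \<Longrightarrow> cinner (f i) (f j) = 0" "finite F"
  shows "(norm (\<Sum>i\<in>F. f i :: 'h::chilbert))\<^sup>2 = (\<Sum>i\<in>F. (norm (f i))\<^sup>2)"
  using assms(2,1)
proof (induction F rule: finite_induct)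
  case (insert a F)
  have "cinner (f a) (\<Sum>i\<in>F. f i) = 0"
    unfolding cinner_sum_right using insert by (intro sum.neutral) auto
  from norm_add_orthogonal[OF this] show ?case using insert by simp
qed simp

definition orthonormal :: "'h::chilbert set \<Rightarrow> bool" where
  "orthonormal E \<longleftrightarrow> (\<forall>x\<in>E. \<forall>y\<in>E. cinner x y = (if x = y then 1 else 0))"

lemma orthonormal_independent:
  assumes "finite E" "orthonormal E" shows "cvec.independent E"
proof -
  have "u x = 0" if "(\<Sum>v\<in>E. u v *\<^sub>C v) = 0" "x \<in> E" for u x
  proof -
    have "cinner (\<Sum>v\<in>E. u v *\<^sub>C v) x = (\<Sum>v\<in>E. if v = x then u v else 0)"
      unfolding cinner_sum_left using assms(2) that(2)
      by (intro sum.cong) (auto simp: cinner_scaleC_left orthonormal_def)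
    then show ?thesis using that assms(1) by simp
  qed
  then show ?thesis using cvec.dependent_finite[OF assms(1)] by blast
qed

lemma orthonormal_residual:
  assumes "finite E" "orthonormal E" "\<omega> \<in> cspan E"
  shows "cinner (\<xi> - (\<Sum>b\<in>E. cinner \<xi> b *\<^sub>C b)) \<omega> = 0"
  using assms(3)
proof (induction rule: cvec.span_induct)
  case base
  show ?case
    unfolding cvec.subspace_def by (auto simp: cinner_add_right cinner_scaleC_right)
next
  case (step x)
  have "cinner (\<Sum>b\<in>E. cinner \<xi> b *\<^sub>C b) x = (\<Sum>b\<in>E. if b = x then cinner \<xi> b else 0)"
    unfolding cinner_sum_left using assms(2) step
    by (intro sum.cong) (auto simp: cinner_scaleC_left orthonormal_def)
  then show ?case using assms(1) step by (simp add: cinner_diff_left)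
qed

text \<open>An orthonormal subset of V of largest size exists, since sizes are bounded by that of B.
  The normalised residual of a vector outside its span would enlarge it.\<close>

lemma orthonormal_basis_exists:
  assumes V: "cvec.subspace (V :: 'h::chilbert set)" and B: "finite B" "V \<subseteq> cspan B"
  obtains E where "finite E" "orthonormal E" "cspan E = V"
proof -
  let ?P = "\<lambda>n. \<exists>E. E \<subseteq> V \<and> finite E \<and> orthonormal E \<and> card E = n"
  have bound: "n \<le> card B" if P: "?P n" for n
  proof -
    obtain E where E: "E \<subseteq> V" "finite E" "orthonormal E" "card E = n" using P by blast
    have "E \<subseteq> cspan B" using E B by blast
    then show ?thesis
      using cvec.independent_span_bound[OF B(1) orthonormal_independent[OF E(2,3)]] E by simp
  qed
  have P0: "?P 0" by (intro exI[of _ "{}"]) (simp add: orthonormal_def)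
  have "?P (GREATEST n. ?P n)" using GreatestI_nat[of ?P 0 "card B"] P0 bound by blast
  then obtain E where E: "E \<subseteq> V" "finite E" "orthonormal E" "card E = (GREATEST n. ?P n)" by blast
  have "V \<subseteq> cspan E"
  proof
    fix v assume v: "v \<in> V"
    define r where "r = v - (\<Sum>b\<in>E. cinner v b *\<^sub>C b)"
    have sumV: "(\<Sum>b\<in>E. cinner v b *\<^sub>C b) \<in> V"
      using E by (intro cvec.subspace_sum[OF V] cvec.subspace_scale[OF V]) auto
    then have rV: "r \<in> V" unfolding r_def using v cvec.subspace_diff[OF V] by blast
    have rE: "cinner r b = 0" if "b \<in> E" for b
      unfolding r_def using orthonormal_residual[OF E(2,3)] cvec.span_base[OF that] by blast
    have "r = 0"
    proof (rule ccontr)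
      assume r: "r \<noteq> 0"
      define e where "e = (1 / norm r) *\<^sub>R r"
      have eV: "e \<in> V" unfolding e_def scaleR_scaleC using rV cvec.subspace_scale[OF V] by blast
      have ee: "cinner e e = 1" using r by (simp add: e_def cinner_scaleR_left cinner_scaleR_right cinner_self power2_eq_square)
      have eE: "cinner e b = 0" "cinner b e = 0" if "b \<in> E" for b
        using rE[OF that] cinner_eq_zero_sym[of r b] by (simp_all add: e_def cinner_scaleR_left cinner_scaleR_right)
      have "e \<notin> E" using ee eE by force
      then have "card (insert e E) = Suc (card E)" using E by simp
      moreover have "orthonormal (insert e E)"
        using E(3) ee eE unfolding orthonormal_def by auto
      ultimately have "?P (Suc (card E))" using E eV by (intro exI[of _ "insert e E"]) auto
      then have "Suc (card E) \<le> (GREATEST n. ?P n)" using Greatest_le_nat[of ?P "Suc (card E)" "card B"] bound by blast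
      then show False using E(4) by simp
    qed
    then have "v = (\<Sum>b\<in>E. cinner v b *\<^sub>C b)" by (simp add: r_def)
    also have "\<dots> \<in> cspan E" by (intro cvec.span_sum cvec.span_scale cvec.span_base)
    finally show "v \<in> cspan E" .
  qed
  moreover have "cspan E \<subseteq> V" using E(1) V by (rule cvec.span_minimal)
  ultimately show ?thesis using that[OF E(2,3)] by blast
qed

lemma orth_proj_eqI:
  assumes "cvec.subspace (V :: 'h::chilbert set)" "\<upsilon> \<in> V" "\<And>\<omega>. \<omega> \<in> V \<Longrightarrow> cinner (\<xi> - \<upsilon>) \<omega> = 0"
  shows "orth_proj V \<xi> = \<upsilon>"
  unfolding orth_proj_def
proof (rule the_equality)
  show "\<upsilon> \<in> V \<and> (\<forall>\<omega>\<in>V. cinner (\<xi> - \<upsilon>) \<omega> = 0)" using assms by blast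
  fix \<upsilon>' assume u: "\<upsilon>' \<in> V \<and> (\<forall>\<omega>\<in>V. cinner (\<xi> - \<upsilon>') \<omega> = 0)"
  then have d: "\<upsilon> - \<upsilon>' \<in> V" using assms cvec.subspace_diff by blast
  have "cinner (\<xi> - \<upsilon>') (\<upsilon> - \<upsilon>') - cinner (\<xi> - \<upsilon>) (\<upsilon> - \<upsilon>') = 0" using u d assms(3) by simp
  then have "cinner (\<upsilon> - \<upsilon>') (\<upsilon> - \<upsilon>') = 0" by (simp add: cinner_diff_left)
  then show "\<upsilon>' = \<upsilon>" by simp
qed

section \<open>Orthogonal decompositions and their diagonal operators\<close>

text \<open>The eigenvalues w are natural numbers so that the band argument can sum over them;
  finiteness of the levels gives the compact resolvent and turns unordered sums into sequences of
  partial sums.\<close>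

locale orth_decomp =
  fixes I :: "'i set" and V :: "'i \<Rightarrow> 'h::chilbert set" and w :: "'i \<Rightarrow> nat"
  assumes sub: "i \<in> I \<Longrightarrow> cvec.subspace (V i)"
    and fin: "i \<in> I \<Longrightarrow> \<exists>B. finite B \<and> V i \<subseteq> cspan B"
    and orth: "i \<in> I \<Longrightarrow> j \<in> I \<Longrightarrow> i \<noteq> j \<Longrightarrow> x \<in> V i \<Longrightarrow> y \<in> V j \<Longrightarrow> cinner x y = 0"
    and total: "closure (cspan (\<Union>i\<in>I. V i)) = UNIV"
    and levels: "finite {i \<in> I. w i \<le> N}"
begin

abbreviation P where "P i \<equiv> orth_proj (V i)"

lemma P_basis:
  assumes "i \<in> I"
  obtains E where "finite E" "orthonormal E" "cspan E = V i" "\<And>\<xi>. P i \<xi> = (\<Sum>b\<in>E. cinner \<xi> b *\<^sub>C b)"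
proof -
  obtain B where "finite B" "V i \<subseteq> cspan B" using fin assms by blast
  then obtain E where E: "finite E" "orthonormal E" "cspan E = V i"
    using orthonormal_basis_exists sub[OF assms] by blast
  have "P i \<xi> = (\<Sum>b\<in>E. cinner \<xi> b *\<^sub>C b)" for \<xi>
  proof (rule orth_proj_eqI[OF sub[OF assms]])
    show "(\<Sum>b\<in>E. cinner \<xi> b *\<^sub>C b) \<in> V i"
      unfolding E(3)[symmetric] by (intro cvec.span_sum cvec.span_scale cvec.span_base)
    show "cinner (\<xi> - (\<Sum>b\<in>E. cinner \<xi> b *\<^sub>C b)) \<omega> = 0" if "\<omega> \<in> V i" for \<omega>
      using orthonormal_residual[OF E(1,2)] that E(3) by blast
  qed
  then show ?thesis using that E by blast
qed

lemma P_in: "i \<in> I \<Longrightarrow> P i \<xi> \<in> V i"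
proof -
  assume "i \<in> I"
  then obtain E where E: "cspan E = V i" "P i \<xi> = (\<Sum>b\<in>E. cinner \<xi> b *\<^sub>C b)" by (rule P_basis) blast
  have "(\<Sum>b\<in>E. cinner \<xi> b *\<^sub>C b) \<in> cspan E" by (intro cvec.span_sum cvec.span_scale cvec.span_base)
  then show ?thesis unfolding E .
qed

lemma P_orth: "i \<in> I \<Longrightarrow> \<omega> \<in> V i \<Longrightarrow> cinner (\<xi> - P i \<xi>) \<omega> = 0"
proof -
  assume i: "i \<in> I" and \<omega>: "\<omega> \<in> V i"
  obtain E where E: "finite E" "orthonormal E" "cspan E = V i" "P i \<xi> = (\<Sum>b\<in>E. cinner \<xi> b *\<^sub>C b)"
    using P_basis[OF i] by metis
  show ?thesis unfolding E(4) using orthonormal_residual[OF E(1,2)] \<omega> E(3) by blast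
qed

lemma P_eqI: "i \<in> I \<Longrightarrow> \<upsilon> \<in> V i \<Longrightarrow> (\<And>\<omega>. \<omega> \<in> V i \<Longrightarrow> cinner \<xi> \<omega> = cinner \<upsilon> \<omega>) \<Longrightarrow> P i \<xi> = \<upsilon>"
  by (rule orth_proj_eqI[OF sub]) (simp_all add: cinner_diff_left)

lemma cinner_P: "i \<in> I \<Longrightarrow> \<omega> \<in> V i \<Longrightarrow> cinner (P i \<xi>) \<omega> = cinner \<xi> \<omega>"
  using P_orth[of i \<omega> \<xi>] by (simp add: cinner_diff_left)

lemma cinner_P_right: "i \<in> I \<Longrightarrow> \<omega> \<in> V i \<Longrightarrow> cinner \<omega> (P i \<xi>) = cinner \<omega> \<xi>"
  using cinner_P[of i \<omega> \<xi>] cinner_commute[of \<omega>] by metis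

lemma P_P: "i \<in> I \<Longrightarrow> cinner (P i \<xi>) (P i \<zeta>) = cinner (P i \<xi>) \<zeta>"
  using cinner_P_right P_in by blast

lemma P_id: "i \<in> I \<Longrightarrow> v \<in> V i \<Longrightarrow> P i v = v"
  by (rule P_eqI) auto

lemma P_other: "i \<in> I \<Longrightarrow> j \<in> I \<Longrightarrow> i \<noteq> j \<Longrightarrow> v \<in> V j \<Longrightarrow> P i v = 0"
  using orth cvec.subspace_0[OF sub] by (intro P_eqI) auto

lemma P_add: "i \<in> I \<Longrightarrow> P i (\<xi> + \<zeta>) = P i \<xi> + P i \<zeta>"
  by (rule P_eqI) (auto intro: cvec.subspace_add[OF sub] P_in simp: cinner_add_left cinner_P)

lemma P_scaleC: "i \<in> I \<Longrightarrow> P i (c *\<^sub>C \<xi>) = c *\<^sub>C P i \<xi>"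
  by (rule P_eqI) (auto intro: cvec.subspace_scale[OF sub] P_in simp: cinner_scaleC_left cinner_P)

lemma P_scaleR: "i \<in> I \<Longrightarrow> P i (c *\<^sub>R \<xi>) = c *\<^sub>R P i \<xi>"
  using P_scaleC[of i "complex_of_real c"] by simp

lemma V_scaleR: "i \<in> I \<Longrightarrow> v \<in> V i \<Longrightarrow> r *\<^sub>R v \<in> V i"
  unfolding scaleR_scaleC using cvec.subspace_scale[OF sub] by blast

lemma P_norm: "i \<in> I \<Longrightarrow> norm (P i \<xi>) \<le> norm \<xi>"
proof -
  assume i: "i \<in> I"
  have "(norm (\<xi> - P i \<xi> + P i \<xi>))\<^sup>2 = (norm (\<xi> - P i \<xi>))\<^sup>2 + (norm (P i \<xi>))\<^sup>2"
    by (rule norm_add_orthogonal) (rule P_orth[OF i P_in[OF i]])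
  then have "(norm (P i \<xi>))\<^sup>2 \<le> (norm \<xi>)\<^sup>2" by simp
  then show ?thesis using power2_le_imp_le norm_ge_zero by blast
qed

lemma P_bounded_linear: "i \<in> I \<Longrightarrow> bounded_linear (P i)"
  by (rule bounded_linear_intro[of _ 1]) (simp_all add: P_add P_scaleR P_norm)

lemma P_diff: "i \<in> I \<Longrightarrow> P i (\<xi> - \<zeta>) = P i \<xi> - P i \<zeta>"
  and P_0: "i \<in> I \<Longrightarrow> P i 0 = 0"
  and P_sum: "i \<in> I \<Longrightarrow> P i (sum f S) = (\<Sum>s\<in>S. P i (f s))"
  using P_bounded_linear linear_diff linear_0 linear_sum bounded_linear.linear by metis+

lemma norm_sum_V:
  assumes "finite F" "F \<subseteq> I" "\<And>i. i \<in> F \<Longrightarrow> \<zeta> i \<in> V i"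
  shows "(norm (\<Sum>i\<in>F. \<zeta> i))\<^sup>2 = (\<Sum>i\<in>F. (norm (\<zeta> i))\<^sup>2)"
  using assms orth by (intro norm_sum_orthogonal) blast+

lemma residual_orth:
  assumes "finite F" "F \<subseteq> I" "i \<in> F" "\<omega> \<in> V i"
  shows "cinner (\<xi> - (\<Sum>i\<in>F. P i \<xi>)) \<omega> = 0"
proof -
  have "cinner (P j \<xi>) \<omega> = (if j = i then cinner \<xi> \<omega> else 0)" if "j \<in> F" for j
  proof (cases "j = i")
    case True
    then show ?thesis using cinner_P assms by auto
  next
    case False
    have "j \<in> I" "i \<in> I" using that assms by auto
    then show ?thesis using orth[OF _ _ False P_in assms(4)] False by simp
  qed
  then have "(\<Sum>j\<in>F. cinner (P j \<xi>) \<omega>) = (\<Sum>j\<in>F. if j = i then cinner \<xi> \<omega> else 0)"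
    by (rule sum.cong[OF refl])
  then show ?thesis using assms by (simp add: cinner_diff_left cinner_sum_left)
qed

text \<open>Pythagoras, since the residual of the projections is orthogonal to every V i with i in
  F. Taking all components zero yields Bessel's inequality.\<close>

lemma best_approx:
  assumes "finite F" "F \<subseteq> I" "\<And>i. i \<in> F \<Longrightarrow> \<zeta> i \<in> V i"
  shows "(norm (\<xi> - (\<Sum>i\<in>F. \<zeta> i)))\<^sup>2 = (norm (\<xi> - (\<Sum>i\<in>F. P i \<xi>)))\<^sup>2 + (\<Sum>i\<in>F. (norm (P i \<xi> - \<zeta> i))\<^sup>2)"
proof -
  have "\<And>i. i \<in> F \<Longrightarrow> P i \<xi> - \<zeta> i \<in> V i" using assms P_in cvec.subspace_diff[OF sub] by blast
  then have "cinner (\<xi> - (\<Sum>i\<in>F. P i \<xi>)) (\<Sum>i\<in>F. P i \<xi> - \<zeta> i) = 0"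
    unfolding cinner_sum_right using residual_orth assms by (intro sum.neutral) blast
  from norm_add_orthogonal[OF this] norm_sum_V[of F "\<lambda>i. P i \<xi> - \<zeta> i"] show ?thesis
    using assms \<open>\<And>i. i \<in> F \<Longrightarrow> P i \<xi> - \<zeta> i \<in> V i\<close> by (simp add: sum_subtractf)
qed

lemma Bessel:
  assumes "finite F" "F \<subseteq> I"
  shows "(\<Sum>i\<in>F. (norm (P i \<xi>))\<^sup>2) \<le> (norm \<xi>)\<^sup>2"
proof -
  have "\<And>i. i \<in> F \<Longrightarrow> 0 \<in> V i" using assms cvec.subspace_0[OF sub] by blast
  from best_approx[OF assms this, of \<xi>] show ?thesis by simp
qed

text \<open>A representation by finitely many projections stays valid on larger index sets because
  the additional projections vanish. Hence the representable vectors form a subspace.\<close>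

lemma span_UN_rep:
  assumes "v \<in> cspan (\<Union>i\<in>I. V i)"
  obtains F where "finite F" "F \<subseteq> I" "v = (\<Sum>i\<in>F. P i v)"
proof -
  let ?S = "{v. \<exists>F. finite F \<and> F \<subseteq> I \<and> v = (\<Sum>i\<in>F. P i v)}"
  have ext: "v = (\<Sum>i\<in>F'. P i v)" if v: "v = (\<Sum>i\<in>F. P i v)" and F: "finite F" "F \<subseteq> I" "F \<subseteq> F'" "finite F'" "F' \<subseteq> I" for v F F'
  proof -
    have "P j v = 0" if j: "j \<in> F' - F" for j
    proof -
      have jI: "j \<in> I" and jF: "j \<notin> F" using j F by auto
      have "P j (\<Sum>i\<in>F. P i v) = (\<Sum>i\<in>F. P j (P i v))" using jI by (rule P_sum)
      also have "\<dots> = 0"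
      proof (rule sum.neutral, intro ballI)
        fix i assume "i \<in> F"
        then have "i \<in> I" "j \<noteq> i" using jF F by auto
        then show "P j (P i v) = 0" using P_other[OF jI] P_in by blast
      qed
      finally show ?thesis using v by simp
    qed
    then have "(\<Sum>i\<in>F. P i v) = (\<Sum>i\<in>F'. P i v)" using F by (intro sum.mono_neutral_left) auto
    then show ?thesis using v by simp
  qed
  have sS: "cvec.subspace ?S"
    unfolding cvec.subspace_def
  proof (intro conjI ballI allI)
    show "0 \<in> ?S" by (auto intro!: exI[of _ "{}"])
    fix x y assume "x \<in> ?S" "y \<in> ?S"
    then obtain F G where F: "finite F" "F \<subseteq> I" "x = (\<Sum>i\<in>F. P i x)" and G: "finite G" "G \<subseteq> I" "y = (\<Sum>i\<in>G. P i y)"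
      by blast
    have "x = (\<Sum>i\<in>F \<union> G. P i x)" "y = (\<Sum>i\<in>F \<union> G. P i y)"
      using ext[OF F(3)] ext[OF G(3)] F G by auto
    then have "x + y = (\<Sum>i\<in>F \<union> G. P i x) + (\<Sum>i\<in>F \<union> G. P i y)" by metis
    also have "\<dots> = (\<Sum>i\<in>F \<union> G. P i (x + y))"
      unfolding sum.distrib[symmetric] using F G by (intro sum.cong refl P_add[symmetric]) auto
    finally show "x + y \<in> ?S" using F G by (intro CollectI exI[of _ "F \<union> G"]) auto
  next
    fix c x assume "x \<in> ?S"
    then obtain F where F: "finite F" "F \<subseteq> I" "x = (\<Sum>i\<in>F. P i x)" by blast
    then have "c *\<^sub>C x = c *\<^sub>C (\<Sum>i\<in>F. P i x)" by metis
    also have "\<dots> = (\<Sum>i\<in>F. P i (c *\<^sub>C x))"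
      unfolding cvec.scale_sum_right using F by (intro sum.cong refl P_scaleC[symmetric]) auto
    finally show "c *\<^sub>C x \<in> ?S" using F by (intro CollectI exI[of _ F]) auto
  qed
  have VS: "(\<Union>i\<in>I. V i) \<subseteq> ?S"
  proof
    fix v assume "v \<in> (\<Union>i\<in>I. V i)"
    then obtain i where "i \<in> I" "v \<in> V i" by blast
    then show "v \<in> ?S" using P_id by (intro CollectI exI[of _ "{i}"]) simp
  qed
  have "v \<in> ?S" using cvec.span_minimal[OF VS sS] assms by (rule subsetD)
  then show ?thesis using that by blast
qed

text \<open>Vectors of the algebraic span are dense, and the partial sums of the projections
  approximate at least as well as any of them.\<close>

lemma P_has_sum: "((\<lambda>i. P i \<xi>) has_sum \<xi>) I"
  unfolding has_sum_def
proof (rule tendstoI)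
  fix e :: real assume e: "0 < e"
  obtain v where v: "v \<in> cspan (\<Union>i\<in>I. V i)" "dist v \<xi> < e"
    using total e closure_approachable[of \<xi> "cspan (\<Union>i\<in>I. V i)"] by auto
  obtain F where F: "finite F" "F \<subseteq> I" "v = (\<Sum>i\<in>F. P i v)" using span_UN_rep[OF v(1)] .
  have "dist (\<Sum>i\<in>G. P i \<xi>) \<xi> < e" if G: "finite G" "F \<subseteq> G" "G \<subseteq> I" for G
  proof -
    define \<zeta> where "\<zeta> i = (if i \<in> F then P i v else 0)" for i
    have \<zeta>: "\<zeta> i \<in> V i" if "i \<in> G" for i
      using that G P_in cvec.subspace_0[OF sub] by (auto simp: \<zeta>_def)
    have "(\<Sum>i\<in>G. \<zeta> i) = v"
      using F G by (simp add: \<zeta>_def sum.If_cases Int_absorb1 flip: F(3))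
    then have "(norm (\<xi> - (\<Sum>i\<in>G. P i \<xi>)))\<^sup>2 \<le> (norm (\<xi> - v))\<^sup>2"
      using best_approx[OF G(1,3) \<zeta>, of \<xi>] by (simp add: sum_nonneg)
    then have "norm (\<xi> - (\<Sum>i\<in>G. P i \<xi>)) \<le> norm (\<xi> - v)" using power2_le_imp_le norm_ge_zero by blast
    then show ?thesis using v(2) by (simp add: dist_norm norm_minus_commute)
  qed
  then show "\<forall>\<^sub>F G in finite_subsets_at_top I. dist (\<Sum>i\<in>G. P i \<xi>) \<xi> < e"
    unfolding eventually_finite_subsets_at_top using F by blast
qed

lemma vec_eqI: "(\<And>i. i \<in> I \<Longrightarrow> P i x = P i y) \<Longrightarrow> x = y"
proof -
  assume eq: "\<And>i. i \<in> I \<Longrightarrow> P i x = P i y"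
  have "((\<lambda>i. P i x) has_sum x) I" "((\<lambda>i. P i y) has_sum y) I" by (rule P_has_sum)+
  moreover have "((\<lambda>i. P i x) has_sum y) I \<longleftrightarrow> ((\<lambda>i. P i y) has_sum y) I"
    using eq by (intro has_sum_cong) auto
  ultimately show ?thesis using has_sum_unique by blast
qed

lemma P_norm_summable: "(\<lambda>i. (norm (P i \<xi>))\<^sup>2) summable_on I"
  by (rule nonneg_bdd_above_summable_on) (auto intro!: bdd_aboveI[of _ "(norm \<xi>)\<^sup>2"] Bessel)

lemma norm_le_of_finite_sums:
  assumes "\<And>F. finite F \<Longrightarrow> F \<subseteq> I \<Longrightarrow> (\<Sum>i\<in>F. (norm (P i z))\<^sup>2) \<le> K\<^sup>2" "0 \<le> K"
  shows "norm z \<le> K"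
proof -
  have "((\<lambda>F. norm (\<Sum>i\<in>F. P i z)) \<longlongrightarrow> norm z) (finite_subsets_at_top I)"
    using P_has_sum[of z] unfolding has_sum_def by (rule tendsto_norm)
  moreover have "\<forall>\<^sub>F F in finite_subsets_at_top I. norm (\<Sum>i\<in>F. P i z) \<le> K"
  proof (rule eventually_finite_subsets_at_top_weakI)
    fix F assume F: "finite F" "F \<subseteq> I"
    have "\<And>i. i \<in> F \<Longrightarrow> P i z \<in> V i" using F P_in by blast
    from norm_sum_V[OF F this] have "(norm (\<Sum>i\<in>F. P i z))\<^sup>2 \<le> K\<^sup>2"
      using assms(1)[OF F] by simp
    then show "norm (\<Sum>i\<in>F. P i z) \<le> K" using assms(2) power2_le_imp_le by blast
  qed
  ultimately show ?thesis by (rule tendsto_upperbound) simp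
qed

text \<open>Summation along w i \<le> N makes the partial sums a sequence, to which completeness
  applies; each coordinate is eventually constant.\<close>

lemma Riesz_Fischer:
  assumes "\<And>i. i \<in> I \<Longrightarrow> \<zeta> i \<in> V i" "(\<lambda>i. (norm (\<zeta> i))\<^sup>2) summable_on I"
  obtains z where "\<And>i. i \<in> I \<Longrightarrow> P i z = \<zeta> i"
proof -
  let ?L = "\<lambda>N. {i \<in> I. w i \<le> N}"
  define s S where "s N = (\<Sum>i\<in>?L N. (norm (\<zeta> i))\<^sup>2)" and "S N = (\<Sum>i\<in>?L N. \<zeta> i)" for N
  have diff: "(norm (S N - S M))\<^sup>2 = s N - s M" if "M \<le> N" for M N
  proof -
    have sub: "?L M \<subseteq> ?L N" using that by auto
    have "S N - S M = (\<Sum>i\<in>?L N - ?L M. \<zeta> i)" "s N - s M = (\<Sum>i\<in>?L N - ?L M. (norm (\<zeta> i))\<^sup>2)"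
      unfolding S_def s_def by (rule sum_diff[OF levels sub, symmetric])+
    then show ?thesis using norm_sum_V[of "?L N - ?L M" \<zeta>] assms(1) levels by auto
  qed
  have "Bseq s"
  proof (rule BseqI')
    show "norm (s N) \<le> infsum (\<lambda>i. (norm (\<zeta> i))\<^sup>2) I" for N
      unfolding s_def using levels assms(2)
      by (simp add: sum_nonneg) (rule finite_sum_le_infsum, auto)
  qed
  moreover have "incseq s"
    unfolding incseq_def s_def using levels by (auto intro!: sum_mono2)
  ultimately have "convergent s" using Bseq_monoseq_convergent incseq_imp_monoseq by blast
  then have Cs: "Cauchy s" by (rule convergent_Cauchy)
  have "Cauchy S"
  proof (rule metric_CauchyI)
    fix e :: real assume e: "0 < e"
    then obtain K where K: "\<And>m n. m \<ge> K \<Longrightarrow> n \<ge> K \<Longrightarrow> dist (s m) (s n) < e\<^sup>2"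
      using metric_CauchyD[OF Cs, of "e\<^sup>2"] by auto
    have le: "dist (S m) (S n) < e" if "m \<ge> K" "n \<ge> K" "n \<le> m" for m n
    proof -
      have "(norm (S m - S n))\<^sup>2 < e\<^sup>2" using diff[OF that(3)] K[OF that(1,2)] by (simp add: dist_norm)
      then show ?thesis using e power2_less_imp_less[of "norm (S m - S n)" e] by (simp add: dist_norm)
    qed
    show "\<exists>M. \<forall>m\<ge>M. \<forall>n\<ge>M. dist (S m) (S n) < e"
      using le by (metis dist_commute linorder_le_cases)
  qed
  then obtain z where z: "S \<longlonglongrightarrow> z" using Cauchy_convergent convergent_def by blast
  show ?thesis
  proof (rule that)
    fix i assume i: "i \<in> I"
    have "(\<lambda>N. P i (S N)) \<longlonglongrightarrow> P i z"
      using bounded_linear.tendsto[OF P_bounded_linear[OF i] z] .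
    moreover have "\<forall>\<^sub>F N in sequentially. P i (S N) = \<zeta> i"
    proof (rule eventually_sequentiallyI[of "w i"])
      fix N assume N: "w i \<le> N"
      have "P i (S N) = (\<Sum>j\<in>?L N. P i (\<zeta> j))" unfolding S_def by (rule P_sum[OF i])
      also have "\<dots> = (\<Sum>j\<in>?L N. if j = i then \<zeta> i else 0)"
        using i assms(1) P_id P_other by (intro sum.cong) auto
      finally show "P i (S N) = \<zeta> i" using N i levels by simp
    qed
    ultimately have "(\<lambda>_. \<zeta> i) \<longlonglongrightarrow> P i z" using tendsto_cong by fast
    then show "P i z = \<zeta> i" using LIMSEQ_unique tendsto_const by blast
  qed
qed

lemma multiplier_exists:
  assumes "\<And>i. \<bar>h i\<bar> \<le> 1"
  obtains z where "\<And>i. i \<in> I \<Longrightarrow> P i z = h i *\<^sub>R P i \<xi>"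
proof (rule Riesz_Fischer)
  show "i \<in> I \<Longrightarrow> h i *\<^sub>R P i \<xi> \<in> V i" for i by (intro V_scaleR P_in)
  show "(\<lambda>i. (norm (h i *\<^sub>R P i \<xi>))\<^sup>2) summable_on I"
  proof (rule nonneg_bdd_above_summable_on)
    show "bdd_above (sum (\<lambda>i. (norm (h i *\<^sub>R P i \<xi>))\<^sup>2) ` {F. F \<subseteq> I \<and> finite F})"
    proof (rule bdd_aboveI2)
      fix F assume F: "F \<in> {F. F \<subseteq> I \<and> finite F}"
      have "(norm (h i *\<^sub>R P i \<xi>))\<^sup>2 \<le> (norm (P i \<xi>))\<^sup>2" for i
        using mult_right_mono[OF assms[of i] norm_ge_zero[of "P i \<xi>"]] by (intro power_mono) auto
      then have "(\<Sum>i\<in>F. (norm (h i *\<^sub>R P i \<xi>))\<^sup>2) \<le> (\<Sum>i\<in>F. (norm (P i \<xi>))\<^sup>2)" by (rule sum_mono)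
      also have "\<dots> \<le> (norm \<xi>)\<^sup>2" using F by (intro Bessel) auto
      finally show "(\<Sum>i\<in>F. (norm (h i *\<^sub>R P i \<xi>))\<^sup>2) \<le> (norm \<xi>)\<^sup>2" .
    qed
  qed simp
qed (rule that)

lemma cinner_has_sum: "((\<lambda>i. cinner (P i x) (P i y)) has_sum cinner x y) I"
proof -
  have "((\<lambda>i. cinner (P i x) y) has_sum cinner x y) I"
    using has_sum_bounded_linear[OF bounded_linear_cinner_left P_has_sum] by (simp add: comp_def)
  then show ?thesis using P_P by (subst has_sum_cong[where g = "\<lambda>i. cinner (P i x) y"]) auto
qed

definition DD where "DD = {\<xi>. (\<lambda>i. (real (w i))\<^sup>2 * (norm (P i \<xi>))\<^sup>2) summable_on I}"
definition D where "D \<xi> = (\<Sum>\<^sub>\<infinity>i\<in>I. real (w i) *\<^sub>R P i \<xi>)"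

text \<open>Domain membership and value are both obtained by naming a vector with the right
  coordinates. Together with \<open>P_D\<close> this reduces all statements on D to
  coordinates.\<close>

lemma D_I:
  assumes "\<And>i. i \<in> I \<Longrightarrow> P i z = real (w i) *\<^sub>R P i \<xi>"
  shows "\<xi> \<in> DD" "D \<xi> = z"
proof -
  have "(\<lambda>i. (real (w i))\<^sup>2 * (norm (P i \<xi>))\<^sup>2) summable_on I \<longleftrightarrow> (\<lambda>i. (norm (P i z))\<^sup>2) summable_on I"
    using assms by (intro summable_on_cong) (simp add: power_mult_distrib)
  then show "\<xi> \<in> DD" using P_norm_summable by (simp add: DD_def)
  have "((\<lambda>i. real (w i) *\<^sub>R P i \<xi>) has_sum z) I"
    using P_has_sum[of z] assms by (subst has_sum_cong[where g = "\<lambda>i. P i z"]) auto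
  then show "D \<xi> = z" unfolding D_def by (rule infsumI)
qed

lemma P_D:
  assumes "\<xi> \<in> DD" "i \<in> I"
  shows "P i (D \<xi>) = real (w i) *\<^sub>R P i \<xi>"
proof -
  have "(\<lambda>i. (norm (real (w i) *\<^sub>R P i \<xi>))\<^sup>2) summable_on I"
    using assms(1) by (simp add: DD_def power_mult_distrib)
  moreover have "\<And>i. i \<in> I \<Longrightarrow> real (w i) *\<^sub>R P i \<xi> \<in> V i" by (intro V_scaleR P_in)
  ultimately obtain z where z: "\<And>i. i \<in> I \<Longrightarrow> P i z = real (w i) *\<^sub>R P i \<xi>"
    using Riesz_Fischer[of "\<lambda>i. real (w i) *\<^sub>R P i \<xi>"] by blast
  then show ?thesis using D_I(2)[OF z] assms(2) by blast
qed

lemma DD_subspace: "cvec.subspace DD"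
  unfolding cvec.subspace_def
proof (intro conjI ballI allI)
  show "0 \<in> DD" by (rule D_I[of 0]) (simp add: P_0)
  show "x + y \<in> DD" if "x \<in> DD" "y \<in> DD" for x y
    using that by (intro D_I(1)[of "D x + D y"]) (simp add: P_add P_D scaleR_right_distrib)
  show "c *\<^sub>C x \<in> DD" if "x \<in> DD" for c x
    using that by (intro D_I(1)[of "c *\<^sub>C D x"]) (simp add: P_scaleC P_D scaleC_scaleR_commute)
qed

lemma V_DD: "i \<in> I \<Longrightarrow> v \<in> V i \<Longrightarrow> v \<in> DD \<and> D v = real (w i) *\<^sub>R v"
proof -
  assume iv: "i \<in> I" "v \<in> V i"
  have "P j (real (w i) *\<^sub>R v) = real (w j) *\<^sub>R P j v" if "j \<in> I" for j
    using iv that P_other[of j i v] by (cases "j = i") (auto simp: P_scaleR)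
  then show ?thesis using D_I by blast
qed

lemma DD_dense: "closure DD = UNIV"
proof -
  have "cspan (\<Union>i\<in>I. V i) \<subseteq> DD" using V_DD DD_subspace by (intro cvec.span_minimal) auto
  then show ?thesis using closure_mono total by blast
qed

text \<open>Testing the adjoint relation on the vectors of V i forces the coordinates of \<zeta> to
  be w i times those of \<xi>, which already puts \<xi> into the domain.\<close>

lemma D_selfadjoint: "selfadjoint DD D"
proof -
  have sym: "cinner (D \<psi>) \<xi> = cinner \<psi> (D \<xi>)" if "\<psi> \<in> DD" "\<xi> \<in> DD" for \<psi> \<xi>
  proof -
    have "((\<lambda>i. cinner (P i (D \<psi>)) (P i \<xi>)) has_sum cinner (D \<psi>) \<xi>) I" by (rule cinner_has_sum)
    moreover have "((\<lambda>i. cinner (P i (D \<psi>)) (P i \<xi>)) has_sum cinner \<psi> (D \<xi>)) I"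
      using cinner_has_sum[of \<psi> "D \<xi>"] that
      by (subst has_sum_cong[where g = "\<lambda>i. cinner (P i \<psi>) (P i (D \<xi>))"])
        (auto simp: P_D cinner_scaleR_left cinner_scaleR_right)
    ultimately show ?thesis by (rule has_sum_unique)
  qed
  have "\<xi> \<in> DD \<and> \<zeta> = D \<xi>" if adj: "\<forall>\<psi>\<in>DD. cinner (D \<psi>) \<xi> = cinner \<psi> \<zeta>" for \<xi> \<zeta>
  proof -
    have "P i \<zeta> = real (w i) *\<^sub>R P i \<xi>" if i: "i \<in> I" for i
    proof (rule P_eqI[OF i])
      show "real (w i) *\<^sub>R P i \<xi> \<in> V i" using V_scaleR P_in i by blast
      fix \<omega> assume \<omega>: "\<omega> \<in> V i"
      have "cinner \<omega> \<zeta> = real (w i) * cinner \<omega> \<xi>"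
        using adj V_DD[OF i \<omega>] by (metis cinner_scaleR_left)
      then have "cinner \<omega> \<zeta> = cinner \<omega> (real (w i) *\<^sub>R P i \<xi>)"
        using cinner_P_right[OF i \<omega>] by (simp add: cinner_scaleR_right)
      then show "cinner \<zeta> \<omega> = cinner (real (w i) *\<^sub>R P i \<xi>) \<omega>" by (metis cinner_commute)
    qed
    then show ?thesis using D_I by metis
  qed
  then show ?thesis unfolding selfadjoint_def using sym DD_dense by blast
qed

lemma compact_bounded_finite_dim:
  assumes "finite (E :: 'a::cbanach set)"
  shows "compact {\<Sum>b\<in>E. c b *\<^sub>C b | c. \<forall>b\<in>E. cmod (c b) \<le> K}"
  using assms
proof (induction E rule: finite_induct)
  case empty
  have "{\<Sum>b\<in>{}. c b *\<^sub>C b | c. \<forall>b\<in>{}. cmod (c b) \<le> K} \<subseteq> {0::'a}" by auto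
  then show ?case using finite_subset finite_imp_compact by blast
next
  case (insert a E)
  have eq: "{\<Sum>b\<in>insert a E. c b *\<^sub>C b | c. \<forall>b\<in>insert a E. cmod (c b) \<le> K} =
     {x + y | x y. x \<in> (\<lambda>c. c *\<^sub>C a) ` cball 0 K \<and> y \<in> {\<Sum>b\<in>E. c b *\<^sub>C b | c. \<forall>b\<in>E. cmod (c b) \<le> K}}" (is "?L = ?R")
  proof (intro equalityI subsetI)
    fix z assume "z \<in> ?L"
    then obtain c where "z = (\<Sum>b\<in>insert a E. c b *\<^sub>C b)" "\<forall>b\<in>insert a E. cmod (c b) \<le> K" by blast
    moreover have "(\<Sum>b\<in>insert a E. c b *\<^sub>C b) = c a *\<^sub>C a + (\<Sum>b\<in>E. c b *\<^sub>C b)" using insert by simp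
    moreover have "c a *\<^sub>C a \<in> (\<lambda>c. c *\<^sub>C a) ` cball 0 K" using calculation(2) by auto
    moreover have "(\<Sum>b\<in>E. c b *\<^sub>C b) \<in> {\<Sum>b\<in>E. c b *\<^sub>C b | c. \<forall>b\<in>E. cmod (c b) \<le> K}"
      using calculation(2) by blast
    ultimately show "z \<in> ?R" by blast
  next
    fix z assume "z \<in> ?R"
    then obtain d c where z: "z = d *\<^sub>C a + (\<Sum>b\<in>E. c b *\<^sub>C b)" "cmod d \<le> K" "\<forall>b\<in>E. cmod (c b) \<le> K" by auto
    have "(\<Sum>b\<in>E. (c(a := d)) b *\<^sub>C b) = (\<Sum>b\<in>E. c b *\<^sub>C b)" using insert by (intro sum.cong) auto
    then show "z \<in> ?L" using insert z by (intro CollectI exI[of _ "c(a := d)"]) auto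
  qed
  show ?case unfolding eq
  proof (rule compact_sums)
    show "compact ((\<lambda>c. c *\<^sub>C a) ` cball 0 K)"
      using bounded_linear.continuous_on[OF bounded_linear_scaleC_left continuous_on_id]
      by (intro compact_continuous_image) auto
  qed (rule insert.IH)
qed

text \<open>The inverse R is diagonal with entries 1/(1 + w^2). On the unit ball it is uniformly
  close to its truncations, which take values in compact sets, so the image of the ball is totally
  bounded.\<close>

lemma D_compact_resolvent: "compact_resolvent DD D"
proof -
  define h where "h i = 1 / (1 + (real (w i))\<^sup>2)" for i
  have h01: "0 < h i" "h i \<le> 1" for i by (auto simp: h_def add_pos_nonneg divide_le_eq)
  have "\<exists>z. \<forall>i\<in>I. P i z = h i *\<^sub>R P i \<xi>" for \<xi>
  proof -
    have "\<bar>h i\<bar> \<le> 1" for i using h01[of i] by simp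
    then obtain z where "\<And>i. i \<in> I \<Longrightarrow> P i z = h i *\<^sub>R P i \<xi>" using multiplier_exists by blast
    then show ?thesis by blast
  qed
  then obtain R where R: "\<And>\<xi> i. i \<in> I \<Longrightarrow> P i (R \<xi>) = h i *\<^sub>R P i \<xi>" by metis
  have R_dom: "R \<xi> \<in> square_dom DD D \<and> R \<xi> + D (D (R \<xi>)) = \<xi>" for \<xi>
  proof -
    \<comment> \<open>Boundedness of w h gives a vector with the coordinates of D (R \<xi>); a
      second application of D leads to \<xi> - R \<xi>, because w^2 h = 1 - h.\<close>
    have "\<bar>real (w i) * h i\<bar> \<le> 1" for i
    proof -
      have "real (w i) \<le> 1 + (real (w i))\<^sup>2"
        by (cases "w i") (auto simp: power2_eq_square algebra_simps)
      moreover have "0 < 1 + (real (w i))\<^sup>2" by (rule add_pos_nonneg) auto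
      ultimately show ?thesis by (simp add: h_def)
    qed
    then obtain z where "\<And>i. i \<in> I \<Longrightarrow> P i z = (real (w i) * h i) *\<^sub>R P i \<xi>"
      using multiplier_exists[of "\<lambda>i. real (w i) * h i"] by blast
    then have z: "\<And>i. i \<in> I \<Longrightarrow> P i z = real (w i) *\<^sub>R P i (R \<xi>)" by (simp add: R)
    have 1: "R \<xi> \<in> DD" "D (R \<xi>) = z" using D_I[OF z] by auto
    have "P i (\<xi> - R \<xi>) = real (w i) *\<^sub>R P i z" if "i \<in> I" for i
    proof -
      have "1 - h i = (real (w i))\<^sup>2 * h i" by (simp add: h_def field_simps add_pos_nonneg power2_eq_square add_nonneg_eq_0_iff)
      then have "P i \<xi> - h i *\<^sub>R P i \<xi> = ((real (w i))\<^sup>2 * h i) *\<^sub>R P i \<xi>"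
        by (metis scaleR_left_diff_distrib scaleR_one)
      then show ?thesis using that by (simp add: P_diff R z power2_eq_square)
    qed
    from D_I[OF this] show ?thesis using 1 by (auto simp: square_dom_def)
  qed
  have inj: "inj_on (\<lambda>\<xi>. \<xi> + D (D \<xi>)) (square_dom DD D)"
  proof (rule inj_onI)
    fix x y assume xy: "x \<in> square_dom DD D" "y \<in> square_dom DD D" "x + D (D x) = y + D (D y)"
    show "x = y"
    proof (rule vec_eqI)
      fix i assume i: "i \<in> I"
      have "P i (u + D (D u)) = (1 + (real (w i))\<^sup>2) *\<^sub>R P i u" if "u \<in> square_dom DD D" for u
        using that i by (simp add: square_dom_def P_add P_D scaleR_left_distrib power2_eq_square)
      then have "(1 + (real (w i))\<^sup>2) *\<^sub>R P i x = (1 + (real (w i))\<^sup>2) *\<^sub>R P i y" using xy by metis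
      moreover have "1 + (real (w i))\<^sup>2 \<noteq> 0" by (metis add_pos_nonneg less_irrefl zero_le_power2 zero_less_one)
      ultimately show "P i x = P i y" by simp
    qed
  qed
  have bij: "bij_betw (\<lambda>\<xi>. \<xi> + D (D \<xi>)) (square_dom DD D) UNIV"
    unfolding bij_betw_def using inj R_dom by (auto simp: image_iff) metis
  have inv: "the_inv_into (square_dom DD D) (\<lambda>\<xi>. \<xi> + D (D \<xi>)) = R"
    using R_dom by (intro ext the_inv_into_f_eq[OF inj]) auto
  have Rlin: "bounded_clinear R"
    unfolding bounded_clinear_def
  proof
    have norm: "norm (R x) \<le> norm x" for x
    proof (rule norm_le_of_finite_sums)
      fix F assume F: "finite F" "F \<subseteq> I"
      have "(\<Sum>i\<in>F. (norm (P i (R x)))\<^sup>2) \<le> (\<Sum>i\<in>F. (norm (P i x))\<^sup>2)"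
      proof (rule sum_mono)
        fix i assume "i \<in> F"
        then show "(norm (P i (R x)))\<^sup>2 \<le> (norm (P i x))\<^sup>2"
          using F h01[of i] mult_right_mono[of "\<bar>h i\<bar>" 1 "norm (P i x)"] by (intro power_mono) (auto simp: R subset_iff)
      qed
      then show "(\<Sum>i\<in>F. (norm (P i (R x)))\<^sup>2) \<le> (norm x)\<^sup>2" using Bessel[OF F, of x] by linarith
    qed simp
    show "bounded_linear R"
    proof (rule bounded_linear_intro[of _ 1])
      show "R (x + y) = R x + R y" for x y by (rule vec_eqI) (simp add: P_add R scaleR_right_distrib)
      show "R (r *\<^sub>R x) = r *\<^sub>R R x" for r x by (rule vec_eqI) (simp add: P_scaleR R)
    qed (use norm in simp)
    show "\<forall>c x. R (c *\<^sub>C x) = c *\<^sub>C R x"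
      by (intro allI, rule vec_eqI) (simp add: P_scaleC R scaleC_scaleR_commute)
  qed
  have approx: "\<exists>K. compact K \<and> (\<forall>x\<in>cball 0 1. \<exists>y\<in>K. dist (R x) y \<le> e)" if e: "0 < e" for e
  proof -
    \<comment> \<open>For w > N the inequality w \<le> 1 + w^2 gives h < e, so truncation at N costs
      at most e on the unit ball.\<close>
    obtain N where N: "1 / e < real N" using reals_Archimedean2 by blast
    let ?L = "{i \<in> I. w i \<le> N}"
    have "\<exists>E. \<forall>i\<in>I. finite (E i) \<and> orthonormal (E i) \<and> (\<forall>\<xi>. P i \<xi> = (\<Sum>b\<in>E i. cinner \<xi> b *\<^sub>C b))"
      using P_basis by (intro bchoice) metis
    then obtain E where E: "\<And>i. i \<in> I \<Longrightarrow> finite (E i)" "\<And>i. i \<in> I \<Longrightarrow> orthonormal (E i)"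
      "\<And>i \<xi>. i \<in> I \<Longrightarrow> P i \<xi> = (\<Sum>b\<in>E i. cinner \<xi> b *\<^sub>C b)" by blast
    have cmp: "compact {\<Sum>i\<in>G. f i | f. \<forall>i\<in>G. f i \<in> {\<Sum>b\<in>E i. c b *\<^sub>C b | c. \<forall>b\<in>E i. cmod (c b) \<le> 1}}"
      if "finite G" "G \<subseteq> I" for G
      using that
    proof (induction G rule: finite_induct)
      case empty
      have "{\<Sum>i\<in>{}. f i | f. \<forall>i\<in>{}. f i \<in> {\<Sum>b\<in>E i. c b *\<^sub>C b | c. \<forall>b\<in>E i. cmod (c b) \<le> 1}} = {0}" by auto
      then show ?case by simp
    next
      case (insert a G)
      let ?C = "\<lambda>i. {\<Sum>b\<in>E i. c b *\<^sub>C b | c. \<forall>b\<in>E i. cmod (c b) \<le> 1}"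
      have eq: "{\<Sum>i\<in>insert a G. f i | f. \<forall>i\<in>insert a G. f i \<in> ?C i} =
        {x + y | x y. x \<in> ?C a \<and> y \<in> {\<Sum>i\<in>G. f i | f. \<forall>i\<in>G. f i \<in> ?C i}}" (is "?A = ?B")
      proof (intro equalityI subsetI)
        fix z assume "z \<in> ?A"
        then obtain f where f: "z = (\<Sum>i\<in>insert a G. f i)" "\<forall>i\<in>insert a G. f i \<in> ?C i" by blast
        have "z = f a + (\<Sum>i\<in>G. f i)" using f insert by simp
        then show "z \<in> ?B" using f(2) by blast
      next
        fix z assume "z \<in> ?B"
        then obtain x f where z: "z = x + (\<Sum>i\<in>G. f i)" "x \<in> ?C a" "\<forall>i\<in>G. f i \<in> ?C i" by blast
        have "(\<Sum>i\<in>G. (f(a := x)) i) = (\<Sum>i\<in>G. f i)" using insert by (intro sum.cong) auto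
        then have "z = (\<Sum>i\<in>insert a G. (f(a := x)) i)" using insert z by simp
        moreover have "\<forall>i\<in>insert a G. (f(a := x)) i \<in> ?C i" using z by auto
        ultimately show "z \<in> ?A" by blast
      qed
      show ?case unfolding eq
        using insert E(1) by (intro compact_sums compact_bounded_finite_dim) auto
    qed
    define K where "K = {\<Sum>i\<in>?L. f i | f. \<forall>i\<in>?L. f i \<in> {\<Sum>b\<in>E i. c b *\<^sub>C b | c. \<forall>b\<in>E i. cmod (c b) \<le> 1}}"
    have "compact K" unfolding K_def using levels by (intro cmp) auto
    moreover have "\<exists>y\<in>K. dist (R x) y \<le> e" if x: "x \<in> cball 0 1" for x
    proof
      define y where "y = (\<Sum>i\<in>?L. h i *\<^sub>R P i x)"
      show "y \<in> K"
        unfolding y_def K_def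
      proof (rule CollectI, rule exI[of _ "\<lambda>i. h i *\<^sub>R P i x"], rule conjI, rule refl, rule ballI)
        fix i assume i: "i \<in> ?L"
        have "h i *\<^sub>R P i x = (\<Sum>b\<in>E i. (h i * cinner x b) *\<^sub>C b)"
          using i E(3) by (simp add: scaleR_scaleC cvec.scale_sum_right scaleC_scaleC del: scaleC_of_real)
        moreover have "cmod (h i * cinner x b) \<le> 1" if b: "b \<in> E i" for b
        proof -
          have "cinner b b = 1" using E(2) i b by (auto simp: orthonormal_def)
          then have "(norm b)\<^sup>2 = 1" unfolding cinner_self using of_real_eq_1_iff by blast
          then have "norm b = 1" using power2_eq_imp_eq[of "norm b" 1] by simp
          then have "cmod (cinner x b) \<le> 1" using Cauchy_Schwarz_cinner[of x b] x by auto
          then show ?thesis using h01[of i] mult_mono[of "\<bar>h i\<bar>" 1 "cmod (cinner x b)" 1] by (auto simp: norm_mult)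
        qed
        ultimately show "h i *\<^sub>R P i x \<in> {\<Sum>b\<in>E i. c b *\<^sub>C b | c. \<forall>b\<in>E i. cmod (c b) \<le> 1}"
          by (intro CollectI exI[of _ "\<lambda>b. h i * cinner x b"]) auto
      qed
      have "norm (R x - y) \<le> e"
      proof (rule norm_le_of_finite_sums)
        fix F assume F: "finite F" "F \<subseteq> I"
        have Pd: "norm (P i (R x - y)) \<le> e * norm (P i x)" if i: "i \<in> I" for i
        proof (cases "w i \<le> N")
          case True
          have "P i y = (\<Sum>j\<in>?L. P i (h j *\<^sub>R P j x))" unfolding y_def by (rule P_sum[OF i])
          also have "\<dots> = (\<Sum>j\<in>?L. if j = i then h i *\<^sub>R P i x else 0)"
            using i P_in P_id P_other by (intro sum.cong) (auto simp: P_scaleR)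
          finally have "P i y = h i *\<^sub>R P i x" using True i levels by simp
          then show ?thesis using i e by (simp add: P_diff R)
        next
          case False
          have "P i y = (\<Sum>j\<in>?L. P i (h j *\<^sub>R P j x))" unfolding y_def by (rule P_sum[OF i])
          also have "\<dots> = 0"
          proof (rule sum.neutral, intro ballI)
            fix j assume "j \<in> ?L"
            then have "j \<in> I" "i \<noteq> j" using False by auto
            then show "P i (h j *\<^sub>R P j x) = 0" using P_other[OF i] P_in i by (simp add: P_scaleR)
          qed
          finally have "P i (R x - y) = h i *\<^sub>R P i x" using i by (simp add: P_diff R)
          moreover have "h i \<le> e"
          proof -
            have "1 / e \<le> real (w i)" using False N by linarith
            also have "\<dots> \<le> 1 + (real (w i))\<^sup>2" by (cases "w i") (auto simp: power2_eq_square algebra_simps)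
            finally show ?thesis using e by (simp add: h_def field_simps add_pos_nonneg)
          qed
          ultimately show ?thesis using h01[of i] by (simp add: mult_right_mono)
        qed
        have "(\<Sum>i\<in>F. (norm (P i (R x - y)))\<^sup>2) \<le> (\<Sum>i\<in>F. e\<^sup>2 * (norm (P i x))\<^sup>2)"
          using Pd F by (intro sum_mono) (auto simp: power_mult_distrib[symmetric] intro!: power_mono)
        also have "\<dots> = e\<^sup>2 * (\<Sum>i\<in>F. (norm (P i x))\<^sup>2)" by (simp add: sum_distrib_left)
        also have "\<dots> \<le> e\<^sup>2 * (norm x)\<^sup>2" using Bessel[OF F] by (intro mult_left_mono) auto
        also have "\<dots> \<le> e\<^sup>2 * 1" using x by (intro mult_left_mono) (auto simp: power_le_one)
        finally show "(\<Sum>i\<in>F. (norm (P i (R x - y)))\<^sup>2) \<le> e\<^sup>2" by simp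
      qed (use e in simp)
      then show "dist (R x) y \<le> e" by (simp add: dist_norm)
    qed
    ultimately show ?thesis by blast
  qed
  have "compact (closure (R ` cball 0 1))"
    unfolding compact_eq_totally_bounded
  proof (intro conjI allI impI)
    show "complete (closure (R ` cball 0 1))" by (simp add: complete_eq_closed)
    fix e :: real assume e: "0 < e"
    then obtain K where K: "compact K" "\<And>x. x \<in> cball 0 1 \<Longrightarrow> \<exists>y\<in>K. dist (R x) y \<le> e / 4"
      using approx[of "e / 4"] by auto
    then obtain T where T: "finite T" "K \<subseteq> (\<Union>x\<in>T. ball x (e / 4))"
      using e K(1) unfolding compact_eq_totally_bounded by (metis divide_pos_pos zero_less_numeral)
    have "closure (R ` cball 0 1) \<subseteq> (\<Union>x\<in>T. ball x e)"
    proof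
      fix z assume "z \<in> closure (R ` cball 0 1)"
      then obtain x where x: "x \<in> cball 0 1" "dist (R x) z < e / 4"
        using e closure_approachable[of z "R ` cball 0 1"] by (metis (no_types, lifting) imageE divide_pos_pos zero_less_numeral)
      obtain y where y: "y \<in> K" "dist (R x) y \<le> e / 4" using K x by blast
      obtain t where t: "t \<in> T" "dist t y < e / 4" using T y by (auto simp: subset_iff)
      have "dist t z \<le> dist t y + dist (R x) y + dist (R x) z"
        using dist_triangle[of t z y] dist_triangle[of y z "R x"] by (simp add: dist_commute)
      then have "dist t z < e" using x y t e by linarith
      then show "z \<in> (\<Union>x\<in>T. ball x e)" using t by auto
    qed
    then show "\<exists>k. finite k \<and> closure (R ` cball 0 1) \<subseteq> (\<Union>x\<in>k. ball x e)" using T by blast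
  qed
  then show ?thesis unfolding compact_resolvent_def inv compact_operator_def using bij Rlin by blast
qed

section \<open>Commutators of banded operators\<close>

text \<open>The matrix of the commutator has the entries (w i - w k) P_i A P_k, where the factor is
  at most c in modulus on the band and the entry vanishes off it. For each i at most 2c + 1
  eigenvalues contribute, so Cauchy-Schwarz over these and Bessel's inequality bound the
  whole.\<close>

lemma banded_bounded_commutator:
  assumes A: "bounded_clinear A"
    and band: "\<And>i k v. i \<in> I \<Longrightarrow> k \<in> I \<Longrightarrow> v \<in> V k \<Longrightarrow> w i > w k + c \<or> w k > w i + c \<Longrightarrow> P i (A v) = 0"
  shows "bounded_commutator DD D A"
proof -
  have Abl: "bounded_linear A" and AC: "\<And>c x. A (c *\<^sub>C x) = c *\<^sub>C A x"
    using A by (auto simp: bounded_clinear_def)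
  obtain KA where KA: "\<And>x. norm (A x) \<le> norm x * KA" "0 < KA" using bounded_linear.pos_bounded[OF Abl] by blast
  have A_add: "A (x + y) = A x + A y" for x y using Abl by (simp add: bounded_linear.linear linear_add)
  have A_diff: "A (x - y) = A x - A y" for x y using Abl by (simp add: bounded_linear.linear linear_diff)
  have A_sum: "A (sum f S) = (\<Sum>s\<in>S. A (f s))" for f :: "'i \<Rightarrow> 'h" and S using Abl by (simp add: bounded_linear.linear linear_sum)
  define W where "W k = {i \<in> I. w i \<le> w k + c \<and> w k \<le> w i + c}" for k
  have finW: "finite (W k)" for k unfolding W_def by (rule finite_subset[OF _ levels[of "w k + c"]]) auto
  \<comment> \<open>By the band condition A v has only finitely many non-zero coordinates.\<close>
  have A_V_DD: "A v \<in> DD" if kv: "k \<in> I" "v \<in> V k" for k v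
    unfolding DD_def
  proof
    have "(\<lambda>i. (real (w i))\<^sup>2 * (norm (P i (A v)))\<^sup>2) summable_on W k" using finW by simp
    then show "(\<lambda>i. (real (w i))\<^sup>2 * (norm (P i (A v)))\<^sup>2) summable_on I"
    proof (rule summable_on_cong_neutral[THEN iffD1, rotated -1])
      show "(real (w x))\<^sup>2 * (norm (P x (A v)))\<^sup>2 = 0" if "x \<in> I - W k" for x
        using band[OF _ kv, of x] that by (auto simp: W_def not_le)
    qed (auto simp: W_def)
  qed
  have dom: "closure (commutator_dom DD A) = UNIV"
  proof -
    have "cvec.subspace (commutator_dom DD A)"
      using DD_subspace linear_0[OF bounded_linear.linear[OF Abl]]
      by (auto simp: cvec.subspace_def commutator_dom_def A_add AC)
    then have "cspan (\<Union>i\<in>I. V i) \<subseteq> commutator_dom DD A"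
      using V_DD A_V_DD by (intro cvec.span_minimal) (auto simp: commutator_dom_def)
    then show ?thesis using closure_mono total by blast
  qed
  define \<zeta> where "\<zeta> \<xi> i = (\<Sum>k\<in>W i. (real (w i) - real (w k)) *\<^sub>R P i (A (P k \<xi>)))" for \<xi> i
  \<comment> \<open>The projection onto the eigenspace of D for the eigenvalue N.\<close>
  define Q where "Q N \<xi> = (\<Sum>k\<in>{k \<in> I. w k = N}. P k \<xi>)" for N \<xi>
  define J where "J i = {N. N \<le> w i + c \<and> w i \<le> N + c}" for i
  \<comment> \<open>Cauchy-Schwarz over at most 2c + 1 terms gives a factor 2c + 1 for the squared
    norms; its square is taken so that K contains no root.\<close>
  define K where "K = (2 * real c + 1) * real c * KA"
  have finL: "finite {k \<in> I. w k = N}" for N by (rule finite_subset[OF _ levels[of N]]) auto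
  have finJ: "finite (J i)" "card (J i) \<le> 2 * c + 1" for i
  proof -
    have "J i \<subseteq> {w i - c..w i + c}" by (auto simp: J_def)
    then show "finite (J i)" "card (J i) \<le> 2 * c + 1"
      using card_mono[of "{w i - c..w i + c}" "J i"] finite_subset by auto
  qed
  \<comment> \<open>The set W i may be large, but grouped by eigenvalue there are at most 2c + 1
    terms, and Bessel's inequality can be applied to each \<open>A (Q N \<xi>)\<close>.\<close>
  have \<zeta>_Q: "\<zeta> \<xi> i = (\<Sum>N\<in>J i. (real (w i) - real N) *\<^sub>R P i (A (Q N \<xi>)))" if i: "i \<in> I" for \<xi> i
  proof -
    have "\<zeta> \<xi> i = (\<Sum>N\<in>J i. \<Sum>k\<in>{k \<in> W i. w k = N}. (real (w i) - real (w k)) *\<^sub>R P i (A (P k \<xi>)))"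
      unfolding \<zeta>_def using finW finJ by (intro sum.group[symmetric]) (auto simp: W_def J_def)
    also have "\<dots> = (\<Sum>N\<in>J i. (real (w i) - real N) *\<^sub>R P i (A (Q N \<xi>)))"
    proof (rule sum.cong[OF refl])
      fix N assume N: "N \<in> J i"
      have "{k \<in> W i. w k = N} = {k \<in> I. w k = N}" using N by (auto simp: W_def J_def)
      then show "(\<Sum>k\<in>{k \<in> W i. w k = N}. (real (w i) - real (w k)) *\<^sub>R P i (A (P k \<xi>))) =
          (real (w i) - real N) *\<^sub>R P i (A (Q N \<xi>))"
        unfolding Q_def by (simp add: A_sum P_sum[OF i] scaleR_sum_right)
    qed
    finally show ?thesis .
  qed
  have bound: "(\<Sum>i\<in>F. (norm (\<zeta> \<xi> i))\<^sup>2) \<le> (K * norm \<xi>)\<^sup>2" if F: "finite F" "F \<subseteq> I" for F \<xi>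
  proof -
    \<comment> \<open>A common bound for all eigenvalues within distance c of those occurring in F;
      it lets the two sums be interchanged.\<close>
    define M where "M = Max (insert 0 (w ` F)) + c"
    have M: "J i \<subseteq> {..M}" if "i \<in> F" for i
    proof -
      have "w i \<le> Max (insert 0 (w ` F))" using F that by (intro Max_ge) auto
      then show ?thesis by (auto simp: J_def M_def)
    qed
    have one: "(norm (\<zeta> \<xi> i))\<^sup>2 \<le> (2 * real c + 1) * (real c)\<^sup>2 * (\<Sum>N\<le>M. (norm (P i (A (Q N \<xi>))))\<^sup>2)" if i: "i \<in> F" for i
    proof -
      have "norm (\<zeta> \<xi> i) \<le> (\<Sum>N\<in>J i. real c * norm (P i (A (Q N \<xi>))))"
        unfolding \<zeta>_Q[OF subsetD[OF F(2) i]]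
        by (rule sum_norm_le) (auto simp: J_def intro!: mult_right_mono)
      then have "(norm (\<zeta> \<xi> i))\<^sup>2 \<le> (\<Sum>N\<in>J i. real c * norm (P i (A (Q N \<xi>))))\<^sup>2" by (intro power_mono) auto
      also have "\<dots> \<le> (\<Sum>N\<in>J i. (real c * norm (P i (A (Q N \<xi>))))\<^sup>2) * real (card (J i))"
        by (rule sum_squared_le_sum_of_squares)
      also have "\<dots> \<le> (\<Sum>N\<in>J i. (real c * norm (P i (A (Q N \<xi>))))\<^sup>2) * (2 * real c + 1)"
        using finJ(2)[of i] by (intro mult_left_mono sum_nonneg) (auto simp: of_nat_le_iff[symmetric, where 'a = real] simp del: of_nat_le_iff)
      also have "\<dots> \<le> (\<Sum>N\<le>M. (real c * norm (P i (A (Q N \<xi>))))\<^sup>2) * (2 * real c + 1)"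
        using M[OF i] by (intro mult_right_mono sum_mono2) auto
      finally show ?thesis by (simp add: power_mult_distrib sum_distrib_left[symmetric] mult_ac)
    qed
    have "(\<Sum>i\<in>F. (norm (\<zeta> \<xi> i))\<^sup>2) \<le> (\<Sum>i\<in>F. (2 * real c + 1) * (real c)\<^sup>2 * (\<Sum>N\<le>M. (norm (P i (A (Q N \<xi>))))\<^sup>2))"
      by (rule sum_mono) (rule one)
    also have "\<dots> = (2 * real c + 1) * (real c)\<^sup>2 * (\<Sum>N\<le>M. \<Sum>i\<in>F. (norm (P i (A (Q N \<xi>))))\<^sup>2)"
      by (subst sum.swap) (simp add: sum_distrib_left)
    also have "\<dots> \<le> (2 * real c + 1) * (real c)\<^sup>2 * (\<Sum>N\<le>M. (norm (Q N \<xi>) * KA)\<^sup>2)"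
    proof (intro mult_left_mono sum_mono)
      fix N
      have "(\<Sum>i\<in>F. (norm (P i (A (Q N \<xi>))))\<^sup>2) \<le> (norm (A (Q N \<xi>)))\<^sup>2" by (rule Bessel[OF F])
      also have "\<dots> \<le> (norm (Q N \<xi>) * KA)\<^sup>2" using KA(1) by (intro power_mono) auto
      finally show "(\<Sum>i\<in>F. (norm (P i (A (Q N \<xi>))))\<^sup>2) \<le> (norm (Q N \<xi>) * KA)\<^sup>2" .
    qed simp
    also have "\<dots> = (2 * real c + 1) * (real c)\<^sup>2 * KA\<^sup>2 * (\<Sum>N\<le>M. (norm (Q N \<xi>))\<^sup>2)"
      by (simp add: power_mult_distrib sum_distrib_right[symmetric])
    also have "(\<Sum>N\<le>M. (norm (Q N \<xi>))\<^sup>2) = (\<Sum>N\<le>M. \<Sum>k\<in>{k \<in> {k \<in> I. w k \<le> M}. w k = N}. (norm (P k \<xi>))\<^sup>2)"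
    proof (rule sum.cong[OF refl])
      fix N assume "N \<in> {..M}"
      then have eq: "{k \<in> {k \<in> I. w k \<le> M}. w k = N} = {k \<in> I. w k = N}" by auto
      show "(norm (Q N \<xi>))\<^sup>2 = (\<Sum>k\<in>{k \<in> {k \<in> I. w k \<le> M}. w k = N}. (norm (P k \<xi>))\<^sup>2)"
        unfolding Q_def eq using finL P_in by (intro norm_sum_V) auto
    qed
    also have "\<dots> = (\<Sum>k\<in>{k \<in> I. w k \<le> M}. (norm (P k \<xi>))\<^sup>2)"
      using levels[of M] by (intro sum.group) auto
    also have "\<dots> \<le> (norm \<xi>)\<^sup>2" using levels by (intro Bessel) auto
    finally have "(\<Sum>i\<in>F. (norm (\<zeta> \<xi> i))\<^sup>2) \<le> (2 * real c + 1) * (real c)\<^sup>2 * KA\<^sup>2 * (norm \<xi>)\<^sup>2"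
      by (simp add: mult_left_mono)
    also have "\<dots> \<le> (2 * real c + 1)\<^sup>2 * (real c)\<^sup>2 * KA\<^sup>2 * (norm \<xi>)\<^sup>2"
      by (intro mult_right_mono) (auto simp: power2_eq_square)
    finally show ?thesis by (simp add: K_def power_mult_distrib)
  qed
  have \<zeta>_V: "\<zeta> \<xi> i \<in> V i" if "i \<in> I" for \<xi> i
    unfolding \<zeta>_def using that by (intro cvec.subspace_sum[OF sub] V_scaleR P_in)
  have "\<exists>z. \<forall>i\<in>I. P i z = \<zeta> \<xi> i" for \<xi>
  proof -
    have "(\<lambda>i. (norm (\<zeta> \<xi> i))\<^sup>2) summable_on I"
    proof (rule nonneg_bdd_above_summable_on)
      show "bdd_above (sum (\<lambda>i. (norm (\<zeta> \<xi> i))\<^sup>2) ` {F. F \<subseteq> I \<and> finite F})"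
        by (rule bdd_aboveI2[of _ _ "(K * norm \<xi>)\<^sup>2"]) (rule bound; simp)
    qed simp
    then show ?thesis by (rule Riesz_Fischer[of "\<zeta> \<xi>", rotated 1]) (auto intro: \<zeta>_V)
  qed
  then obtain C where C: "\<And>\<xi> i. i \<in> I \<Longrightarrow> P i (C \<xi>) = \<zeta> \<xi> i" by metis
  have K0: "0 \<le> K" using KA by (simp add: K_def)
  have C_norm: "norm (C \<xi>) \<le> K * norm \<xi>" for \<xi>
    using bound K0 by (intro norm_le_of_finite_sums) (auto simp: C subset_iff cong: sum.cong)
  have C_lin: "bounded_clinear C"
    unfolding bounded_clinear_def
  proof
    show "bounded_linear C"
    proof (rule bounded_linear_intro[of _ K])
      show "C (x + y) = C x + C y" for x y
        by (rule vec_eqI) (auto simp: C P_add \<zeta>_def A_add W_def scaleR_right_distrib sum.distrib[symmetric] intro!: sum.cong)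
      show "C (r *\<^sub>R x) = r *\<^sub>R C x" for r x
        by (rule vec_eqI) (auto simp: C P_scaleR \<zeta>_def W_def linear_cmul[OF bounded_linear.linear[OF Abl]] scaleR_sum_right mult.commute intro!: sum.cong)
    qed (use C_norm in \<open>simp add: mult.commute\<close>)
    show "\<forall>c x. C (c *\<^sub>C x) = c *\<^sub>C C x"
      by (intro allI, rule vec_eqI)
        (auto simp: C P_scaleC \<zeta>_def W_def AC cvec.scale_sum_right scaleC_scaleR_commute intro!: sum.cong)
  qed
  have PA: "P i (A \<xi>) = (\<Sum>k\<in>W i. P i (A (P k \<xi>)))" if i: "i \<in> I" for i \<xi>
  proof -
    have "((\<lambda>k. P i (A (P k \<xi>))) has_sum P i (A \<xi>)) I"
      using has_sum_bounded_linear[OF bounded_linear_compose[OF P_bounded_linear[OF i] Abl] P_has_sum] by (simp add: comp_def)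
    moreover have "((\<lambda>k. P i (A (P k \<xi>))) has_sum (\<Sum>k\<in>W i. P i (A (P k \<xi>)))) I"
    proof (rule has_sum_finite_neutralI)
      show "P i (A (P x \<xi>)) = 0" if "x \<in> I - W i" for x
      proof -
        have x: "x \<in> I" "w i > w x + c \<or> w x > w i + c" using that by (auto simp: W_def)
        show ?thesis by (rule band[OF i x(1) P_in[OF x(1)] x(2)])
      qed
    qed (use finW in \<open>auto simp: W_def\<close>)
    ultimately show ?thesis by (rule has_sum_unique)
  qed
  have "C \<xi> = D (A \<xi>) - A (D \<xi>)" if \<xi>: "\<xi> \<in> commutator_dom DD A" for \<xi>
  proof (rule vec_eqI)
    fix i assume i: "i \<in> I"
    have d: "\<xi> \<in> DD" "A \<xi> \<in> DD" using \<xi> by (auto simp: commutator_dom_def)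
    have "P i (A (D \<xi>)) = (\<Sum>k\<in>W i. real (w k) *\<^sub>R P i (A (P k \<xi>)))"
      unfolding PA[OF i, of "D \<xi>"]
      using d i by (intro sum.cong) (auto simp: W_def P_D linear_cmul[OF bounded_linear.linear[OF Abl]] P_scaleR)
    moreover have "P i (D (A \<xi>)) = (\<Sum>k\<in>W i. real (w i) *\<^sub>R P i (A (P k \<xi>)))"
      using d i by (simp add: P_D PA[OF i, of \<xi>] scaleR_sum_right)
    ultimately show "P i (C \<xi>) = P i (D (A \<xi>) - A (D \<xi>))"
      using i by (simp add: C \<zeta>_def P_diff scaleR_left_diff_distrib sum_subtractf)
  qed
  then show ?thesis unfolding bounded_commutator_def using dom C_lin by blast
qed

end


section \<open>The GNS representation\<close>

lemma norm_star [simp]: "norm (star (a::'a::cstar_algebra)) = norm a"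
proof -
  have le: "norm b \<le> norm (star b)" for b :: 'a
  proof (cases "norm b = 0")
    case False
    have "norm b * norm b \<le> norm (star b) * norm b"
      using norm_mult_ineq[of "star b" b] by (simp add: norm_star_mult power2_eq_square)
    then show ?thesis using False by simp
  qed simp
  show ?thesis using le[of a] le[of "star a"] by (simp add: star_star)
qed

section \<open>Extension of operators from dense subspaces\<close>

lemma continuous_eq_dense:
  fixes f g :: "'a::topological_space \<Rightarrow> 'b::t2_space"
  assumes "continuous_on UNIV f" "continuous_on UNIV g" "closure S = UNIV" "\<And>x. x \<in> S \<Longrightarrow> f x = g x"
  shows "f x = g x"
proof -
  have "closed {x. f x = g x}" using assms(1,2) by (rule closed_Collect_eq)
  then have "closure S \<subseteq> {x. f x = g x}" using assms(4) by (intro closure_minimal) auto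
  then show ?thesis using assms(3) by auto
qed

lemma bounded_linear_dense_extension:
  fixes S :: "'a::cbanach set" and f :: "'a \<Rightarrow> 'b::cbanach"
  assumes S: "closure S = UNIV" "cvec.subspace S"
    and add: "\<And>x y. x \<in> S \<Longrightarrow> y \<in> S \<Longrightarrow> f (x + y) = f x + f y"
    and scale: "\<And>c x. x \<in> S \<Longrightarrow> f (c *\<^sub>C x) = c *\<^sub>C f x"
    and bd: "\<And>x. x \<in> S \<Longrightarrow> norm (f x) \<le> K * norm x"
  obtains T where "bounded_clinear T" "\<And>x. x \<in> S \<Longrightarrow> T x = f x"
proof -
  have diff: "f (x - y) = f x - f y" if "x \<in> S" "y \<in> S" for x y
    using add[of "x - y" y] cvec.subspace_diff[OF S(2)] that by simp
  have "uniformly_continuous_on S f"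
  proof (rule lipschitz_on_uniformly_continuous)
    show "\<bar>K\<bar>-lipschitz_on S f"
    proof (rule lipschitz_onI)
      fix x y assume "x \<in> S" "y \<in> S"
      then have "dist (f x) (f y) \<le> K * dist x y"
        using bd[of "x - y"] cvec.subspace_diff[OF S(2)] by (simp add: dist_norm diff)
      also have "\<dots> \<le> \<bar>K\<bar> * dist x y" by (intro mult_right_mono) auto
      finally show "dist (f x) (f y) \<le> \<bar>K\<bar> * dist x y" .
    qed simp
  qed
  then obtain T where T: "uniformly_continuous_on (closure S) T" "\<And>x. x \<in> S \<Longrightarrow> f x = T x"
    by (rule uniformly_continuous_on_extension_on_closure) blast
  have Tc: "continuous_on UNIV T" using T(1) S(1) uniformly_continuous_imp_continuous by metis
  have cc: "continuous_on UNIV (\<lambda>x. T (g x))" if "continuous_on UNIV g" for g :: "'a \<Rightarrow> 'a"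
    using continuous_on_compose2[OF Tc that] by simp
  have ci: "continuous_on UNIV (\<lambda>x::'b. c *\<^sub>C x)" "continuous_on UNIV (\<lambda>x::'a. c *\<^sub>C x)" for c
    by (intro linear_continuous_on bounded_linear_scaleC)+
  \<comment> \<open>Additivity is extended by continuity in one variable at a time.\<close>
  have a1: "T (x + y) = T x + T y" if y: "y \<in> S" for x y
    by (rule continuous_eq_dense[OF _ _ S(1)]) (use T(2) add y cvec.subspace_add[OF S(2)] in \<open>auto intro!: continuous_intros cc Tc\<close>)
  have a2: "T (x + y) = T x + T y" for x y
    by (rule continuous_eq_dense[OF _ _ S(1), where x = y]) (use a1 in \<open>auto intro!: continuous_intros cc Tc\<close>)
  have s: "T (c *\<^sub>C x) = c *\<^sub>C T x" for c x
    by (rule continuous_eq_dense[OF _ _ S(1)])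
      (use T(2) scale cvec.subspace_scale[OF S(2)] in \<open>auto intro!: cc ci continuous_on_compose2[OF ci(1) Tc]\<close>)
  have n: "norm (T x) \<le> K * norm x" for x
  proof -
    have "closed {x. norm (T x) \<le> K * norm x}"
      by (intro closed_Collect_le continuous_intros Tc)
    then have "closure S \<subseteq> {x. norm (T x) \<le> K * norm x}" using T(2) bd by (intro closure_minimal) auto
    then show ?thesis using S(1) by auto
  qed
  have "bounded_linear T"
    by (rule bounded_linear_intro[of _ K]) (use a2 s n in \<open>simp_all add: mult.commute scaleR_scaleC del: scaleC_of_real\<close>)
  then show ?thesis using that[of T] s T(2) by (simp add: bounded_clinear_def)
qed

section \<open>Left multiplication on the GNS space\<close>

locale gns_rep =
  fixes \<tau> :: "'a::cstar_algebra \<Rightarrow> complex" and \<eta> :: "'a \<Rightarrow> 'h::chilbert"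
  assumes gns: "is_gns_space \<tau> \<eta>" and tau: "bounded_linear \<tau>"
begin

lemma eta_add: "\<eta> (a + b) = \<eta> a + \<eta> b"
  and eta_scaleC: "\<eta> (c *\<^sub>C a) = c *\<^sub>C \<eta> a"
  and cinner_eta: "cinner (\<eta> a) (\<eta> b) = \<tau> (star b * a)"
  and eta_dense: "closure (range \<eta>) = UNIV"
  using gns unfolding is_gns_space_def by blast+

lemma norm_eta: "(norm (\<eta> a))\<^sup>2 = Re (\<tau> (star a * a))"
  using arg_cong[OF cinner_self[of "\<eta> a"], of Re] by (simp add: cinner_eta)

lemma eta_bounded: obtains C where "0 \<le> C" "\<And>a. norm (\<eta> a) \<le> C * norm a"
proof -
  obtain K where K: "0 \<le> K" "\<And>a. norm (\<tau> a) \<le> norm a * K"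
    using bounded_linear.nonneg_bounded[OF tau] by blast
  have "norm (\<eta> a) \<le> sqrt K * norm a" for a
  proof (rule power2_le_imp_le)
    have "(norm (\<eta> a))\<^sup>2 \<le> cmod (\<tau> (star a * a))" using norm_eta complex_Re_le_cmod by simp
    also have "\<dots> \<le> (sqrt K * norm a)\<^sup>2"
      using K(2)[of "star a * a"] K(1) by (simp add: norm_star_mult power_mult_distrib mult.commute)
    finally show "(norm (\<eta> a))\<^sup>2 \<le> (sqrt K * norm a)\<^sup>2" .
  qed (use K in simp)
  then show ?thesis using that[of "sqrt K"] K(1) by simp
qed

lemma eta_bounded_linear: "bounded_linear \<eta>"
proof -
  obtain C where "\<And>a. norm (\<eta> a) \<le> C * norm a" using eta_bounded by metis
  then show ?thesis
    by (intro bounded_linear_intro[of _ C]) (simp_all add: eta_add eta_scaleC scaleR_scaleC mult.commute del: scaleC_of_real)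
qed

lemmas eta_diff = linear_diff[OF bounded_linear.linear[OF eta_bounded_linear]]
lemmas eta_sum = linear_sum[OF bounded_linear.linear[OF eta_bounded_linear]]

text \<open>For self-adjoint h the squared norm of h b is the inner product of h h b with b, so
  Cauchy-Schwarz passes from h to its square.\<close>

lemma norm_eta_mult_self_adjoint:
  assumes "star h = h" shows "(norm (\<eta> (h * b)))\<^sup>2 \<le> norm (\<eta> (h * h * b)) * norm (\<eta> b)"
proof -
  have "cinner (\<eta> (h * h * b)) (\<eta> b) = \<tau> (star (h * b) * (h * b))"
    by (simp add: cinner_eta star_mult assms mult.assoc)
  then have "(norm (\<eta> (h * b)))\<^sup>2 = Re (cinner (\<eta> (h * h * b)) (\<eta> b))" by (simp add: norm_eta)
  also have "\<dots> \<le> norm (\<eta> (h * h * b)) * norm (\<eta> b)"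
    using complex_Re_le_cmod Cauchy_Schwarz_cinner by (rule order_trans)
  finally show ?thesis .
qed

text \<open>Iterating the previous estimate along \<open>h, h\<^sup>2, h\<^sup>4, \<dots>\<close> replaces the constant of
  \<open>eta_bounded\<close> by its \<open>2\<^sup>n\<close>-th root.\<close>

lemma norm_eta_mult_self_adjoint_le:
  assumes h: "star h = h" shows "norm (\<eta> (h * b)) \<le> norm h * norm (\<eta> b)"
proof (cases "\<eta> b = 0")
  case True
  then show ?thesis using norm_eta_mult_self_adjoint[OF h, of b] by simp
next
  case False
  define Y where "Y = norm (\<eta> b)"
  have Y: "0 < Y" using False by (simp add: Y_def)
  define g where "g = rec_nat h (\<lambda>_ x. x * x)"
  have g: "g 0 = h" "g (Suc n) = g n * g n" for n by (simp_all add: g_def)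
  have gs: "star (g n) = g n" for n by (induction n) (simp_all add: g h star_mult)
  have gn: "norm (g n) = norm h ^ (2 ^ n)" for n
  proof (induction n)
    case (Suc n)
    have "norm (g n * g n) = (norm (g n))\<^sup>2" using norm_star_mult[of "g n"] by (simp add: gs)
    then show ?case using Suc by (simp add: g power_mult[symmetric] mult.commute)
  qed (simp add: g)
  define r where "r = norm (\<eta> (h * b)) / Y"
  have r: "r ^ (2 ^ n) \<le> norm (\<eta> (g n * b)) / Y" for n
  proof (induction n)
    case 0
    then show ?case by (simp add: r_def g)
  next
    case (Suc n)
    have "r ^ (2 ^ Suc n) = (r ^ (2 ^ n))\<^sup>2" by (simp add: power_mult[symmetric] mult.commute)
    also have "\<dots> \<le> (norm (\<eta> (g n * b)) / Y)\<^sup>2" using Suc Y by (intro power_mono) (simp_all add: r_def)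
    also have "\<dots> \<le> norm (\<eta> (g (Suc n) * b)) * Y / Y\<^sup>2"
      unfolding power_divide using norm_eta_mult_self_adjoint[OF gs, of n b] by (intro divide_right_mono) (simp_all add: g Y_def)
    also have "\<dots> = norm (\<eta> (g (Suc n) * b)) / Y" using Y by (simp add: power2_eq_square)
    finally show ?case .
  qed
  obtain C where C: "0 \<le> C" "\<And>a. norm (\<eta> a) \<le> C * norm a" using eta_bounded by metis
  define L where "L = C * norm b / Y"
  \<comment> \<open>L does not depend on n, so r cannot exceed the norm of h: the powers of a
    quotient greater than 1 would stay bounded.\<close>
  have bound: "r ^ (2 ^ n) \<le> L * norm h ^ (2 ^ n)" for n
  proof -
    have "norm (\<eta> (g n * b)) \<le> C * norm (g n * b)" by (rule C(2))
    also have "\<dots> \<le> C * (norm (g n) * norm b)" using C(1) norm_mult_ineq by (intro mult_left_mono)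
    finally have "norm (\<eta> (g n * b)) / Y \<le> C * (norm (g n) * norm b) / Y" using Y by (intro divide_right_mono) simp_all
    then show ?thesis using r[of n] by (simp add: gn L_def mult_ac)
  qed
  have "r \<le> norm h"
  proof (rule ccontr)
    assume nle: "\<not> r \<le> norm h"
    show False
    proof (cases "norm h = 0")
      case True
      then show False using bound[of 0] nle by simp
    next
      case h0: False
      then have "1 < r / norm h" using nle by simp
      then obtain n where n: "L < (r / norm h) ^ n" using real_arch_pow by blast
      have "(r / norm h) ^ n \<le> (r / norm h) ^ (2 ^ n)"
        using \<open>1 < r / norm h\<close> by (intro power_increasing) (simp_all add: less_imp_le)
      moreover have "(r / norm h) ^ (2 ^ n) \<le> L"
        using bound[of n] h0 by (simp add: power_divide divide_le_eq)
      ultimately show False using n by simp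
    qed
  qed
  then show ?thesis using Y by (simp add: r_def Y_def divide_le_eq)
qed

text \<open>Reduction to the self-adjoint element \<open>star a * a\<close>, whose norm is the
  square of that of a.\<close>

lemma norm_eta_mult_le: "norm (\<eta> (a * b)) \<le> norm a * norm (\<eta> b)"
proof (rule power2_le_imp_le)
  let ?h = "star a * a"
  have "(norm (\<eta> (a * b)))\<^sup>2 = Re (cinner (\<eta> (?h * b)) (\<eta> b))"
    by (simp add: norm_eta cinner_eta star_mult mult.assoc)
  also have "\<dots> \<le> norm (\<eta> (?h * b)) * norm (\<eta> b)"
    using complex_Re_le_cmod Cauchy_Schwarz_cinner by (rule order_trans)
  also have "\<dots> \<le> (norm ?h * norm (\<eta> b)) * norm (\<eta> b)"
    by (intro mult_right_mono norm_eta_mult_self_adjoint_le) (simp_all add: star_mult star_star)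
  also have "\<dots> = (norm a * norm (\<eta> b))\<^sup>2" by (simp add: norm_star_mult power2_eq_square)
  finally show "(norm (\<eta> (a * b)))\<^sup>2 \<le> (norm a * norm (\<eta> b))\<^sup>2" .
qed simp

lemma left_mult: "bounded_clinear (left_mult \<eta> a)" "left_mult \<eta> a (\<eta> b) = \<eta> (a * b)"
proof -
  \<comment> \<open>\<open>inv \<eta>\<close> picks some preimage; by the norm estimate the result
    is the same for every choice.\<close>
  have eq: "\<eta> (a * inv \<eta> (\<eta> b)) = \<eta> (a * b)" for b
  proof -
    have "norm (\<eta> (a * (inv \<eta> (\<eta> b) - b))) \<le> norm a * norm (\<eta> (inv \<eta> (\<eta> b) - b))" by (rule norm_eta_mult_le)
    also have "\<dots> = 0" by (simp add: eta_diff f_inv_into_f)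
    finally show ?thesis by (simp add: right_diff_distrib eta_diff)
  qed
  have sub: "cvec.subspace (range \<eta>)"
  proof (rule cvec.subspaceI)
    show "0 \<in> range \<eta>" using eta_diff[of undefined undefined] by (metis cancel_comm_monoid_add_class.diff_cancel rangeI)
  qed (auto simp: eta_add[symmetric] eta_scaleC[symmetric])
  obtain T where T: "bounded_clinear T" "\<And>x. x \<in> range \<eta> \<Longrightarrow> T x = \<eta> (a * inv \<eta> x)"
  proof (rule bounded_linear_dense_extension[OF eta_dense sub])
    show "\<eta> (a * inv \<eta> (x + y)) = \<eta> (a * inv \<eta> x) + \<eta> (a * inv \<eta> y)" if xy: "x \<in> range \<eta>" "y \<in> range \<eta>" for x y
    proof -
      obtain b c where "x = \<eta> b" "y = \<eta> c" using xy by blast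
      then show ?thesis by (simp add: eta_add[symmetric] eq distrib_left)
    qed
    show "\<eta> (a * inv \<eta> (c *\<^sub>C x)) = c *\<^sub>C \<eta> (a * inv \<eta> x)" if x: "x \<in> range \<eta>" for c x
    proof -
      obtain b where "x = \<eta> b" using x by blast
      then show ?thesis by (simp add: eta_scaleC[symmetric] eq mult_scaleC_right)
    qed
    show "norm (\<eta> (a * inv \<eta> x)) \<le> norm a * norm x" if x: "x \<in> range \<eta>" for x
      using norm_eta_mult_le[of a "inv \<eta> x"] x by (simp add: f_inv_into_f)
  qed blast
  have ex: "bounded_clinear T \<and> (\<forall>b. T (\<eta> b) = \<eta> (a * b))" using T eq by simp
  moreover have "T' = T" if "bounded_clinear T' \<and> (\<forall>b. T' (\<eta> b) = \<eta> (a * b))" for T'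
  proof
    fix x show "T' x = T x"
      by (rule continuous_eq_dense[OF _ _ eta_dense])
        (use that ex in \<open>auto simp: bounded_clinear_def linear_continuous_on\<close>)
  qed
  ultimately have "bounded_clinear (left_mult \<eta> a) \<and> (\<forall>b. left_mult \<eta> a (\<eta> b) = \<eta> (a * b))"
    unfolding left_mult_def by (rule theI)
  then show "bounded_clinear (left_mult \<eta> a)" "left_mult \<eta> a (\<eta> b) = \<eta> (a * b)" by auto
qed

lemma left_mult_adjoint: "cinner (left_mult \<eta> a x) y = cinner x (left_mult \<eta> (star a) y)"
proof -
  have c1: "continuous_on UNIV (left_mult \<eta> a)" for a
    using left_mult(1)[of a] by (simp add: bounded_clinear_def linear_continuous_on)
  have cl: "continuous_on UNIV (\<lambda>x. cinner x y)" and cr: "continuous_on UNIV (\<lambda>x. cinner y x)" for y :: 'h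
    by (intro linear_continuous_on bounded_linear_cinner_left bounded_linear_cinner_right)+
  have 1: "cinner (left_mult \<eta> a x) (\<eta> c) = cinner x (left_mult \<eta> (star a) (\<eta> c))" for x c
  proof (rule continuous_eq_dense[OF _ _ eta_dense,
        where f = "\<lambda>x. cinner (left_mult \<eta> a x) (\<eta> c)" and g = "\<lambda>x. cinner x (left_mult \<eta> (star a) (\<eta> c))"])
    show "continuous_on UNIV (\<lambda>x. cinner (left_mult \<eta> a x) (\<eta> c))" by (rule continuous_on_compose2[OF cl c1]) simp
    show "continuous_on UNIV (\<lambda>x. cinner x (left_mult \<eta> (star a) (\<eta> c)))" by (rule cl)
    show "cinner (left_mult \<eta> a x) (\<eta> c) = cinner x (left_mult \<eta> (star a) (\<eta> c))" if "x \<in> range \<eta>" for x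
      using that by (auto simp: left_mult(2) cinner_eta star_mult star_star mult.assoc)
  qed
  show ?thesis
  proof (rule continuous_eq_dense[OF _ _ eta_dense,
        where f = "\<lambda>y. cinner (left_mult \<eta> a x) y" and g = "\<lambda>y. cinner x (left_mult \<eta> (star a) y)"])
    show "continuous_on UNIV (\<lambda>y. cinner (left_mult \<eta> a x) y)" by (rule cr)
    show "continuous_on UNIV (\<lambda>y. cinner x (left_mult \<eta> (star a) y))" by (rule continuous_on_compose2[OF cr c1]) simp
  qed (use 1 in auto)
qed

end

lemma cspan_orthogonal:
  assumes "\<And>a b. a \<in> A \<Longrightarrow> b \<in> B \<Longrightarrow> cinner a b = 0" "x \<in> cspan A" "y \<in> cspan B"
  shows "cinner x (y::'h::chilbert) = 0"
  using assms(2)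
proof (induction rule: cvec.span_induct_alt)
  case (step c a z)
  have "cinner a y = 0"
    using assms(3)
  proof (induction rule: cvec.span_induct_alt)
    case (step c b y)
    then show ?case using assms(1)[OF \<open>a \<in> A\<close>] by (simp add: cinner_add_right cinner_scaleC_right)
  qed simp
  then show ?case using step by (simp add: cinner_add_left cinner_scaleC_left)
qed simp


section \<open>The filtration by level\<close>

lemma level_gens_mono: "N \<le> N' \<Longrightarrow> level_gens k N \<subseteq> level_gens k N'"
  unfolding level_gens_def using order_trans[of _ N N'] by blast

lemma finite_level_gens: "finite (level_gens k N)"
proof (rule finite_subset)
  show "level_gens k N \<subseteq> (\<Union>j\<in>{..N}. \<Union>l\<in>{..N}. \<Union>q\<in>{..N}. S_pairs k j l \<times> Q_part k (p_index k j + l + 1) (int q - 1))"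
  proof
    fix D assume "D \<in> level_gens k N"
    then obtain \<Delta> E j l q where "D = (\<Delta>, E)" "\<Delta> \<in> S_pairs k j l" "max j 1 + l + q \<le> N"
      "E \<in> Q_part k (p_index k j + l + 1) (int q - 1)" unfolding level_gens_def by blast
    then show "D \<in> (\<Union>j\<in>{..N}. \<Union>l\<in>{..N}. \<Union>q\<in>{..N}. S_pairs k j l \<times> Q_part k (p_index k j + l + 1) (int q - 1))"
      by (intro UN_I[of j] UN_I[of l] UN_I[of q]) auto
  qed
  show "finite (\<Union>j\<in>{..N}. \<Union>l\<in>{..N}. \<Union>q\<in>{..N}. S_pairs k j l \<times> Q_part k (p_index k j + l + 1) (int q - 1))"
    using finite_S_pairs finite_Q_part by auto
qed

lemma level_gensI:
  "\<Delta> \<in> S_pairs k j l \<Longrightarrow> max j 1 + l + q \<le> N \<Longrightarrow> E \<in> Q_part k (p_index k j + l + 1) (int q - 1) \<Longrightarrow>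
    (\<Delta>, E) \<in> level_gens k N"
  unfolding level_gens_def by blast

lemma Cc_bis:
  assumes f: "f \<in> Cc k" and \<Delta>: "\<Delta> \<in> rpairs k"
  shows "(\<lambda>a. if a \<in> bis k \<Delta> then f a else 0) \<in> Cc k"
proof (rule Cc_cut[OF f])
  fix \<mu> \<nu> x assume *: "gpair k \<mu> \<nu>" "x \<in> Zs k \<mu>"
  have r: "gpair k (fst \<Delta>) (snd \<Delta>)" "red (fst \<Delta>) (snd \<Delta>)" using rpairsD[OF \<Delta>] by auto
  show "\<exists>q. \<forall>y\<in>cls k q x. germ \<mu> \<nu> y \<in> bis k \<Delta> \<longleftrightarrow> germ \<mu> \<nu> x \<in> bis k \<Delta>"
    unfolding bis_def using germ_set_local[OF r order_refl sat_ipaths_from *] by blast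
qed

lemma cells_disjoint:
  assumes "1 \<le> m" "E \<in> Q_part k m (int q - 1)" "F \<in> Q_part k m (int q' - 1)" "q' \<le> q" "x \<in> E" "x \<in> F"
  shows "E \<subseteq> F" "q = q' \<Longrightarrow> E = F"
proof -
  have "E = cls k q x" "F = cls k q' x"
    using Q_part_cls[OF assms(1,2) _ assms(5)] Q_part_cls[OF assms(1,3) _ assms(6)] by simp_all
  then show "E \<subseteq> F" "q = q' \<Longrightarrow> E = F" using cls_mono[OF assms(4), of k x] by simp_all
qed

lemma closure_sum:
  fixes A :: "'a::cbanach set"
  assumes A: "cvec.subspace A" and f: "\<And>i. i \<in> I \<Longrightarrow> f i \<in> closure A"
  shows "sum f I \<in> closure A"
  using f
proof (induction I rule: infinite_finite_induct)
  case (insert i I)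
  obtain x y where "\<forall>n. x n \<in> A" "x \<longlonglongrightarrow> f i" "\<forall>n. y n \<in> A" "y \<longlonglongrightarrow> sum f I"
    using insert unfolding closure_sequential by blast
  then have "\<forall>n. x n + y n \<in> A" "(\<lambda>n. x n + y n) \<longlonglongrightarrow> f i + sum f I"
    using cvec.subspace_add[OF A] by (auto intro: tendsto_add)
  then show ?case using insert unfolding closure_sequential by auto
qed (use closure_subset cvec.subspace_0[OF A] in auto)

section \<open>Generators of the algebra and the inner products of their vectors\<close>

locale dirac_setting = gns_rep \<tau> \<eta>
  for \<tau> :: "'a::cstar_algebra \<Rightarrow> complex" and \<eta> :: "'a \<Rightarrow> 'h::chilbert" +
  fixes k :: "nat \<Rightarrow> nat" and M :: "ipath measure" and \<iota> :: "(gelem \<Rightarrow> complex) \<Rightarrow> 'a"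
  assumes inf: "infinite {i. 1 \<le> i \<and> k i \<noteq> 0}" and cstar: "is_groupoid_cstar k \<iota>"
    and trace: "f \<in> Cc k \<Longrightarrow> \<tau> (\<iota> f) = (LINT x|M. f (unit_germ x))"
begin

lemma iota_add: "f \<in> Cc k \<Longrightarrow> g \<in> Cc k \<Longrightarrow> \<iota> (\<lambda>a. f a + g a) = \<iota> f + \<iota> g"
  and iota_scale: "f \<in> Cc k \<Longrightarrow> \<iota> (\<lambda>a. c * f a) = c *\<^sub>C \<iota> f"
  and iota_conv: "f \<in> Cc k \<Longrightarrow> g \<in> Cc k \<Longrightarrow> \<iota> (convolution k f g) = \<iota> f * \<iota> g"
  and iota_star: "f \<in> Cc k \<Longrightarrow> \<iota> (involution f) = star (\<iota> f)"
  and iota_norm: "f \<in> Cc k \<Longrightarrow> norm (\<iota> f) = full_norm k f"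
  and iota_dense: "closure (\<iota> ` Cc k) = UNIV"
  using cstar unfolding is_groupoid_cstar_def by blast+

lemma iota_zero: "\<iota> (\<lambda>_. 0) = 0"
  using iota_scale[OF Cc_zero, of 0] by simp

lemma iota_sum: "(\<And>s. s \<in> S \<Longrightarrow> f s \<in> Cc k) \<Longrightarrow> \<iota> (\<lambda>a. \<Sum>s\<in>S. f s a) = (\<Sum>s\<in>S. \<iota> (f s))"
proof (induction S rule: infinite_finite_induct)
  case (insert s S)
  then have "\<iota> (\<lambda>a. f s a + (\<Sum>s\<in>S. f s a)) = \<iota> (f s) + \<iota> (\<lambda>a. \<Sum>s\<in>S. f s a)"
    by (intro iota_add Cc_sum) auto
  then show ?case using insert by simp
qed (simp_all add: iota_zero)

definition gen :: "(fpath \<times> fpath) \<times> ipath set \<Rightarrow> 'a" where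
  "gen D = \<iota> (indicator (gset D))"

definition vec :: "(fpath \<times> fpath) \<times> ipath set \<Rightarrow> 'h" where
  "vec D = \<eta> (gen D)"

lemma eta_vec_vec: "eta_vec (\<eta> \<circ> \<iota>) \<Delta> E = vec (\<Delta>, E)"
  by (simp add: eta_vec_def vec_def gen_def gset_def)

abbreviation "gens \<equiv> (\<Union>N. level_gens k N)"

definition alg :: "'a set" where "alg = cspan (gen ` gens)"

text \<open>By \<open>cls_Lebesgue\<close> f varies by at most e/2 on all cells of some level, so a
  combination of their indicators is uniformly close to f. The difference still lives on one
  bisection, where the full norm is controlled by the supremum.\<close>

lemma bisection_approx:
  assumes f: "f \<in> Cc k" and \<Delta>: "\<Delta> \<in> rpairs k" and sup: "\<And>g. f g \<noteq> 0 \<Longrightarrow> g \<in> bis k \<Delta>"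
  shows "\<iota> f \<in> closure alg"
proof -
  obtain \<delta> \<epsilon> where D: "\<Delta> = (\<delta>, \<epsilon>)" by (cases \<Delta>)
  have gp: "gpair k \<delta> \<epsilon>" "red \<delta> \<epsilon>" using \<Delta> by (auto simp: D rpairs_def)
  then have "\<delta> \<in> Lambda_from k 1" "\<epsilon> \<in> Lambda_from k 1" "plen \<delta> = plen \<epsilon>"
    by (auto simp: gpair_def psource_def Lambda_from_def)
  then obtain j l where S: "(\<delta>, \<epsilon>) \<in> S_pairs k j l" using S_pairs_exists[OF inf] gp(2) by metis
  define m where "m = psource \<delta>"
  have m: "1 \<le> m" "m = p_index k j + l + 1" using S_pairs_rpairs[OF S] by (auto simp: m_def)
  have "\<exists>h\<in>alg. norm (\<iota> f - h) < e" if e: "0 < e" for e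
  proof -
    define P where "P F \<longleftrightarrow> (\<forall>y\<in>F. \<forall>y'\<in>F. dist (f (germ \<delta> \<epsilon> y)) (f (germ \<delta> \<epsilon> y')) \<le> e / 2)" for F
    have "\<exists>q. \<forall>x\<in>ipaths_from k m. P (cls k q x)"
    proof (rule cls_Lebesgue[OF m(1)])
      fix x assume x: "x \<in> ipaths_from k m"
      obtain q where q: "\<forall>y\<in>cls k q x. dist (f (germ \<delta> \<epsilon> y)) (f (germ \<delta> \<epsilon> x)) < e / 4"
        using Cc_continuous[OF f gp(1), of x "e / 4"] x e by (auto simp: m_def)
      have "P (cls k q x)"
        unfolding P_def
      proof (intro ballI)
        fix y y' assume "y \<in> cls k q x" "y' \<in> cls k q x"
        then have "dist (f (germ \<delta> \<epsilon> y)) (f (germ \<delta> \<epsilon> x)) < e / 4" "dist (f (germ \<delta> \<epsilon> y')) (f (germ \<delta> \<epsilon> x)) < e / 4"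
          using q by auto
        then show "dist (f (germ \<delta> \<epsilon> y)) (f (germ \<delta> \<epsilon> y')) \<le> e / 2"
          using dist_triangle2[of "f (germ \<delta> \<epsilon> y)" "f (germ \<delta> \<epsilon> y')" "f (germ \<delta> \<epsilon> x)"] by linarith
      qed
      then show "\<exists>q. P (cls k q x)" by blast
    next
      show "P A" if "P B" "A \<subseteq> B" for A B using that unfolding P_def by blast
    qed
    then obtain q where q: "\<And>x. x \<in> ipaths_from k m \<Longrightarrow> P (cls k q x)" by blast
    let ?Q = "Q_part k m (int q - 1)"
    \<comment> \<open>A sample value of f on the cell; for an empty cell the choice is arbitrary and
      the indicator vanishes.\<close>
    define c where "c E = f (germ \<delta> \<epsilon> (SOME y. y \<in> E))" for E
    let ?I = "\<lambda>E g. indicator (gset (\<Delta>, E)) g :: complex"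
    let ?h = "\<lambda>g. \<Sum>E\<in>?Q. c E * ?I E g"
    let ?d = "\<lambda>g. f g + (-1) * ?h g"
    have lev: "(\<Delta>, E) \<in> level_gens k (max j 1 + l + q)" if "E \<in> ?Q" for E
      using level_gensI[OF S order_refl] that m(2) D by simp
    have IC: "?I E \<in> Cc k" if "E \<in> ?Q" for E using gset_Cc[OF lev[OF that]] by simp
    have hC: "?h \<in> Cc k" by (intro Cc_sum Cc_scale IC)
    have dC: "?d \<in> Cc k" by (intro Cc_add f Cc_scale hC)
    have val: "?h (germ \<delta> \<epsilon> y) = c (cls k q y)" if y: "y \<in> ipaths_from k m" for y
    proof -
      have in_iff: "germ \<delta> \<epsilon> y \<in> gset (\<Delta>, E) \<longleftrightarrow> E = cls k q y" if E: "E \<in> ?Q" for E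
      proof
        assume "germ \<delta> \<epsilon> y \<in> gset (\<Delta>, E)"
        moreover have "germ \<delta> \<epsilon> y \<in> germ_set (fst \<Delta>) (snd \<Delta>) {y}" by (simp add: germ_set_def D)
        ultimately have "germ \<delta> \<epsilon> y \<in> germ_set (fst \<Delta>) (snd \<Delta>) (E \<inter> {y})"
          using bis_disjoint[OF \<Delta> \<Delta>, of E "{y}"] Q_part_sat[OF m(1) E] y by (auto simp: gset_def D m_def)
        then have "y \<in> E" by (auto simp: germ_set_def)
        then show "E = cls k q y" using Q_part_cls[OF m(1) E] by simp
      next
        assume "E = cls k q y"
        then show "germ \<delta> \<epsilon> y \<in> gset (\<Delta>, E)" using mem_cls y by (auto simp: gset_def germ_set_def D ipaths_from_def)
      qed
      have "?h (germ \<delta> \<epsilon> y) = (\<Sum>E\<in>?Q. if E = cls k q y then c (cls k q y) else 0)"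
        by (rule sum.cong) (auto simp: indicator_def in_iff)
      then show ?thesis using cls_Q_part'[OF y m(1)] finite_Q_part by simp
    qed
    have out: "?h g = 0" if "g \<notin> bis k \<Delta>" for g
    proof (rule sum.neutral, intro ballI)
      fix E assume "E \<in> ?Q"
      then have "gset (\<Delta>, E) \<subseteq> bis k \<Delta>" using Q_part_sat[OF m(1)] by (fastforce simp: gset_def bis_def germ_set_def D m_def)
      then show "c E * ?I E g = 0" using that by (auto simp: indicator_def)
    qed
    have le: "cmod (?d g) \<le> e / 2" for g
    proof (cases "g \<in> bis k \<Delta>")
      case True
      then obtain y where y: "y \<in> ipaths_from k m" "g = germ \<delta> \<epsilon> y" by (auto simp: bis_def germ_set_def D m_def)
      have "y \<in> cls k q y" using y mem_cls by (simp add: ipaths_from_def)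
      moreover from this have "(SOME y'. y' \<in> cls k q y) \<in> cls k q y" by (rule someI)
      ultimately have "dist (f g) (c (cls k q y)) \<le> e / 2" using q[OF y(1)] by (simp add: P_def c_def y(2))
      moreover have "?d g = f g - c (cls k q y)" unfolding y(2) val[OF y(1)] by simp
      ultimately show ?thesis by (simp only: dist_norm)
    next
      case False
      then have "f g = 0" using sup by blast
      then show ?thesis using out[OF False] e by simp
    qed
    have "full_norm k ?d \<le> e / 2"
    proof (rule full_norm_bisection[OF dC gp(1) _ le])
      show "g \<in> germ_set \<delta> \<epsilon> (Zs k \<delta>)" if "?d g \<noteq> 0" for g
      proof (rule ccontr)
        assume "g \<notin> germ_set \<delta> \<epsilon> (Zs k \<delta>)"
        then have "g \<notin> bis k \<Delta>" by (simp add: bis_def D)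
        then have "?d g = 0" using out[of g] sup[of g] by auto
        then show False using that by blast
      qed
    qed (use e in simp)
    moreover have "\<iota> ?d = \<iota> f - \<iota> ?h"
      using iota_add[OF f Cc_scale[OF hC, of "-1"]] iota_scale[OF hC, of "-1"] by simp
    ultimately have "norm (\<iota> f - \<iota> ?h) < e" using iota_norm[OF dC] e by simp
    moreover have "\<iota> ?h = (\<Sum>E\<in>?Q. c E *\<^sub>C gen (\<Delta>, E))"
      using iota_sum[of ?Q "\<lambda>E g. c E * ?I E g"] Cc_scale[OF IC] iota_scale[OF IC] by (simp add: gen_def)
    moreover have "(\<Sum>E\<in>?Q. c E *\<^sub>C gen (\<Delta>, E)) \<in> alg"
      unfolding alg_def using lev by (intro cvec.span_sum cvec.span_scale cvec.span_base) blast
    ultimately show ?thesis by metis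
  qed
  then show ?thesis unfolding closure_approachable by (simp add: dist_norm norm_minus_commute)
qed

lemma alg_dense: "closure alg = UNIV"
proof -

  have "\<iota> f \<in> closure alg" if f: "f \<in> Cc k" for f
  proof -
    obtain \<D> where \<D>: "finite \<D>" "\<D> \<subseteq> rpairs k" "\<forall>g. f g \<noteq> 0 \<longrightarrow> (\<exists>\<Delta>\<in>\<D>. g \<in> bis k \<Delta>)" using Cc_support[OF f] by blast
    let ?f = "\<lambda>\<Delta> a. if a \<in> bis k \<Delta> then f a else 0"
    have C: "?f \<Delta> \<in> Cc k" if "\<Delta> \<in> \<D>" for \<Delta> using Cc_bis[OF f] \<D>(2) that by blast
    have "f a = (\<Sum>\<Delta>\<in>\<D>. ?f \<Delta> a)" for a
    proof (cases "\<exists>\<Delta>\<in>\<D>. a \<in> bis k \<Delta>")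
      case True
      then obtain \<Delta> where \<Delta>: "\<Delta> \<in> \<D>" "a \<in> bis k \<Delta>" by blast
      have "a \<in> bis k \<Delta>' \<longleftrightarrow> \<Delta>' = \<Delta>" if "\<Delta>' \<in> \<D>" for \<Delta>'
        using bis_disjoint[of \<Delta>' k \<Delta>, OF _ _ order_refl order_refl] \<D>(2) \<Delta> that unfolding bis_def by blast
      then have "(\<Sum>\<Delta>'\<in>\<D>. ?f \<Delta>' a) = (\<Sum>\<Delta>'\<in>\<D>. if \<Delta>' = \<Delta> then f a else 0)" by (intro sum.cong) auto
      then show ?thesis using \<Delta>(1) \<D>(1) by simp
    next
      case False
      then have "f a = 0" using \<D>(3) by blast
      then show ?thesis by (subst sum.neutral) auto
    qed
    then have "\<iota> f = \<iota> (\<lambda>a. \<Sum>\<Delta>\<in>\<D>. ?f \<Delta> a)" by presburger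
    also have "\<dots> = (\<Sum>\<Delta>\<in>\<D>. \<iota> (?f \<Delta>))" by (rule iota_sum[OF C])
    also have "\<dots> \<in> closure alg"
    proof (rule closure_sum)
      show "cvec.subspace alg" by (simp add: alg_def)
      fix \<Delta> assume \<Delta>: "\<Delta> \<in> \<D>"
      show "\<iota> (?f \<Delta>) \<in> closure alg"
        by (rule bisection_approx[OF C[OF \<Delta>]]) (use \<Delta> \<D>(2) in \<open>auto split: if_splits\<close>)
    qed
    finally show ?thesis .
  qed
  then have "closure (\<iota> ` Cc k) \<subseteq> closure alg" by (intro closure_minimal) auto
  then show ?thesis using iota_dense by auto
qed

text \<open>Reducedness is symmetric in the two paths, so the adjoint of a generator is a generator.
  Both paths have the same source, so E remains a cell over the right vertex.\<close>

lemma gen_swap: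
  assumes "D \<in> level_gens k N"
  obtains N' where "(prod.swap (fst D), snd D) \<in> level_gens k N'" "star (gen D) = gen (prod.swap (fst D), snd D)"
    "involution (indicator (gset D)) = indicator (gset (prod.swap (fst D), snd D))"
proof -
  obtain \<delta> \<epsilon> E where D: "D = ((\<delta>, \<epsilon>), E)" by (metis prod.exhaust)
  obtain j l q where *: "(\<delta>, \<epsilon>) \<in> S_pairs k j l" "E \<in> Q_part k (p_index k j + l + 1) (int q - 1)" "(\<delta>, \<epsilon>) \<in> rpairs k"
    "psource \<delta> = p_index k j + l + 1"
    using gset_level assms D by (metis fst_conv)
  have gp: "gpair k \<delta> \<epsilon>" "red \<delta> \<epsilon>" using *(3) by (auto simp: rpairs_def)
  then have "\<delta> \<in> Lambda_from k 1" "\<epsilon> \<in> Lambda_from k 1" "plen \<epsilon> = plen \<delta>"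
    by (auto simp: gpair_def psource_def Lambda_from_def)
  then obtain j' l' where S: "(\<epsilon>, \<delta>) \<in> S_pairs k j' l'" using S_pairs_exists[OF inf] red_sym[OF gp(2)] by metis
  have "psource \<epsilon> = p_index k j' + l' + 1" using S_pairs_rpairs[OF S] by simp
  then have "p_index k j' + l' + 1 = p_index k j + l + 1" using gp *(4) by (simp add: gpair_def)
  then have "((\<epsilon>, \<delta>), E) \<in> level_gens k (max j' 1 + l' + q)" using level_gensI[OF S order_refl] *(2) by simp
  moreover have inv: "involution (indicator (gset D)) = indicator (gset ((\<epsilon>, \<delta>), E))"
    by (simp add: D gset_def involution_indicator)
  moreover have "star (gen D) = gen ((\<epsilon>, \<delta>), E)"
    using iota_star[OF gset_Cc[OF assms]] inv by (simp add: gen_def)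
  ultimately show ?thesis using that D by simp
qed

text \<open>The second conjunct is recorded for \<open>cinner_vec\<close>, where the trace formula
  is applied to the convolution itself.\<close>

lemma gen_mult:
  assumes "D \<in> level_gens k N0"
  obtains c where "\<forall>N D'. D' \<in> level_gens k N \<longrightarrow> gen D * gen D' \<in> cspan (gen ` level_gens k (N + c)) \<and>
    convolution k (indicator (gset D)) (indicator (gset D')) \<in> Cc k"
proof -
  obtain c where c: "\<And>N D'. D' \<in> level_gens k N \<Longrightarrow>
    \<exists>W. finite W \<and> W \<subseteq> level_gens k (N + c) \<and>
      convolution k (indicator (gset D)) (indicator (gset D')) = (\<lambda>g. \<Sum>D\<in>W. indicator (gset D) g)"
    using convolution_level[OF inf assms] by blast
  have main: "gen D * gen D' \<in> cspan (gen ` level_gens k (N + c)) \<and>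
    convolution k (indicator (gset D)) (indicator (gset D')) \<in> Cc k" if D': "D' \<in> level_gens k N" for N D'
  proof -
    obtain W where W: "W \<subseteq> level_gens k (N + c)"
      "convolution k (indicator (gset D)) (indicator (gset D')) = (\<lambda>g. \<Sum>D\<in>W. indicator (gset D) g)" using c[OF D'] by blast
    have C: "indicator (gset X) \<in> Cc k" if "X \<in> W" for X using W(1) gset_Cc that by blast
    have "gen D * gen D' = \<iota> (\<lambda>g. \<Sum>D\<in>W. indicator (gset D) g)"
      using iota_conv[OF gset_Cc[OF assms] gset_Cc[OF D']] W(2) by (simp add: gen_def)
    also have "\<dots> = (\<Sum>X\<in>W. gen X)" unfolding gen_def by (rule iota_sum[OF C])
    also have "\<dots> \<in> cspan (gen ` level_gens k (N + c))" using W(1) by (intro cvec.span_sum cvec.span_base) blast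
    finally have "gen D * gen D' \<in> cspan (gen ` level_gens k (N + c))" .
    moreover have "(\<lambda>g. \<Sum>D\<in>W. indicator (gset D) g :: complex) \<in> Cc k" by (rule Cc_sum[OF C])
    ultimately show ?thesis unfolding W(2) by (rule conjI)
  qed
  show ?thesis by (rule that[of c]) (intro allI impI main)
qed

text \<open>In effect the measure of the set of sources of G: x contributes if it is the unit
  obtained from some b in G as inverse times b. Its essential features are that it depends on G
  alone and vanishes for the empty set.\<close>

definition unit_integral :: "gelem set \<Rightarrow> complex" where
  "unit_integral G = (LINT x|M. (if \<exists>b\<in>G. is_product k (ginv b) b (unit_germ x) then 1 else 0))"

lemma unit_integral_empty [simp]: "unit_integral {} = 0"
  by (simp add: unit_integral_def)

text \<open>At a unit, the adjoint of one indicator convolved with the other is 1 exactly if some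
  germ lies in both bisections and has this unit as its source. Orthogonality thus becomes a
  question about intersections of sets.\<close>

lemma cinner_vec:
  assumes D: "D \<in> level_gens k N" and D': "D' \<in> level_gens k N'"
  shows "cinner (vec D') (vec D) = unit_integral (gset D \<inter> gset D')"
proof -
  let ?D = "(prod.swap (fst D), snd D)"
  obtain N0 where sw: "?D \<in> level_gens k N0" "star (gen D) = gen ?D"
    "involution (indicator (gset D)) = indicator (gset ?D)" by (rule gen_swap[OF D])
  let ?c = "convolution k (indicator (gset ?D)) (indicator (gset D'))"
  have mem: "ginv b \<in> gset ?D \<longleftrightarrow> b \<in> gset D" for b
    by (simp add: gset_def germ_set_involution)
  have inj: "inj_on grange (gset ?D)" "inj_on gsource (gset D')"
    using gset_level[of "fst ?D" "snd ?D"] gset_level[of "fst D'" "snd D'"] sw(1) D' inj_on_germ_set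
    unfolding gset_def by (metis prod.collapse)+
  have "?c \<in> Cc k" using gen_mult[OF sw(1)] D' by metis
  moreover have "gen ?D * gen D' = \<iota> ?c" using iota_conv[OF gset_Cc[OF sw(1)] gset_Cc[OF D']] by (simp add: gen_def)
  ultimately have "cinner (vec D') (vec D) = (LINT x|M. ?c (unit_germ x))"
    using trace sw(2) by (simp add: vec_def cinner_eta)
  moreover have "?c (unit_germ x) = (if \<exists>b\<in>gset D \<inter> gset D'. is_product k (ginv b) b (unit_germ x) then 1 else 0)" for x
  proof (cases "\<exists>b\<in>gset D \<inter> gset D'. is_product k (ginv b) b (unit_germ x)")
    case True
    then obtain b where b: "b \<in> gset D" "b \<in> gset D'" "is_product k (ginv b) b (unit_germ x)" by blast
    have "?c (unit_germ x) = indicator (gset ?D) (ginv b) * indicator (gset D') b"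
      by (rule convolution_bisections(1)[OF _ _ inj _ b(2,3)]) (use b mem in \<open>auto simp: indicator_def split: if_splits\<close>)
    then show ?thesis using True b mem by simp
  next
    case False
    have "unit_germ x \<notin> gprod k (gset ?D) (gset D')"
    proof
      assume "unit_germ x \<in> gprod k (gset ?D) (gset D')"
      then obtain a b where ab: "a \<in> gset ?D" "b \<in> gset D'" "is_product k a b (unit_germ x)" by (auto simp: gprod_def)
      then have "a = ginv b" using is_product_unit[OF ab(3)] by simp
      then show False using ab mem False by blast
    qed
    then have "?c (unit_germ x) = 0"
      by (intro convolution_bisections(2)[OF _ _ inj]) (auto simp: indicator_def split: if_splits)
    then show ?thesis using False by simp
  qed
  ultimately show ?thesis by (simp add: unit_integral_def)
qed


section \<open>The decomposition of the Hilbert space\<close>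

lemma gset_level_disjoint:
  assumes "D \<in> level_gens k N" "D' \<in> level_gens k N'" "fst D \<noteq> fst D' \<or> snd D \<inter> snd D' = {}"
  shows "gset D \<inter> gset D' = {}"
proof (rule ccontr)
  assume "gset D \<inter> gset D' \<noteq> {}"
  then obtain g where g: "g \<in> gset D" "g \<in> gset D'" by blast
  have "fst D \<in> rpairs k" "snd D \<subseteq> Zs k (fst (fst D))" "fst D' \<in> rpairs k" "snd D' \<subseteq> Zs k (fst (fst D'))"
    using gset_level[of "fst D" "snd D" k N] gset_level[of "fst D'" "snd D'" k N'] assms(1,2) unfolding prod.collapse by metis+
  then have "fst D = fst D' \<and> g \<in> germ_set (fst (fst D)) (snd (fst D)) (snd D \<inter> snd D')"
    using bis_disjoint g unfolding gset_def by blast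
  then show False using assms(3) by (auto simp: germ_set_def)
qed

definition piece :: "fpath \<times> fpath \<Rightarrow> nat \<Rightarrow> int \<Rightarrow> 'h set" where
  "piece \<Delta> m n = (if n = -2 then {vec (\<Delta>, cyl k (vertex m))} else \<Union>E\<in>Q_part k m n. K_space k (\<eta> \<circ> \<iota>) m \<Delta> n E)"

lemma H_space_piece: "H_space k (\<eta> \<circ> \<iota>) j l n =
  cspan (\<Union>i\<in>(if j = 1 then {0, 1} else {j}). \<Union>\<Delta>\<in>S_pairs k i l. piece \<Delta> (p_index k i + l + 1) n)"
  by (simp add: H_space_def piece_def Let_def eta_vec_vec)

lemma K_space_vec: "K_space k (\<eta> \<circ> \<iota>) m \<Delta> n E =
  cspan {vec (\<Delta>, F) | F. F \<in> Q_part k m (n + 1) \<and> F \<subseteq> E} \<inter> {\<xi>. cinner \<xi> (vec (\<Delta>, E)) = 0}"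
  by (simp add: K_space_def eta_vec_vec)

lemma piece_span:
  assumes "x \<in> piece \<Delta> m n"
  shows "x \<in> cspan {vec (\<Delta>, F) | F. F \<in> Q_part k m (n + 1)}"
proof (cases "n = -2")
  case True
  then have "x = vec (\<Delta>, cyl k (vertex m))" using assms by (simp add: piece_def)
  moreover have "cyl k (vertex m) \<in> Q_part k m (n + 1)" using True by (simp add: Q_part_def)
  ultimately show ?thesis by (intro cvec.span_base) blast
next
  case False
  then obtain E where "x \<in> cspan {vec (\<Delta>, F) | F. F \<in> Q_part k m (n + 1) \<and> F \<subseteq> E}"
    using assms by (auto simp: piece_def K_space_vec)
  moreover have "cspan {vec (\<Delta>, F) | F. F \<in> Q_part k m (n + 1) \<and> F \<subseteq> E} \<subseteq> cspan {vec (\<Delta>, F) | F. F \<in> Q_part k m (n + 1)}"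
    by (rule cvec.span_mono) blast
  ultimately show ?thesis by blast
qed

lemma level_gens_S:
  assumes "\<Delta> \<in> S_pairs k i l" "E \<in> Q_part k (p_index k i + l + 1) n" "-1 \<le> n"
  shows "(\<Delta>, E) \<in> level_gens k (max i 1 + l + nat (n + 1))"
  using level_gensI[OF assms(1) order_refl, of E "nat (n + 1)"] assms by simp

text \<open>A vector y inside a cell E' is orthogonal to the vector of E'. A cell F that is coarser
  than or equal to E' either contains E', and then has the same inner product with y as E', or is
  disjoint from it.\<close>

lemma piece_orthogonal_levels:
  assumes S: "\<Delta> \<in> S_pairs k i l" and m: "m = p_index k i + l + 1" and n: "-2 \<le> n" "n < n'"
    and x: "x \<in> piece \<Delta> m n" and y: "y \<in> piece \<Delta> m n'"
  shows "cinner y x = 0"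
proof -
  obtain E' where E': "E' \<in> Q_part k m n'" "y \<in> K_space k (\<eta> \<circ> \<iota>) m \<Delta> n' E'"
    using y n by (auto simp: piece_def)
  have y1: "y \<in> cspan {vec (\<Delta>, F) | F. F \<in> Q_part k m (n' + 1) \<and> F \<subseteq> E'}" and y2: "cinner y (vec (\<Delta>, E')) = 0"
    using E'(2) by (auto simp: K_space_vec)
  have "cinner y (vec (\<Delta>, F)) = 0" if F: "F \<in> Q_part k m (n + 1)" for F
  proof -
    have lE: "(\<Delta>, E') \<in> level_gens k (max i 1 + l + nat (n' + 1))" using E'(1) m n by (intro level_gens_S[OF S]) simp_all
    have lF: "(\<Delta>, F) \<in> level_gens k (max i 1 + l + nat (n + 1 + 1))" using F m n by (intro level_gens_S[OF S]) simp_all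
    \<comment> \<open>E' has lower index n' and F has n + 1 \<le> n', so E' is the finer
      cell.\<close>
    have alt: "E' \<subseteq> F \<or> E' \<inter> F = {}"
    proof -
      have "int (nat (n' + 1)) - 1 = n'" "int (nat (n + 2)) - 1 = n + 1" "nat (n + 2) \<le> nat (n' + 1)" using n by simp_all
      then have "E' \<subseteq> F" if "x \<in> E'" "x \<in> F" for x
        using cells_disjoint(1)[of m E' k "nat (n' + 1)" F "nat (n + 2)" x] E'(1) F m that by (simp only:)
      then show ?thesis by blast
    qed
    have "cinner z (vec (\<Delta>, F)) = (if E' \<subseteq> F then cinner z (vec (\<Delta>, E')) else 0)"
      if "z \<in> cspan {vec (\<Delta>, F) | F. F \<in> Q_part k m (n' + 1) \<and> F \<subseteq> E'}" for z
      using that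
    proof (induction rule: cvec.span_induct_alt)
      case base
      then show ?case by simp
    next
      case (step c v z)
      then obtain F' where F': "v = vec (\<Delta>, F')" "F' \<in> Q_part k m (n' + 1)" "F' \<subseteq> E'" by blast
      have lF': "(\<Delta>, F') \<in> level_gens k (max i 1 + l + nat (n' + 1 + 1))" using F'(2) m n by (intro level_gens_S[OF S]) simp_all
      have "cinner v (vec (\<Delta>, F)) = (if E' \<subseteq> F then cinner v (vec (\<Delta>, E')) else 0)"
      proof (cases "E' \<subseteq> F")
        case True
        then have "gset (\<Delta>, F) \<inter> gset (\<Delta>, F') = gset (\<Delta>, E') \<inter> gset (\<Delta>, F')"
          using F'(3) by (auto simp: gset_def germ_set_def)
        then show ?thesis using True cinner_vec[OF lF lF'] cinner_vec[OF lE lF'] F'(1) by simp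
      next
        case False
        then have "gset (\<Delta>, F) \<inter> gset (\<Delta>, F') = {}"
          using alt F'(3) by (intro gset_level_disjoint[OF lF lF']) auto
        then show ?thesis using False cinner_vec[OF lF lF'] F'(1) by simp
      qed
      then show ?case using step by (simp add: cinner_add_left cinner_scaleC_left)
    qed
    then show ?thesis using y1 y2 by simp
  qed
  moreover have "x \<in> cspan {vec (\<Delta>, F) | F. F \<in> Q_part k m (n + 1)}" using piece_span[OF x] .
  moreover have "y \<in> cspan {y}" by (simp add: cvec.span_base)
  ultimately show ?thesis
    using cspan_orthogonal[of "{y}" "{vec (\<Delta>, F) | F. F \<in> Q_part k m (n + 1)}" y x] by blast
qed

lemma piece_orthogonal_pairs:
  assumes S: "\<Delta> \<in> S_pairs k i l" "\<Delta>' \<in> S_pairs k i' l'" "\<Delta> \<noteq> \<Delta>'" and n: "-2 \<le> n" "-2 \<le> n'"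
    and x: "x \<in> piece \<Delta> (p_index k i + l + 1) n" and y: "y \<in> piece \<Delta>' (p_index k i' + l' + 1) n'"
  shows "cinner x y = 0"
proof (rule cspan_orthogonal[OF _ piece_span[OF x] piece_span[OF y]])
  fix a b
  assume "a \<in> {vec (\<Delta>, F) | F. F \<in> Q_part k (p_index k i + l + 1) (n + 1)}"
    "b \<in> {vec (\<Delta>', F) | F. F \<in> Q_part k (p_index k i' + l' + 1) (n' + 1)}"
  then obtain F F' where F: "a = vec (\<Delta>, F)" "F \<in> Q_part k (p_index k i + l + 1) (n + 1)"
    "b = vec (\<Delta>', F')" "F' \<in> Q_part k (p_index k i' + l' + 1) (n' + 1)" by blast
  have lF: "(\<Delta>, F) \<in> level_gens k (max i 1 + l + nat (n + 1 + 1))" using level_gens_S[OF S(1) F(2)] n by simp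
  have lF': "(\<Delta>', F') \<in> level_gens k (max i' 1 + l' + nat (n' + 1 + 1))" using level_gens_S[OF S(2) F(4)] n by simp
  have "gset (\<Delta>', F') \<inter> gset (\<Delta>, F) = {}" using S(3) by (intro gset_level_disjoint[OF lF' lF]) simp
  then show "cinner a b = 0" using cinner_vec[OF lF' lF] F by simp
qed

definition HS :: "nat \<times> nat \<times> int \<Rightarrow> 'h set" where
  "HS p = (case p of (j, l, n) \<Rightarrow> H_space k (\<eta> \<circ> \<iota>) j l n)"

definition wt :: "nat \<times> nat \<times> int \<Rightarrow> nat" where
  "wt p = (case p of (j, l, n) \<Rightarrow> nat (int j + int l + n + 2))"

lemma HS_orthogonal:
  assumes "p \<in> H_index" "p' \<in> H_index" "p \<noteq> p'" "x \<in> HS p" "y \<in> HS p'"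
  shows "cinner x y = 0"
proof -
  obtain j l n j' l' n' where p: "p = (j, l, n)" "p' = (j', l', n')" by (metis prod.exhaust)
  have idx: "1 \<le> j" "-2 \<le> n" "1 \<le> j'" "-2 \<le> n'" using assms(1,2) by (auto simp: H_index_def p)
  show ?thesis
  proof (rule cspan_orthogonal)
    show "x \<in> cspan (\<Union>i\<in>(if j = 1 then {0, 1} else {j}). \<Union>\<Delta>\<in>S_pairs k i l. piece \<Delta> (p_index k i + l + 1) n)"
      using assms(4) by (simp add: HS_def p H_space_piece)
    show "y \<in> cspan (\<Union>i\<in>(if j' = 1 then {0, 1} else {j'}). \<Union>\<Delta>\<in>S_pairs k i l'. piece \<Delta> (p_index k i + l' + 1) n')"
      using assms(5) by (simp add: HS_def p H_space_piece)
    fix a b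
    assume "a \<in> (\<Union>i\<in>(if j = 1 then {0, 1} else {j}). \<Union>\<Delta>\<in>S_pairs k i l. piece \<Delta> (p_index k i + l + 1) n)"
      "b \<in> (\<Union>i\<in>(if j' = 1 then {0, 1} else {j'}). \<Union>\<Delta>\<in>S_pairs k i l'. piece \<Delta> (p_index k i + l' + 1) n')"
    then obtain i \<Delta> i' \<Delta>' where a: "i \<in> (if j = 1 then {0, 1} else {j})" "\<Delta> \<in> S_pairs k i l" "a \<in> piece \<Delta> (p_index k i + l + 1) n"
      and b: "i' \<in> (if j' = 1 then {0, 1} else {j'})" "\<Delta>' \<in> S_pairs k i' l'" "b \<in> piece \<Delta>' (p_index k i' + l' + 1) n'" by blast
    have ij: "max i 1 = j" "max i' 1 = j'" using a(1) b(1) idx by (auto split: if_splits)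
    show "cinner a b = 0"
    proof (cases "\<Delta> = \<Delta>'")
      case False
      then show ?thesis using piece_orthogonal_pairs[OF a(2) b(2) _ idx(2,4) a(3) b(3)] by blast
    next
      case True
      \<comment> \<open>The pair determines its indices, so two different summands that contain the
        same pair differ in n alone.\<close>
      then have eq: "i = i'" "l = l'" using S_pairs_unique[OF inf a(2)] b(2) by auto
      then have "n < n' \<or> n' < n" using assms(3) ij p by auto
      then show ?thesis
      proof
        assume "n < n'"
        then have "cinner b a = 0" using piece_orthogonal_levels[OF a(2) refl idx(2) _ a(3)] b(3) True eq by simp
        then show ?thesis by (simp add: cinner_eq_zero_sym)
      next
        assume "n' < n"
        then show ?thesis using piece_orthogonal_levels[OF a(2) refl idx(4) _ _ a(3)] b(3) True eq by simp
      qed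
    qed
  qed
qed

text \<open>The space with third index n is spanned by vectors of cells from the partition with
  index n + 1, for which q = n + 2; so weight and level coincide.\<close>

lemma HS_sub:
  assumes "p \<in> H_index" shows "HS p \<subseteq> cspan (vec ` level_gens k (wt p))"
proof -
  obtain j l n where p: "p = (j, l, n)" by (metis prod.exhaust)
  have idx: "1 \<le> j" "-2 \<le> n" using assms by (auto simp: H_index_def p)
  let ?L = "vec ` level_gens k (wt p)"
  have "a \<in> cspan ?L"
    if i: "i \<in> (if j = 1 then {0, 1} else {j})" and S: "\<Delta> \<in> S_pairs k i l" and a: "a \<in> piece \<Delta> (p_index k i + l + 1) n" for i \<Delta> a
  proof -
    have ij: "max i 1 = j" using i idx by (auto split: if_splits)
    have "{vec (\<Delta>, F) | F. F \<in> Q_part k (p_index k i + l + 1) (n + 1)} \<subseteq> ?L"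
    proof
      fix v assume "v \<in> {vec (\<Delta>, F) | F. F \<in> Q_part k (p_index k i + l + 1) (n + 1)}"
      then obtain F where F: "v = vec (\<Delta>, F)" "F \<in> Q_part k (p_index k i + l + 1) (n + 1)" by blast
      have "max i 1 + l + nat (n + 1 + 1) = wt p" using ij idx by (simp add: wt_def p)
      then show "v \<in> ?L" using level_gens_S[OF S F(2)] idx F(1) by simp
    qed
    then show ?thesis using piece_span[OF a] cvec.span_mono by blast
  qed
  then have "cspan (\<Union>i\<in>(if j = 1 then {0, 1} else {j}). \<Union>\<Delta>\<in>S_pairs k i l. piece \<Delta> (p_index k i + l + 1) n) \<subseteq> cspan ?L"
    by (intro cvec.span_minimal cvec.subspace_span) blast
  then show ?thesis by (simp only: HS_def p prod.case H_space_piece)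
qed

text \<open>A cell is the disjoint union of its subcells one level finer. Consequently the vector of
  a parent lies in the span from which \<open>K_space\<close> is cut out.\<close>

lemma vec_refine:
  assumes S: "\<Delta> \<in> S_pairs k i l" and m: "m = p_index k i + l + 1" and E: "E \<in> Q_part k m (int q - 1)"
  shows "vec (\<Delta>, E) = (\<Sum>F\<in>{F \<in> Q_part k m (int q). F \<subseteq> E}. vec (\<Delta>, F))"
proof -
  let ?S = "{F \<in> Q_part k m (int q). F \<subseteq> E}"
  have m1: "1 \<le> m" using m by simp
  have fS: "finite ?S" using finite_Q_part by simp
  have lev: "(\<Delta>, F) \<in> level_gens k (max i 1 + l + nat (int q + 1))" if "F \<in> ?S" for F
    using level_gens_S[OF S] that m by simp
  have "E = \<Union>?S"
  proof
    show "E \<subseteq> \<Union>?S"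
    proof
      fix x assume x: "x \<in> E"
      have e: "E = cls k q x" "x \<in> ipaths_from k m" using Q_part_cls[OF m1 E _ x] by simp_all
      then have "cls k (Suc q) x \<in> ?S" using cls_Q_part'[OF e(2) m1, of "Suc q"] cls_mono[of q "Suc q" k x] by simp
      moreover have "x \<in> cls k (Suc q) x" using e(2) mem_cls by (simp add: ipaths_from_def)
      ultimately show "x \<in> \<Union>?S" by blast
    qed
  qed blast
  then have "gset (\<Delta>, E) = (\<Union>F\<in>?S. gset (\<Delta>, F))"
    using image_Union[of "germ (fst \<Delta>) (snd \<Delta>)" ?S] by (simp only: gset_def germ_set_def fst_conv snd_conv)
  moreover have "indicator (\<Union>F\<in>?S. gset (\<Delta>, F)) g = (\<Sum>F\<in>?S. indicator (gset (\<Delta>, F)) g :: complex)" for g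
  proof (rule indicator_disjoint_sum[OF fS])
    fix s t x assume st: "s \<in> ?S" "t \<in> ?S" and x: "x \<in> gset (\<Delta>, s)" "x \<in> gset (\<Delta>, t)"
    then have "s \<inter> t \<noteq> {}" using gset_level_disjoint[OF lev[OF st(1)] lev[OF st(2)]] by auto
    then show "s = t" using cells_disjoint(2)[OF m1, of s k "Suc q" t "Suc q"] st by auto
  qed
  ultimately have "indicator (gset (\<Delta>, E)) = (\<lambda>g. \<Sum>F\<in>?S. indicator (gset (\<Delta>, F)) g :: complex)" by auto
  then have "gen (\<Delta>, E) = \<iota> (\<lambda>g. \<Sum>F\<in>?S. indicator (gset (\<Delta>, F)) g)" by (simp only: gen_def)
  also have "\<dots> = (\<Sum>F\<in>?S. gen (\<Delta>, F))" unfolding gen_def by (rule iota_sum) (rule gset_Cc[OF lev])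
  finally show ?thesis by (simp only: vec_def eta_sum)
qed

text \<open>Induction on the level of the cell: the vector of E is a multiple of the vector of its
  parent cell plus a remainder orthogonal to the latter, which lies in the \<open>K_space\<close> of
  the parent.\<close>

lemma vec_in_HS:
  assumes "D \<in> level_gens k N" shows "vec D \<in> cspan (\<Union>p\<in>{p \<in> H_index. wt p \<le> N}. HS p)"
proof -
  let ?T = "\<Union>p\<in>{p \<in> H_index. wt p \<le> N}. HS p"
  obtain \<Delta> E j l q where D: "D = (\<Delta>, E)" "\<Delta> \<in> S_pairs k j l" "max j 1 + l + q \<le> N"
    "E \<in> Q_part k (p_index k j + l + 1) (int q - 1)" using assms unfolding level_gens_def by blast
  define m where "m = p_index k j + l + 1"
  have m1: "1 \<le> m" by (simp add: m_def)
  have sub: "piece \<Delta> m (int q - 2) \<subseteq> ?T" if "max j 1 + l + q \<le> N" for q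
  proof -
    have "(max j 1, l, int q - 2) \<in> {p \<in> H_index. wt p \<le> N}"
      using that by (simp add: H_index_def wt_def)
    moreover have "piece \<Delta> m (int q - 2) \<subseteq> HS (max j 1, l, int q - 2)"
    proof -
      have "j \<in> (if max j 1 = 1 then {0, 1} else {max j 1})" by auto
      then have "piece \<Delta> m (int q - 2) \<subseteq> (\<Union>i\<in>(if max j 1 = 1 then {0, 1} else {max j 1}). \<Union>\<Delta>\<in>S_pairs k i l. piece \<Delta> (p_index k i + l + 1) (int q - 2))"
        using D(2) unfolding m_def by blast
      then show ?thesis unfolding HS_def prod.case H_space_piece using cvec.span_superset by blast
    qed
    ultimately show ?thesis by blast
  qed
  have "vec (\<Delta>, E) \<in> cspan ?T" if "max j 1 + l + q \<le> N" "E \<in> Q_part k m (int q - 1)" for q E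
    using that
  proof (induction q arbitrary: E)
    case 0
    then have "vec (\<Delta>, E) \<in> piece \<Delta> m (int 0 - 2)" by (simp add: Q_part_def piece_def)
    then show ?case using sub[OF 0(1)] by (intro cvec.span_base) blast
  next
    case (Suc q)
    show ?case
    proof (cases "E = {}")
      case True
      have "indicator (gset (\<Delta>, E)) = (\<lambda>_. 0 :: complex)" by (auto simp: True gset_def germ_set_def indicator_def)
      then have "vec (\<Delta>, E) = 0"
        using iota_zero linear_0[OF bounded_linear.linear[OF eta_bounded_linear]] by (simp add: vec_def gen_def)
      then show ?thesis by (simp add: cvec.span_zero)
    next
      case False
      then obtain x where x: "x \<in> E" by blast
      have Ex: "E = cls k (Suc q) x" "x \<in> ipaths_from k m" using Q_part_cls[OF m1 Suc.prems(2) _ x]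
        by (simp_all add: nat_add_distrib)
      define E0 where "E0 = cls k q x"
      have E0: "E0 \<in> Q_part k m (int q - 1)" unfolding E0_def by (rule cls_Q_part'[OF Ex(2) m1])
      have EE: "E \<subseteq> E0" unfolding Ex(1) E0_def by (rule cls_mono) simp
      have EQ: "E \<in> Q_part k m (int q)" using Suc.prems(2) by simp
      have IH: "vec (\<Delta>, E0) \<in> cspan ?T" using Suc.IH[OF _ E0] Suc.prems(1) by simp
      \<comment> \<open>The projection coefficient. If the vector of the parent vanishes, division
        by zero gives 0 and orthogonality is trivial.\<close>
      define c where "c = cinner (vec (\<Delta>, E)) (vec (\<Delta>, E0)) / cinner (vec (\<Delta>, E0)) (vec (\<Delta>, E0))"
      define u where "u = vec (\<Delta>, E) - c *\<^sub>C vec (\<Delta>, E0)"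
      have "cinner u (vec (\<Delta>, E0)) = 0"
      proof (cases "vec (\<Delta>, E0) = 0")
        case False
        then show ?thesis by (simp add: u_def c_def cinner_diff_left cinner_scaleC_left)
      qed simp
      moreover have "u \<in> cspan {vec (\<Delta>, F) | F. F \<in> Q_part k m (int q - 1 + 1) \<and> F \<subseteq> E0}"
      proof -
        have "vec (\<Delta>, E0) = (\<Sum>F\<in>{F \<in> Q_part k m (int q). F \<subseteq> E0}. vec (\<Delta>, F))"
          by (rule vec_refine[OF D(2) m_def E0])
        also have "\<dots> \<in> cspan {vec (\<Delta>, F) | F. F \<in> Q_part k m (int q - 1 + 1) \<and> F \<subseteq> E0}"
          by (intro cvec.span_sum cvec.span_base) auto
        finally have "vec (\<Delta>, E0) \<in> cspan {vec (\<Delta>, F) | F. F \<in> Q_part k m (int q - 1 + 1) \<and> F \<subseteq> E0}" .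
        moreover have "vec (\<Delta>, E) \<in> cspan {vec (\<Delta>, F) | F. F \<in> Q_part k m (int q - 1 + 1) \<and> F \<subseteq> E0}"
          using EQ EE by (intro cvec.span_base) auto
        ultimately show ?thesis unfolding u_def by (intro cvec.span_diff cvec.span_scale)
      qed
      ultimately have "u \<in> K_space k (\<eta> \<circ> \<iota>) m \<Delta> (int q - 1) E0" by (simp add: K_space_vec)
      then have "u \<in> piece \<Delta> m (int (Suc q) - 2)" using E0 by (auto simp: piece_def)
      then have "u \<in> cspan ?T" using sub[OF Suc.prems(1)] by (intro cvec.span_base) blast
      then have "u + c *\<^sub>C vec (\<Delta>, E0) \<in> cspan ?T" using IH by (intro cvec.span_add cvec.span_scale)
      then show ?thesis by (simp add: u_def)
    qed
  qed
  then show ?thesis using D m_def by simp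
qed

lemma HS_total: "closure (cspan (\<Union>p\<in>H_index. HS p)) = UNIV"
proof -
  let ?T = "cspan (\<Union>p\<in>H_index. HS p)"
  have "vec D \<in> ?T" if "D \<in> gens" for D
  proof -
    obtain N where "D \<in> level_gens k N" using \<open>D \<in> gens\<close> by blast
    then have "vec D \<in> cspan (\<Union>p\<in>{p \<in> H_index. wt p \<le> N}. HS p)" by (rule vec_in_HS)
    moreover have "\<dots> \<subseteq> ?T" by (rule cvec.span_mono) blast
    ultimately show ?thesis by blast
  qed
  then have vec: "vec D \<in> ?T" if "D \<in> gens" for D using that by blast
  have alg: "\<eta> a \<in> ?T" if "a \<in> alg" for a
    using that unfolding alg_def
  proof (induction rule: cvec.span_induct_alt)
    case base
    then show ?case using linear_0[OF bounded_linear.linear[OF eta_bounded_linear]] by (simp add: cvec.span_zero)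
  next
    case (step c x y)
    then have "\<eta> x \<in> ?T" using vec by (auto simp: vec_def)
    then show ?case using step by (simp add: eta_add eta_scaleC cvec.span_add cvec.span_scale)
  qed
  then have "\<eta> ` closure alg \<subseteq> closure ?T"
    by (intro image_closure_subset linear_continuous_on eta_bounded_linear) (use closure_subset alg in auto)
  then have "closure (range \<eta>) \<subseteq> closure ?T" unfolding alg_dense by (intro closure_minimal) auto
  then show ?thesis using eta_dense by auto
qed

section \<open>The banded action of the dense subalgebra\<close>

lemma star_alg: "a \<in> alg \<Longrightarrow> star a \<in> alg"
  unfolding alg_def
proof (induction rule: cvec.span_induct_alt)
  case base
  have "star (0::'a) = 0" using star_scaleC[of 0 "0::'a"] by simp
  then show ?case by (simp add: cvec.span_zero)
next
  case (step c x y)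
  then obtain D N where D: "x = gen D" "D \<in> level_gens k N" by blast
  obtain N' where "(prod.swap (fst D), snd D) \<in> level_gens k N'" "star (gen D) = gen (prod.swap (fst D), snd D)"
    by (rule gen_swap[OF D(2)])
  then have "star x \<in> cspan (gen ` gens)" using D(1) by (auto intro!: cvec.span_base)
  then show ?case using step by (simp add: star_add star_scaleC cvec.span_add cvec.span_scale)
qed

lemma eta_span: "a \<in> cspan (gen ` L) \<Longrightarrow> \<eta> a \<in> cspan (vec ` L)"
proof (induction rule: cvec.span_induct_alt)
  case base
  then show ?case using linear_0[OF bounded_linear.linear[OF eta_bounded_linear]] by (simp add: cvec.span_zero)
next
  case (step c x y)
  then have "\<eta> x \<in> cspan (vec ` L)" by (auto simp: vec_def intro!: cvec.span_base)
  then show ?case using step by (simp add: eta_add eta_scaleC cvec.span_add cvec.span_scale)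
qed

text \<open>The constants of the generators add up along the linear combination; the band width
  depends on a but not on the level N.\<close>

lemma alg_banded_gen:
  "a \<in> alg \<Longrightarrow> \<exists>c. \<forall>N D. D \<in> level_gens k N \<longrightarrow> \<eta> (a * gen D) \<in> cspan (vec ` level_gens k (N + c))"
  unfolding alg_def
proof (induction rule: cvec.span_induct_alt)
  case base
  then show ?case using linear_0[OF bounded_linear.linear[OF eta_bounded_linear]] by (simp add: cvec.span_zero)
next
  case (step s x y)
  then obtain D0 N0 where D0: "x = gen D0" "D0 \<in> level_gens k N0" by blast
  obtain c1 where c1: "\<forall>N D'. D' \<in> level_gens k N \<longrightarrow> gen D0 * gen D' \<in> cspan (gen ` level_gens k (N + c1)) \<and>
    convolution k (indicator (gset D0)) (indicator (gset D')) \<in> Cc k" by (rule gen_mult[OF D0(2)])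
  obtain c2 where c2: "\<forall>N D. D \<in> level_gens k N \<longrightarrow> \<eta> (y * gen D) \<in> cspan (vec ` level_gens k (N + c2))"
    using step by blast
  have "\<eta> ((s *\<^sub>C x + y) * gen D) \<in> cspan (vec ` level_gens k (N + (c1 + c2)))" if D: "D \<in> level_gens k N" for N D
  proof -
    have "\<eta> (x * gen D) \<in> cspan (vec ` level_gens k (N + c1))" unfolding D0(1) using c1 D by (intro eta_span) blast
    moreover have "\<dots> \<subseteq> cspan (vec ` level_gens k (N + (c1 + c2)))"
      by (intro cvec.span_mono image_mono level_gens_mono) simp
    moreover have "\<eta> (y * gen D) \<in> cspan (vec ` level_gens k (N + c2))" using c2 D by blast
    moreover have "\<dots> \<subseteq> cspan (vec ` level_gens k (N + (c1 + c2)))"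
      by (intro cvec.span_mono image_mono level_gens_mono) simp
    ultimately have "s *\<^sub>C \<eta> (x * gen D) + \<eta> (y * gen D) \<in> cspan (vec ` level_gens k (N + (c1 + c2)))"
      by (intro cvec.span_add cvec.span_scale) blast+
    then show ?thesis by (simp add: distrib_right mult_scaleC_left eta_add eta_scaleC)
  qed
  then show ?case by blast
qed

lemma alg_banded:
  assumes "a \<in> alg"
  obtains c where "\<forall>N v. v \<in> cspan (vec ` level_gens k N) \<longrightarrow> left_mult \<eta> a v \<in> cspan (vec ` level_gens k (N + c))"
proof -
  obtain c where c: "\<forall>N D. D \<in> level_gens k N \<longrightarrow> \<eta> (a * gen D) \<in> cspan (vec ` level_gens k (N + c))"
    using alg_banded_gen[OF assms] by blast
  have T: "linear (left_mult \<eta> a)" "\<And>s x. left_mult \<eta> a (s *\<^sub>C x) = s *\<^sub>C left_mult \<eta> a x"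
    using left_mult(1)[of a] by (auto simp: bounded_clinear_def bounded_linear.linear)
  have "left_mult \<eta> a v \<in> cspan (vec ` level_gens k (N + c))" if "v \<in> cspan (vec ` level_gens k N)" for N v
    using that
  proof (induction rule: cvec.span_induct_alt)
    case base
    then show ?case by (simp add: linear_0[OF T(1)] cvec.span_zero)
  next
    case (step s x y)
    then have "left_mult \<eta> a x \<in> cspan (vec ` level_gens k (N + c))" using c by (auto simp: vec_def left_mult(2))
    then show ?case using step by (simp add: linear_add[OF T(1)] T(2) cvec.span_add cvec.span_scale)
  qed
  then show ?thesis by (intro that[of c]) blast
qed

sublocale orth_decomp H_index HS wt
proof
  fix p assume p: "p \<in> H_index"
  show "cvec.subspace (HS p)" by (cases p) (simp add: HS_def H_space_def)
  show "\<exists>B. finite B \<and> HS p \<subseteq> cspan B" using HS_sub[OF p] finite_level_gens by (meson finite_imageI)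
next
  show "finite {p \<in> H_index. wt p \<le> N}" for N
    by (rule finite_subset[of _ "{..N} \<times> {..N} \<times> {-2..int N}"]) (auto simp: H_index_def wt_def)
qed (rule HS_orthogonal HS_total; assumption?)+

lemma HS_orthogonal_level:
  assumes "p \<in> H_index" "N < wt p" "x \<in> HS p" "y \<in> cspan (vec ` level_gens k N)"
  shows "cinner x y = 0"
proof -
  let ?T = "\<Union>p\<in>{p \<in> H_index. wt p \<le> N}. HS p"
  have "cspan (vec ` level_gens k N) \<subseteq> cspan ?T"
    using vec_in_HS by (intro cvec.span_minimal cvec.subspace_span) blast
  then have "y \<in> cspan ?T" using assms(4) by blast
  moreover have "cinner a b = 0" if ab: "a \<in> {x}" "b \<in> ?T" for a b
  proof -
    obtain r where r: "r \<in> H_index" "wt r \<le> N" "b \<in> HS r" using ab(2) by blast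
    then have "p \<noteq> r" using assms(2) by auto
    then show ?thesis using HS_orthogonal[OF assms(1) r(1) _ assms(3) r(3)] ab(1) by simp
  qed
  ultimately show ?thesis using cspan_orthogonal[of "{x}" ?T x y] cvec.span_base[of x "{x}"] by blast
qed

text \<open>Raising of levels by a kills the entries far on one side of the diagonal; moving a to
  the other argument as its adjoint kills those far on the other side.\<close>

lemma alg_bounded_commutator:
  assumes a: "a \<in> alg" shows "bounded_commutator DD D (left_mult \<eta> a)"
proof -
  obtain c1 where c1: "\<forall>N v. v \<in> cspan (vec ` level_gens k N) \<longrightarrow> left_mult \<eta> a v \<in> cspan (vec ` level_gens k (N + c1))"
    by (rule alg_banded[OF a])
  obtain c2 where c2: "\<forall>N v. v \<in> cspan (vec ` level_gens k N) \<longrightarrow> left_mult \<eta> (star a) v \<in> cspan (vec ` level_gens k (N + c2))"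
    by (rule alg_banded[OF star_alg[OF a]])
  show ?thesis
  proof (rule banded_bounded_commutator[OF left_mult(1), where c = "max c1 c2"])
    fix i r v assume i: "i \<in> H_index" and r: "r \<in> H_index" and v: "v \<in> HS r"
      and far: "wt r + max c1 c2 < wt i \<or> wt i + max c1 c2 < wt r"
    show "P i (left_mult \<eta> a v) = 0"
    proof (rule P_eqI[OF i])
      show "0 \<in> HS i" by (rule cvec.subspace_0[OF sub[OF i]])
      fix \<omega> assume w: "\<omega> \<in> HS i"
      have "cinner (left_mult \<eta> a v) \<omega> = 0"
        using far
      proof
        assume "wt r + max c1 c2 < wt i"
        moreover have "left_mult \<eta> a v \<in> cspan (vec ` level_gens k (wt r + c1))" using c1 HS_sub[OF r] v by blast
        ultimately have "cinner \<omega> (left_mult \<eta> a v) = 0" using HS_orthogonal_level[OF i _ w, of "wt r + c1"] by simp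
        then show ?thesis by (simp add: cinner_eq_zero_sym)
      next
        assume "wt i + max c1 c2 < wt r"
        moreover have "left_mult \<eta> (star a) \<omega> \<in> cspan (vec ` level_gens k (wt i + c2))" using c2 HS_sub[OF i] w by blast
        ultimately have "cinner v (left_mult \<eta> (star a) \<omega>) = 0" using HS_orthogonal_level[OF r _ v, of "wt i + c2"] by simp
        then show ?thesis by (simp add: left_mult_adjoint)
      qed
      then show "cinner (left_mult \<eta> a v) \<omega> = cinner 0 \<omega>" by simp
    qed
  qed
qed

lemma D_weight_wt: "(j, l, n) \<in> H_index \<Longrightarrow> D_weight j l n = real (wt (j, l, n))"
  by (simp add: D_weight_def wt_def H_index_def)

lemma D_dom_DD: "D_dom k (\<eta> \<circ> \<iota>) = DD"
  unfolding D_dom_def DD_def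
  by (intro Collect_cong summable_on_cong) (auto simp: D_weight_wt HS_def)

lemma D_op_D: "D_op k (\<eta> \<circ> \<iota>) = D"
proof
  fix \<xi> show "D_op k (\<eta> \<circ> \<iota>) \<xi> = D \<xi>"
    unfolding D_op_def D_def by (intro infsum_cong) (auto simp: D_weight_wt HS_def)
qed

lemma spectral_triple: "spectral_triple (left_mult \<eta>) (D_dom k (\<eta> \<circ> \<iota>)) (D_op k (\<eta> \<circ> \<iota>))"
proof -
  have "alg \<subseteq> {a. bounded_commutator DD D (left_mult \<eta> a)}" using alg_bounded_commutator by blast
  then have "closure {a. bounded_commutator DD D (left_mult \<eta> a)} = UNIV" using closure_mono alg_dense by blast
  then show ?thesis
    unfolding spectral_triple_def D_dom_DD D_op_D using D_selfadjoint D_compact_resolvent by blast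
qed

end

theorem theorem3p41:
  fixes k :: "nat \<Rightarrow> nat"
    and M :: "ipath measure"
    and \<iota> :: "(gelem \<Rightarrow> complex) \<Rightarrow> 'a::cstar_algebra"
    and \<tau> :: "'a \<Rightarrow> complex"
    and \<eta> :: "'a \<Rightarrow> 'h::chilbert"
  assumes "infinite {i. 1 \<le> i \<and> k i \<noteq> 0}"
    and "invariant_prob k M"
    and "is_groupoid_cstar k \<iota>"
    and "is_trace k M \<iota> \<tau>"
    and "is_gns_space \<tau> \<eta>"
  shows "spectral_triple (left_mult \<eta>) (D_dom k (\<eta> \<circ> \<iota>)) (D_op k (\<eta> \<circ> \<iota>))"
proof -
  have "gns_rep \<tau> \<eta>" using assms(4,5) by (simp add: gns_rep_def is_trace_def)
  then interpret dirac_setting \<tau> \<eta> k M \<iota>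
    by (rule dirac_setting.intro) (use assms in \<open>unfold_locales, auto simp: is_trace_def\<close>)
  show ?thesis by (rule spectral_triple)
qed

end
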